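(* Let $\mathcal C$ be a join restriction category with local glueings. The adjunction $\Psi\dashv\Phi\colon\mathrm{pCat}_c(\mathcal C)\to\mathrm{rCat}/\!/\mathcal C$ is Galois. In particular, $\mathrm{jrCat}/\!/_h\,\mathcal C$ is reflective in $\mathrm{rCat}/\!/\mathcal C$ via $\Phi\Psi$, while $\mathrm{peCat}_c(\mathcal C)$ is coreflective in $\mathrm{pCat}_c(\mathcal C)$ via $\Psi\Phi$.
   Context: GALOIS ADJUNCTIONS. For an adjunction $F\dashv G\colon\mathcal B\to\mathcal A$, a left fixpoint is $B\in\mathcal B$ at which the counit is invertible and a right fixpoint is $A\in\mathcal A$ at which the unit is invertible. The adjunction is Galois if every $FA$ is a left fixpoint (equivalently, every $GB$ is a right fixpoint). RESTRICTION CATEGORIES. A restriction category is a category with an operation assigning to each $f\colon A\to B$ a map $\bar f\colon A\to A$ such that $f\bar f=f$; $\bar f\bar g=\bar g\bar f$ and $\overline{g\bar f}=\bar g\bar f$ for $f\colon A\to B$, $g\colon A\to C$; and $\bar g f=f\,\overline{gf}$ for $f\colon A\to B$, $g\colon B\to C$. $\mathcal O(A)$ is the set of restriction idempotents on $A$ (maps $e\colon A\to A$ with $\bar e=e$). A map $f$ is total if $\bar f=1$. For parallel maps, $f\leqslant g$ iff $f=g\bar f$, and $f\smile g$ (compatible) iff $f\bar g=g\bar f$. A restriction functor satisfies $F\bar f=\overline{Ff}$; it is hyperconnected if each induced $\mathcal O(A)\to\mathcal O(FA)$ is an isomorphism. A join restriction category is a restriction category in which every pairwise-compatible family of parallel maps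 has a join for $\leqslant$, and these joins are preserved by precomposition. A partial isomorphism is a map $s\colon A\to B$ with a (necessarily unique) partial inverse $s^*\colon B\to A$: $s^*s=\bar s$, $ss^*=\overline{s^*}$. A local homeomorphism is a total map which is a join of partial isomorphisms. A local atlas on $X$ is a set $I$ and a family $\varphi_{ij}\in\mathcal O(X)$ ($i,j\in I$) with $\varphi_{ij}=\varphi_{ji}$ and $\varphi_{jk}\varphi_{ij}\leqslant\varphi_{ik}$. A glueing of $\varphi$ is a local homeomorphism $p=\bigvee_i p_i\colon A\to X$, with each $p_i$ a partial isomorphism with partial inverse $s_i$, such that $\varphi_{ij}=p_js_i$. $\mathcal C$ has local glueings if every local atlas on every object has a glueing. A partial section of a total map $p\colon A\to X$ is a map $s\colon X\to A$ with $ps=\bar s$. PARTITE INTERNAL CATEGORIES. For a set $I$, an $I$-partite internal category $\mathbb A$ in $\mathcal C$ comprises objects $A_i$; objects $A_{ij}$ with total maps $\sigma_{ij}\colon A_{ij}\to A_i$, $\tau_{ij}\colon A_{ij}\to A_j$, where $\sigma_{ij}$ admits pullbacks along all total maps; maps $\eta_i\colon A_i\to A_{ii}$ with $\sigma_{ii}\eta_i=1=\tau_{ii}\eta_i$; and maps $\mu_{ijk}\colon A_{jk}\times_{A_j}A_{ij}\to A_{ik}$ (domain the pullback of $\sigma_{jk}$ along $\tau_{ij}$) with $\sigma_{ik}\mu_{ijk}=\sigma_{ij}\pi_2$, $\tau_{ik}\mu_{ijk}=\tau_{jk}\pi_1$, satisfying $\mu_{iij}(1,\eta_i\sigma_{ij})=1=\mu_{ijj}(\eta_j\tau_{ij},1)$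 and $\mu_{ik\ell}(1\times\mu_{ijk})=\mu_{ij\ell}(\mu_{jk\ell}\times 1)$. It is source-étale if every $\sigma_{ij}$ is a local homeomorphism. A partite cofunctor $F\colon\mathbb A\rightsquigarrow\mathbb B$ from an $I$-partite to a $J$-partite internal category comprises a function $I\to J$, $i\mapsto Fi$; total maps $F_i\colon B_{Fi}\to A_i$; and total maps $F_{ij}\colon A_{ij}\times_{A_i}B_{Fi}\to B_{Fi,Fj}$ (domain the pullback of $\sigma_{ij}$ along $F_i$) with $\sigma_{Fi,Fj}F_{ij}=\pi_2$, $F_j\tau_{Fi,Fj}F_{ij}=\tau_{ij}\pi_1$, $F_{ii}(\eta_iF_i,1)=\eta_{Fi}$, and $F_{ik}(\mu_{ijk}\times1)=\mu_{Fi,Fj,Fk}(F_{jk}\times1)(1\times F_{ij})$ on $A_{jk}\times_{A_j}A_{ij}\times_{A_i}B_{Fi}$ (using $A_{jk}\times_{A_j}B_{Fi,Fj}\cong(A_{jk}\times_{A_j}B_{Fj})\times_{B_{Fj}}B_{Fi,Fj}$). Composition: $(GF)i=G(Fi)$, $(GF)_i=F_iG_{Fi}$, $(GF)_{ij}=G_{Fi,Fj}(F_{ij}\times1)$ up to the canonical isomorphism of pullbacks. $\mathrm{pCat}_c(\mathcal C)$ is the resulting category, $\mathrm{peCat}_c(\mathcal C)$ its full subcategory of source-étale objects. CATEGORIES OVER $\mathcal C$. $\mathrm{rCat}/\!/\mathcal C$ has as objects pairs $(\mathcal A,P)$ of a restriction category and a restriction functor $P\colon\mathcal A\to\mathcal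 C$; a map $(F,\alpha)\colon(\mathcal A,P)\to(\mathcal B,Q)$ is a restriction functor $F\colon\mathcal A\to\mathcal B$ and a natural transformation $\alpha\colon QF\Rightarrow P$ with total components; $(G,\beta)(F,\alpha)=(GF,\alpha\circ\beta F)$. $\mathrm{jrCat}/\!/_h\,\mathcal C$ is the full subcategory of those $(\mathcal A,P)$ with $\mathcal A$ a join restriction category and $P$ hyperconnected. THE FUNCTOR $\Phi$. $\Phi(\mathbb A)=(\Phi\mathbb A,\pi_{\mathbb A})$: $\Phi\mathbb A$ has object-set $I$; $\Phi\mathbb A(i,j)$ is the set of partial sections of $\sigma_{ij}$; identities are $\eta_i$; the composite of $s\in\Phi\mathbb A(i,j)$, $t\in\Phi\mathbb A(j,k)$ is $\mu_{ijk}\circ\tau_{ij}^*(t)\circ s$ where $\tau_{ij}^*(t)=(t\tau_{ij},\overline{t\tau_{ij}})\colon A_{ij}\to A_{jk}\times_{A_j}A_{ij}$; the restriction of $s$ is $\eta_i\bar s$; $\pi_{\mathbb A}(i)=A_i$, $\pi_{\mathbb A}(s)=\tau_{ij}s$. For a cofunctor $F$, $\Phi(F)=(\Phi F,\varpi^F)$ with $\Phi F(i)=Fi$, $\Phi F(s)=F_{ij}\circ(sF_i,\overline{sF_i})$, $\varpi^F_i=F_i$. THE FUNCTOR $\Psi$. Given $(\mathcal A,P)$ and $f,g\in\mathcal A(i,j)$ put $[\![f=_Pg]\!]=\bigvee\{Pe: e\in\mathcal O(i),\ e\leqslant\bar f\bar g,\ fe=ge\}\in\mathcal O(Pi)$.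 $\Psi P$ is the $\mathrm{ob}(\mathcal A)$-partite internal category with objects $Pi$; $\sigma_{ij}\colon\Psi P_{ij}\to Pi$ a glueing of the local atlas $([\![f=_Pg]\!])_{f,g\in\mathcal A(i,j)}$, with associated partial sections $s_f$; $\tau_{ij}$ the unique map with $\tau_{ij}s_f=Pf$ for all $f$; $\eta_i=s_{1_i}$; $\mu_{ijk}$ the unique map with $\mu_{ijk}\tau_{ij}^*(s_g)s_f=s_{gf}$ for all $f,g$. $\Psi$ is left adjoint to $\Phi$ with unit $(\eta_P,1)\colon(\mathcal A,P)\to\Phi(\Psi P)$, $\eta_P$ the identity on objects and $f\mapsto s_f$ on maps. *)

theory Defs
  imports Main "HOL-Library.FuncSet"
begin

unbundle cardinal_syntax

section \<open>Categories, functors and adjunctions\<close>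

text \<open>
  Hom-sets are indexed by pairs of objects and are not assumed to be pairwise disjoint.
  Accordingly, composition takes the three objects involved as arguments: \<open>Cmp C x y z g f\<close> is the
  composite of \<open>f : x \<rightarrow> y\<close> and \<open>g : y \<rightarrow> z\<close>. Values of the operations at arguments outside the
  carriers are irrelevant.
\<close>

record ('o, 'm) cat =
  Ob  :: "'o set"
  Hom :: "'o \<Rightarrow> 'o \<Rightarrow> 'm set"
  Idn :: "'o \<Rightarrow> 'm"
  Cmp :: "'o \<Rightarrow> 'o \<Rightarrow> 'o \<Rightarrow> 'm \<Rightarrow> 'm \<Rightarrow> 'm"

locale category =
  fixes C :: "('o, 'm, 'x) cat_scheme"
  assumes Idn_in: "x \<in> Ob C \<Longrightarrow> Idn C x \<in> Hom C x x"
    and Cmp_in: "\<lbrakk>x \<in> Ob C; y \<in> Ob C; z \<in> Ob C; f \<in> Hom C x y; g \<in> Hom C y z\<rbrakk>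
      \<Longrightarrow> Cmp C x y z g f \<in> Hom C x z"
    and Cmp_Idn: "\<lbrakk>x \<in> Ob C; y \<in> Ob C; f \<in> Hom C x y\<rbrakk> \<Longrightarrow> Cmp C x x y f (Idn C x) = f"
    and Idn_Cmp: "\<lbrakk>x \<in> Ob C; y \<in> Ob C; f \<in> Hom C x y\<rbrakk> \<Longrightarrow> Cmp C x y y (Idn C y) f = f"
    and Cmp_assoc: "\<lbrakk>w \<in> Ob C; x \<in> Ob C; y \<in> Ob C; z \<in> Ob C;
        f \<in> Hom C w x; g \<in> Hom C x y; h \<in> Hom C y z\<rbrakk>
      \<Longrightarrow> Cmp C w y z h (Cmp C w x y g f) = Cmp C w x z (Cmp C x y z h g) f"

definition is_iso :: "('o, 'm, 'x) cat_scheme \<Rightarrow> 'o \<Rightarrow> 'o \<Rightarrow> 'm \<Rightarrow> bool" where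
  "is_iso C x y f \<longleftrightarrow> f \<in> Hom C x y \<and>
     (\<exists>g\<in>Hom C y x. Cmp C x y x g f = Idn C x \<and> Cmp C y x y f g = Idn C y)"

definition full_sub :: "('o, 'm, 'x) cat_scheme \<Rightarrow> ('o \<Rightarrow> bool) \<Rightarrow> ('o, 'm, 'x) cat_scheme" where
  "full_sub C Q = C\<lparr>Ob := {x \<in> Ob C. Q x}\<rparr>"

record ('o, 'm, 'p, 'n) ftor =
  FOb  :: "'o \<Rightarrow> 'p"
  FHom :: "'o \<Rightarrow> 'o \<Rightarrow> 'm \<Rightarrow> 'n"

locale cat_functor =
  fixes A :: "('o, 'm, 'x) cat_scheme" and B :: "('p, 'n, 'y) cat_scheme"
    and F :: "('o, 'm, 'p, 'n) ftor"
  assumes FOb_in: "x \<in> Ob A \<Longrightarrow> FOb F x \<in> Ob B"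
    and FHom_in: "\<lbrakk>x \<in> Ob A; y \<in> Ob A; f \<in> Hom A x y\<rbrakk>
      \<Longrightarrow> FHom F x y f \<in> Hom B (FOb F x) (FOb F y)"
    and FHom_Idn: "x \<in> Ob A \<Longrightarrow> FHom F x x (Idn A x) = Idn B (FOb F x)"
    and FHom_Cmp: "\<lbrakk>x \<in> Ob A; y \<in> Ob A; z \<in> Ob A; f \<in> Hom A x y; g \<in> Hom A y z\<rbrakk>
      \<Longrightarrow> FHom F x z (Cmp A x y z g f)
        = Cmp B (FOb F x) (FOb F y) (FOb F z) (FHom F y z g) (FHom F x y f)"

text \<open>
  Functors that are themselves arrows of a category are normalised to be \<open>undefined\<close> outside
  their domain, so that equality of functors is equality in HOL.
\<close>

definition mk_ftor :: "('o, 'm, 'x) cat_scheme \<Rightarrow> ('o \<Rightarrow> 'p) \<Rightarrow> ('o \<Rightarrow> 'o \<Rightarrow> 'm \<Rightarrow> 'n)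
    \<Rightarrow> ('o, 'm, 'p, 'n) ftor" where
  "mk_ftor A F0 F1 = \<lparr>FOb = restrict F0 (Ob A),
     FHom = (\<lambda>x y f. if x \<in> Ob A \<and> y \<in> Ob A \<and> f \<in> Hom A x y then F1 x y f else undefined)\<rparr>"

definition ext_ftor :: "('o, 'm, 'x) cat_scheme \<Rightarrow> ('o, 'm, 'p, 'n) ftor \<Rightarrow> bool" where
  "ext_ftor A F \<longleftrightarrow> mk_ftor A (FOb F) (FHom F) = F"

definition id_ftor :: "('o, 'm, 'x) cat_scheme \<Rightarrow> ('o, 'm, 'o, 'm) ftor" where
  "id_ftor A = mk_ftor A (\<lambda>x. x) (\<lambda>x y f. f)"

definition comp_ftor :: "('o, 'm, 'x) cat_scheme \<Rightarrow> ('p, 'n, 'q, 'l) ftor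
    \<Rightarrow> ('o, 'm, 'p, 'n) ftor \<Rightarrow> ('o, 'm, 'q, 'l) ftor" where
  "comp_ftor A G F = mk_ftor A (\<lambda>x. FOb G (FOb F x))
     (\<lambda>x y f. FHom G (FOb F x) (FOb F y) (FHom F x y f))"

definition nat_trans :: "('o, 'm, 'x) cat_scheme \<Rightarrow> ('p, 'n, 'y) cat_scheme
    \<Rightarrow> ('o, 'm, 'p, 'n) ftor \<Rightarrow> ('o, 'm, 'p, 'n) ftor \<Rightarrow> ('o \<Rightarrow> 'n) \<Rightarrow> bool" where
  "nat_trans A B F G \<alpha> \<longleftrightarrow>
     (\<forall>x\<in>Ob A. \<alpha> x \<in> Hom B (FOb F x) (FOb G x)) \<and>
     (\<forall>x\<in>Ob A. \<forall>y\<in>Ob A. \<forall>f\<in>Hom A x y.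
        Cmp B (FOb F x) (FOb F y) (FOb G y) (\<alpha> y) (FHom F x y f)
      = Cmp B (FOb F x) (FOb G x) (FOb G y) (FHom G x y f) (\<alpha> x))"

locale adjunction =
  A: category A + B: category B + F: cat_functor A B F + G: cat_functor B A G
  for A :: "('o, 'm, 'x) cat_scheme" and B :: "('p, 'n, 'y) cat_scheme"
    and F :: "('o, 'm, 'p, 'n) ftor" and G :: "('p, 'n, 'o, 'm) ftor" +
  fixes unit :: "'o \<Rightarrow> 'm" and counit :: "'p \<Rightarrow> 'n"
  assumes unit_natural: "nat_trans A A (id_ftor A) (comp_ftor A G F) unit"
    and counit_natural: "nat_trans B B (comp_ftor B F G) (id_ftor B) counit"
    and triangle_left: "a \<in> Ob A \<Longrightarrow>
      Cmp B (FOb F a) (FOb F (FOb G (FOb F a))) (FOb F a)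
        (counit (FOb F a)) (FHom F a (FOb G (FOb F a)) (unit a)) = Idn B (FOb F a)"
    and triangle_right: "b \<in> Ob B \<Longrightarrow>
      Cmp A (FOb G b) (FOb G (FOb F (FOb G b))) (FOb G b)
        (FHom G (FOb F (FOb G b)) b (counit b)) (unit (FOb G b)) = Idn A (FOb G b)"

definition left_fixpoint :: "('p, 'n, 'y) cat_scheme \<Rightarrow> ('o, 'm, 'p, 'n) ftor
    \<Rightarrow> ('p, 'n, 'o, 'm) ftor \<Rightarrow> ('p \<Rightarrow> 'n) \<Rightarrow> 'p \<Rightarrow> bool" where
  "left_fixpoint B F G counit b \<longleftrightarrow> b \<in> Ob B \<and> is_iso B (FOb F (FOb G b)) b (counit b)"

definition galois_adjunction where
  "galois_adjunction A B F G unit counit \<longleftrightarrow>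
     adjunction A B F G unit counit \<and>
     (\<forall>a\<in>Ob A. left_fixpoint B F G counit (FOb F a))"

text \<open>
  The full subcategory of \<open>A\<close> on the objects satisfying \<open>Q\<close> is reflective via the endofunctor \<open>T\<close>
  of \<open>A\<close> if \<open>T\<close>, regarded as a functor into that subcategory, is left adjoint to the inclusion with
  unit the given family \<open>unit a : a \<rightarrow> T a\<close>. The dual notion has the given family as counit.
\<close>

definition reflective_via where
  "reflective_via A Q T unit \<longleftrightarrow>
     (\<exists>counit. adjunction A (full_sub A Q) T (id_ftor (full_sub A Q)) unit counit)"

definition coreflective_via where
  "coreflective_via B Q T counit \<longleftrightarrow>
     (\<exists>unit. adjunction (full_sub B Q) B (id_ftor (full_sub B Q)) T unit counit)"

section \<open>Restriction categories\<close>

text \<open>\<open>Rst C x y f : x \<rightarrow> x\<close> is the restriction idempotent of \<open>f : x \<rightarrow> y\<close>.\<close>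

record ('o, 'm) rcat = "('o, 'm) cat" +
  Rst :: "'o \<Rightarrow> 'o \<Rightarrow> 'm \<Rightarrow> 'm"

locale restriction_category = category C for C :: "('o, 'm) rcat" +
  assumes Rst_in: "\<lbrakk>x \<in> Ob C; y \<in> Ob C; f \<in> Hom C x y\<rbrakk> \<Longrightarrow> Rst C x y f \<in> Hom C x x"
    and Cmp_Rst: "\<lbrakk>x \<in> Ob C; y \<in> Ob C; f \<in> Hom C x y\<rbrakk> \<Longrightarrow> Cmp C x x y f (Rst C x y f) = f"
    and Rst_commute: "\<lbrakk>x \<in> Ob C; y \<in> Ob C; z \<in> Ob C; f \<in> Hom C x y; g \<in> Hom C x z\<rbrakk>
      \<Longrightarrow> Cmp C x x x (Rst C x y f) (Rst C x z g) = Cmp C x x x (Rst C x z g) (Rst C x y f)"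
    and Rst_Cmp_Rst: "\<lbrakk>x \<in> Ob C; y \<in> Ob C; z \<in> Ob C; f \<in> Hom C x y; g \<in> Hom C x z\<rbrakk>
      \<Longrightarrow> Rst C x z (Cmp C x x z g (Rst C x y f)) = Cmp C x x x (Rst C x z g) (Rst C x y f)"
    and Rst_Cmp: "\<lbrakk>x \<in> Ob C; y \<in> Ob C; z \<in> Ob C; f \<in> Hom C x y; g \<in> Hom C y z\<rbrakk>
      \<Longrightarrow> Cmp C x y y (Rst C y z g) f = Cmp C x x y f (Rst C x z (Cmp C x y z g f))"

definition rst_idems :: "('o, 'm) rcat \<Rightarrow> 'o \<Rightarrow> 'm set" where
  "rst_idems C x = {e \<in> Hom C x x. Rst C x x e = e}"

definition total_map :: "('o, 'm) rcat \<Rightarrow> 'o \<Rightarrow> 'o \<Rightarrow> 'm \<Rightarrow> bool" where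
  "total_map C x y f \<longleftrightarrow> f \<in> Hom C x y \<and> Rst C x y f = Idn C x"

definition map_le :: "('o, 'm) rcat \<Rightarrow> 'o \<Rightarrow> 'o \<Rightarrow> 'm \<Rightarrow> 'm \<Rightarrow> bool" where
  "map_le C x y f g \<longleftrightarrow> f = Cmp C x x y g (Rst C x y f)"

definition compatible :: "('o, 'm) rcat \<Rightarrow> 'o \<Rightarrow> 'o \<Rightarrow> 'm \<Rightarrow> 'm \<Rightarrow> bool" where
  "compatible C x y f g \<longleftrightarrow> Cmp C x x y f (Rst C x y g) = Cmp C x x y g (Rst C x y f)"

definition is_join :: "('o, 'm) rcat \<Rightarrow> 'o \<Rightarrow> 'o \<Rightarrow> 'm set \<Rightarrow> 'm \<Rightarrow> bool" where
  "is_join C x y S f \<longleftrightarrow> f \<in> Hom C x y \<and> (\<forall>s\<in>S. map_le C x y s f) \<and>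
     (\<forall>h\<in>Hom C x y. (\<forall>s\<in>S. map_le C x y s h) \<longrightarrow> map_le C x y f h)"

definition Join :: "('o, 'm) rcat \<Rightarrow> 'o \<Rightarrow> 'o \<Rightarrow> 'm set \<Rightarrow> 'm" where
  "Join C x y S = (THE f. is_join C x y S f)"

locale join_restriction_category = restriction_category +
  assumes join_exists: "\<lbrakk>x \<in> Ob C; y \<in> Ob C; S \<subseteq> Hom C x y;
        \<And>f g. f \<in> S \<Longrightarrow> g \<in> S \<Longrightarrow> compatible C x y f g\<rbrakk>
      \<Longrightarrow> \<exists>f. is_join C x y S f"
    and join_precomp: "\<lbrakk>w \<in> Ob C; x \<in> Ob C; y \<in> Ob C; S \<subseteq> Hom C x y;
        \<And>f g. f \<in> S \<Longrightarrow> g \<in> S \<Longrightarrow> compatible C x y f g; is_join C x y S f; h \<in> Hom C w x\<rbrakk>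
      \<Longrightarrow> is_join C w y ((\<lambda>s. Cmp C w x y s h) ` S) (Cmp C w x y f h)"

locale restriction_functor =
  cat_functor A B F for A :: "('o, 'm) rcat" and B :: "('p, 'n) rcat"
    and F :: "('o, 'm, 'p, 'n) ftor" +
  assumes FHom_Rst: "\<lbrakk>x \<in> Ob A; y \<in> Ob A; f \<in> Hom A x y\<rbrakk>
      \<Longrightarrow> FHom F x x (Rst A x y f) = Rst B (FOb F x) (FOb F y) (FHom F x y f)"

text \<open>
  Each \<open>rst_idems A x\<close> is a meet-semilattice under composition and a restriction functor preserves
  meets; so the induced map is an isomorphism as soon as it is bijective.
\<close>

definition hyperconnected :: "('o, 'm) rcat \<Rightarrow> ('p, 'n) rcat \<Rightarrow> ('o, 'm, 'p, 'n) ftor \<Rightarrow> bool" where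
  "hyperconnected A B F \<longleftrightarrow>
     (\<forall>x\<in>Ob A. bij_betw (FHom F x x) (rst_idems A x) (rst_idems B (FOb F x)))"

definition partial_inverse :: "('o, 'm) rcat \<Rightarrow> 'o \<Rightarrow> 'o \<Rightarrow> 'm \<Rightarrow> 'm \<Rightarrow> bool" where
  "partial_inverse C x y s t \<longleftrightarrow> s \<in> Hom C x y \<and> t \<in> Hom C y x \<and>
     Cmp C x y x t s = Rst C x y s \<and> Cmp C y x y s t = Rst C y x t"

definition partial_iso :: "('o, 'm) rcat \<Rightarrow> 'o \<Rightarrow> 'o \<Rightarrow> 'm \<Rightarrow> bool" where
  "partial_iso C x y s \<longleftrightarrow> (\<exists>t. partial_inverse C x y s t)"

definition local_homeo :: "('o, 'm) rcat \<Rightarrow> 'o \<Rightarrow> 'o \<Rightarrow> 'm \<Rightarrow> bool" where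
  "local_homeo C x y p \<longleftrightarrow> total_map C x y p \<and>
     (\<exists>S. (\<forall>s\<in>S. partial_iso C x y s) \<and> is_join C x y S p)"

definition partial_section :: "('o, 'm) rcat \<Rightarrow> 'o \<Rightarrow> 'o \<Rightarrow> 'm \<Rightarrow> 'm \<Rightarrow> bool" where
  "partial_section C a x p s \<longleftrightarrow> s \<in> Hom C x a \<and> Cmp C x a x p s = Rst C x a s"

definition local_atlas :: "('o, 'm) rcat \<Rightarrow> 'o \<Rightarrow> 'k set \<Rightarrow> ('k \<Rightarrow> 'k \<Rightarrow> 'm) \<Rightarrow> bool" where
  "local_atlas C x I \<phi> \<longleftrightarrow>
     (\<forall>i\<in>I. \<forall>j\<in>I. \<phi> i j \<in> rst_idems C x \<and> \<phi> i j = \<phi> j i) \<and>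
     (\<forall>i\<in>I. \<forall>j\<in>I. \<forall>k\<in>I. map_le C x x (Cmp C x x x (\<phi> j k) (\<phi> i j)) (\<phi> i k))"

definition is_glueing :: "('o, 'm) rcat \<Rightarrow> 'o \<Rightarrow> 'k set \<Rightarrow> ('k \<Rightarrow> 'k \<Rightarrow> 'm)
    \<Rightarrow> 'o \<Rightarrow> 'm \<Rightarrow> ('k \<Rightarrow> 'm) \<Rightarrow> ('k \<Rightarrow> 'm) \<Rightarrow> bool" where
  "is_glueing C x I \<phi> a p q s \<longleftrightarrow> a \<in> Ob C \<and> local_homeo C a x p \<and>
     (\<forall>i\<in>I. partial_inverse C a x (q i) (s i)) \<and> is_join C a x (q ` I) p \<and>
     (\<forall>i\<in>I. \<forall>j\<in>I. \<phi> i j = Cmp C x a x (q j) (s i))"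

text \<open>
  Size conventions: \<open>\<kappa>\<close> is the cardinal bounding the sets that count as small (classically, an
  inaccessible cardinal). A category with local glueings is in general large, with small hom-sets,
  and can only be asked to have glueings of small atlases: a glueing of the discrete atlas indexed
  by \<open>I\<close> on an object with \<open>0 \<noteq> 1\<close> has at least \<open>2 ^ |I|\<close> restriction idempotents, so
  admitting all index sets \<open>I\<close> in \<open>'m\<close> would force every object to be degenerate.
\<close>

definition locally_small :: "'k rel \<Rightarrow> ('o, 'm, 'x) cat_scheme \<Rightarrow> bool" where
  "locally_small \<kappa> C \<longleftrightarrow> (\<forall>x\<in>Ob C. \<forall>y\<in>Ob C. |Hom C x y| <o \<kappa>)"

definition small_cat :: "'k rel \<Rightarrow> ('o, 'm, 'x) cat_scheme \<Rightarrow> bool" where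
  "small_cat \<kappa> C \<longleftrightarrow> |Ob C| <o \<kappa> \<and> locally_small \<kappa> C"

definition has_local_glueings :: "'k rel \<Rightarrow> ('o, 'm) rcat \<Rightarrow> bool" where
  "has_local_glueings \<kappa> C \<longleftrightarrow> (\<forall>x\<in>Ob C. \<forall>(I :: 'm set) \<phi>.
     |I| <o \<kappa> \<and> local_atlas C x I \<phi> \<longrightarrow> (\<exists>a p q s. is_glueing C x I \<phi> a p q s))"

section \<open>Pullbacks\<close>

record ('o, 'm) cospan =
  ob1 :: 'o
  ob2 :: 'o
  base :: 'o
  leg1 :: 'm
  leg2 :: 'm

definition is_pullback :: "('o, 'm, 'x) cat_scheme \<Rightarrow> ('o, 'm) cospan \<Rightarrow> 'o \<Rightarrow> 'm \<Rightarrow> 'm \<Rightarrow> bool" where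
  "is_pullback C K a p q \<longleftrightarrow>
     a \<in> Ob C \<and> p \<in> Hom C a (ob1 K) \<and> q \<in> Hom C a (ob2 K) \<and>
     Cmp C a (ob1 K) (base K) (leg1 K) p = Cmp C a (ob2 K) (base K) (leg2 K) q \<and>
     (\<forall>w\<in>Ob C. \<forall>u\<in>Hom C w (ob1 K). \<forall>v\<in>Hom C w (ob2 K).
        Cmp C w (ob1 K) (base K) (leg1 K) u = Cmp C w (ob2 K) (base K) (leg2 K) v \<longrightarrow>
        (\<exists>!h. h \<in> Hom C w a \<and> Cmp C w a (ob1 K) p h = u \<and> Cmp C w a (ob2 K) q h = v))"

text \<open>A choice of pullbacks, with its projections and the maps \<open>(u, v) : w \<rightarrow> pb C K\<close>.\<close>

definition chosen_pb :: "('o, 'm, 'x) cat_scheme \<Rightarrow> ('o, 'm) cospan \<Rightarrow> 'o \<times> 'm \<times> 'm" where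
  "chosen_pb C K = (SOME (a, p, q). is_pullback C K a p q)"

definition pb :: "('o, 'm, 'x) cat_scheme \<Rightarrow> ('o, 'm) cospan \<Rightarrow> 'o" where
  "pb C K = fst (chosen_pb C K)"

definition pr1 :: "('o, 'm, 'x) cat_scheme \<Rightarrow> ('o, 'm) cospan \<Rightarrow> 'm" where
  "pr1 C K = fst (snd (chosen_pb C K))"

definition pr2 :: "('o, 'm, 'x) cat_scheme \<Rightarrow> ('o, 'm) cospan \<Rightarrow> 'm" where
  "pr2 C K = snd (snd (chosen_pb C K))"

definition pair :: "('o, 'm, 'x) cat_scheme \<Rightarrow> ('o, 'm) cospan \<Rightarrow> 'o \<Rightarrow> 'm \<Rightarrow> 'm \<Rightarrow> 'm" where
  "pair C K w u v = (THE h. h \<in> Hom C w (pb C K) \<and>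
     Cmp C w (pb C K) (ob1 K) (pr1 C K) h = u \<and> Cmp C w (pb C K) (ob2 K) (pr2 C K) h = v)"

section \<open>Partite internal categories and cofunctors\<close>

record ('i, 'o, 'm) pcat =
  Ix  :: "'i set"
  A0  :: "'i \<Rightarrow> 'o"
  A1  :: "'i \<Rightarrow> 'i \<Rightarrow> 'o"
  src :: "'i \<Rightarrow> 'i \<Rightarrow> 'm"
  tgt :: "'i \<Rightarrow> 'i \<Rightarrow> 'm"
  idm :: "'i \<Rightarrow> 'm"
  mul :: "'i \<Rightarrow> 'i \<Rightarrow> 'i \<Rightarrow> 'm"

text \<open>\<open>A1 j k \<times>\<^bsub>A0 j\<^esub> A1 i j\<close>, the domain of \<open>mul i j k\<close>\<close>

definition cmp_cospan :: "('i, 'o, 'm) pcat \<Rightarrow> 'i \<Rightarrow> 'i \<Rightarrow> 'i \<Rightarrow> ('o, 'm) cospan" where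
  "cmp_cospan \<AA> i j k = \<lparr>ob1 = A1 \<AA> j k, ob2 = A1 \<AA> i j, base = A0 \<AA> j,
     leg1 = src \<AA> j k, leg2 = tgt \<AA> i j\<rparr>"

text \<open>\<open>A1 k l \<times>\<^bsub>A0 k\<^esub> (A1 j k \<times>\<^bsub>A0 j\<^esub> A1 i j)\<close>\<close>

definition cmp_cospan3 ::
    "('o, 'm) rcat \<Rightarrow> ('i, 'o, 'm) pcat \<Rightarrow> 'i \<Rightarrow> 'i \<Rightarrow> 'i \<Rightarrow> 'i \<Rightarrow> ('o, 'm) cospan" where
  "cmp_cospan3 C \<AA> i j k l = (let K = cmp_cospan \<AA> i j k in
     \<lparr>ob1 = A1 \<AA> k l, ob2 = pb C K, base = A0 \<AA> k,
      leg1 = src \<AA> k l, leg2 = Cmp C (pb C K) (A1 \<AA> j k) (A0 \<AA> k) (tgt \<AA> j k) (pr1 C K)\<rparr>)"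

definition mul_assoc :: "('o, 'm) rcat \<Rightarrow> ('i, 'o, 'm) pcat \<Rightarrow> 'i \<Rightarrow> 'i \<Rightarrow> 'i \<Rightarrow> 'i \<Rightarrow> bool" where
  "mul_assoc C \<AA> i j k l \<longleftrightarrow>
     (let K = cmp_cospan \<AA> i j k; T = cmp_cospan3 C \<AA> i j k l; t = pb C T;
          h = pr1 C T;
          gf = pr2 C T;
          g = Cmp C t (pb C K) (A1 \<AA> j k) (pr1 C K) gf;
          f = Cmp C t (pb C K) (A1 \<AA> i j) (pr2 C K) gf
      in Cmp C t (pb C (cmp_cospan \<AA> i k l)) (A1 \<AA> i l) (mul \<AA> i k l)
           (pair C (cmp_cospan \<AA> i k l) t h (Cmp C t (pb C K) (A1 \<AA> i k) (mul \<AA> i j k) gf))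
       = Cmp C t (pb C (cmp_cospan \<AA> i j l)) (A1 \<AA> i l) (mul \<AA> i j l)
           (pair C (cmp_cospan \<AA> i j l) t
              (Cmp C t (pb C (cmp_cospan \<AA> j k l)) (A1 \<AA> j l) (mul \<AA> j k l)
                 (pair C (cmp_cospan \<AA> j k l) t h g))
              f))"

locale partite_internal_category =
  fixes C :: "('o, 'm) rcat" and \<AA> :: "('i, 'o, 'm) pcat"
  assumes A0_in: "i \<in> Ix \<AA> \<Longrightarrow> A0 \<AA> i \<in> Ob C"
    and A1_in: "\<lbrakk>i \<in> Ix \<AA>; j \<in> Ix \<AA>\<rbrakk> \<Longrightarrow> A1 \<AA> i j \<in> Ob C"
    and src_total: "\<lbrakk>i \<in> Ix \<AA>; j \<in> Ix \<AA>\<rbrakk> \<Longrightarrow> total_map C (A1 \<AA> i j) (A0 \<AA> i) (src \<AA> i j)"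
    and tgt_total: "\<lbrakk>i \<in> Ix \<AA>; j \<in> Ix \<AA>\<rbrakk> \<Longrightarrow> total_map C (A1 \<AA> i j) (A0 \<AA> j) (tgt \<AA> i j)"
    and src_pullbacks: "\<lbrakk>i \<in> Ix \<AA>; j \<in> Ix \<AA>; y \<in> Ob C; total_map C y (A0 \<AA> i) g\<rbrakk>
      \<Longrightarrow> \<exists>a p q. is_pullback C
            \<lparr>ob1 = A1 \<AA> i j, ob2 = y, base = A0 \<AA> i, leg1 = src \<AA> i j, leg2 = g\<rparr> a p q"
    and idm_in: "i \<in> Ix \<AA> \<Longrightarrow> idm \<AA> i \<in> Hom C (A0 \<AA> i) (A1 \<AA> i i)"
    and src_idm: "i \<in> Ix \<AA> \<Longrightarrow>
      Cmp C (A0 \<AA> i) (A1 \<AA> i i) (A0 \<AA> i) (src \<AA> i i) (idm \<AA> i) = Idn C (A0 \<AA> i)"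
    and tgt_idm: "i \<in> Ix \<AA> \<Longrightarrow>
      Cmp C (A0 \<AA> i) (A1 \<AA> i i) (A0 \<AA> i) (tgt \<AA> i i) (idm \<AA> i) = Idn C (A0 \<AA> i)"
    and mul_in: "\<lbrakk>i \<in> Ix \<AA>; j \<in> Ix \<AA>; k \<in> Ix \<AA>\<rbrakk>
      \<Longrightarrow> mul \<AA> i j k \<in> Hom C (pb C (cmp_cospan \<AA> i j k)) (A1 \<AA> i k)"
    and src_mul: "\<lbrakk>i \<in> Ix \<AA>; j \<in> Ix \<AA>; k \<in> Ix \<AA>; K = cmp_cospan \<AA> i j k\<rbrakk>
      \<Longrightarrow> Cmp C (pb C K) (A1 \<AA> i k) (A0 \<AA> i) (src \<AA> i k) (mul \<AA> i j k)
        = Cmp C (pb C K) (A1 \<AA> i j) (A0 \<AA> i) (src \<AA> i j) (pr2 C K)"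
    and tgt_mul: "\<lbrakk>i \<in> Ix \<AA>; j \<in> Ix \<AA>; k \<in> Ix \<AA>; K = cmp_cospan \<AA> i j k\<rbrakk>
      \<Longrightarrow> Cmp C (pb C K) (A1 \<AA> i k) (A0 \<AA> k) (tgt \<AA> i k) (mul \<AA> i j k)
        = Cmp C (pb C K) (A1 \<AA> j k) (A0 \<AA> k) (tgt \<AA> j k) (pr1 C K)"
    and mul_idm: "\<lbrakk>i \<in> Ix \<AA>; j \<in> Ix \<AA>; K = cmp_cospan \<AA> i i j\<rbrakk>
      \<Longrightarrow> Cmp C (A1 \<AA> i j) (pb C K) (A1 \<AA> i j) (mul \<AA> i i j)
            (pair C K (A1 \<AA> i j) (Idn C (A1 \<AA> i j))
               (Cmp C (A1 \<AA> i j) (A0 \<AA> i) (A1 \<AA> i i) (idm \<AA> i) (src \<AA> i j)))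
        = Idn C (A1 \<AA> i j)"
    and idm_mul: "\<lbrakk>i \<in> Ix \<AA>; j \<in> Ix \<AA>; K = cmp_cospan \<AA> i j j\<rbrakk>
      \<Longrightarrow> Cmp C (A1 \<AA> i j) (pb C K) (A1 \<AA> i j) (mul \<AA> i j j)
            (pair C K (A1 \<AA> i j)
               (Cmp C (A1 \<AA> i j) (A0 \<AA> j) (A1 \<AA> j j) (idm \<AA> j) (tgt \<AA> i j))
               (Idn C (A1 \<AA> i j)))
        = Idn C (A1 \<AA> i j)"
    and mul_mul: "\<lbrakk>i \<in> Ix \<AA>; j \<in> Ix \<AA>; k \<in> Ix \<AA>; l \<in> Ix \<AA>\<rbrakk> \<Longrightarrow> mul_assoc C \<AA> i j k l"

definition source_etale :: "('o, 'm) rcat \<Rightarrow> ('i, 'o, 'm) pcat \<Rightarrow> bool" where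
  "source_etale C \<AA> \<longleftrightarrow>
     (\<forall>i\<in>Ix \<AA>. \<forall>j\<in>Ix \<AA>. local_homeo C (A1 \<AA> i j) (A0 \<AA> i) (src \<AA> i j))"

text \<open>For a cofunctor \<open>F\<close>: \<open>cof F i\<close> is \<open>Fi\<close>, \<open>cof0 F i\<close> is \<open>F\<^sub>i\<close> and \<open>cof1 F i j\<close> is \<open>F\<^sub>i\<^sub>j\<close>.\<close>

record ('i, 'm) cofun =
  cof  :: "'i \<Rightarrow> 'i"
  cof0 :: "'i \<Rightarrow> 'm"
  cof1 :: "'i \<Rightarrow> 'i \<Rightarrow> 'm"

text \<open>\<open>A1 i j \<times>\<^bsub>A0 i\<^esub> B0 (F i)\<close>, the domain of \<open>cof1 F i j\<close>\<close>

definition act_cospan :: "('i, 'o, 'm) pcat \<Rightarrow> ('i, 'o, 'm) pcat \<Rightarrow> ('i, 'm) cofun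
    \<Rightarrow> 'i \<Rightarrow> 'i \<Rightarrow> ('o, 'm) cospan" where
  "act_cospan \<AA> \<BB> F i j = \<lparr>ob1 = A1 \<AA> i j, ob2 = A0 \<BB> (cof F i), base = A0 \<AA> i,
     leg1 = src \<AA> i j, leg2 = cof0 F i\<rparr>"

text \<open>\<open>A1 j k \<times>\<^bsub>A0 j\<^esub> (A1 i j \<times>\<^bsub>A0 i\<^esub> B0 (F i))\<close>\<close>

definition act_cospan3 :: "('o, 'm) rcat \<Rightarrow> ('i, 'o, 'm) pcat \<Rightarrow> ('i, 'o, 'm) pcat
    \<Rightarrow> ('i, 'm) cofun \<Rightarrow> 'i \<Rightarrow> 'i \<Rightarrow> 'i \<Rightarrow> ('o, 'm) cospan" where
  "act_cospan3 C \<AA> \<BB> F i j k = (let K = act_cospan \<AA> \<BB> F i j in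
     \<lparr>ob1 = A1 \<AA> j k, ob2 = pb C K, base = A0 \<AA> j,
      leg1 = src \<AA> j k, leg2 = Cmp C (pb C K) (A1 \<AA> i j) (A0 \<AA> j) (tgt \<AA> i j) (pr1 C K)\<rparr>)"

text \<open>
  In terms of the projections \<open>g, f, b\<close> of the triple pullback, this states
  \<open>F\<^sub>i\<^sub>k (g f, b) = F\<^sub>j\<^sub>k (g, \<tau> F\<^sub>i\<^sub>j (f, b)) \<cdot> F\<^sub>i\<^sub>j (f, b)\<close>.
\<close>

definition cof_mul :: "('o, 'm) rcat \<Rightarrow> ('i, 'o, 'm) pcat \<Rightarrow> ('i, 'o, 'm) pcat
    \<Rightarrow> ('i, 'm) cofun \<Rightarrow> 'i \<Rightarrow> 'i \<Rightarrow> 'i \<Rightarrow> bool" where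
  "cof_mul C \<AA> \<BB> F i j k \<longleftrightarrow>
     (let i' = cof F i; j' = cof F j; k' = cof F k;
          Kij = act_cospan \<AA> \<BB> F i j; Kjk = act_cospan \<AA> \<BB> F j k; Kik = act_cospan \<AA> \<BB> F i k;
          M = cmp_cospan \<AA> i j k; M' = cmp_cospan \<BB> i' j' k';
          T = act_cospan3 C \<AA> \<BB> F i j k; t = pb C T;
          g = pr1 C T;
          f = Cmp C t (pb C Kij) (A1 \<AA> i j) (pr1 C Kij) (pr2 C T);
          b = Cmp C t (pb C Kij) (A0 \<BB> i') (pr2 C Kij) (pr2 C T);
          Ffb = Cmp C t (pb C Kij) (A1 \<BB> i' j') (cof1 F i j) (pr2 C T)
      in Cmp C t (pb C Kik) (A1 \<BB> i' k') (cof1 F i k)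
           (pair C Kik t (Cmp C t (pb C M) (A1 \<AA> i k) (mul \<AA> i j k) (pair C M t g f)) b)
       = Cmp C t (pb C M') (A1 \<BB> i' k') (mul \<BB> i' j' k')
           (pair C M' t
              (Cmp C t (pb C Kjk) (A1 \<BB> j' k') (cof1 F j k)
                 (pair C Kjk t g (Cmp C t (A1 \<BB> i' j') (A0 \<BB> j') (tgt \<BB> i' j') Ffb)))
              Ffb))"

locale partite_cofunctor =
  fixes C :: "('o, 'm) rcat" and \<AA> \<BB> :: "('i, 'o, 'm) pcat" and F :: "('i, 'm) cofun"
  assumes cof_in: "i \<in> Ix \<AA> \<Longrightarrow> cof F i \<in> Ix \<BB>"
    and cof0_total: "i \<in> Ix \<AA> \<Longrightarrow> total_map C (A0 \<BB> (cof F i)) (A0 \<AA> i) (cof0 F i)"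
    and cof1_total: "\<lbrakk>i \<in> Ix \<AA>; j \<in> Ix \<AA>\<rbrakk>
      \<Longrightarrow> total_map C (pb C (act_cospan \<AA> \<BB> F i j)) (A1 \<BB> (cof F i) (cof F j)) (cof1 F i j)"
    and src_cof1: "\<lbrakk>i \<in> Ix \<AA>; j \<in> Ix \<AA>; K = act_cospan \<AA> \<BB> F i j\<rbrakk>
      \<Longrightarrow> Cmp C (pb C K) (A1 \<BB> (cof F i) (cof F j)) (A0 \<BB> (cof F i))
            (src \<BB> (cof F i) (cof F j)) (cof1 F i j)
        = pr2 C K"
    and tgt_cof1: "\<lbrakk>i \<in> Ix \<AA>; j \<in> Ix \<AA>; K = act_cospan \<AA> \<BB> F i j\<rbrakk>
      \<Longrightarrow> Cmp C (pb C K) (A0 \<BB> (cof F j)) (A0 \<AA> j) (cof0 F j)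
            (Cmp C (pb C K) (A1 \<BB> (cof F i) (cof F j)) (A0 \<BB> (cof F j))
               (tgt \<BB> (cof F i) (cof F j)) (cof1 F i j))
        = Cmp C (pb C K) (A1 \<AA> i j) (A0 \<AA> j) (tgt \<AA> i j) (pr1 C K)"
    and cof1_idm: "\<lbrakk>i \<in> Ix \<AA>; K = act_cospan \<AA> \<BB> F i i; b = A0 \<BB> (cof F i)\<rbrakk>
      \<Longrightarrow> Cmp C b (pb C K) (A1 \<BB> (cof F i) (cof F i)) (cof1 F i i)
            (pair C K b (Cmp C b (A0 \<AA> i) (A1 \<AA> i i) (idm \<AA> i) (cof0 F i)) (Idn C b))
        = idm \<BB> (cof F i)"
    and cof1_mul: "\<lbrakk>i \<in> Ix \<AA>; j \<in> Ix \<AA>; k \<in> Ix \<AA>\<rbrakk> \<Longrightarrow> cof_mul C \<AA> \<BB> F i j k"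

definition mk_cofun :: "('i, 'o, 'm) pcat \<Rightarrow> ('i \<Rightarrow> 'i) \<Rightarrow> ('i \<Rightarrow> 'm) \<Rightarrow> ('i \<Rightarrow> 'i \<Rightarrow> 'm)
    \<Rightarrow> ('i, 'm) cofun" where
  "mk_cofun \<AA> F F0 F1 = \<lparr>cof = restrict F (Ix \<AA>), cof0 = restrict F0 (Ix \<AA>),
     cof1 = (\<lambda>i j. if i \<in> Ix \<AA> \<and> j \<in> Ix \<AA> then F1 i j else undefined)\<rparr>"

definition ext_cofun :: "('i, 'o, 'm) pcat \<Rightarrow> ('i, 'm) cofun \<Rightarrow> bool" where
  "ext_cofun \<AA> F \<longleftrightarrow> mk_cofun \<AA> (cof F) (cof0 F) (cof1 F) = F"

definition id_cofun :: "('o, 'm) rcat \<Rightarrow> ('i, 'o, 'm) pcat \<Rightarrow> ('i, 'm) cofun" where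
  "id_cofun C \<AA> = mk_cofun \<AA> (\<lambda>i. i) (\<lambda>i. Idn C (A0 \<AA> i))
     (\<lambda>i j. pr1 C \<lparr>ob1 = A1 \<AA> i j, ob2 = A0 \<AA> i, base = A0 \<AA> i,
                    leg1 = src \<AA> i j, leg2 = Idn C (A0 \<AA> i)\<rparr>)"

text \<open>\<open>(GF)\<^sub>i\<^sub>j (a, c) = G\<^sub>F\<^sub>i\<^sub>,\<^sub>F\<^sub>j (F\<^sub>i\<^sub>j (a, G\<^sub>F\<^sub>i c), c)\<close>\<close>

definition comp_cofun :: "('o, 'm) rcat \<Rightarrow> ('i, 'o, 'm) pcat \<Rightarrow> ('i, 'o, 'm) pcat
    \<Rightarrow> ('i, 'o, 'm) pcat \<Rightarrow> ('i, 'm) cofun \<Rightarrow> ('i, 'm) cofun \<Rightarrow> ('i, 'm) cofun" where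
  "comp_cofun C \<AA> \<BB> \<DD> G F =
     (let GF = (\<lambda>i. cof G (cof F i));
          GF0 = (\<lambda>i. Cmp C (A0 \<DD> (GF i)) (A0 \<BB> (cof F i)) (A0 \<AA> i) (cof0 F i) (cof0 G (cof F i)));
          GF1 = (\<lambda>i j.
            let i' = cof F i; j' = cof F j;
                K = \<lparr>ob1 = A1 \<AA> i j, ob2 = A0 \<DD> (GF i), base = A0 \<AA> i,
                      leg1 = src \<AA> i j, leg2 = GF0 i\<rparr>;
                KF = act_cospan \<AA> \<BB> F i j; KG = act_cospan \<BB> \<DD> G i' j';
                a = pr1 C K; c = pr2 C K;
                Gc = Cmp C (pb C K) (A0 \<DD> (GF i)) (A0 \<BB> i') (cof0 G i') c;
                Fac = Cmp C (pb C K) (pb C KF) (A1 \<BB> i' j') (cof1 F i j) (pair C KF (pb C K) a Gc)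
            in Cmp C (pb C K) (pb C KG) (A1 \<DD> (GF i) (GF j)) (cof1 G i' j')
                 (pair C KG (pb C K) Fac c))
      in mk_cofun \<AA> GF GF0 GF1)"

definition pCat :: "'k rel \<Rightarrow> ('o, 'm) rcat \<Rightarrow> (('i, 'o, 'm) pcat, ('i, 'm) cofun) cat" where
  "pCat \<kappa> C = \<lparr>
     Ob = {\<AA>. partite_internal_category C \<AA> \<and> |Ix \<AA>| <o \<kappa>},
     Hom = (\<lambda>\<AA> \<BB>. {F. partite_cofunctor C \<AA> \<BB> F \<and> ext_cofun \<AA> F}),
     Idn = id_cofun C,
     Cmp = comp_cofun C\<rparr>"

section \<open>Restriction categories over a restriction category\<close>

text \<open>
  The hom-sets of the small restriction categories over \<open>C\<close> are sets of elements of the type \<open>'m\<close>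
  of arrows of \<open>C\<close>. As the hom-sets of \<open>C\<close> need not exhaust \<open>'m\<close>, this type merely serves as the
  universe from which the elements of hom-sets are drawn.
\<close>

type_synonym ('i, 'o, 'm) over = "('i, 'm) rcat \<times> ('i, 'm, 'o, 'm) ftor"
type_synonym ('i, 'm) over_map = "('i, 'm, 'i, 'm) ftor \<times> ('i \<Rightarrow> 'm)"

definition over_object :: "'k rel \<Rightarrow> ('o, 'm) rcat \<Rightarrow> ('i, 'o, 'm) over \<Rightarrow> bool" where
  "over_object \<kappa> C X = (case X of (A, P) \<Rightarrow>
     restriction_category A \<and> small_cat \<kappa> A \<and> restriction_functor A C P)"

definition over_map :: "('o, 'm) rcat \<Rightarrow> ('i, 'o, 'm) over \<Rightarrow> ('i, 'o, 'm) over
    \<Rightarrow> ('i, 'm) over_map \<Rightarrow> bool" where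
  "over_map C X Y f = (case (X, Y, f) of ((A, P), (B, Q), (F, \<alpha>)) \<Rightarrow>
     restriction_functor A B F \<and> ext_ftor A F \<and>
     nat_trans A C (comp_ftor A Q F) P \<alpha> \<and> \<alpha> \<in> extensional (Ob A) \<and>
     (\<forall>x\<in>Ob A. total_map C (FOb Q (FOb F x)) (FOb P x) (\<alpha> x)))"

definition over_id :: "('o, 'm) rcat \<Rightarrow> ('i, 'o, 'm) over \<Rightarrow> ('i, 'm) over_map" where
  "over_id C X = (case X of (A, P) \<Rightarrow> (id_ftor A, \<lambda>x\<in>Ob A. Idn C (FOb P x)))"

definition over_comp :: "('o, 'm) rcat \<Rightarrow> ('i, 'o, 'm) over \<Rightarrow> ('i, 'o, 'm) over
    \<Rightarrow> ('i, 'o, 'm) over \<Rightarrow> ('i, 'm) over_map \<Rightarrow> ('i, 'm) over_map \<Rightarrow> ('i, 'm) over_map" where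
  "over_comp C X Y Z g f =
     (case (X, Y, Z, g, f) of ((A, P), (B, Q), (D, R), (G, \<beta>), (F, \<alpha>)) \<Rightarrow>
       (comp_ftor A G F,
        \<lambda>x\<in>Ob A. Cmp C (FOb R (FOb G (FOb F x))) (FOb Q (FOb F x)) (FOb P x) (\<alpha> x) (\<beta> (FOb F x))))"

definition rCat_over ::
    "'k rel \<Rightarrow> ('o, 'm) rcat \<Rightarrow> (('i, 'o, 'm) over, ('i, 'm) over_map) cat" where
  "rCat_over \<kappa> C = \<lparr>
     Ob = {X. over_object \<kappa> C X},
     Hom = (\<lambda>X Y. {f. over_map C X Y f}),
     Idn = over_id C,
     Cmp = over_comp C\<rparr>"

definition join_hyperconnected :: "('o, 'm) rcat \<Rightarrow> ('i, 'o, 'm) over \<Rightarrow> bool" where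
  "join_hyperconnected C X =
     (case X of (A, P) \<Rightarrow> join_restriction_category A \<and> hyperconnected A C P)"

section \<open>The functor \<open>\<Phi>\<close>\<close>

text \<open>\<open>\<tau>\<^sub>i\<^sub>j\<^sup>* (t) = (t \<tau>\<^sub>i\<^sub>j, rst (t \<tau>\<^sub>i\<^sub>j)) : A1 i j \<rightarrow> A1 j k \<times>\<^bsub>A0 j\<^esub> A1 i j\<close> for \<open>t : A0 j \<rightarrow> A1 j k\<close>\<close>

definition tgt_pull :: "('o, 'm) rcat \<Rightarrow> ('i, 'o, 'm) pcat \<Rightarrow> 'i \<Rightarrow> 'i \<Rightarrow> 'i \<Rightarrow> 'm \<Rightarrow> 'm" where
  "tgt_pull C \<AA> i j k t =
     (let u = Cmp C (A1 \<AA> i j) (A0 \<AA> j) (A1 \<AA> j k) t (tgt \<AA> i j)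
      in pair C (cmp_cospan \<AA> i j k) (A1 \<AA> i j) u (Rst C (A1 \<AA> i j) (A1 \<AA> j k) u))"

definition Phi_cat :: "('o, 'm) rcat \<Rightarrow> ('i, 'o, 'm) pcat \<Rightarrow> ('i, 'm) rcat" where
  "Phi_cat C \<AA> = \<lparr>
     Ob = Ix \<AA>,
     Hom = (\<lambda>i j. {s. partial_section C (A1 \<AA> i j) (A0 \<AA> i) (src \<AA> i j) s}),
     Idn = idm \<AA>,
     Cmp = (\<lambda>i j k t s. let K = cmp_cospan \<AA> i j k in
       Cmp C (A0 \<AA> i) (pb C K) (A1 \<AA> i k) (mul \<AA> i j k)
         (Cmp C (A0 \<AA> i) (A1 \<AA> i j) (pb C K) (tgt_pull C \<AA> i j k t) s)),
     Rst = (\<lambda>i j s. Cmp C (A0 \<AA> i) (A0 \<AA> i) (A1 \<AA> i i) (idm \<AA> i)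
                      (Rst C (A0 \<AA> i) (A1 \<AA> i j) s))\<rparr>"

definition Phi_proj :: "('o, 'm) rcat \<Rightarrow> ('i, 'o, 'm) pcat \<Rightarrow> ('i, 'm, 'o, 'm) ftor" where
  "Phi_proj C \<AA> = mk_ftor (Phi_cat C \<AA>) (A0 \<AA>)
     (\<lambda>i j s. Cmp C (A0 \<AA> i) (A1 \<AA> i j) (A0 \<AA> j) (tgt \<AA> i j) s)"

definition Phi_map :: "('o, 'm) rcat \<Rightarrow> ('i, 'o, 'm) pcat \<Rightarrow> ('i, 'o, 'm) pcat
    \<Rightarrow> ('i, 'm) cofun \<Rightarrow> ('i, 'm) over_map" where
  "Phi_map C \<AA> \<BB> F =
     (mk_ftor (Phi_cat C \<AA>) (cof F)
        (\<lambda>i j s. let K = act_cospan \<AA> \<BB> F i j; b = A0 \<BB> (cof F i);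
                     u = Cmp C b (A0 \<AA> i) (A1 \<AA> i j) s (cof0 F i)
                 in Cmp C b (pb C K) (A1 \<BB> (cof F i) (cof F j)) (cof1 F i j)
                      (pair C K b u (Rst C b (A1 \<AA> i j) u))),
      restrict (cof0 F) (Ix \<AA>))"

definition Phi :: "('o, 'm) rcat
    \<Rightarrow> (('i, 'o, 'm) pcat, ('i, 'm) cofun, ('i, 'o, 'm) over, ('i, 'm) over_map) ftor" where
  "Phi C = \<lparr>FOb = (\<lambda>\<AA>. (Phi_cat C \<AA>, Phi_proj C \<AA>)), FHom = Phi_map C\<rparr>"

section \<open>The functor \<open>\<Psi>\<close>\<close>

definition eq_locus :: "('o, 'm) rcat \<Rightarrow> ('i, 'o, 'm) over \<Rightarrow> 'i \<Rightarrow> 'i \<Rightarrow> 'm \<Rightarrow> 'm \<Rightarrow> 'm" where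
  "eq_locus C X i j f g = (case X of (A, P) \<Rightarrow> Join C (FOb P i) (FOb P i)
     {FHom P i i e | e. e \<in> rst_idems A i \<and>
        map_le A i i e (Cmp A i i i (Rst A i j f) (Rst A i j g)) \<and>
        Cmp A i i j f e = Cmp A i i j g e})"

text \<open>
  The chosen glueing of the atlas \<open>eq_locus C X i j\<close>, as a quadruple consisting of the glued object,
  the local homeomorphism to \<open>FOb P i\<close>, and the families of partial isomorphisms and of their
  partial inverses, both indexed by the arrows \<open>i \<rightarrow> j\<close>.
\<close>

definition Psi_glueing :: "('o, 'm) rcat \<Rightarrow> ('i, 'o, 'm) over \<Rightarrow> 'i \<Rightarrow> 'i
    \<Rightarrow> 'o \<times> 'm \<times> ('m \<Rightarrow> 'm) \<times> ('m \<Rightarrow> 'm)" where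
  "Psi_glueing C X i j = (case X of (A, P) \<Rightarrow>
     (SOME (a, p, q, s). is_glueing C (FOb P i) (Hom A i j) (eq_locus C X i j) a p q s))"

definition Psi_A1 :: "('o, 'm) rcat \<Rightarrow> ('i, 'o, 'm) over \<Rightarrow> 'i \<Rightarrow> 'i \<Rightarrow> 'o" where
  "Psi_A1 C X i j = (case Psi_glueing C X i j of (a, p, q, s) \<Rightarrow> a)"

definition Psi_src :: "('o, 'm) rcat \<Rightarrow> ('i, 'o, 'm) over \<Rightarrow> 'i \<Rightarrow> 'i \<Rightarrow> 'm" where
  "Psi_src C X i j = (case Psi_glueing C X i j of (a, p, q, s) \<Rightarrow> p)"

definition Psi_sec :: "('o, 'm) rcat \<Rightarrow> ('i, 'o, 'm) over \<Rightarrow> 'i \<Rightarrow> 'i \<Rightarrow> 'm \<Rightarrow> 'm" where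
  "Psi_sec C X i j = (case Psi_glueing C X i j of (a, p, q, s) \<Rightarrow> s)"

definition Psi_tgt :: "('o, 'm) rcat \<Rightarrow> ('i, 'o, 'm) over \<Rightarrow> 'i \<Rightarrow> 'i \<Rightarrow> 'm" where
  "Psi_tgt C X i j = (case X of (A, P) \<Rightarrow>
     (THE t. t \<in> Hom C (Psi_A1 C X i j) (FOb P j) \<and>
        (\<forall>f\<in>Hom A i j. Cmp C (FOb P i) (Psi_A1 C X i j) (FOb P j) t (Psi_sec C X i j f)
                       = FHom P i j f)))"

text \<open>\<open>\<Psi>\<close> with the multiplication left open, as the latter is specified in terms of the other data.\<close>

definition Psi_pre :: "('o, 'm) rcat \<Rightarrow> ('i, 'o, 'm) over \<Rightarrow> ('i, 'o, 'm) pcat" where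
  "Psi_pre C X = (case X of (A, P) \<Rightarrow> \<lparr>
     Ix = Ob A,
     A0 = FOb P,
     A1 = Psi_A1 C X,
     src = Psi_src C X,
     tgt = Psi_tgt C X,
     idm = (\<lambda>i. Psi_sec C X i i (Idn A i)),
     mul = undefined\<rparr>)"

definition Psi_mul :: "('o, 'm) rcat \<Rightarrow> ('i, 'o, 'm) over \<Rightarrow> 'i \<Rightarrow> 'i \<Rightarrow> 'i \<Rightarrow> 'm" where
  "Psi_mul C X i j k = (case X of (A, P) \<Rightarrow>
     (let K = cmp_cospan (Psi_pre C X) i j k in
      THE m. m \<in> Hom C (pb C K) (Psi_A1 C X i k) \<and>
        (\<forall>f\<in>Hom A i j. \<forall>g\<in>Hom A j k.
           Cmp C (FOb P i) (pb C K) (Psi_A1 C X i k) m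
             (Cmp C (FOb P i) (Psi_A1 C X i j) (pb C K)
                (tgt_pull C (Psi_pre C X) i j k (Psi_sec C X j k g)) (Psi_sec C X i j f))
           = Psi_sec C X i k (Cmp A i j k g f))))"

definition Psi_ob :: "('o, 'm) rcat \<Rightarrow> ('i, 'o, 'm) over \<Rightarrow> ('i, 'o, 'm) pcat" where
  "Psi_ob C X = (Psi_pre C X)\<lparr>mul := Psi_mul C X\<rparr>"

definition Psi_unit :: "('o, 'm) rcat \<Rightarrow> ('i, 'o, 'm) over \<Rightarrow> ('i, 'm) over_map" where
  "Psi_unit C X = (case X of (A, P) \<Rightarrow>
     (mk_ftor A (\<lambda>i. i) (Psi_sec C X), \<lambda>i\<in>Ob A. Idn C (FOb P i)))"

text \<open>
  The action of \<open>\<Psi>\<close> on maps is the one determined by the universal property of the unit: \<open>\<Psi> m\<close> is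
  the unique cofunctor with \<open>\<Phi> (\<Psi> m) \<circ> unit X = unit Y \<circ> m\<close>.
\<close>

definition Psi_map :: "'k rel \<Rightarrow> ('o, 'm) rcat \<Rightarrow> ('i, 'o, 'm) over \<Rightarrow> ('i, 'o, 'm) over
    \<Rightarrow> ('i, 'm) over_map \<Rightarrow> ('i, 'm) cofun" where
  "Psi_map \<kappa> C X Y m =
     (THE H. H \<in> Hom (pCat \<kappa> C) (Psi_ob C X) (Psi_ob C Y) \<and>
        Cmp (rCat_over \<kappa> C) X (FOb (Phi C) (Psi_ob C X)) (FOb (Phi C) (Psi_ob C Y))
          (FHom (Phi C) (Psi_ob C X) (Psi_ob C Y) H) (Psi_unit C X)
      = Cmp (rCat_over \<kappa> C) X Y (FOb (Phi C) (Psi_ob C Y)) (Psi_unit C Y) m)"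

definition Psi :: "'k rel \<Rightarrow> ('o, 'm) rcat
    \<Rightarrow> (('i, 'o, 'm) over, ('i, 'm) over_map, ('i, 'o, 'm) pcat, ('i, 'm) cofun) ftor" where
  "Psi \<kappa> C = \<lparr>FOb = Psi_ob C, FHom = Psi_map \<kappa> C\<rparr>"

end

theory Submission
  imports Defs
begin

text \<open>
  The category \<open>\<Psi> P\<close> is determined by being generated by the sections \<open>s\<^sub>f\<close>: maps out of a glueing
  of the equality loci, or out of its pullbacks, are the compatible families of maps indexed by the
  arrows \<open>f\<close> of the domain of \<open>P\<close>. Call a category with this property presented by \<open>P\<close>. A cofunctor out of a
  category presented by \<open>P\<close> then amounts to a map from \<open>P\<close> into the image of its target under \<open>\<Phi>\<close>,
  which is the universal property of the unit.

  A source-etale category \<open>\<BB>\<close> is presented by \<open>\<Phi> \<BB>\<close>, with every partial section serving as its own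
  generator. Hence \<open>\<BB>\<close> and \<open>\<Psi> (\<Phi> \<BB>)\<close> have the same universal property and the counit at \<open>\<BB>\<close> is
  invertible. Since each \<open>\<Psi> P\<close> is source-etale, the adjunction is Galois. Finally, if \<open>P\<close> is
  hyperconnected with domain a join restriction category, then each partial section of \<open>\<Psi> P\<close> is locally
  of the form \<open>s\<^sub>f\<close>, and the witnesses \<open>f\<close> can be restricted and joined upstairs, so that the unit at
  \<open>P\<close> is invertible.
\<close>

section \<open>Adjunctions from universal arrows\<close>

text \<open>The join that defines an equality locus is formed in \<open>C\<close>, while
  \<open>A\<close> may have no joins. So two arrows f and g need not agree over the whole locus, but
  only on each idempotent e of \<open>A\<close> that enters the join, and these cover the locus only
  after \<open>P\<close> has been applied. Compatibility on an overlap is therefore always refined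
  to the pulled back cover by such e (\<open>overlap_cov\<close>, \<open>glue_ext\<close>), where it
  becomes the equation f e = g e in \<open>A\<close>.

  An internal category must have pullbacks of its sources along all total maps. For \<Psi> these
  come from a second use of local glueings, for the atlas pulled back along the total map. The
  multiplication lives on such a pullback; maps out of it are tested on pairs of sections, covering
  one factor at a time.

  The action of \<Psi> on maps and the counit are definite descriptions given by the universal
  property of the unit, so functoriality, naturality and the triangle identities need no computation
  with chosen glueings.\<close>

text \<open>\<open>F_map\<close> and \<open>counit\<close> have the shape of \<open>Psi_map\<close>
  and of the counit below, and \<open>univ\<close> makes these descriptions meaningful.
  Functoriality of \<open>F\<close>, naturality of the counit and the left triangle identity compare
  arrows out of some \<open>FOb F a\<close>, which may be done after applying \<open>G\<close> and
  precomposing with the unit. Naturality of the unit and the right triangle identity are the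
  descriptions themselves.\<close>

lemma adjunction_from_universal:
  fixes A :: "('o, 'm, 'x) cat_scheme" and B :: "('p, 'n, 'y) cat_scheme"
    and F :: "('o, 'm, 'p, 'n) ftor" and G :: "('p, 'n, 'o, 'm) ftor"
  assumes "category A" "category B" "cat_functor B A G"
    and F_ob: "\<And>a. a \<in> Ob A \<Longrightarrow> FOb F a \<in> Ob B"
    and unit_in: "\<And>a. a \<in> Ob A \<Longrightarrow> unit a \<in> Hom A a (FOb G (FOb F a))"
    and univ: "\<And>a b f. \<lbrakk>a \<in> Ob A; b \<in> Ob B; f \<in> Hom A a (FOb G b)\<rbrakk> \<Longrightarrow>
      \<exists>!h. h \<in> Hom B (FOb F a) b \<and>
        Cmp A a (FOb G (FOb F a)) (FOb G b) (FHom G (FOb F a) b h) (unit a) = f"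
    and F_map: "\<And>a a' m. FHom F a a' m = (THE h. h \<in> Hom B (FOb F a) (FOb F a') \<and>
        Cmp A a (FOb G (FOb F a)) (FOb G (FOb F a')) (FHom G (FOb F a) (FOb F a') h) (unit a)
      = Cmp A a a' (FOb G (FOb F a')) (unit a') m)"
    and counit: "\<And>b. counit b = (THE h. h \<in> Hom B (FOb F (FOb G b)) b \<and>
        Cmp A (FOb G b) (FOb G (FOb F (FOb G b))) (FOb G b)
          (FHom G (FOb F (FOb G b)) b h) (unit (FOb G b)) = Idn A (FOb G b))"
  shows "adjunction A B F G unit counit"
proof -
  interpret A: category A by fact
  interpret B: category B by fact
  interpret G: cat_functor B A G by fact
  note [simp] = F_ob unit_in G.FOb_in G.FHom_in G.FHom_Idn G.FHom_Cmp
    A.Idn_in A.Cmp_in A.Cmp_Idn A.Idn_Cmp B.Idn_in B.Cmp_in B.Cmp_Idn B.Idn_Cmp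
  have uniq: "h = h'"
    if "a \<in> Ob A" "b \<in> Ob B" "h \<in> Hom B (FOb F a) b" "h' \<in> Hom B (FOb F a) b"
      "Cmp A a (FOb G (FOb F a)) (FOb G b) (FHom G (FOb F a) b h) (unit a)
     = Cmp A a (FOb G (FOb F a)) (FOb G b) (FHom G (FOb F a) b h') (unit a)" for a b h h'
    using univ[of a b "Cmp A a (FOb G (FOb F a)) (FOb G b) (FHom G (FOb F a) b h) (unit a)"] that
    by (metis A.Cmp_in F_ob G.FHom_in G.FOb_in unit_in)
  have map: "FHom F a a' m \<in> Hom B (FOb F a) (FOb F a') \<and>
        Cmp A a (FOb G (FOb F a)) (FOb G (FOb F a')) (FHom G (FOb F a) (FOb F a') (FHom F a a' m)) (unit a)
      = Cmp A a a' (FOb G (FOb F a')) (unit a') m"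
    if "a \<in> Ob A" "a' \<in> Ob A" "m \<in> Hom A a a'" for a a' m
    unfolding F_map by (rule theI', rule univ) (use that in \<open>auto intro: A.Cmp_in\<close>)
  have cou: "counit b \<in> Hom B (FOb F (FOb G b)) b \<and>
        Cmp A (FOb G b) (FOb G (FOb F (FOb G b))) (FOb G b)
          (FHom G (FOb F (FOb G b)) b (counit b)) (unit (FOb G b)) = Idn A (FOb G b)"
    if "b \<in> Ob B" for b
    unfolding counit by (rule theI', rule univ) (use that in \<open>auto\<close>)
  note [simp] = map[THEN conjunct1] cou[THEN conjunct1]
  interpret F: cat_functor A B F
  proof
    fix x assume x: "x \<in> Ob A"
    show "FHom F x x (Idn A x) = Idn B (FOb F x)"
      by (rule uniq[of x "FOb F x"]) (use x map[of x x "Idn A x"] in auto)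
  next
    fix x y z f g assume *: "x \<in> Ob A" "y \<in> Ob A" "z \<in> Ob A" "f \<in> Hom A x y" "g \<in> Hom A y z"
    show "FHom F x z (Cmp A x y z g f)
      = Cmp B (FOb F x) (FOb F y) (FOb F z) (FHom F y z g) (FHom F x y f)"
    proof (rule uniq[of x "FOb F z"])
      let ?G = "\<lambda>a. FOb G (FOb F a)" let ?M = "\<lambda>a b h. FHom G (FOb F a) (FOb F b) (FHom F a b h)"
      have "Cmp A x (?G x) (?G z) (Cmp A (?G x) (?G y) (?G z) (?M y z g) (?M x y f)) (unit x)
          = Cmp A x (?G y) (?G z) (?M y z g) (Cmp A x (?G x) (?G y) (?M x y f) (unit x))"
        using * by (simp add: A.Cmp_assoc)
      also have "\<dots> = Cmp A x y (?G z) (Cmp A y (?G y) (?G z) (?M y z g) (unit y)) f"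
        using * by (simp add: map A.Cmp_assoc)
      also have "\<dots> = Cmp A x z (?G z) (unit z) (Cmp A x y z g f)"
        using * by (simp add: map A.Cmp_assoc)
      finally show "Cmp A x (?G x) (?G z) (?M x z (Cmp A x y z g f)) (unit x)
        = Cmp A x (?G x) (?G z) (FHom G (FOb F x) (FOb F z) (Cmp B (FOb F x) (FOb F y) (FOb F z) (FHom F y z g) (FHom F x y f))) (unit x)"
        using * by (simp add: map)
    qed (use * in auto)
  qed auto
  show ?thesis
  proof
    show "nat_trans A A (id_ftor A) (comp_ftor A G F) unit"
      by (auto simp: nat_trans_def id_ftor_def comp_ftor_def mk_ftor_def map)
    show "nat_trans B B (comp_ftor B F G) (id_ftor B) counit"
      unfolding nat_trans_def
    proof (intro conjI ballI)
      fix x y f assume *: "x \<in> Ob B" "y \<in> Ob B" "f \<in> Hom B x y"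
      let ?g = "FOb G" let ?fg = "\<lambda>b. FOb F (FOb G b)" let ?gfg = "\<lambda>b. FOb G (FOb F (FOb G b))"
      let ?m = "FHom F (?g x) (?g y) (FHom G x y f)"
      have "Cmp B (?fg x) (?fg y) y (counit y) ?m = Cmp B (?fg x) x y f (counit x)"
      proof (rule uniq[of "?g x"])
        have "Cmp A (?g x) (?gfg x) (?g y)
           (Cmp A (?gfg x) (?gfg y) (?g y) (FHom G (?fg y) y (counit y)) (FHom G (?fg x) (?fg y) ?m)) (unit (?g x))
          = Cmp A (?g x) (?gfg y) (?g y) (FHom G (?fg y) y (counit y))
             (Cmp A (?g x) (?gfg x) (?gfg y) (FHom G (?fg x) (?fg y) ?m) (unit (?g x)))"
          using * by (simp add: A.Cmp_assoc)
        also have "\<dots> = FHom G x y f"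
          using * by (simp add: map A.Cmp_assoc cou)
        finally show "Cmp A (?g x) (?gfg x) (?g y) (FHom G (?fg x) y (Cmp B (?fg x) (?fg y) y (counit y) ?m)) (unit (?g x))
          = Cmp A (?g x) (?gfg x) (?g y) (FHom G (?fg x) y (Cmp B (?fg x) x y f (counit x))) (unit (?g x))"
          using * by (simp add: A.Cmp_assoc[symmetric] cou)
      qed (use * in auto)
      then show "Cmp B (FOb (comp_ftor B F G) x) (FOb (comp_ftor B F G) y) (FOb (id_ftor B) y) (counit y)
              (FHom (comp_ftor B F G) x y f) =
             Cmp B (FOb (comp_ftor B F G) x) (FOb (id_ftor B) x) (FOb (id_ftor B) y)
              (FHom (id_ftor B) x y f) (counit x)"
        using * by (simp add: id_ftor_def comp_ftor_def mk_ftor_def)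
    qed (auto simp: id_ftor_def comp_ftor_def mk_ftor_def)
  next
    fix a assume a: "a \<in> Ob A"
    let ?f = "FOb F a" let ?gf = "FOb G (FOb F a)" let ?gfgf = "FOb G (FOb F (FOb G (FOb F a)))"
    let ?fgf = "FOb F (FOb G (FOb F a))"
    show "Cmp B ?f ?fgf ?f (counit ?f) (FHom F a ?gf (unit a)) = Idn B ?f"
    proof (rule uniq[of a])
      have "Cmp A a ?gf ?gf
          (Cmp A ?gf ?gfgf ?gf (FHom G ?fgf ?f (counit ?f)) (FHom G ?f ?fgf (FHom F a ?gf (unit a)))) (unit a)
        = Cmp A a ?gfgf ?gf (FHom G ?fgf ?f (counit ?f))
          (Cmp A a ?gf ?gfgf (FHom G ?f ?fgf (FHom F a ?gf (unit a))) (unit a))"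
        using a by (simp add: A.Cmp_assoc)
      also have "\<dots> = unit a"
        using a by (simp add: map A.Cmp_assoc cou)
      finally show "Cmp A a ?gf ?gf (FHom G ?f ?f (Cmp B ?f ?fgf ?f (counit ?f) (FHom F a ?gf (unit a)))) (unit a)
        = Cmp A a ?gf ?gf (FHom G ?f ?f (Idn B ?f)) (unit a)"
        using a by simp
    qed (use a in auto)
  qed (auto simp: cou)
qed

definition inverse_map :: "('o, 'm, 'x) cat_scheme \<Rightarrow> 'o \<Rightarrow> 'o \<Rightarrow> 'm \<Rightarrow> 'm" where
  "inverse_map C x y f =
     (SOME g. g \<in> Hom C y x \<and> Cmp C x y x g f = Idn C x \<and> Cmp C y x y f g = Idn C y)"

lemma inverse_map:
  assumes "is_iso C x y f"
  shows "inverse_map C x y f \<in> Hom C y x" "Cmp C x y x (inverse_map C x y f) f = Idn C x"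
    "Cmp C y x y f (inverse_map C x y f) = Idn C y"
proof -
  have "\<exists>g. g \<in> Hom C y x \<and> Cmp C x y x g f = Idn C x \<and> Cmp C y x y f g = Idn C y"
    using assms by (auto simp: is_iso_def)
  from someI_ex[OF this] show "inverse_map C x y f \<in> Hom C y x" "Cmp C x y x (inverse_map C x y f) f = Idn C x"
    "Cmp C y x y f (inverse_map C x y f) = Idn C y"
    unfolding inverse_map_def by blast+
qed

section \<open>Reflective and coreflective subcategories cut out by an adjunction\<close>

lemma full_sub_simps [simp]:
  "Ob (full_sub C Q) = {x \<in> Ob C. Q x}" "Hom (full_sub C Q) = Hom C"
  "Idn (full_sub C Q) = Idn C" "Cmp (full_sub C Q) = Cmp C"
  by (simp_all add: full_sub_def)

lemma (in category) full_sub: "category (full_sub C Q)"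
  by unfold_locales (auto simp: Idn_in Cmp_in Cmp_Idn Idn_Cmp Cmp_assoc)

lemma id_ftor_simps [simp]:
  "x \<in> Ob A \<Longrightarrow> FOb (id_ftor A) x = x"
  "\<lbrakk>x \<in> Ob A; y \<in> Ob A; f \<in> Hom A x y\<rbrakk> \<Longrightarrow> FHom (id_ftor A) x y f = f"
  by (simp_all add: id_ftor_def mk_ftor_def)

lemma comp_ftor_simps [simp]:
  "x \<in> Ob A \<Longrightarrow> FOb (comp_ftor A G F) x = FOb G (FOb F x)"
  "\<lbrakk>x \<in> Ob A; y \<in> Ob A; f \<in> Hom A x y\<rbrakk> \<Longrightarrow>
    FHom (comp_ftor A G F) x y f = FHom G (FOb F x) (FOb F y) (FHom F x y f)"
  by (simp_all add: comp_ftor_def mk_ftor_def)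

context adjunction
begin

lemma cmp_rules [simp]:
  "a \<in> Ob A \<Longrightarrow> FOb F a \<in> Ob B" "b \<in> Ob B \<Longrightarrow> FOb G b \<in> Ob A"
  "\<lbrakk>x \<in> Ob A; y \<in> Ob A; f \<in> Hom A x y\<rbrakk> \<Longrightarrow> FHom F x y f \<in> Hom B (FOb F x) (FOb F y)"
  "\<lbrakk>x' \<in> Ob B; y' \<in> Ob B; g \<in> Hom B x' y'\<rbrakk> \<Longrightarrow> FHom G x' y' g \<in> Hom A (FOb G x') (FOb G y')"
  "x \<in> Ob A \<Longrightarrow> Idn A x \<in> Hom A x x" "x' \<in> Ob B \<Longrightarrow> Idn B x' \<in> Hom B x' x'"
  by (simp_all add: F.FOb_in G.FOb_in F.FHom_in G.FHom_in A.Idn_in B.Idn_in)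

lemma unit_in [simp]: "a \<in> Ob A \<Longrightarrow> unit a \<in> Hom A a (FOb G (FOb F a))"
  using unit_natural by (auto simp: nat_trans_def)

lemma counit_in [simp]: "b \<in> Ob B \<Longrightarrow> counit b \<in> Hom B (FOb F (FOb G b)) b"
  using counit_natural by (auto simp: nat_trans_def)

lemma unit_nat: "\<lbrakk>x \<in> Ob A; y \<in> Ob A; f \<in> Hom A x y\<rbrakk> \<Longrightarrow>
  Cmp A x y (FOb G (FOb F y)) (unit y) f
  = Cmp A x (FOb G (FOb F x)) (FOb G (FOb F y)) (FHom G (FOb F x) (FOb F y) (FHom F x y f)) (unit x)"
  using unit_natural by (auto simp: nat_trans_def)

lemma counit_nat: "\<lbrakk>x \<in> Ob B; y \<in> Ob B; f \<in> Hom B x y\<rbrakk> \<Longrightarrow>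
  Cmp B (FOb F (FOb G x)) (FOb F (FOb G y)) y (counit y) (FHom F (FOb G x) (FOb G y) (FHom G x y f))
  = Cmp B (FOb F (FOb G x)) x y f (counit x)"
  using counit_natural by (auto simp: nat_trans_def)

lemma functor_comp_GF: "cat_functor A (full_sub A Q) (comp_ftor A G F)" if "\<And>b. b \<in> Ob B \<Longrightarrow> Q (FOb G b)"
  by unfold_locales (auto simp: that A.Cmp_in F.FHom_Idn G.FHom_Idn F.FHom_Cmp G.FHom_Cmp)

lemma functor_comp_FG: "cat_functor B (full_sub B Q) (comp_ftor B F G)" if "\<And>a. a \<in> Ob A \<Longrightarrow> Q (FOb F a)"
  by unfold_locales (auto simp: that B.Cmp_in F.FHom_Idn G.FHom_Idn F.FHom_Cmp G.FHom_Cmp)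

end

lemma (in category) functor_id_sub: "cat_functor (full_sub C Q) C (id_ftor (full_sub C Q))"
  by unfold_locales (auto simp: Idn_in Cmp_in)

lemma (in category) inverse_map_natural:
  assumes "is_iso C x x' f" "is_iso C y y' g" "h \<in> Hom C x y" "h' \<in> Hom C x' y'"
    and "x \<in> Ob C" "y \<in> Ob C" "x' \<in> Ob C" "y' \<in> Ob C"
    and "Cmp C x y y' g h = Cmp C x x' y' h' f"
  shows "Cmp C x' y' y (inverse_map C y y' g) h' = Cmp C x' x y h (inverse_map C x x' f)"
proof -
  note i = inverse_map[OF assms(1)] note j = inverse_map[OF assms(2)]
  have fg: "f \<in> Hom C x x'" "g \<in> Hom C y y'"
    using assms(1,2) by (auto simp: is_iso_def)
  note [simp] = assms(3-8) i j Cmp_in Idn_Cmp Cmp_Idn fg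
  have "Cmp C x' y' y (inverse_map C y y' g) h'
      = Cmp C x' y' y (inverse_map C y y' g) (Cmp C x' x' y' h' (Cmp C x' x x' f (inverse_map C x x' f)))"
    by simp
  also have "\<dots> = Cmp C x' y' y (inverse_map C y y' g) (Cmp C x' x y' (Cmp C x x' y' h' f) (inverse_map C x x' f))"
    by (simp add: Cmp_assoc del: i(3))
  also have "\<dots> = Cmp C x' y y (Cmp C y y' y (inverse_map C y y' g) g) (Cmp C x' x y h (inverse_map C x x' f))"
    by (simp add: Cmp_assoc[symmetric] assms(9)[symmetric] del: j(2) Idn_Cmp)
  finally show ?thesis by simp
qed

context adjunction
begin

text \<open>The counit of the reflection is the inverse of the unit. Its triangle identity needs
  \<open>unit\<close> at GFa to be GF applied to \<open>unit a\<close>: both are right inverses of G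
  applied to the counit at Fa, and that arrow is invertible because \<open>unit\<close> at GFa is,
  so its right inverses coincide.\<close>

lemma reflective:
  assumes Q: "\<And>b. b \<in> Ob B \<Longrightarrow> Q (FOb G b)"
    and iso: "\<And>a. a \<in> Ob A \<Longrightarrow> Q a \<Longrightarrow> is_iso A a (FOb G (FOb F a)) (unit a)"
  shows "reflective_via A Q (comp_ftor A G F) unit"
  unfolding reflective_via_def
proof (rule exI)
  let ?S = "full_sub A Q" and ?T = "comp_ftor A G F"
  let ?gf = "\<lambda>a. FOb G (FOb F a)"
  define c where "c = (\<lambda>a. inverse_map A a (?gf a) (unit a))"
  have unit_GF: "unit (?gf a) = FHom G (FOb F a) (FOb F (?gf a)) (FHom F a (?gf a) (unit a))"
    if a: "a \<in> Ob A" for a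
  proof -
    let ?u = "unit (?gf a)" and ?v = "FHom G (FOb F a) (FOb F (?gf a)) (FHom F a (?gf a) (unit a))"
      and ?e = "FHom G (FOb F (?gf a)) (FOb F a) (counit (FOb F a))"
    have qa: "Q (?gf a)" using a Q by simp
    note j = inverse_map[OF iso[OF _ qa]]
    have u: "Cmp A (?gf a) (?gf (?gf a)) (?gf a) ?e ?u = Idn A (?gf a)"
      using a by (simp add: triangle_right)
    have v: "Cmp A (?gf a) (?gf (?gf a)) (?gf a) ?e ?v = Idn A (?gf a)"
      using a by (simp add: G.FHom_Cmp[symmetric] triangle_left G.FHom_Idn)
    \<comment> \<open>A left inverse of the invertible \<open>?u\<close> is the inverse of
      \<open>?u\<close>, hence also a right inverse.\<close>
    have "Cmp A (?gf (?gf a)) (?gf a) (?gf (?gf a)) ?u ?e = Idn A (?gf (?gf a))"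
    proof -
      let ?i = "inverse_map A (?gf a) (?gf (?gf a)) ?u"
      have "?e = Cmp A (?gf (?gf a)) (?gf (?gf a)) (?gf a) ?e (Cmp A (?gf (?gf a)) (?gf a) (?gf (?gf a)) ?u ?i)"
        using a j by (simp add: A.Cmp_Idn)
      also have "\<dots> = ?i" using a j(1) u by (simp add: A.Cmp_assoc A.Idn_Cmp)
      finally show ?thesis using a j by simp
    qed
    then have "Cmp A (?gf a) (?gf (?gf a)) (?gf (?gf a)) (Cmp A (?gf (?gf a)) (?gf a) (?gf (?gf a)) ?u ?e) ?v = ?v"
      using a by (simp add: A.Idn_Cmp)
    then show ?thesis using a v by (simp add: A.Cmp_assoc[symmetric] A.Cmp_Idn)
  qed
  interpret S: category ?S by (rule A.full_sub)
  interpret T: cat_functor A ?S ?T by (rule functor_comp_GF) (rule Q)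
  interpret I: cat_functor ?S A "id_ftor ?S" by (rule A.functor_id_sub)
  show "adjunction A ?S ?T (id_ftor ?S) unit c"
  proof
    show "nat_trans A A (id_ftor A) (comp_ftor A (id_ftor ?S) ?T) unit"
      using Q by (auto simp: nat_trans_def unit_nat)
    show "nat_trans ?S ?S (comp_ftor ?S ?T (id_ftor ?S)) (id_ftor ?S) c"
      unfolding nat_trans_def
    proof (intro conjI ballI)
      fix x y f assume "x \<in> Ob ?S" "y \<in> Ob ?S" "f \<in> Hom ?S x y"
      then show "Cmp ?S (FOb (comp_ftor ?S ?T (id_ftor ?S)) x) (FOb (comp_ftor ?S ?T (id_ftor ?S)) y) (FOb (id_ftor ?S) y) (c y)
              (FHom (comp_ftor ?S ?T (id_ftor ?S)) x y f) =
             Cmp ?S (FOb (comp_ftor ?S ?T (id_ftor ?S)) x) (FOb (id_ftor ?S) x) (FOb (id_ftor ?S) y)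
              (FHom (id_ftor ?S) x y f) (c x)"
        unfolding c_def by (simp add: A.inverse_map_natural[OF iso iso] unit_nat)
    qed (use inverse_map(1)[OF iso] in \<open>auto simp: c_def\<close>)
  next
    fix a assume a: "a \<in> Ob A"
    then show "Cmp ?S (FOb ?T a) (FOb ?T (FOb (id_ftor ?S) (FOb ?T a))) (FOb ?T a) (c (FOb ?T a))
          (FHom ?T a (FOb (id_ftor ?S) (FOb ?T a)) (unit a)) = Idn ?S (FOb ?T a)"
      using Q inverse_map(2)[OF iso, of "?gf a"] by (simp add: unit_GF c_def)
  next
    fix b assume "b \<in> Ob ?S"
    then show "Cmp A (FOb (id_ftor ?S) b) (FOb (id_ftor ?S) (FOb ?T (FOb (id_ftor ?S) b))) (FOb (id_ftor ?S) b)
          (FHom (id_ftor ?S) (FOb ?T (FOb (id_ftor ?S) b)) b (c b)) (unit (FOb (id_ftor ?S) b)) = Idn A (FOb (id_ftor ?S) b)"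
      using Q inverse_map[OF iso, of b] by (simp add: c_def)
  qed
qed

text \<open>The mirror image of \<open>reflective\<close>. The counit at FGb and FG applied to
  \<open>counit b\<close> are both left inverses of F applied to the unit at Gb, which is invertible
  because the counit at FGb is.\<close>

lemma coreflective:
  assumes Q: "\<And>a. a \<in> Ob A \<Longrightarrow> Q (FOb F a)"
    and iso: "\<And>b. b \<in> Ob B \<Longrightarrow> Q b \<Longrightarrow> is_iso B (FOb F (FOb G b)) b (counit b)"
  shows "coreflective_via B Q (comp_ftor B F G) counit"
  unfolding coreflective_via_def
proof (rule exI)
  let ?S = "full_sub B Q" and ?T = "comp_ftor B F G"
  let ?fg = "\<lambda>b. FOb F (FOb G b)"
  define c where "c = (\<lambda>b. inverse_map B (?fg b) b (counit b))"
  have counit_FG: "counit (?fg b) = FHom F (FOb G (?fg b)) (FOb G b) (FHom G (?fg b) b (counit b))"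
    if b: "b \<in> Ob B" for b
  proof -
    let ?u = "counit (?fg b)" and ?v = "FHom F (FOb G (?fg b)) (FOb G b) (FHom G (?fg b) b (counit b))"
      and ?e = "FHom F (FOb G b) (FOb G (?fg b)) (unit (FOb G b))"
    have qb: "Q (?fg b)" using b Q by simp
    note j = inverse_map[OF iso[OF _ qb]]
    have u: "Cmp B (?fg b) (?fg (?fg b)) (?fg b) ?u ?e = Idn B (?fg b)"
      using b by (simp add: triangle_left)
    have v: "Cmp B (?fg b) (?fg (?fg b)) (?fg b) ?v ?e = Idn B (?fg b)"
      using b by (simp add: F.FHom_Cmp[symmetric] triangle_right F.FHom_Idn)
    have "Cmp B (?fg (?fg b)) (?fg b) (?fg (?fg b)) ?e ?u = Idn B (?fg (?fg b))"
    proof -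
      let ?i = "inverse_map B (?fg (?fg b)) (?fg b) ?u"
      have "?e = Cmp B (?fg b) (?fg (?fg b)) (?fg (?fg b)) (Cmp B (?fg (?fg b)) (?fg b) (?fg (?fg b)) ?i ?u) ?e"
        using b j by (simp add: B.Idn_Cmp)
      also have "\<dots> = ?i" using b j(1) u by (simp add: B.Cmp_assoc[symmetric] B.Cmp_Idn)
      finally show ?thesis using b j by simp
    qed
    then have "Cmp B (?fg (?fg b)) (?fg (?fg b)) (?fg b) ?v (Cmp B (?fg (?fg b)) (?fg b) (?fg (?fg b)) ?e ?u) = ?v"
      using b by (simp add: B.Cmp_Idn)
    then show ?thesis using b v by (simp add: B.Cmp_assoc B.Idn_Cmp)
  qed
  interpret S: category ?S by (rule B.full_sub)
  interpret T: cat_functor B ?S ?T by (rule functor_comp_FG) (rule Q)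
  interpret I: cat_functor ?S B "id_ftor ?S" by (rule B.functor_id_sub)
  show "adjunction ?S B (id_ftor ?S) ?T c counit"
  proof
    show "nat_trans B B (comp_ftor B (id_ftor ?S) ?T) (id_ftor B) counit"
      using Q by (auto simp: nat_trans_def counit_nat)
    show "nat_trans ?S ?S (id_ftor ?S) (comp_ftor ?S ?T (id_ftor ?S)) c"
      unfolding nat_trans_def
    proof (intro conjI ballI)
      fix x y f assume "x \<in> Ob ?S" "y \<in> Ob ?S" "f \<in> Hom ?S x y"
      then show "Cmp ?S (FOb (id_ftor ?S) x) (FOb (id_ftor ?S) y) (FOb (comp_ftor ?S ?T (id_ftor ?S)) y) (c y)
              (FHom (id_ftor ?S) x y f) =
             Cmp ?S (FOb (id_ftor ?S) x) (FOb (comp_ftor ?S ?T (id_ftor ?S)) x) (FOb (comp_ftor ?S ?T (id_ftor ?S)) y)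
              (FHom (comp_ftor ?S ?T (id_ftor ?S)) x y f) (c x)"
        unfolding c_def by (simp add: B.inverse_map_natural[OF iso iso] counit_nat)
    qed (use inverse_map(1)[OF iso] in \<open>auto simp: c_def\<close>)
  next
    fix b assume b: "b \<in> Ob B"
    then show "Cmp ?S (FOb ?T b) (FOb ?T (FOb (id_ftor ?S) (FOb ?T b))) (FOb ?T b)
          (FHom ?T (FOb (id_ftor ?S) (FOb ?T b)) b (counit b)) (c (FOb ?T b)) = Idn ?S (FOb ?T b)"
      using Q inverse_map(3)[OF iso, of "?fg b"] by (simp add: counit_FG c_def)
  next
    fix a assume "a \<in> Ob ?S"
    then show "Cmp B (FOb (id_ftor ?S) a) (FOb (id_ftor ?S) (FOb ?T (FOb (id_ftor ?S) a))) (FOb (id_ftor ?S) a)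
          (counit (FOb (id_ftor ?S) a)) (FHom (id_ftor ?S) a (FOb ?T (FOb (id_ftor ?S) a)) (c a)) = Idn B (FOb (id_ftor ?S) a)"
      using Q inverse_map[OF iso, of a] by (simp add: c_def)
  qed
qed

end

text \<open>Let h be the arrow that \<open>G\<close> sends to the unit at Gb. The composite counit
  after h is the identity because \<open>G\<close> sends both to the identity of Gb, by a triangle
  identity; h after the counit is rewritten by naturality of the counit and becomes the other
  triangle identity.\<close>

lemma (in adjunction) counit_iso:
  assumes b: "b \<in> Ob B"
    and full: "\<And>b' m. \<lbrakk>b' \<in> Ob B; m \<in> Hom A (FOb G b) (FOb G b')\<rbrakk> \<Longrightarrow> \<exists>!h. h \<in> Hom B b b' \<and> FHom G b b' h = m"
  shows "is_iso B (FOb F (FOb G b)) b (counit b)"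
proof -
  let ?T = "FOb F (FOb G b)"
  note [simp] = b A.Idn_in B.Idn_in F.FOb_in G.FOb_in F.FHom_in G.FHom_in G.FHom_Idn G.FHom_Cmp
  obtain h where h: "h \<in> Hom B b ?T" "FHom G b ?T h = unit (FOb G b)" using full[of ?T "unit (FOb G b)"] by auto
  have c: "Cmp B b ?T b (counit b) h \<in> Hom B b b" using h by (auto intro: B.Cmp_in)
  have "FHom G b b (Cmp B b ?T b (counit b) h) = FHom G b b (Idn B b)" using h triangle_right[OF b] by simp
  then have 1: "Cmp B b ?T b (counit b) h = Idn B b" using full[of b "Idn A (FOb G b)"] c by auto
  have "Cmp B ?T b ?T h (counit b) = Cmp B ?T (FOb F (FOb G ?T)) ?T (counit ?T) (FHom F (FOb G b) (FOb G ?T) (FHom G b ?T h))"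
    using counit_nat[of b ?T h] h by simp
  also have "\<dots> = Idn B ?T" using triangle_left[of "FOb G b"] by (simp add: h(2))
  finally show ?thesis unfolding is_iso_def using h(1) 1 by auto
qed

section \<open>Object-free composition\<close>

text \<open>
  An arrow carries its domain and codomain, and \<open>None\<close> stands for every undefined composite. So
  composition is associative without side conditions, and the object arguments of \<open>Cmp\<close> and \<open>Rst\<close>
  disappear from calculations.
\<close>

type_synonym ('o, 'm) arrow = "('o \<times> 'm \<times> 'o) option"

definition mor :: "('o, 'm) arrow \<Rightarrow> 'm" where
  "mor a = fst (snd (the a))"

context category
begin

definition arr :: "'o \<Rightarrow> 'o \<Rightarrow> 'm \<Rightarrow> ('o, 'm) arrow" where
  "arr x y f = (if x \<in> Ob C \<and> y \<in> Ob C \<and> f \<in> Hom C x y then Some (x, f, y) else None)"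

definition hom :: "'o \<Rightarrow> 'o \<Rightarrow> ('o, 'm) arrow set" where
  "hom x y = {Some (x, f, y) | f. x \<in> Ob C \<and> y \<in> Ob C \<and> f \<in> Hom C x y}"

text \<open>
  The generalised elements of \<open>y\<close>; \<open>None\<close> is included so that they are closed under precomposition
  with anything.
\<close>

definition el :: "'o \<Rightarrow> ('o, 'm) arrow set" where
  "el y = insert None (\<Union>x. hom x y)"

definition cmp :: "('o, 'm) arrow \<Rightarrow> ('o, 'm) arrow \<Rightarrow> ('o, 'm) arrow" (infixr "\<cdot>" 70) where
  "cmp g f = (case g of None \<Rightarrow> None | Some (y', g', z) \<Rightarrow>
     (case f of None \<Rightarrow> None | Some (x, f', y) \<Rightarrow>
       if y = y' \<and> arr x y f' \<noteq> None \<and> arr y z g' \<noteq> None then Some (x, Cmp C x y z g' f', z) else None))"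

definition ide :: "'o \<Rightarrow> ('o, 'm) arrow" where
  "ide x = arr x x (Idn C x)"

lemma homI: "\<lbrakk>x \<in> Ob C; y \<in> Ob C; f \<in> Hom C x y\<rbrakk> \<Longrightarrow> arr x y f \<in> hom x y"
  by (auto simp: arr_def hom_def)

lemma homE:
  assumes "a \<in> hom x y"
  obtains f where "x \<in> Ob C" "y \<in> Ob C" "f \<in> Hom C x y" "a = arr x y f" "mor a = f"
  using assms by (auto simp: arr_def hom_def mor_def)

lemma hom_ob: "a \<in> hom x y \<Longrightarrow> x \<in> Ob C" "a \<in> hom x y \<Longrightarrow> y \<in> Ob C"
  by (auto simp: hom_def)

lemma mor_in: "a \<in> hom x y \<Longrightarrow> mor a \<in> Hom C x y"
  by (auto simp: hom_def mor_def)

lemma arr_mor: "a \<in> hom x y \<Longrightarrow> arr x y (mor a) = a"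
  by (auto simp: arr_def hom_def mor_def)

lemma mor_arr: "\<lbrakk>x \<in> Ob C; y \<in> Ob C; f \<in> Hom C x y\<rbrakk> \<Longrightarrow> mor (arr x y f) = f"
  by (auto simp: arr_def mor_def)

lemma arr_inj: "\<lbrakk>arr x y f = arr x y g; x \<in> Ob C; y \<in> Ob C; f \<in> Hom C x y; g \<in> Hom C x y\<rbrakk> \<Longrightarrow> f = g"
  by (auto simp: arr_def)

lemma cmp_None [simp]: "None \<cdot> f = None" "f \<cdot> None = None"
  by (auto simp: cmp_def split: option.split)

lemma cmp_Some: "Some (y', g, z) \<cdot> Some (x, f, y) =
    (if y = y' \<and> x \<in> Ob C \<and> y \<in> Ob C \<and> z \<in> Ob C \<and> f \<in> Hom C x y \<and> g \<in> Hom C y z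
     then Some (x, Cmp C x y z g f, z) else None)"
  by (auto simp: cmp_def arr_def)

lemma cmp_assoc: "(h \<cdot> g) \<cdot> f = h \<cdot> g \<cdot> f"
proof (cases "h = None \<or> g = None \<or> f = None")
  case False
  then obtain x f' y y' g' z z' h' w where "f = Some (x, f', y)" "g = Some (y', g', z)" "h = Some (z', h', w)"
    by (metis option.exhaust prod_cases3)
  then show ?thesis by (cases "y = y'"; cases "z = z'") (auto simp: cmp_Some Cmp_in Cmp_assoc)
qed auto

text \<open>Composites are kept nested to the right, where an equation for
  \<open>a \<cdot> b\<close> does not match as it stands; this is its form for the interior of a
  longer composite.\<close>

lemma cmp_reassoc: "a \<cdot> b = c \<Longrightarrow> a \<cdot> b \<cdot> x = c \<cdot> x"
  by (simp flip: cmp_assoc)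

lemma arr_Cmp: "\<lbrakk>x \<in> Ob C; y \<in> Ob C; z \<in> Ob C; f \<in> Hom C x y; g \<in> Hom C y z\<rbrakk>
    \<Longrightarrow> arr x z (Cmp C x y z g f) = arr y z g \<cdot> arr x y f"
  by (auto simp: cmp_def arr_def Cmp_in)

lemma cmp_hom: "\<lbrakk>g \<in> hom y z; f \<in> hom x y\<rbrakk> \<Longrightarrow> g \<cdot> f \<in> hom x z"
  by (auto simp: cmp_def hom_def arr_def Cmp_in)

lemma ide_hom: "x \<in> Ob C \<Longrightarrow> ide x \<in> hom x x"
  by (auto simp: ide_def Idn_in homI)

lemma cmp_ide: "f \<in> hom x y \<Longrightarrow> f \<cdot> ide x = f"
  by (auto simp: cmp_def hom_def ide_def arr_def Idn_in Cmp_Idn)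

lemma ide_cmp [simp]: "f \<in> el y \<Longrightarrow> ide y \<cdot> f = f"
  by (auto simp: el_def cmp_def hom_def ide_def arr_def Idn_in Idn_Cmp)

lemma ide_cmp_hom: "f \<in> hom x y \<Longrightarrow> ide y \<cdot> f = f"
  by (rule ide_cmp) (auto simp: el_def)

lemma hom_el: "f \<in> hom x y \<Longrightarrow> f \<in> el y"
  by (auto simp: el_def)

lemma el_None [simp]: "None \<in> el y"
  by (auto simp: el_def)

lemma cmp_el: "f \<in> el y \<Longrightarrow> f \<cdot> g \<in> el y"
  by (auto simp: cmp_def el_def hom_def arr_def Cmp_in split: option.split)

lemma hom_not_None: "f \<in> hom x y \<Longrightarrow> f \<noteq> None"
  by (auto simp: hom_def)

lemma cmp_eq_None_iff: "\<lbrakk>g \<in> hom y z; f \<in> el y\<rbrakk> \<Longrightarrow> g \<cdot> f = None \<longleftrightarrow> f = None"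
  by (auto simp: cmp_def hom_def el_def arr_def)

lemma hom_cmp_el: "f \<in> hom x y \<Longrightarrow> f \<cdot> g \<in> el y"
  by (rule cmp_el[OF hom_el])

lemma cmp_hom_dom: "\<lbrakk>g \<in> hom y z; f \<in> el y; g \<cdot> f \<in> hom x z'\<rbrakk> \<Longrightarrow> f \<in> hom x y"
  by (auto simp: cmp_def hom_def el_def arr_def split: if_splits)

text \<open>An arrow other than \<open>None\<close> carries its domain, so equal composites force
  their right factors to start at the same object.\<close>

lemma el_eq_hom: "\<lbrakk>g \<in> hom y z; g' \<in> hom y' z'; f \<in> el y; f' \<in> hom x y'; g \<cdot> f = g' \<cdot> f'\<rbrakk> \<Longrightarrow> f \<in> hom x y"
  using cmp_hom[of g' y' z' f' x] cmp_hom_dom[of g y z f x z'] by simp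

end

section \<open>Restriction idempotents, total maps and the order on object-free arrows\<close>

context restriction_category
begin

definition rst :: "('o, 'm) arrow \<Rightarrow> ('o, 'm) arrow" where
  "rst f = (case f of None \<Rightarrow> None | Some (x, f', y) \<Rightarrow>
     if arr x y f' \<noteq> None then Some (x, Rst C x y f', x) else None)"

lemma rst_None [simp]: "rst None = None"
  by (simp add: rst_def)

lemma arr_Rst: "\<lbrakk>x \<in> Ob C; y \<in> Ob C; f \<in> Hom C x y\<rbrakk> \<Longrightarrow> arr x x (Rst C x y f) = rst (arr x y f)"
  by (auto simp: arr_def rst_def Rst_in)

lemma rst_hom: "f \<in> hom x y \<Longrightarrow> rst f \<in> hom x x"
  by (auto simp: hom_def rst_def arr_def Rst_in)

lemma rst_Some: "rst (Some (x, f, y)) =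
    (if x \<in> Ob C \<and> y \<in> Ob C \<and> f \<in> Hom C x y then Some (x, Rst C x y f, x) else None)"
  by (auto simp: rst_def arr_def)

lemma arrow_cases2:
  obtains "f = None \<or> g = None" | x f' y x' g' y' where "f = Some (x, f', y)" "g = Some (x', g', y')"
  by (metis option.exhaust prod_cases3)

lemma cmp_rst_self [simp]: "f \<cdot> rst f = f" if "f \<in> el y"
  using that by (auto simp: el_def cmp_Some rst_Some hom_def Rst_in Cmp_Rst)

lemma hom_rst: "f \<in> hom x y \<Longrightarrow> f \<cdot> rst f = f"
  by (rule cmp_rst_self[OF hom_el])

lemma rst_comm: "rst f \<cdot> rst g = rst g \<cdot> rst f"
  by (cases rule: arrow_cases2[of f g]) (auto simp: cmp_Some rst_Some Rst_in intro: Rst_commute)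

lemma rst_cmp_rst [simp]: "rst (g \<cdot> rst f) = rst g \<cdot> rst f"
  by (cases rule: arrow_cases2[of f g]) (auto simp: cmp_Some rst_Some Rst_in Cmp_in Rst_Cmp_Rst)

lemma rst_swap: "rst g \<cdot> f = f \<cdot> rst (g \<cdot> f)"
  by (cases rule: arrow_cases2[of f g]) (auto simp: cmp_Some rst_Some Rst_in Cmp_in Rst_Cmp)

lemma rst_el_None: "(\<forall>y. f \<notin> el y) \<Longrightarrow> rst f = None"
  by (auto simp: el_def rst_def hom_def arr_def split: option.split)

lemma rst_idem [simp]: "rst f \<cdot> rst f = rst f"
  by (metis cmp_None(1) cmp_rst_self rst_cmp_rst rst_el_None)

lemma rst_rst [simp]: "rst (rst f) = rst f"
proof (cases "\<exists>y. f \<in> el y")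
  case True
  then consider "f = None" | x y where "f \<in> hom x y" by (auto simp: el_def)
  then show ?thesis
  proof cases
    case 2
    then have "ide x \<in> hom x x" by (simp add: hom_ob ide_hom)
    then have "rst (ide x) = ide x"
      by (metis cmp_rst_self ide_cmp_hom hom_el rst_hom)
    then show ?thesis
      using rst_cmp_rst[of "ide x" f] 2 by (simp add: ide_cmp_hom[OF rst_hom])
  qed simp
qed (simp add: rst_el_None)

lemma rst_cmp_rst_right [simp]: "rst (g \<cdot> f) \<cdot> rst f = rst (g \<cdot> f)"
proof (cases "\<exists>y. f \<in> el y")
  case True
  then show ?thesis by (metis cmp_rst_self rst_cmp_rst cmp_assoc)
next
  case False
  then have "g \<cdot> f = None" by (auto simp: cmp_def el_def hom_def arr_def split: option.split)
  then show ?thesis by simp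
qed

lemma rst_rst_cmp [simp]: "rst (rst g \<cdot> f) = rst (g \<cdot> f)"
  by (metis rst_swap rst_cmp_rst rst_comm rst_cmp_rst_right)

lemma rst_rst_idem_assoc [simp]: "rst f \<cdot> rst f \<cdot> x = rst f \<cdot> x"
  by (simp flip: cmp_assoc)

lemma rst_left_comm: "rst f \<cdot> rst g \<cdot> x = rst g \<cdot> rst f \<cdot> x"
  by (metis cmp_assoc rst_comm)

definition tot :: "'o \<Rightarrow> 'o \<Rightarrow> ('o, 'm) arrow set" where
  "tot x y = {f \<in> hom x y. rst f = ide x}"

lemma tot_hom: "f \<in> tot x y \<Longrightarrow> f \<in> hom x y"
  by (simp add: tot_def)

lemma tot_rst: "f \<in> tot x y \<Longrightarrow> rst f = ide x"
  by (simp add: tot_def)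

lemma rst_tot [simp]: "\<lbrakk>g \<in> tot x y; f \<in> el x\<rbrakk> \<Longrightarrow> rst (g \<cdot> f) = rst f"
  by (metis tot_rst ide_cmp rst_rst_cmp)

lemma ide_tot: "x \<in> Ob C \<Longrightarrow> ide x \<in> tot x x"
  using hom_rst[OF ide_hom] ide_cmp_hom[OF rst_hom[OF ide_hom]] by (simp add: tot_def ide_hom)

lemma rst_ide [simp]: "x \<in> Ob C \<Longrightarrow> rst (ide x) = ide x"
  using ide_tot tot_rst by blast

lemma cmp_tot: "\<lbrakk>g \<in> tot y z; f \<in> tot x y\<rbrakk> \<Longrightarrow> g \<cdot> f \<in> tot x z"
  using rst_tot[of g y z f] by (auto simp: tot_def cmp_hom hom_el)

lemma total_map_iff: "\<lbrakk>x \<in> Ob C; y \<in> Ob C\<rbrakk> \<Longrightarrow> total_map C x y f \<longleftrightarrow> f \<in> Hom C x y \<and> arr x y f \<in> tot x y"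
  by (auto simp: total_map_def tot_def homI ide_def arr_Rst[symmetric] Rst_in Idn_in intro: arr_inj)

lemma arr_tot: "\<lbrakk>total_map C x y f; x \<in> Ob C; y \<in> Ob C\<rbrakk> \<Longrightarrow> arr x y f \<in> tot x y"
  by (simp add: total_map_iff)

definition idem :: "'o \<Rightarrow> ('o, 'm) arrow set" where
  "idem x = {e \<in> hom x x. rst e = e}"

lemma idem_hom: "e \<in> idem x \<Longrightarrow> e \<in> hom x x"
  by (simp add: idem_def)

lemma idem_rst: "e \<in> idem x \<Longrightarrow> rst e = e"
  by (simp add: idem_def)

lemma rst_in_idem: "f \<in> hom x y \<Longrightarrow> rst f \<in> idem x"
  by (simp add: idem_def rst_hom)

lemma idem_comm: "\<lbrakk>e \<in> idem x; d \<in> idem x\<rbrakk> \<Longrightarrow> e \<cdot> d = d \<cdot> e"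
  by (metis idem_rst rst_comm)

lemma idem_idem: "e \<in> idem x \<Longrightarrow> e \<cdot> e = e"
  by (metis idem_rst rst_idem)

lemma cmp_idem: "\<lbrakk>e \<in> idem x; d \<in> idem x\<rbrakk> \<Longrightarrow> e \<cdot> d \<in> idem x"
  using rst_cmp_rst[of e d] by (auto simp: idem_def cmp_hom)

lemma ide_idem: "x \<in> Ob C \<Longrightarrow> ide x \<in> idem x"
  by (simp add: idem_def ide_hom)

lemma rst_cmp_idem: "e \<in> idem x \<Longrightarrow> rst (f \<cdot> e) = rst f \<cdot> e"
  by (metis idem_rst rst_cmp_rst)

lemma idem_absorb: "\<lbrakk>e \<in> idem x; u \<in> hom x y\<rbrakk> \<Longrightarrow> e \<cdot> rst (u \<cdot> e) = rst (u \<cdot> e)"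
  by (metis cmp_assoc idem_comm idem_idem rst_cmp_idem rst_in_idem)

lemma rst_idems_iff: "x \<in> Ob C \<Longrightarrow> e \<in> rst_idems C x \<longleftrightarrow> e \<in> Hom C x x \<and> arr x x e \<in> idem x"
  unfolding rst_idems_def idem_def
  by (auto simp: homI arr_Rst[symmetric]) (metis Rst_in arr_inj)

text \<open>\<open>s\<close> is below \<open>u\<close> iff \<open>u \<cdot> rst s = s\<close>; with
  this reading of \<open>map_le\<close> the predicate is \<open>is_join\<close> for object-free
  arrows, and \<open>lub_iff\<close> makes the translation.\<close>

definition lub :: "'o \<Rightarrow> 'o \<Rightarrow> ('o, 'm) arrow set \<Rightarrow> ('o, 'm) arrow \<Rightarrow> bool" where
  "lub x y U u \<longleftrightarrow> u \<in> hom x y \<and> U \<subseteq> hom x y \<and> (\<forall>s\<in>U. u \<cdot> rst s = s) \<and>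
     (\<forall>h\<in>hom x y. (\<forall>s\<in>U. h \<cdot> rst s = s) \<longrightarrow> h \<cdot> rst u = u)"

lemma map_le_iff: "\<lbrakk>x \<in> Ob C; y \<in> Ob C; f \<in> Hom C x y; g \<in> Hom C x y\<rbrakk>
    \<Longrightarrow> map_le C x y f g \<longleftrightarrow> arr x y g \<cdot> rst (arr x y f) = arr x y f"
  unfolding map_le_def
  by (metis Cmp_in Rst_in arr_Cmp arr_Rst arr_inj)

lemma compatible_iff: "\<lbrakk>x \<in> Ob C; y \<in> Ob C; f \<in> Hom C x y; g \<in> Hom C x y\<rbrakk>
    \<Longrightarrow> compatible C x y f g \<longleftrightarrow> arr x y f \<cdot> rst (arr x y g) = arr x y g \<cdot> rst (arr x y f)"
  unfolding compatible_def
  by (metis Cmp_in Rst_in arr_Cmp arr_Rst arr_inj)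

lemma hom_image: "\<lbrakk>x \<in> Ob C; y \<in> Ob C\<rbrakk> \<Longrightarrow> hom x y = arr x y ` Hom C x y"
  by (auto simp: hom_def arr_def image_iff)

lemma lub_iff: "\<lbrakk>x \<in> Ob C; y \<in> Ob C; S \<subseteq> Hom C x y; f \<in> Hom C x y\<rbrakk>
    \<Longrightarrow> lub x y (arr x y ` S) (arr x y f) \<longleftrightarrow> is_join C x y S f"
  unfolding lub_def is_join_def hom_image
  by (auto simp: map_le_iff subset_eq)

text \<open>Both sides are \<open>u\<close> restricted to the meet of the two domains. This
  discharges the compatibility premise of \<open>lub_exists\<close> for families that have an upper
  bound.\<close>

lemma below_compatible:
  assumes "u \<cdot> rst s = s" "u \<cdot> rst t = t"
  shows "s \<cdot> rst t = t \<cdot> rst s"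
proof -
  have "(u \<cdot> rst s) \<cdot> rst t = (u \<cdot> rst t) \<cdot> rst s"
    by (simp only: cmp_assoc rst_comm[of s t])
  then show ?thesis by (simp only: assms)
qed

lemma lub_hom: "lub x y U u \<Longrightarrow> u \<in> hom x y"
  by (simp add: lub_def)

lemma lub_upper: "\<lbrakk>lub x y U u; s \<in> U\<rbrakk> \<Longrightarrow> u \<cdot> rst s = s"
  by (simp add: lub_def)

lemma lub_least: "\<lbrakk>lub x y U u; h \<in> hom x y; \<And>s. s \<in> U \<Longrightarrow> h \<cdot> rst s = s\<rbrakk> \<Longrightarrow> h \<cdot> rst u = u"
  by (simp add: lub_def)

lemma lub_unique: "\<lbrakk>lub x y U u; lub x y U v\<rbrakk> \<Longrightarrow> u = v"
  unfolding lub_def by (metis cmp_assoc rst_cmp_rst rst_comm)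

lemma is_join_unique: "\<lbrakk>x \<in> Ob C; y \<in> Ob C; S \<subseteq> Hom C x y; is_join C x y S f; is_join C x y S g\<rbrakk> \<Longrightarrow> f = g"
  by (meson arr_inj is_join_def lub_iff lub_unique)

end

section \<open>Covers\<close>

context join_restriction_category
begin

lemma lub_exists:
  assumes "x \<in> Ob C" "y \<in> Ob C" "U \<subseteq> hom x y"
    and "\<And>u v. \<lbrakk>u \<in> U; v \<in> U\<rbrakk> \<Longrightarrow> u \<cdot> rst v = v \<cdot> rst u"
  shows "\<exists>u. lub x y U u"
proof -
  have U: "arr x y ` mor ` U = U" "mor ` U \<subseteq> Hom C x y"
    using assms(3) by (force simp: arr_mor mor_in image_iff)+
  have "\<exists>f. is_join C x y (mor ` U) f"
    by (rule join_exists) (use assms in \<open>auto simp: compatible_iff arr_mor mor_in subset_eq\<close>)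
  then obtain f where f: "is_join C x y (mor ` U) f" ..
  then have "f \<in> Hom C x y" by (simp add: is_join_def)
  then show ?thesis
    using lub_iff[OF assms(1,2) U(2)] f U(1) by auto
qed

lemma lub_precomp:
  assumes "lub x y U u" "h \<in> hom w x"
  shows "lub w y ((\<lambda>s. s \<cdot> h) ` U) (u \<cdot> h)"
proof -
  have ob: "x \<in> Ob C" "y \<in> Ob C" "w \<in> Ob C" and sub: "U \<subseteq> hom x y"
    using assms by (auto simp: lub_def hom_ob)
  have U: "arr x y ` mor ` U = U" "mor ` U \<subseteq> Hom C x y"
    using sub by (force simp: arr_mor mor_in image_iff)+
  have u: "arr x y (mor u) = u" "mor u \<in> Hom C x y" and h: "arr w x (mor h) = h" "mor h \<in> Hom C w x"
    using assms by (auto simp: arr_mor mor_in lub_def)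
  have c: "s \<cdot> rst t = t \<cdot> rst s" if "s \<in> U" "t \<in> U" for s t
    using below_compatible lub_upper[OF assms(1)] that by blast
  have "is_join C w y ((\<lambda>s. Cmp C w x y s (mor h)) ` mor ` U) (Cmp C w x y (mor u) (mor h))"
  proof (rule join_precomp)
    show "is_join C x y (mor ` U) (mor u)"
      using assms(1) U u ob by (simp flip: lub_iff)
    show "compatible C x y f g" if "f \<in> mor ` U" "g \<in> mor ` U" for f g
      using that sub ob by (auto simp: compatible_iff subset_eq mor_in arr_mor c)
  qed (use ob U h in auto)
  moreover have "arr w y ` (\<lambda>s. Cmp C w x y s (mor h)) ` mor ` U = (\<lambda>s. s \<cdot> h) ` U"
    using sub h ob by (auto simp: image_image subset_eq mor_in arr_mor arr_Cmp intro!: image_cong)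
  ultimately show ?thesis
    using ob u h U by (simp add: lub_iff[symmetric] Cmp_in image_subset_iff arr_Cmp)
qed

text \<open>Let e be the join of the restrictions. Then e is below \<open>rst u\<close>, and
  \<open>u \<cdot> e\<close> is still an upper bound of \<open>U\<close>, so \<open>u\<close> is
  below \<open>u \<cdot> e\<close> and \<open>rst u\<close> cannot exceed e.\<close>

lemma lub_rst:
  assumes u: "lub x y U u"
  shows "lub x x (rst ` U) (rst u)"
proof -
  have sub: "U \<subseteq> hom x y" and uh: "u \<in> hom x y" using u by (auto simp: lub_def)
  then have ob: "x \<in> Ob C" by (auto simp: hom_ob)
  have "\<exists>e. lub x x (rst ` U) e"
    by (rule lub_exists) (use sub ob in \<open>auto simp: rst_hom rst_comm\<close>)
  then obtain e where e: "lub x x (rst ` U) e" ..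
  have le: "rst u \<cdot> rst s = rst s" if "s \<in> U" for s
    using lub_upper[OF u that] by (metis rst_cmp_rst)
  have ue: "rst u \<cdot> rst e = e"
    by (rule lub_least[OF e rst_hom[OF uh]]) (use le in auto)
  then have e': "rst e = e" by (metis rst_cmp_rst rst_rst)
  have "(u \<cdot> e) \<cdot> rst s = s" if "s \<in> U" for s
    using lub_upper[OF e, of "rst s"] lub_upper[OF u that] that by (simp add: cmp_assoc)
  then have "(u \<cdot> e) \<cdot> rst u = u"
    using lub_least[OF u cmp_hom[OF uh lub_hom[OF e]]] by blast
  then have "rst u = e"
    using ue e' by (metis cmp_assoc rst_cmp_rst rst_comm rst_idem)
  then show ?thesis using e by simp
qed

text \<open>The axioms give preservation of joins by precomposition, whereas here a cover is
  composed with \<open>u\<close> and \<open>v\<close> on the left. So it is derived that each map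
  \<open>w\<close> with \<open>w \<cdot> d = w\<close> is the join m of the
  \<open>w \<cdot> e\<close>: m is below \<open>w\<close>, and by \<open>lub_precomp\<close> and
  \<open>lub_rst\<close> it has the same restriction. Agreement on the members of \<open>E\<close>
  then makes the two joins equal.\<close>

lemma lub_eqI:
  assumes d: "lub x x E d" and E: "E \<subseteq> idem x"
    and uv: "u \<in> hom x y" "v \<in> hom x y" "u \<cdot> d = u" "v \<cdot> d = v"
    and eq: "\<And>e. e \<in> E \<Longrightarrow> u \<cdot> e = v \<cdot> e"
  shows "u = v"
proof -
  have main: "lub x y ((\<lambda>e. w \<cdot> e) ` E) w" if w: "w \<in> hom x y" "w \<cdot> d = w" for w
  proof -
    have we: "w \<cdot> e \<in> hom x y" if "e \<in> E" for e using that E w by (auto intro: cmp_hom idem_hom)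
    have r: "rst (w \<cdot> e) = rst w \<cdot> e" if "e \<in> E" for e using that E by (auto simp: rst_cmp_idem)
    have up: "w \<cdot> rst (w \<cdot> e) = w \<cdot> e" if "e \<in> E" for e
      by (simp add: r that) (metis cmp_assoc cmp_rst_self hom_el w(1))
    have "\<exists>m. lub x y ((\<lambda>e. w \<cdot> e) ` E) m"
    proof (rule lub_exists)
      show "s \<cdot> rst t = t \<cdot> rst s" if "s \<in> (\<lambda>e. w \<cdot> e) ` E" "t \<in> (\<lambda>e. w \<cdot> e) ` E" for s t
        by (rule below_compatible[of w]) (use that up in auto)
    qed (use w we in \<open>auto simp: hom_ob\<close>)
    then obtain m where m: "lub x y ((\<lambda>e. w \<cdot> e) ` E) m" ..
    have "lub x x ((\<lambda>e. e \<cdot> rst w) ` E) (d \<cdot> rst w)"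
      by (rule lub_precomp[OF d rst_hom[OF w(1)]])
    moreover have "(\<lambda>e. e \<cdot> rst w) ` E = rst ` (\<lambda>e. w \<cdot> e) ` E"
      using E r by (force simp: image_image intro!: image_cong intro: idem_comm rst_in_idem[OF w(1)])
    moreover have "d \<cdot> rst w = rst w"
    proof -
      have "rst ` E = E" using E by (force simp: idem_rst image_iff)
      then have "rst d = d" using lub_rst[OF d] d lub_unique by metis
      then show ?thesis by (metis rst_cmp_rst rst_comm w(2))
    qed
    ultimately have "rst m = rst w"
      using lub_rst[OF m] by (simp add: lub_unique)
    moreover have "w \<cdot> rst m = m" by (rule lub_least[OF m w(1)]) (use up in auto)
    ultimately show ?thesis using m w(1) by (simp add: cmp_rst_self[OF hom_el])
  qed
  have "(\<lambda>e. u \<cdot> e) ` E = (\<lambda>e. v \<cdot> e) ` E" using eq by auto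
  then show ?thesis using main[of u] main[of v] uv by (metis lub_unique)
qed

text \<open>An upper bound with the right domain is the join: any other upper bound \<open>h\<close>
  agrees with \<open>u\<close> on every \<open>rst s\<close>, these cover \<open>rst u\<close>, and
  \<open>lub_eqI\<close> applies.\<close>

lemma lubI:
  assumes "u \<in> hom x y" "U \<subseteq> hom x y" "\<And>s. s \<in> U \<Longrightarrow> u \<cdot> rst s = s"
    and r: "lub x x (rst ` U) (rst u)"
  shows "lub x y U u"
  unfolding lub_def
proof (intro conjI ballI impI)
  fix h assume h: "h \<in> hom x y" "\<forall>s\<in>U. h \<cdot> rst s = s"
  show "h \<cdot> rst u = u"
  proof (rule lub_eqI[OF r])
    show "rst ` U \<subseteq> idem x" using assms(2) by (auto intro: rst_in_idem)
    show "h \<cdot> rst u \<in> hom x y" using h(1) assms(1) by (auto intro: cmp_hom rst_hom)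
    fix e assume "e \<in> rst ` U"
    then obtain s where s: "s \<in> U" "e = rst s" by auto
    then have "rst u \<cdot> e = e" using assms(3) by (metis rst_cmp_rst)
    then show "(h \<cdot> rst u) \<cdot> e = u \<cdot> e" using h(2) s assms(3) by (simp add: cmp_assoc)
  qed (use assms(1) in \<open>auto simp: cmp_assoc intro: cmp_rst_self hom_el\<close>)
qed (use assms in auto)

text \<open>The covered idempotent \<open>d\<close> is kept general instead of being the identity,
  so that covers can be pulled back along partial maps (\<open>cov_pull\<close>) and cut down
  (\<open>cov_meet\<close>). Maps supported on \<open>d\<close> are then compared and glued over the
  cover.\<close>

definition cov :: "'a \<Rightarrow> ('a, 'b) arrow \<Rightarrow> 'k set \<Rightarrow> ('k \<Rightarrow> ('a, 'b) arrow) \<Rightarrow> bool" where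
  "cov x d I e \<longleftrightarrow> d \<in> idem x \<and> (\<forall>i\<in>I. e i \<in> idem x) \<and> lub x x (e ` I) d"

lemma covD: "cov x d I e \<Longrightarrow> d \<in> idem x" "\<lbrakk>cov x d I e; i \<in> I\<rbrakk> \<Longrightarrow> e i \<in> idem x"
  "cov x d I e \<Longrightarrow> lub x x (e ` I) d" "\<lbrakk>cov x d I e; i \<in> I\<rbrakk> \<Longrightarrow> d \<cdot> e i = e i"
  unfolding cov_def by (auto dest!: lub_upper simp: idem_rst)

lemma cov_eq:
  assumes "cov x d I e" "u \<in> hom x y" "v \<in> hom x y" "u \<cdot> d = u" "v \<cdot> d = v"
    and "\<And>i. i \<in> I \<Longrightarrow> u \<cdot> e i = v \<cdot> e i"
  shows "u = v"
  by (rule lub_eqI[OF covD(3)[OF assms(1)] _ assms(2-5)]) (use assms(6) covD(2)[OF assms(1)] in auto)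

text \<open>Idempotents commute, so every family of them is compatible; by \<open>lub_rst\<close>
  the join is again a restriction idempotent.\<close>

lemma cov_exists:
  assumes "x \<in> Ob C" "\<And>i. i \<in> I \<Longrightarrow> e i \<in> idem x"
  shows "\<exists>d. cov x d I e"
proof -
  have "\<exists>d. lub x x (e ` I) d"
  proof (rule lub_exists)
    show "u \<cdot> rst v = v \<cdot> rst u" if "u \<in> e ` I" "v \<in> e ` I" for u v
      using that assms(2) by (metis idem_comm idem_rst imageE)
  qed (use assms in \<open>auto simp: idem_hom\<close>)
  then obtain d where d: "lub x x (e ` I) d" ..
  have "rst ` e ` I = e ` I" using assms(2) by (force simp: idem_rst image_iff)
  then have "rst d = d" using lub_rst[OF d] d lub_unique by metis
  then show ?thesis using d assms by (auto simp: cov_def idem_def lub_def)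
qed

lemma cov_lub:
  assumes "lub x y (u ` I) v"
  shows "cov x (rst v) I (\<lambda>i. rst (u i))"
  using lub_rst[OF assms] assms by (auto simp: cov_def lub_def image_image intro!: rst_in_idem)

lemma cov_pull:
  assumes "cov x d I e" "h \<in> hom w x"
  shows "cov w (rst (d \<cdot> h)) I (\<lambda>i. rst (e i \<cdot> h))"
  by (rule cov_lub) (use lub_precomp[OF covD(3)[OF assms(1)] assms(2)] in \<open>simp add: image_image\<close>)

lemma cov_meet:
  assumes "cov x d I e" "c \<in> idem x"
  shows "cov x (d \<cdot> c) I (\<lambda>i. e i \<cdot> c)"
proof -
  have "rst (d \<cdot> c) = d \<cdot> c" "\<And>i. i \<in> I \<Longrightarrow> rst (e i \<cdot> c) = e i \<cdot> c"
    using assms covD by (meson cmp_idem idem_rst)+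
  then show ?thesis using cov_pull[OF assms(1) idem_hom[OF assms(2)]]
    by (simp add: cov_def cong: image_cong)
qed

lemma cov_least:
  assumes "cov x d I e" "c \<in> idem x" "\<And>i. i \<in> I \<Longrightarrow> c \<cdot> e i = e i"
  shows "c \<cdot> d = d"
proof -
  have "c \<cdot> rst d = d"
    by (rule lub_least[OF covD(3)[OF assms(1)] idem_hom[OF assms(2)], THEN trans])
      (use assms(3) in \<open>auto simp: idem_rst[OF covD(1)[OF assms(1)]] idem_rst[OF covD(2)[OF assms(1)]]\<close>)
  then show ?thesis by (simp add: idem_rst[OF covD(1)[OF assms(1)]])
qed

lemma cov_cong:
  assumes "cov x d I e" "\<And>i. i \<in> I \<Longrightarrow> e i = e' i"
  shows "cov x d I e'"
  using assms by (simp add: cov_def cong: image_cong)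

text \<open>The sheaf property: \<open>v\<close> is the join of the \<open>u i \<cdot> e i\<close>.
  The last clause controls its domain: if each \<open>u i\<close> is defined on all of
  \<open>e i\<close>, nothing of \<open>d\<close> is lost.\<close>

lemma glue_exists:
  assumes c: "cov x d I e" and y: "y \<in> Ob C" and u: "\<And>i. i \<in> I \<Longrightarrow> u i \<in> hom x y"
    and comp: "\<And>i j. \<lbrakk>i \<in> I; j \<in> I\<rbrakk> \<Longrightarrow> u i \<cdot> e i \<cdot> e j = u j \<cdot> e i \<cdot> e j"
  shows "\<exists>v\<in>hom x y. v \<cdot> d = v \<and> (\<forall>i\<in>I. v \<cdot> e i = u i \<cdot> e i) \<and>
     ((\<forall>i\<in>I. rst (u i) \<cdot> e i = e i) \<longrightarrow> rst v = d)"
proof -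
  have e: "e i \<in> idem x" if "i \<in> I" for i using c that by (simp add: covD)
  have x: "x \<in> Ob C" using covD(1)[OF c] idem_hom hom_ob by blast
  have ue: "u i \<cdot> e i \<in> hom x y" if "i \<in> I" for i using that by (auto intro: cmp_hom u e idem_hom)
  have "\<exists>v. lub x y ((\<lambda>i. u i \<cdot> e i) ` I) v"
  proof (rule lub_exists)
    fix s t assume "s \<in> (\<lambda>i. u i \<cdot> e i) ` I" "t \<in> (\<lambda>i. u i \<cdot> e i) ` I"
    then obtain i j where ij: "i \<in> I" "j \<in> I" "s = u i \<cdot> e i" "t = u j \<cdot> e j" by auto
    \<comment> \<open>The domain of \<open>u j \<cdot> e j\<close> lies below \<open>e j\<close>, so
      a factor \<open>e j\<close> may be inserted, which brings the composite into the shape of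
      \<open>comp\<close>.\<close>
    have "u i \<cdot> e i \<cdot> rst (u j \<cdot> e j) = u i \<cdot> e i \<cdot> e j \<cdot> rst (u j \<cdot> e j)"
      using idem_absorb[OF e[OF ij(2)] u[OF ij(2)]] by simp
    also have "\<dots> = u j \<cdot> e j \<cdot> e i \<cdot> rst (u j \<cdot> e j)"
      using comp[OF ij(1,2)] idem_comm[OF e e, OF ij(1,2)] by (metis cmp_assoc)
    also have "\<dots> = (u j \<cdot> e j) \<cdot> rst (u j \<cdot> e j) \<cdot> e i"
      using idem_comm[OF e[OF ij(1)] rst_in_idem[OF ue[OF ij(2)]]] by (simp add: cmp_assoc)
    also have "\<dots> = u j \<cdot> e j \<cdot> e i"
      using hom_rst[OF ue[OF ij(2)]] by (metis cmp_assoc)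
    finally have 1: "u i \<cdot> e i \<cdot> rst (u j \<cdot> e j) = u j \<cdot> e j \<cdot> e i" .
    have "u j \<cdot> e j \<cdot> rst (u i \<cdot> e i) = u j \<cdot> e j \<cdot> e i \<cdot> rst (u i \<cdot> e i)"
      using idem_absorb[OF e[OF ij(1)] u[OF ij(1)]] by simp
    also have "\<dots> = u i \<cdot> e i \<cdot> e j \<cdot> rst (u i \<cdot> e i)"
      using comp[OF ij(1,2)] idem_comm[OF e e, OF ij(1,2)] by (metis cmp_assoc)
    also have "\<dots> = (u i \<cdot> e i) \<cdot> rst (u i \<cdot> e i) \<cdot> e j"
      using idem_comm[OF e[OF ij(2)] rst_in_idem[OF ue[OF ij(1)]]] by (simp add: cmp_assoc)
    also have "\<dots> = u i \<cdot> e i \<cdot> e j"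
      using hom_rst[OF ue[OF ij(1)]] by (metis cmp_assoc)
    finally have "u j \<cdot> e j \<cdot> rst (u i \<cdot> e i) = u i \<cdot> e i \<cdot> e j" .
    then show "s \<cdot> rst t = t \<cdot> rst s"
      using 1 ij comp[OF ij(1,2)] idem_comm[OF e e, OF ij(1,2)] by (simp add: cmp_assoc)
  qed (use x y ue in auto)
  then obtain v where v: "lub x y ((\<lambda>i. u i \<cdot> e i) ` I) v" ..
  have vh: "v \<in> hom x y" using v by (simp add: lub_def)
  have cr: "cov x (rst v) I (\<lambda>i. rst (u i \<cdot> e i))" by (rule cov_lub[OF v])
  have d: "d \<in> idem x" "\<And>i. i \<in> I \<Longrightarrow> d \<cdot> e i = e i" using c by (simp_all add: covD)
  have dv: "d \<cdot> rst v = rst v"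
  proof (rule cov_least[OF cr d(1)])
    show "d \<cdot> rst (u i \<cdot> e i) = rst (u i \<cdot> e i)" if i: "i \<in> I" for i
      using idem_absorb[OF e[OF i] u[OF i]] d(2)[OF i] by (metis cmp_assoc)
  qed
  then have vd: "v \<cdot> d = v"
    using d vh by (metis cmp_rst_self hom_el cmp_assoc idem_comm rst_in_idem)
  have ve: "v \<cdot> e i = u i \<cdot> e i" if i: "i \<in> I" for i
  proof -
    have c': "cov x (rst v \<cdot> e i) I (\<lambda>j. rst (u j \<cdot> e j) \<cdot> e i)" by (rule cov_meet[OF cr e[OF i]])
    \<comment> \<open>No other piece enlarges \<open>v\<close> on \<open>e i\<close>:
      \<open>rst v \<cdot> e i\<close> is covered by the
      \<open>rst (u j \<cdot> e j) \<cdot> e i\<close>, and \<open>comp\<close> bounds each of them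
      by \<open>rst (u i \<cdot> e i)\<close>.\<close>
    have r: "rst v \<cdot> e i = rst (u i \<cdot> e i)"
    proof -
      have 1: "rst (u i \<cdot> e i) \<cdot> (rst v \<cdot> e i) = rst v \<cdot> e i"
      proof (rule cov_least[OF c' rst_in_idem[OF ue[OF i]]])
        fix j assume j: "j \<in> I"
        have "rst (u j \<cdot> e j) \<cdot> e i = rst (u j \<cdot> e j \<cdot> e i)"
          using e[OF i] by (simp add: rst_cmp_idem flip: cmp_assoc)
        also have "\<dots> = rst (u i \<cdot> e i \<cdot> e j)" using comp[OF i j] idem_comm[OF e e, OF i j] by simp
        also have "\<dots> = rst (u i \<cdot> e i) \<cdot> e j" using e[OF j] by (simp add: rst_cmp_idem flip: cmp_assoc)
        finally have *: "rst (u j \<cdot> e j) \<cdot> e i = rst (u i \<cdot> e i) \<cdot> e j" .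
        show "rst (u i \<cdot> e i) \<cdot> rst (u j \<cdot> e j) \<cdot> e i = rst (u j \<cdot> e j) \<cdot> e i"
          unfolding * by simp
      qed
      have "v \<cdot> rst (u i \<cdot> e i) = u i \<cdot> e i" using lub_upper[OF v] i by blast
      then have 2: "rst v \<cdot> rst (u i \<cdot> e i) = rst (u i \<cdot> e i)" by (metis rst_cmp_rst)
      have 3: "rst (u i \<cdot> e i) \<cdot> e i = rst (u i \<cdot> e i)"
        using e[OF i] by (metis cmp_assoc idem_idem rst_cmp_idem)
      show ?thesis using 1 2 3 by (metis cmp_assoc rst_comm)
    qed
    have "v \<cdot> e i = v \<cdot> rst v \<cdot> e i" using vh by (metis cmp_assoc cmp_rst_self hom_el)
    also have "\<dots> = u i \<cdot> e i" unfolding r using lub_upper[OF v] i by blast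
    finally show ?thesis .
  qed
  have "rst v = d" if t: "\<forall>i\<in>I. rst (u i) \<cdot> e i = e i"
  proof -
    have "rst v \<cdot> d = d"
    proof (rule cov_least[OF c rst_in_idem[OF vh]])
      fix i assume i: "i \<in> I"
      have "rst v \<cdot> e i = rst (v \<cdot> e i)" using e[OF i] by (simp add: rst_cmp_idem)
      also have "\<dots> = e i" using t i e[OF i] by (simp add: ve rst_cmp_idem)
      finally show "rst v \<cdot> e i = e i" .
    qed
    then show ?thesis using dv d(1) vh by (metis idem_comm rst_in_idem)
  qed
  then show ?thesis using vh vd ve by blast
qed

end

section \<open>Pullbacks and generalised elements\<close>

context restriction_category
begin

definition l1 :: "('o, 'm) cospan \<Rightarrow> ('o, 'm) arrow" where
  "l1 K = arr (ob1 K) (base K) (leg1 K)"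

definition l2 :: "('o, 'm) cospan \<Rightarrow> ('o, 'm) arrow" where
  "l2 K = arr (ob2 K) (base K) (leg2 K)"

definition pb1 :: "('o, 'm) cospan \<Rightarrow> ('o, 'm) arrow" where
  "pb1 K = arr (pb C K) (ob1 K) (pr1 C K)"

definition pb2 :: "('o, 'm) cospan \<Rightarrow> ('o, 'm) arrow" where
  "pb2 K = arr (pb C K) (ob2 K) (pr2 C K)"

text \<open>Pairs that do not match are sent to \<open>None\<close>, so that the pair is always a
  generalised element of the pullback (\<open>mpair_el\<close>).\<close>

definition mpair :: "('o, 'm) cospan \<Rightarrow> ('o, 'm) arrow \<Rightarrow> ('o, 'm) arrow \<Rightarrow> ('o, 'm) arrow" where
  "mpair K u v = (if u \<noteq> None \<and> l1 K \<cdot> u = l2 K \<cdot> v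
     then arr (fst (the u)) (pb C K) (pair C K (fst (the u)) (mor u) (mor v)) else None)"

definition cospan_ok :: "('o, 'm) cospan \<Rightarrow> bool" where
  "cospan_ok K \<longleftrightarrow> ob1 K \<in> Ob C \<and> ob2 K \<in> Ob C \<and> base K \<in> Ob C \<and>
     total_map C (ob1 K) (base K) (leg1 K) \<and> total_map C (ob2 K) (base K) (leg2 K) \<and>
     (\<exists>a p q. is_pullback C K a p q)"

lemma fst_hom: "u \<in> hom x y \<Longrightarrow> fst (the u) = x"
  by (auto simp: hom_def)

lemma el_cases: "f \<in> el y \<Longrightarrow> f = None \<or> (\<exists>w. f \<in> hom w y)"
  by (auto simp: el_def)

context
  fixes K assumes K: "cospan_ok K"
begin

lemma leg_tot: "l1 K \<in> tot (ob1 K) (base K)" "l2 K \<in> tot (ob2 K) (base K)"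
  using K by (auto simp: cospan_ok_def l1_def l2_def arr_tot)

lemma pb_spec: "is_pullback C K (pb C K) (pr1 C K) (pr2 C K)"
proof -
  from K obtain a p q where "is_pullback C K a p q" by (auto simp: cospan_ok_def)
  then have "case (a, p, q) of (a, p, q) \<Rightarrow> is_pullback C K a p q" by simp
  from someI[of "\<lambda>(a, p, q). is_pullback C K a p q", OF this]
  show ?thesis by (simp add: pb_def pr1_def pr2_def chosen_pb_def split_beta)
qed

lemma pb_ob [simp]: "pb C K \<in> Ob C"
  and pr_in: "pr1 C K \<in> Hom C (pb C K) (ob1 K)" "pr2 C K \<in> Hom C (pb C K) (ob2 K)"
  using pb_spec by (auto simp: is_pullback_def)

lemma cospan_obs: "ob1 K \<in> Ob C" "ob2 K \<in> Ob C" "base K \<in> Ob C"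
  "leg1 K \<in> Hom C (ob1 K) (base K)" "leg2 K \<in> Hom C (ob2 K) (base K)"
  using K by (auto simp: cospan_ok_def total_map_def)

lemma pb_hom: "pb1 K \<in> hom (pb C K) (ob1 K)" "pb2 K \<in> hom (pb C K) (ob2 K)"
  by (simp_all add: pb1_def pb2_def homI pr_in cospan_obs)

lemma pb_square: "l1 K \<cdot> pb1 K = l2 K \<cdot> pb2 K"
  using pb_spec
  by (simp add: l1_def l2_def pb1_def pb2_def pr_in cospan_obs is_pullback_def flip: arr_Cmp)

text \<open>The definitions of the theory are stated with the raw \<open>pair\<close>; this lemma is
  the passage from it to \<open>mpair\<close>, through which the raw axioms enter the object-free
  calculus.\<close>

lemma pair_raw:
  assumes "w \<in> Ob C" "u \<in> Hom C w (ob1 K)" "v \<in> Hom C w (ob2 K)"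
    "l1 K \<cdot> arr w (ob1 K) u = l2 K \<cdot> arr w (ob2 K) v"
  shows "pair C K w u v \<in> Hom C w (pb C K)"
    "Cmp C w (pb C K) (ob1 K) (pr1 C K) (pair C K w u v) = u"
    "Cmp C w (pb C K) (ob2 K) (pr2 C K) (pair C K w u v) = v"
    "arr w (pb C K) (pair C K w u v) = mpair K (arr w (ob1 K) u) (arr w (ob2 K) v)"
proof -
  have "arr w (base K) (Cmp C w (ob1 K) (base K) (leg1 K) u) = arr w (base K) (Cmp C w (ob2 K) (base K) (leg2 K) v)"
    using assms by (simp add: arr_Cmp cospan_obs l1_def l2_def)
  then have "Cmp C w (ob1 K) (base K) (leg1 K) u = Cmp C w (ob2 K) (base K) (leg2 K) v"
    using arr_inj assms cospan_obs Cmp_in by metis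
  then have ex: "\<exists>!h. h \<in> Hom C w (pb C K) \<and> Cmp C w (pb C K) (ob1 K) (pr1 C K) h = u \<and>
      Cmp C w (pb C K) (ob2 K) (pr2 C K) h = v"
    using pb_spec assms by (simp add: is_pullback_def)
  from theI'[OF ex] show "pair C K w u v \<in> Hom C w (pb C K)"
    "Cmp C w (pb C K) (ob1 K) (pr1 C K) (pair C K w u v) = u"
    "Cmp C w (pb C K) (ob2 K) (pr2 C K) (pair C K w u v) = v"
    by (auto simp: pair_def)
  show "arr w (pb C K) (pair C K w u v) = mpair K (arr w (ob1 K) u) (arr w (ob2 K) v)"
    using assms fst_hom[OF homI, of w "ob1 K" u] hom_not_None[OF homI, of w "ob1 K" u]
    by (simp add: mpair_def mor_arr cospan_obs)
qed

lemma mpair_hom_proj: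
  assumes "u \<in> hom w (ob1 K)" "v \<in> hom w (ob2 K)" "l1 K \<cdot> u = l2 K \<cdot> v"
  shows "mpair K u v \<in> hom w (pb C K) \<and> pb1 K \<cdot> mpair K u v = u \<and> pb2 K \<cdot> mpair K u v = v"
proof -
  from assms(1) obtain f where f: "w \<in> Ob C" "f \<in> Hom C w (ob1 K)" "u = arr w (ob1 K) f" by (rule homE)
  from assms(2) obtain g where g: "g \<in> Hom C w (ob2 K)" "v = arr w (ob2 K) g" by (rule homE)
  note p = pair_raw[OF f(1,2) g(1)]
  have e: "l1 K \<cdot> arr w (ob1 K) f = l2 K \<cdot> arr w (ob2 K) g" using assms f g by simp
  note p = p[OF e]
  have "mpair K u v = arr w (pb C K) (pair C K w f g)" using p(4) f g by simp
  moreover have "pb1 K \<cdot> arr w (pb C K) (pair C K w f g) = u" "pb2 K \<cdot> arr w (pb C K) (pair C K w f g) = v"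
    using p(1-3) f g by (simp_all add: pb1_def pb2_def pr_in cospan_obs flip: arr_Cmp)
  ultimately show ?thesis using p(1) f(1) by (simp add: homI)
qed

lemmas mpair_hom = mpair_hom_proj[THEN conjunct1]

lemma matching_cases:
  assumes "u \<in> el (ob1 K)" "v \<in> el (ob2 K)" "l1 K \<cdot> u = l2 K \<cdot> v"
  obtains "u = None" "v = None" | w where "u \<in> hom w (ob1 K)" "v \<in> hom w (ob2 K)"
proof (cases "u = None")
  case True
  with assms leg_tot have "v = None" using cmp_eq_None_iff[OF tot_hom[OF leg_tot(2)] assms(2)] by simp
  with True show thesis by (rule that)
next
  case False
  then obtain w where w: "u \<in> hom w (ob1 K)" using el_cases[OF assms(1)] by auto
  have "v \<in> hom w (ob2 K)"
    by (rule el_eq_hom[OF tot_hom[OF leg_tot(2)] tot_hom[OF leg_tot(1)] assms(2) w]) (simp add: assms(3))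
  with w show thesis by (rule that)
qed

lemma mpair_None [simp]: "mpair K None v = None"
  by (simp add: mpair_def)

lemma pb_mpair:
  assumes "u \<in> el (ob1 K)" "v \<in> el (ob2 K)" "l1 K \<cdot> u = l2 K \<cdot> v"
  shows "pb1 K \<cdot> mpair K u v = u" "pb2 K \<cdot> mpair K u v = v"
  using matching_cases[OF assms] mpair_hom_proj[OF _ _ assms(3)] by (metis cmp_None(2) mpair_None)+

lemma mpair_el: "mpair K u v \<in> el (pb C K)"
  by (auto simp: mpair_def arr_def el_def hom_def)

lemma pb_joint:
  assumes "h \<in> el (pb C K)" "h' \<in> el (pb C K)" "pb1 K \<cdot> h = pb1 K \<cdot> h'" "pb2 K \<cdot> h = pb2 K \<cdot> h'"
  shows "h = h'"
proof (cases "h = None")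
  case True
  then show ?thesis using assms cmp_eq_None_iff[OF pb_hom(1)] by (metis cmp_None(2))
next
  case False
  then obtain w where w: "h \<in> hom w (pb C K)" using el_cases[OF assms(1)] by auto
  have w': "h' \<in> hom w (pb C K)"
    by (rule el_eq_hom[OF pb_hom(1) pb_hom(1) assms(2) w]) (simp add: assms(3))
  let ?u = "mor (pb1 K \<cdot> h)" and ?v = "mor (pb2 K \<cdot> h)"
  from w obtain f where f: "w \<in> Ob C" "f \<in> Hom C w (pb C K)" "h = arr w (pb C K) f" by (rule homE)
  from w' obtain f' where f': "f' \<in> Hom C w (pb C K)" "h' = arr w (pb C K) f'" by (rule homE)
  have u: "pb1 K \<cdot> h \<in> hom w (ob1 K)" "pb2 K \<cdot> h \<in> hom w (ob2 K)"
    using w pb_hom by (auto intro: cmp_hom)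
  have "pb1 K \<cdot> h = arr w (ob1 K) (Cmp C w (pb C K) (ob1 K) (pr1 C K) f)"
    "pb1 K \<cdot> h' = arr w (ob1 K) (Cmp C w (pb C K) (ob1 K) (pr1 C K) f')"
    "pb2 K \<cdot> h = arr w (ob2 K) (Cmp C w (pb C K) (ob2 K) (pr2 C K) f)"
    "pb2 K \<cdot> h' = arr w (ob2 K) (Cmp C w (pb C K) (ob2 K) (pr2 C K) f')"
    using f f' by (simp_all add: arr_Cmp pb1_def pb2_def pr_in cospan_obs)
  then have m: "Cmp C w (pb C K) (ob1 K) (pr1 C K) f = ?u" "Cmp C w (pb C K) (ob1 K) (pr1 C K) f' = ?u"
    "Cmp C w (pb C K) (ob2 K) (pr2 C K) f = ?v" "Cmp C w (pb C K) (ob2 K) (pr2 C K) f' = ?v"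
    by (metis assms(3,4) mor_arr f(1) cospan_obs(1,2) Cmp_in pr_in f(2) f'(1) pb_ob)+
  have "arr w (base K) (Cmp C w (ob1 K) (base K) (leg1 K) ?u) = arr w (base K) (Cmp C w (ob2 K) (base K) (leg2 K) ?v)"
    using u f(1) cmp_reassoc[OF pb_square]
    by (simp add: arr_Cmp cospan_obs mor_in arr_mor l1_def[symmetric] l2_def[symmetric] cmp_assoc)
  then have "Cmp C w (ob1 K) (base K) (leg1 K) ?u = Cmp C w (ob2 K) (base K) (leg2 K) ?v"
    by (rule arr_inj) (use u f(1) in \<open>auto simp: cospan_obs mor_in intro: Cmp_in\<close>)
  then have "\<exists>!h. h \<in> Hom C w (pb C K) \<and> Cmp C w (pb C K) (ob1 K) (pr1 C K) h = ?u \<and>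
      Cmp C w (pb C K) (ob2 K) (pr2 C K) h = ?v"
    using pb_spec u f(1) by (simp add: is_pullback_def mor_in)
  then have "f = f'" using m f f' by auto
  then show ?thesis using f f' by simp
qed

lemma mpair_eta: "h \<in> el (pb C K) \<Longrightarrow> mpair K (pb1 K \<cdot> h) (pb2 K \<cdot> h) = h"
proof -
  assume h: "h \<in> el (pb C K)"
  have "pb1 K \<cdot> h \<in> el (ob1 K)" "pb2 K \<cdot> h \<in> el (ob2 K)"
    by (rule hom_cmp_el[OF pb_hom(1)] hom_cmp_el[OF pb_hom(2)])+
  moreover have "l1 K \<cdot> pb1 K \<cdot> h = l2 K \<cdot> pb2 K \<cdot> h"
    using cmp_reassoc[OF pb_square] by (simp add: cmp_assoc)
  ultimately show ?thesis
    by (intro pb_joint[OF mpair_el h] pb_mpair)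
qed

lemma mpair_cmp:
  assumes "u \<in> el (ob1 K)" "v \<in> el (ob2 K)" "l1 K \<cdot> u = l2 K \<cdot> v"
  shows "mpair K u v \<cdot> h = mpair K (u \<cdot> h) (v \<cdot> h)"
proof (rule pb_joint[OF cmp_el[OF mpair_el] mpair_el])
  have l: "l1 K \<cdot> u \<cdot> h = l2 K \<cdot> v \<cdot> h"
    using cmp_reassoc[OF assms(3)] by (simp add: cmp_assoc)
  note p = pb_mpair[OF cmp_el[OF assms(1)] cmp_el[OF assms(2)] l]
  show "pb1 K \<cdot> mpair K u v \<cdot> h = pb1 K \<cdot> mpair K (u \<cdot> h) (v \<cdot> h)"
    using cmp_reassoc[OF pb_mpair(1)[OF assms]] by (simp only: p)
  show "pb2 K \<cdot> mpair K u v \<cdot> h = pb2 K \<cdot> mpair K (u \<cdot> h) (v \<cdot> h)"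
    using cmp_reassoc[OF pb_mpair(2)[OF assms]] by (simp only: p)
qed

text \<open>The legs are total, so the two projections have the same restriction. This idempotent
  and the identity have equal composites with both projections, and uniqueness in the pullback,
  which is a pullback for all maps of \<open>C\<close> including partial ones, identifies
  them.\<close>

lemma pb_tot: "pb1 K \<in> tot (pb C K) (ob1 K)" "pb2 K \<in> tot (pb C K) (ob2 K)"
proof -
  have r: "rst (pb1 K) = rst (pb2 K)"
    using rst_tot[OF leg_tot(1) hom_el[OF pb_hom(1)]] rst_tot[OF leg_tot(2) hom_el[OF pb_hom(2)]]
    by (simp add: pb_square)
  have "rst (pb1 K) = ide (pb C K)"
  proof (rule pb_joint)
    show "pb1 K \<cdot> rst (pb1 K) = pb1 K \<cdot> ide (pb C K)"
      using pb_hom by (simp add: cmp_ide cmp_rst_self[OF hom_el])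
    show "pb2 K \<cdot> rst (pb1 K) = pb2 K \<cdot> ide (pb C K)"
      using pb_hom by (simp add: cmp_ide cmp_rst_self[OF hom_el] r)
  qed (use pb_hom in \<open>auto intro: hom_el[OF rst_hom] hom_el[OF ide_hom]\<close>)
  then show "pb1 K \<in> tot (pb C K) (ob1 K)" "pb2 K \<in> tot (pb C K) (ob2 K)"
    using r pb_hom by (auto simp: tot_def)
qed

lemma rst_mpair:
  assumes "u \<in> el (ob1 K)" "v \<in> el (ob2 K)" "l1 K \<cdot> u = l2 K \<cdot> v"
  shows "rst (mpair K u v) = rst u"
  using rst_tot[OF pb_tot(1) mpair_el[of u v]] by (simp add: pb_mpair[OF assms])

end

lemma arr_eq_iff: "\<lbrakk>x \<in> Ob C; y \<in> Ob C; f \<in> Hom C x y; g \<in> Hom C x y\<rbrakk> \<Longrightarrow> f = g \<longleftrightarrow> arr x y f = arr x y g"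
  using arr_inj by blast

end

section \<open>Partite internal categories in terms of generalised elements\<close>

context restriction_category
begin

definition sr :: "('i, 'o, 'm) pcat \<Rightarrow> 'i \<Rightarrow> 'i \<Rightarrow> ('o, 'm) arrow" where
  "sr \<AA> i j = arr (A1 \<AA> i j) (A0 \<AA> i) (src \<AA> i j)"

definition tg :: "('i, 'o, 'm) pcat \<Rightarrow> 'i \<Rightarrow> 'i \<Rightarrow> ('o, 'm) arrow" where
  "tg \<AA> i j = arr (A1 \<AA> i j) (A0 \<AA> j) (tgt \<AA> i j)"

definition un :: "('i, 'o, 'm) pcat \<Rightarrow> 'i \<Rightarrow> ('o, 'm) arrow" where
  "un \<AA> i = arr (A0 \<AA> i) (A1 \<AA> i i) (idm \<AA> i)"

definition mulA :: "('i, 'o, 'm) pcat \<Rightarrow> 'i \<Rightarrow> 'i \<Rightarrow> 'i \<Rightarrow> ('o, 'm) arrow" where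
  "mulA \<AA> i j k = arr (pb C (cmp_cospan \<AA> i j k)) (A1 \<AA> i k) (mul \<AA> i j k)"

definition mu :: "('i, 'o, 'm) pcat \<Rightarrow> 'i \<Rightarrow> 'i \<Rightarrow> 'i \<Rightarrow> ('o, 'm) arrow \<Rightarrow> ('o, 'm) arrow \<Rightarrow> ('o, 'm) arrow" where
  "mu \<AA> i j k g f = mulA \<AA> i j k \<cdot> mpair (cmp_cospan \<AA> i j k) g f"

end

lemma cmp_cospan_simps [simp]:
  "ob1 (cmp_cospan \<AA> i j k) = A1 \<AA> j k" "ob2 (cmp_cospan \<AA> i j k) = A1 \<AA> i j"
  "base (cmp_cospan \<AA> i j k) = A0 \<AA> j" "leg1 (cmp_cospan \<AA> i j k) = src \<AA> j k"
  "leg2 (cmp_cospan \<AA> i j k) = tgt \<AA> i j"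
  by (simp_all add: cmp_cospan_def)

lemma cmp_cospan3_simps [simp]:
  "ob1 (cmp_cospan3 C \<AA> i j k l) = A1 \<AA> k l" "ob2 (cmp_cospan3 C \<AA> i j k l) = pb C (cmp_cospan \<AA> i j k)"
  "base (cmp_cospan3 C \<AA> i j k l) = A0 \<AA> k" "leg1 (cmp_cospan3 C \<AA> i j k l) = src \<AA> k l"
  "leg2 (cmp_cospan3 C \<AA> i j k l) = Cmp C (pb C (cmp_cospan \<AA> i j k)) (A1 \<AA> j k) (A0 \<AA> k) (tgt \<AA> j k) (pr1 C (cmp_cospan \<AA> i j k))"
  by (simp_all add: cmp_cospan3_def Let_def)

text \<open>The axioms of an internal category are split into stages: the underlying graph with
  units, the typing of the multiplication (\<open>premul\<close>), and the equations
  (\<open>internal\<close>). For \<Psi> the multiplication is specified on a pullback whose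
  existence belongs to the first stage, so the calculus of that stage must be available before the
  later ones are established.\<close>

locale pgraph = restriction_category C for C :: "('o, 'm) rcat" +
  fixes \<AA> :: "('i, 'o, 'm) pcat"
  assumes A0_in [simp]: "i \<in> Ix \<AA> \<Longrightarrow> A0 \<AA> i \<in> Ob C"
    and A1_in [simp]: "\<lbrakk>i \<in> Ix \<AA>; j \<in> Ix \<AA>\<rbrakk> \<Longrightarrow> A1 \<AA> i j \<in> Ob C"
    and src_total: "\<lbrakk>i \<in> Ix \<AA>; j \<in> Ix \<AA>\<rbrakk> \<Longrightarrow> total_map C (A1 \<AA> i j) (A0 \<AA> i) (src \<AA> i j)"
    and tgt_total: "\<lbrakk>i \<in> Ix \<AA>; j \<in> Ix \<AA>\<rbrakk> \<Longrightarrow> total_map C (A1 \<AA> i j) (A0 \<AA> j) (tgt \<AA> i j)"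
    and src_pullbacks: "\<lbrakk>i \<in> Ix \<AA>; j \<in> Ix \<AA>; y \<in> Ob C; total_map C y (A0 \<AA> i) g\<rbrakk>
      \<Longrightarrow> \<exists>a p q. is_pullback C
            \<lparr>ob1 = A1 \<AA> i j, ob2 = y, base = A0 \<AA> i, leg1 = src \<AA> i j, leg2 = g\<rparr> a p q"
    and idm_in: "i \<in> Ix \<AA> \<Longrightarrow> idm \<AA> i \<in> Hom C (A0 \<AA> i) (A1 \<AA> i i)"
    and src_idm: "i \<in> Ix \<AA> \<Longrightarrow>
      Cmp C (A0 \<AA> i) (A1 \<AA> i i) (A0 \<AA> i) (src \<AA> i i) (idm \<AA> i) = Idn C (A0 \<AA> i)"
    and tgt_idm: "i \<in> Ix \<AA> \<Longrightarrow>
      Cmp C (A0 \<AA> i) (A1 \<AA> i i) (A0 \<AA> i) (tgt \<AA> i i) (idm \<AA> i) = Idn C (A0 \<AA> i)"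
begin

lemma src_in [simp]: "\<lbrakk>i \<in> Ix \<AA>; j \<in> Ix \<AA>\<rbrakk> \<Longrightarrow> src \<AA> i j \<in> Hom C (A1 \<AA> i j) (A0 \<AA> i)"
  and tgt_in [simp]: "\<lbrakk>i \<in> Ix \<AA>; j \<in> Ix \<AA>\<rbrakk> \<Longrightarrow> tgt \<AA> i j \<in> Hom C (A1 \<AA> i j) (A0 \<AA> j)"
  using src_total tgt_total by (auto simp: total_map_def)

lemma sr_tot: "\<lbrakk>i \<in> Ix \<AA>; j \<in> Ix \<AA>\<rbrakk> \<Longrightarrow> sr \<AA> i j \<in> tot (A1 \<AA> i j) (A0 \<AA> i)"
  and tg_tot: "\<lbrakk>i \<in> Ix \<AA>; j \<in> Ix \<AA>\<rbrakk> \<Longrightarrow> tg \<AA> i j \<in> tot (A1 \<AA> i j) (A0 \<AA> j)"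
  by (simp_all add: sr_def tg_def arr_tot src_total tgt_total)

lemmas sr_hom = sr_tot[THEN tot_hom] and tg_hom = tg_tot[THEN tot_hom]

lemma un_hom: "i \<in> Ix \<AA> \<Longrightarrow> un \<AA> i \<in> hom (A0 \<AA> i) (A1 \<AA> i i)"
  by (simp add: un_def homI idm_in)

lemma sr_un: "i \<in> Ix \<AA> \<Longrightarrow> sr \<AA> i i \<cdot> un \<AA> i = ide (A0 \<AA> i)"
  and tg_un: "i \<in> Ix \<AA> \<Longrightarrow> tg \<AA> i i \<cdot> un \<AA> i = ide (A0 \<AA> i)"
  by (simp_all add: sr_def un_def tg_def ide_def idm_in src_idm tgt_idm flip: arr_Cmp)

lemma un_tot: "i \<in> Ix \<AA> \<Longrightarrow> un \<AA> i \<in> tot (A0 \<AA> i) (A1 \<AA> i i)"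
  using rst_tot[OF sr_tot hom_el[OF un_hom], of i] by (simp add: tot_def un_hom sr_un)

lemma cmp_ok: "\<lbrakk>i \<in> Ix \<AA>; j \<in> Ix \<AA>; k \<in> Ix \<AA>\<rbrakk> \<Longrightarrow> cospan_ok (cmp_cospan \<AA> i j k)"
  using src_pullbacks[of j k "A1 \<AA> i j" "tgt \<AA> i j"]
  by (simp add: cospan_ok_def src_total tgt_total) (simp add: cmp_cospan_def)

lemma leg_cmp [simp]: "l1 (cmp_cospan \<AA> i j k) = sr \<AA> j k" "l2 (cmp_cospan \<AA> i j k) = tg \<AA> i j"
  by (simp_all add: l1_def l2_def sr_def tg_def)

lemma pb_cmp_hom:
  assumes "i \<in> Ix \<AA>" "j \<in> Ix \<AA>" "k \<in> Ix \<AA>"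
  shows "pb1 (cmp_cospan \<AA> i j k) \<in> hom (pb C (cmp_cospan \<AA> i j k)) (A1 \<AA> j k)"
    "pb2 (cmp_cospan \<AA> i j k) \<in> hom (pb C (cmp_cospan \<AA> i j k)) (A1 \<AA> i j)"
    "sr \<AA> j k \<cdot> pb1 (cmp_cospan \<AA> i j k) = tg \<AA> i j \<cdot> pb2 (cmp_cospan \<AA> i j k)"
  using pb_hom[OF cmp_ok[OF assms]] pb_square[OF cmp_ok[OF assms]] by simp_all

lemma cmp3_ok: "\<lbrakk>i \<in> Ix \<AA>; j \<in> Ix \<AA>; k \<in> Ix \<AA>; l \<in> Ix \<AA>\<rbrakk> \<Longrightarrow> cospan_ok (cmp_cospan3 C \<AA> i j k l)"
  and leg_cmp3: "\<lbrakk>i \<in> Ix \<AA>; j \<in> Ix \<AA>; k \<in> Ix \<AA>; l \<in> Ix \<AA>\<rbrakk> \<Longrightarrow> l1 (cmp_cospan3 C \<AA> i j k l) = sr \<AA> k l"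
    "\<lbrakk>i \<in> Ix \<AA>; j \<in> Ix \<AA>; k \<in> Ix \<AA>; l \<in> Ix \<AA>\<rbrakk> \<Longrightarrow>
      l2 (cmp_cospan3 C \<AA> i j k l) = tg \<AA> j k \<cdot> pb1 (cmp_cospan \<AA> i j k)"
proof -
  assume i: "i \<in> Ix \<AA>" "j \<in> Ix \<AA>" "k \<in> Ix \<AA>" "l \<in> Ix \<AA>"
  note ok = cmp_ok[OF i(1-3)]
  have pr: "pr1 C (cmp_cospan \<AA> i j k) \<in> Hom C (pb C (cmp_cospan \<AA> i j k)) (A1 \<AA> j k)"
    using pr_in[OF ok] by simp
  let ?t = "Cmp C (pb C (cmp_cospan \<AA> i j k)) (A1 \<AA> j k) (A0 \<AA> k) (tgt \<AA> j k) (pr1 C (cmp_cospan \<AA> i j k))"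
  have e: "arr (pb C (cmp_cospan \<AA> i j k)) (A0 \<AA> k) ?t = tg \<AA> j k \<cdot> pb1 (cmp_cospan \<AA> i j k)"
    using i pr by (simp add: arr_Cmp pb_ob[OF ok] tg_def pb1_def)
  show "l1 (cmp_cospan3 C \<AA> i j k l) = sr \<AA> k l" "l2 (cmp_cospan3 C \<AA> i j k l) = tg \<AA> j k \<cdot> pb1 (cmp_cospan \<AA> i j k)"
    using e by (simp_all add: l1_def l2_def sr_def)
  have "tg \<AA> j k \<cdot> pb1 (cmp_cospan \<AA> i j k) \<in> tot (pb C (cmp_cospan \<AA> i j k)) (A0 \<AA> k)"
    using cmp_tot[OF tg_tot pb_tot(1)[OF ok, simplified]] i by simp
  then have t: "total_map C (pb C (cmp_cospan \<AA> i j k)) (A0 \<AA> k) ?t"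
    using i pr pb_ob[OF ok] by (simp add: total_map_iff e Cmp_in)
  show "cospan_ok (cmp_cospan3 C \<AA> i j k l)"
    using i t src_pullbacks[OF i(3,4) pb_ob[OF ok] t]
    by (simp add: cospan_ok_def src_total pb_ob[OF ok]) (simp add: cmp_cospan3_def Let_def)
qed

end

locale premul = pgraph +
  assumes mul_in: "\<lbrakk>i \<in> Ix \<AA>; j \<in> Ix \<AA>; k \<in> Ix \<AA>\<rbrakk>
      \<Longrightarrow> mul \<AA> i j k \<in> Hom C (pb C (cmp_cospan \<AA> i j k)) (A1 \<AA> i k)"
    and src_mul: "\<lbrakk>i \<in> Ix \<AA>; j \<in> Ix \<AA>; k \<in> Ix \<AA>; K = cmp_cospan \<AA> i j k\<rbrakk>
      \<Longrightarrow> Cmp C (pb C K) (A1 \<AA> i k) (A0 \<AA> i) (src \<AA> i k) (mul \<AA> i j k)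
        = Cmp C (pb C K) (A1 \<AA> i j) (A0 \<AA> i) (src \<AA> i j) (pr2 C K)"
    and tgt_mul: "\<lbrakk>i \<in> Ix \<AA>; j \<in> Ix \<AA>; k \<in> Ix \<AA>; K = cmp_cospan \<AA> i j k\<rbrakk>
      \<Longrightarrow> Cmp C (pb C K) (A1 \<AA> i k) (A0 \<AA> k) (tgt \<AA> i k) (mul \<AA> i j k)
        = Cmp C (pb C K) (A1 \<AA> j k) (A0 \<AA> k) (tgt \<AA> j k) (pr1 C K)"
begin

lemma mulA_hom: "\<lbrakk>i \<in> Ix \<AA>; j \<in> Ix \<AA>; k \<in> Ix \<AA>\<rbrakk>
    \<Longrightarrow> mulA \<AA> i j k \<in> hom (pb C (cmp_cospan \<AA> i j k)) (A1 \<AA> i k)"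
  by (simp add: mulA_def homI mul_in pb_ob[OF cmp_ok])

context
  fixes i j k assumes ix: "i \<in> Ix \<AA>" "j \<in> Ix \<AA>" "k \<in> Ix \<AA>"
begin

lemma sr_mulA: "sr \<AA> i k \<cdot> mulA \<AA> i j k = sr \<AA> i j \<cdot> pb2 (cmp_cospan \<AA> i j k)"
  and tg_mulA: "tg \<AA> i k \<cdot> mulA \<AA> i j k = tg \<AA> j k \<cdot> pb1 (cmp_cospan \<AA> i j k)"
  using ix src_mul[OF ix refl] tgt_mul[OF ix refl] pr_in[OF cmp_ok[OF ix]]
  by (simp_all add: sr_def tg_def mulA_def pb1_def pb2_def mul_in pb_ob[OF cmp_ok] flip: arr_Cmp)

lemma mu_el: "mu \<AA> i j k g f \<in> el (A1 \<AA> i k)"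
  unfolding mu_def by (rule hom_cmp_el[OF mulA_hom[OF ix]])

lemma mu_hom: "\<lbrakk>g \<in> hom w (A1 \<AA> j k); f \<in> hom w (A1 \<AA> i j); sr \<AA> j k \<cdot> g = tg \<AA> i j \<cdot> f\<rbrakk>
    \<Longrightarrow> mu \<AA> i j k g f \<in> hom w (A1 \<AA> i k)"
  unfolding mu_def by (rule cmp_hom[OF mulA_hom[OF ix] mpair_hom[OF cmp_ok[OF ix]]]) simp_all

context
  fixes g f assumes gf: "g \<in> el (A1 \<AA> j k)" "f \<in> el (A1 \<AA> i j)" "sr \<AA> j k \<cdot> g = tg \<AA> i j \<cdot> f"
begin

lemma mu_cmp: "mu \<AA> i j k g f \<cdot> h = mu \<AA> i j k (g \<cdot> h) (f \<cdot> h)"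
  using mpair_cmp[OF cmp_ok[OF ix], of g f h] gf by (simp add: mu_def cmp_assoc)

lemma sr_mu: "sr \<AA> i k \<cdot> mu \<AA> i j k g f = sr \<AA> i j \<cdot> f"
  and tg_mu: "tg \<AA> i k \<cdot> mu \<AA> i j k g f = tg \<AA> j k \<cdot> g"
  using pb_mpair[OF cmp_ok[OF ix], of g f] gf
  by (simp_all add: mu_def cmp_reassoc[OF sr_mulA] cmp_reassoc[OF tg_mulA] cmp_assoc)

lemma rst_mu: "rst (mu \<AA> i j k g f) = rst f" "rst (mu \<AA> i j k g f) = rst g"
  using rst_tot[OF sr_tot mu_el[of g f]] rst_tot[OF sr_tot gf(2)] rst_tot[OF sr_tot gf(1)] rst_tot[OF tg_tot gf(2)] ix
  by (auto simp: sr_mu gf(3))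

end
end

section \<open>The raw laws of an internal category as equations between generalised
  elements\<close>

lemma mul_idm_iff:
  assumes i: "i \<in> Ix \<AA>" "j \<in> Ix \<AA>"
  shows "Cmp C (A1 \<AA> i j) (pb C (cmp_cospan \<AA> i i j)) (A1 \<AA> i j) (mul \<AA> i i j)
            (pair C (cmp_cospan \<AA> i i j) (A1 \<AA> i j) (Idn C (A1 \<AA> i j))
               (Cmp C (A1 \<AA> i j) (A0 \<AA> i) (A1 \<AA> i i) (idm \<AA> i) (src \<AA> i j)))
        = Idn C (A1 \<AA> i j) \<longleftrightarrow> mu \<AA> i i j (ide (A1 \<AA> i j)) (un \<AA> i \<cdot> sr \<AA> i j) = ide (A1 \<AA> i j)"
proof -
  let ?K = "cmp_cospan \<AA> i i j" let ?s = "Cmp C (A1 \<AA> i j) (A0 \<AA> i) (A1 \<AA> i i) (idm \<AA> i) (src \<AA> i j)"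
  note ok = cmp_ok[OF i(1) i(1,2)]
  have s: "arr (A1 \<AA> i j) (A1 \<AA> i i) ?s = un \<AA> i \<cdot> sr \<AA> i j" "?s \<in> Hom C (A1 \<AA> i j) (A1 \<AA> i i)"
    using i by (simp_all add: arr_Cmp un_def sr_def idm_in Cmp_in)
  have d: "arr (A1 \<AA> i j) (A1 \<AA> i j) (Idn C (A1 \<AA> i j)) = ide (A1 \<AA> i j)"
    by (simp add: ide_def)
  have "sr \<AA> i j \<cdot> ide (A1 \<AA> i j) = tg \<AA> i i \<cdot> un \<AA> i \<cdot> sr \<AA> i j"
    using i sr_hom[OF i] by (simp add: cmp_reassoc[OF tg_un] cmp_ide ide_cmp_hom)
  then have p: "pair C ?K (A1 \<AA> i j) (Idn C (A1 \<AA> i j)) ?s \<in> Hom C (A1 \<AA> i j) (pb C ?K)"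
    "arr (A1 \<AA> i j) (pb C ?K) (pair C ?K (A1 \<AA> i j) (Idn C (A1 \<AA> i j)) ?s)
      = mpair ?K (ide (A1 \<AA> i j)) (un \<AA> i \<cdot> sr \<AA> i j)"
    using pair_raw[OF ok, of "A1 \<AA> i j" "Idn C (A1 \<AA> i j)" ?s] s i by (simp_all add: Idn_in d)
  show ?thesis
    using i p by (simp add: arr_eq_iff[of "A1 \<AA> i j" "A1 \<AA> i j"] Cmp_in mul_in pb_ob[OF ok] Idn_in arr_Cmp mu_def mulA_def d)
qed

lemma idm_mul_iff:
  assumes i: "i \<in> Ix \<AA>" "j \<in> Ix \<AA>"
  shows "Cmp C (A1 \<AA> i j) (pb C (cmp_cospan \<AA> i j j)) (A1 \<AA> i j) (mul \<AA> i j j)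
            (pair C (cmp_cospan \<AA> i j j) (A1 \<AA> i j)
               (Cmp C (A1 \<AA> i j) (A0 \<AA> j) (A1 \<AA> j j) (idm \<AA> j) (tgt \<AA> i j)) (Idn C (A1 \<AA> i j)))
        = Idn C (A1 \<AA> i j) \<longleftrightarrow> mu \<AA> i j j (un \<AA> j \<cdot> tg \<AA> i j) (ide (A1 \<AA> i j)) = ide (A1 \<AA> i j)"
proof -
  let ?K = "cmp_cospan \<AA> i j j" let ?s = "Cmp C (A1 \<AA> i j) (A0 \<AA> j) (A1 \<AA> j j) (idm \<AA> j) (tgt \<AA> i j)"
  note ok = cmp_ok[OF i i(2)]
  have s: "arr (A1 \<AA> i j) (A1 \<AA> j j) ?s = un \<AA> j \<cdot> tg \<AA> i j" "?s \<in> Hom C (A1 \<AA> i j) (A1 \<AA> j j)"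
    using i by (simp_all add: arr_Cmp un_def tg_def idm_in Cmp_in)
  have d: "arr (A1 \<AA> i j) (A1 \<AA> i j) (Idn C (A1 \<AA> i j)) = ide (A1 \<AA> i j)"
    by (simp add: ide_def)
  have "sr \<AA> j j \<cdot> un \<AA> j \<cdot> tg \<AA> i j = tg \<AA> i j \<cdot> ide (A1 \<AA> i j)"
    using i tg_hom[OF i] by (simp add: cmp_reassoc[OF sr_un] cmp_ide ide_cmp_hom)
  then have p: "pair C ?K (A1 \<AA> i j) ?s (Idn C (A1 \<AA> i j)) \<in> Hom C (A1 \<AA> i j) (pb C ?K)"
    "arr (A1 \<AA> i j) (pb C ?K) (pair C ?K (A1 \<AA> i j) ?s (Idn C (A1 \<AA> i j)))
      = mpair ?K (un \<AA> j \<cdot> tg \<AA> i j) (ide (A1 \<AA> i j))"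
    using pair_raw[OF ok, of "A1 \<AA> i j" ?s "Idn C (A1 \<AA> i j)"] s i by (simp_all add: Idn_in d)
  show ?thesis
    using i p by (simp add: arr_eq_iff[of "A1 \<AA> i j" "A1 \<AA> i j"] Cmp_in mul_in pb_ob[OF ok] Idn_in arr_Cmp mu_def mulA_def d)
qed

text \<open>The projections of the triple pullback form the generic composable triple; the raw
  associativity law is associativity of \<open>mu\<close> at this one triple.\<close>

lemma mul_assoc_iff:
  assumes i: "i \<in> Ix \<AA>" "j \<in> Ix \<AA>" "k \<in> Ix \<AA>" "l \<in> Ix \<AA>"
  defines "h \<equiv> pb1 (cmp_cospan3 C \<AA> i j k l)"
    and "g \<equiv> pb1 (cmp_cospan \<AA> i j k) \<cdot> pb2 (cmp_cospan3 C \<AA> i j k l)"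
    and "f \<equiv> pb2 (cmp_cospan \<AA> i j k) \<cdot> pb2 (cmp_cospan3 C \<AA> i j k l)"
  shows "h \<in> hom (pb C (cmp_cospan3 C \<AA> i j k l)) (A1 \<AA> k l)" (is ?h)
    and "g \<in> hom (pb C (cmp_cospan3 C \<AA> i j k l)) (A1 \<AA> j k)" (is ?g)
    and "f \<in> hom (pb C (cmp_cospan3 C \<AA> i j k l)) (A1 \<AA> i j)" (is ?f)
    and "sr \<AA> k l \<cdot> h = tg \<AA> j k \<cdot> g" (is ?hg) and "sr \<AA> j k \<cdot> g = tg \<AA> i j \<cdot> f" (is ?gf)
    and "mul_assoc C \<AA> i j k l \<longleftrightarrow> mu \<AA> i k l h (mu \<AA> i j k g f) = mu \<AA> i j l (mu \<AA> j k l h g) f" (is ?eq)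
proof -
  let ?K = "cmp_cospan \<AA> i j k" let ?T = "cmp_cospan3 C \<AA> i j k l" let ?t = "pb C ?T"
  note okK = cmp_ok[OF i(1-3)] and okT = cmp3_ok[OF i]
  note K = pb_hom[OF okK, simplified] pb_square[OF okK, simplified]
  note T = pb_hom[OF okT, simplified] pb_square[OF okT, simplified leg_cmp3[OF i]]
  show h: ?h and g: ?g and f: ?f
    using K T by (auto simp: h_def g_def f_def intro: cmp_hom)
  show hg: ?hg using T(3) by (simp add: h_def g_def cmp_assoc)
  show gf: ?gf using cmp_reassoc[OF K(3), of "pb2 ?T"] by (simp add: g_def f_def cmp_assoc)
  note obs = pb_ob[OF okK] pb_ob[OF okT] A1_in[OF i(3,4)] A1_in[OF i(2,3)] A1_in[OF i(1,2)] A1_in[OF i(1,3)] A1_in[OF i(1,4)] A1_in[OF i(2,4)]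
  note pr = pr_in[OF okK, simplified] pr_in[OF okT, simplified]
  let ?g = "Cmp C ?t (pb C ?K) (A1 \<AA> j k) (pr1 C ?K) (pr2 C ?T)"
  let ?f = "Cmp C ?t (pb C ?K) (A1 \<AA> i j) (pr2 C ?K) (pr2 C ?T)"
  let ?gf = "Cmp C ?t (pb C ?K) (A1 \<AA> i k) (mul \<AA> i j k) (pr2 C ?T)"
  have r: "pr1 C ?T \<in> Hom C ?t (A1 \<AA> k l)" "?g \<in> Hom C ?t (A1 \<AA> j k)" "?f \<in> Hom C ?t (A1 \<AA> i j)"
    "?gf \<in> Hom C ?t (A1 \<AA> i k)"
    using i by (auto intro!: Cmp_in obs pr mul_in)
  have pbs: "arr (pb C ?K) (A1 \<AA> j k) (pr1 C ?K) = pb1 ?K" "arr (pb C ?K) (A1 \<AA> i j) (pr2 C ?K) = pb2 ?K"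
    "arr ?t (A1 \<AA> k l) (pr1 C ?T) = pb1 ?T" "arr ?t (pb C ?K) (pr2 C ?T) = pb2 ?T"
    by (simp_all add: pb1_def pb2_def)
  have e: "arr ?t (A1 \<AA> k l) (pr1 C ?T) = h" "arr ?t (A1 \<AA> j k) ?g = g" "arr ?t (A1 \<AA> i j) ?f = f"
    by (simp_all add: arr_Cmp obs pr pbs h_def g_def f_def)
  have e': "arr ?t (A1 \<AA> i k) ?gf = mu \<AA> i j k g f"
    using mpair_eta[OF okK hom_el[OF T(2)]] i
    by (simp add: arr_Cmp obs pr mul_in pbs mu_def g_def f_def flip: mulA_def)
  have m1: "sr \<AA> k l \<cdot> h = tg \<AA> i k \<cdot> mu \<AA> i j k g f"
    using tg_mu[OF i(1-3) hom_el[OF g] hom_el[OF f] gf] hg by simp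
  have m2: "sr \<AA> j l \<cdot> mu \<AA> j k l h g = tg \<AA> i j \<cdot> f"
    using sr_mu[OF i(2-4) hom_el[OF h] hom_el[OF g] hg] gf by simp
  note ok1 = cmp_ok[OF i(1,3,4)] and ok2 = cmp_ok[OF i(2,3,4)] and ok3 = cmp_ok[OF i(1,2,4)]
  note p1 = pair_raw[OF ok1 obs(2), simplified, OF r(1,4), unfolded e e', OF m1]
  note p2 = pair_raw[OF ok2 obs(2), simplified, OF r(1,2), unfolded e e', OF hg]
  let ?hg = "Cmp C ?t (pb C (cmp_cospan \<AA> j k l)) (A1 \<AA> j l) (mul \<AA> j k l) (pair C (cmp_cospan \<AA> j k l) ?t (pr1 C ?T) ?g)"
  have hg_in: "?hg \<in> Hom C ?t (A1 \<AA> j l)"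
    using i p2 by (auto intro!: Cmp_in obs pb_ob[OF ok2] mul_in)
  have hg_eq: "arr ?t (A1 \<AA> j l) ?hg = mu \<AA> j k l h g"
    using i p2 by (simp add: arr_Cmp obs pb_ob[OF ok2] mul_in mu_def mulA_def)
  note p3 = pair_raw[OF ok3 obs(2), simplified, OF hg_in r(3), unfolded e hg_eq, OF m2]
  show ?eq
    unfolding mul_assoc_def Let_def using i p1(1,4) p3(1,4)
    by (simp add: arr_eq_iff[OF obs(2,7)] Cmp_in obs pb_ob[OF ok1] pb_ob[OF ok3] mul_in arr_Cmp mu_def mulA_def)
qed

end

locale internal = restriction_category C + partite_internal_category C \<AA>
  for C :: "('o, 'm) rcat" and \<AA> :: "('i, 'o, 'm) pcat"

sublocale internal \<subseteq> premul C \<AA>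
  by unfold_locales
    (auto intro: A0_in A1_in src_total tgt_total src_pullbacks idm_in src_idm tgt_idm mul_in src_mul tgt_mul)

context premul
begin

text \<open>The raw laws are instances at generic elements. In particular the triple of
  \<open>mul_assoc_iff\<close> is one of the composable triples for which \<open>assoc\<close> is
  supposed.\<close>

lemma internalI:
  assumes un1: "\<And>i j. \<lbrakk>i \<in> Ix \<AA>; j \<in> Ix \<AA>\<rbrakk>
      \<Longrightarrow> mu \<AA> i i j (ide (A1 \<AA> i j)) (un \<AA> i \<cdot> sr \<AA> i j) = ide (A1 \<AA> i j)"
    and un2: "\<And>i j. \<lbrakk>i \<in> Ix \<AA>; j \<in> Ix \<AA>\<rbrakk>
      \<Longrightarrow> mu \<AA> i j j (un \<AA> j \<cdot> tg \<AA> i j) (ide (A1 \<AA> i j)) = ide (A1 \<AA> i j)"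
    and assoc: "\<And>i j k l w h g f. \<lbrakk>i \<in> Ix \<AA>; j \<in> Ix \<AA>; k \<in> Ix \<AA>; l \<in> Ix \<AA>; h \<in> hom w (A1 \<AA> k l);
        g \<in> hom w (A1 \<AA> j k); f \<in> hom w (A1 \<AA> i j); sr \<AA> k l \<cdot> h = tg \<AA> j k \<cdot> g; sr \<AA> j k \<cdot> g = tg \<AA> i j \<cdot> f\<rbrakk>
      \<Longrightarrow> mu \<AA> i k l h (mu \<AA> i j k g f) = mu \<AA> i j l (mu \<AA> j k l h g) f"
  shows "internal C \<AA>"
proof -
  have "partite_internal_category C \<AA>"
  proof
    show "mul_assoc C \<AA> i j k l" if i: "i \<in> Ix \<AA>" "j \<in> Ix \<AA>" "k \<in> Ix \<AA>" "l \<in> Ix \<AA>" for i j k l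
      unfolding mul_assoc_iff(6)[OF i] by (rule assoc[OF i mul_assoc_iff(1-5)[OF i]])
  qed (auto simp: src_total tgt_total idm_in src_idm tgt_idm mul_in src_mul tgt_mul mul_idm_iff un1 idm_mul_iff un2 intro: src_pullbacks)
  then show ?thesis by (simp add: internal_def restriction_category_axioms)
qed

end

context internal
begin

lemma mu_un:
  assumes i: "i \<in> Ix \<AA>" "j \<in> Ix \<AA>" and f: "f \<in> el (A1 \<AA> i j)"
  shows "mu \<AA> i i j f (un \<AA> i \<cdot> sr \<AA> i j \<cdot> f) = f"
proof -
  have "mu \<AA> i i j (ide (A1 \<AA> i j)) (un \<AA> i \<cdot> sr \<AA> i j) \<cdot> f = ide (A1 \<AA> i j) \<cdot> f"
    using mul_idm[OF i refl] mul_idm_iff[OF i] by simp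
  also have "mu \<AA> i i j (ide (A1 \<AA> i j)) (un \<AA> i \<cdot> sr \<AA> i j) \<cdot> f
      = mu \<AA> i i j (ide (A1 \<AA> i j) \<cdot> f) ((un \<AA> i \<cdot> sr \<AA> i j) \<cdot> f)"
    by (rule mu_cmp) (use i in \<open>auto intro: hom_el[OF ide_hom] hom_cmp_el[OF un_hom] simp: cmp_reassoc[OF tg_un] cmp_ide[OF sr_hom] ide_cmp_hom[OF sr_hom]\<close>)
  finally show ?thesis using f by (simp add: cmp_assoc)
qed

lemma un_mu:
  assumes i: "i \<in> Ix \<AA>" "j \<in> Ix \<AA>" and f: "f \<in> el (A1 \<AA> i j)"
  shows "mu \<AA> i j j (un \<AA> j \<cdot> tg \<AA> i j \<cdot> f) f = f"
proof -
  have "mu \<AA> i j j (un \<AA> j \<cdot> tg \<AA> i j) (ide (A1 \<AA> i j)) \<cdot> f = ide (A1 \<AA> i j) \<cdot> f"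
    using idm_mul[OF i refl] idm_mul_iff[OF i] by simp
  also have "mu \<AA> i j j (un \<AA> j \<cdot> tg \<AA> i j) (ide (A1 \<AA> i j)) \<cdot> f
      = mu \<AA> i j j ((un \<AA> j \<cdot> tg \<AA> i j) \<cdot> f) (ide (A1 \<AA> i j) \<cdot> f)"
    by (rule mu_cmp) (use i in \<open>auto intro: hom_el[OF ide_hom] hom_cmp_el[OF un_hom] simp: cmp_reassoc[OF sr_un] cmp_ide[OF tg_hom] ide_cmp_hom[OF tg_hom]\<close>)
  finally show ?thesis using f by (simp add: cmp_assoc)
qed

text \<open>The Yoneda direction: the law at the generic triple is precomposed with the map
  \<open>x\<close> that classifies \<open>h\<close>, \<open>g\<close>, \<open>f\<close>, and
  \<open>mu_cmp\<close> carries \<open>x\<close> into the arguments.\<close>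

lemma mu_mu:
  assumes i: "i \<in> Ix \<AA>" "j \<in> Ix \<AA>" "k \<in> Ix \<AA>" "l \<in> Ix \<AA>"
    and el: "h \<in> el (A1 \<AA> k l)" "g \<in> el (A1 \<AA> j k)" "f \<in> el (A1 \<AA> i j)"
    and eq: "sr \<AA> k l \<cdot> h = tg \<AA> j k \<cdot> g" "sr \<AA> j k \<cdot> g = tg \<AA> i j \<cdot> f"
  shows "mu \<AA> i k l h (mu \<AA> i j k g f) = mu \<AA> i j l (mu \<AA> j k l h g) f"
proof -
  let ?K = "cmp_cospan \<AA> i j k" let ?T = "cmp_cospan3 C \<AA> i j k l"
  let ?h = "pb1 ?T" let ?g = "pb1 ?K \<cdot> pb2 ?T" let ?f = "pb2 ?K \<cdot> pb2 ?T"
  note t = mul_assoc_iff[OF i]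
  note e = hom_el[OF t(1)] hom_el[OF t(2)] hom_el[OF t(3)]
  define x where "x = mpair ?T h (mpair ?K g f)"
  have K: "pb1 ?K \<cdot> mpair ?K g f = g" "pb2 ?K \<cdot> mpair ?K g f = f" "mpair ?K g f \<in> el (pb C ?K)"
    using el eq by (auto intro!: pb_mpair[OF cmp_ok[OF i(1-3)]] mpair_el[OF cmp_ok[OF i(1-3)]])
  have "l1 ?T \<cdot> h = l2 ?T \<cdot> mpair ?K g f"
    using K by (simp add: leg_cmp3[OF i] eq cmp_assoc)
  then have T: "pb1 ?T \<cdot> x = h" "pb2 ?T \<cdot> x = mpair ?K g f"
    using pb_mpair[OF cmp3_ok[OF i]] el K by (simp_all add: x_def)
  have x: "?h \<cdot> x = h" "?g \<cdot> x = g" "?f \<cdot> x = f"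
    using T K by (simp_all add: cmp_assoc)
  have "mu \<AA> i k l ?h (mu \<AA> i j k ?g ?f) = mu \<AA> i j l (mu \<AA> j k l ?h ?g) ?f"
    using mul_mul[OF i] t(6) by simp
  then have "mu \<AA> i k l ?h (mu \<AA> i j k ?g ?f) \<cdot> x = mu \<AA> i j l (mu \<AA> j k l ?h ?g) ?f \<cdot> x"
    by simp
  also have "mu \<AA> i k l ?h (mu \<AA> i j k ?g ?f) \<cdot> x = mu \<AA> i k l (?h \<cdot> x) (mu \<AA> i j k (?g \<cdot> x) (?f \<cdot> x))"
    using mu_cmp[OF i(1,3,4) e(1) mu_el[OF i(1-3)], of ?g ?f] mu_cmp[OF i(1-3) e(2,3) t(5)] t(4)
      tg_mu[OF i(1-3) e(2,3) t(5)] by simp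
  also have "mu \<AA> i j l (mu \<AA> j k l ?h ?g) ?f \<cdot> x = mu \<AA> i j l (mu \<AA> j k l (?h \<cdot> x) (?g \<cdot> x)) (?f \<cdot> x)"
    using mu_cmp[OF i(1,2,4) mu_el[OF i(2-4)] e(3), of ?h ?g] mu_cmp[OF i(2-4) e(1,2) t(4)] t(5)
      sr_mu[OF i(2-4) e(1,2) t(4)] by simp
  finally show ?thesis by (simp add: x)
qed

end

section \<open>Cofunctors in terms of generalised elements\<close>

context restriction_category
begin

definition c0 :: "('i, 'o, 'm) pcat \<Rightarrow> ('i, 'o, 'm) pcat \<Rightarrow> ('i, 'm) cofun \<Rightarrow> 'i \<Rightarrow> ('o, 'm) arrow" where
  "c0 \<AA> \<BB> F i = arr (A0 \<BB> (cof F i)) (A0 \<AA> i) (cof0 F i)"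

definition c1 :: "('i, 'o, 'm) pcat \<Rightarrow> ('i, 'o, 'm) pcat \<Rightarrow> ('i, 'm) cofun \<Rightarrow> 'i \<Rightarrow> 'i \<Rightarrow> ('o, 'm) arrow" where
  "c1 \<AA> \<BB> F i j = arr (pb C (act_cospan \<AA> \<BB> F i j)) (A1 \<BB> (cof F i) (cof F j)) (cof1 F i j)"

definition act :: "('i, 'o, 'm) pcat \<Rightarrow> ('i, 'o, 'm) pcat \<Rightarrow> ('i, 'm) cofun \<Rightarrow> 'i \<Rightarrow> 'i
    \<Rightarrow> ('o, 'm) arrow \<Rightarrow> ('o, 'm) arrow \<Rightarrow> ('o, 'm) arrow" where
  "act \<AA> \<BB> F i j a b = c1 \<AA> \<BB> F i j \<cdot> mpair (act_cospan \<AA> \<BB> F i j) a b"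

end

lemma act_cospan_simps [simp]:
  "ob1 (act_cospan \<AA> \<BB> F i j) = A1 \<AA> i j" "ob2 (act_cospan \<AA> \<BB> F i j) = A0 \<BB> (cof F i)"
  "base (act_cospan \<AA> \<BB> F i j) = A0 \<AA> i" "leg1 (act_cospan \<AA> \<BB> F i j) = src \<AA> i j"
  "leg2 (act_cospan \<AA> \<BB> F i j) = cof0 F i"
  by (simp_all add: act_cospan_def)

lemma act_cospan3_simps [simp]:
  "ob1 (act_cospan3 C \<AA> \<BB> F i j k) = A1 \<AA> j k" "ob2 (act_cospan3 C \<AA> \<BB> F i j k) = pb C (act_cospan \<AA> \<BB> F i j)"
  "base (act_cospan3 C \<AA> \<BB> F i j k) = A0 \<AA> j" "leg1 (act_cospan3 C \<AA> \<BB> F i j k) = src \<AA> j k"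
  "leg2 (act_cospan3 C \<AA> \<BB> F i j k) = Cmp C (pb C (act_cospan \<AA> \<BB> F i j)) (A1 \<AA> i j) (A0 \<AA> j) (tgt \<AA> i j) (pr1 C (act_cospan \<AA> \<BB> F i j))"
  by (simp_all add: act_cospan3_def Let_def)

text \<open>Staged like \<open>pgraph\<close> and \<open>premul\<close>. The cospan on which the
  arrow part of a cofunctor is defined involves only \<open>cof\<close> and \<open>cof0\<close>, so
  its pullback is available before anything is said about \<open>cof1\<close>.\<close>

locale precofun = A: internal C \<AA> + B: internal C \<BB>
  for C :: "('o, 'm) rcat" and \<AA> \<BB> :: "('i, 'o, 'm) pcat" +
  fixes F :: "('i, 'm) cofun"
  assumes cof_in [simp]: "i \<in> Ix \<AA> \<Longrightarrow> cof F i \<in> Ix \<BB>"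
    and cof0_total: "i \<in> Ix \<AA> \<Longrightarrow> total_map C (A0 \<BB> (cof F i)) (A0 \<AA> i) (cof0 F i)"
begin

notation A.cmp (infixr "\<cdot>" 70)

lemma c0_tot: "i \<in> Ix \<AA> \<Longrightarrow> A.c0 \<AA> \<BB> F i \<in> A.tot (A0 \<BB> (cof F i)) (A0 \<AA> i)"
  by (simp add: A.c0_def A.arr_tot cof0_total)

lemmas c0_hom = c0_tot[THEN A.tot_hom]

lemma cof0_in [simp]: "i \<in> Ix \<AA> \<Longrightarrow> cof0 F i \<in> Hom C (A0 \<BB> (cof F i)) (A0 \<AA> i)"
  using cof0_total by (simp add: total_map_def)

lemma act_ok: "\<lbrakk>i \<in> Ix \<AA>; j \<in> Ix \<AA>\<rbrakk> \<Longrightarrow> A.cospan_ok (act_cospan \<AA> \<BB> F i j)"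
  using A.src_pullbacks[of i j "A0 \<BB> (cof F i)" "cof0 F i"]
  by (simp add: A.cospan_ok_def A.src_total cof0_total) (simp add: act_cospan_def cof0_total)

lemma leg_act [simp]: "A.l1 (act_cospan \<AA> \<BB> F i j) = A.sr \<AA> i j" "A.l2 (act_cospan \<AA> \<BB> F i j) = A.c0 \<AA> \<BB> F i"
  by (simp_all add: A.l1_def A.l2_def A.sr_def A.c0_def)

lemma act3_ok: "\<lbrakk>i \<in> Ix \<AA>; j \<in> Ix \<AA>; k \<in> Ix \<AA>\<rbrakk> \<Longrightarrow> A.cospan_ok (act_cospan3 C \<AA> \<BB> F i j k)"
  and leg_act3: "\<lbrakk>i \<in> Ix \<AA>; j \<in> Ix \<AA>; k \<in> Ix \<AA>\<rbrakk> \<Longrightarrow> A.l1 (act_cospan3 C \<AA> \<BB> F i j k) = A.sr \<AA> j k"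
    "\<lbrakk>i \<in> Ix \<AA>; j \<in> Ix \<AA>; k \<in> Ix \<AA>\<rbrakk> \<Longrightarrow>
      A.l2 (act_cospan3 C \<AA> \<BB> F i j k) = A.tg \<AA> i j \<cdot> A.pb1 (act_cospan \<AA> \<BB> F i j)"
proof -
  assume i: "i \<in> Ix \<AA>" "j \<in> Ix \<AA>" "k \<in> Ix \<AA>"
  let ?K = "act_cospan \<AA> \<BB> F i j"
  note ok = act_ok[OF i(1-2)]
  have pr: "pr1 C ?K \<in> Hom C (pb C ?K) (A1 \<AA> i j)"
    using A.pr_in[OF ok] by simp
  let ?t = "Cmp C (pb C ?K) (A1 \<AA> i j) (A0 \<AA> j) (tgt \<AA> i j) (pr1 C ?K)"
  have e: "A.arr (pb C ?K) (A0 \<AA> j) ?t = A.tg \<AA> i j \<cdot> A.pb1 ?K"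
    using i pr by (simp add: A.arr_Cmp A.pb_ob[OF ok] A.tg_def A.pb1_def)
  show "A.l1 (act_cospan3 C \<AA> \<BB> F i j k) = A.sr \<AA> j k" "A.l2 (act_cospan3 C \<AA> \<BB> F i j k) = A.tg \<AA> i j \<cdot> A.pb1 ?K"
    using e by (simp_all add: A.l1_def A.l2_def A.sr_def)
  have "A.tg \<AA> i j \<cdot> A.pb1 ?K \<in> A.tot (pb C ?K) (A0 \<AA> j)"
    using A.cmp_tot[OF A.tg_tot A.pb_tot(1)[OF ok, simplified]] i by simp
  then have t: "total_map C (pb C ?K) (A0 \<AA> j) ?t"
    using i pr A.pb_ob[OF ok] by (simp add: A.total_map_iff e A.Cmp_in)
  show "A.cospan_ok (act_cospan3 C \<AA> \<BB> F i j k)"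
    using i t A.src_pullbacks[OF i(2,3) A.pb_ob[OF ok] t]
    by (simp add: A.cospan_ok_def A.src_total A.pb_ob[OF ok]) (simp add: act_cospan3_def Let_def)
qed

end

locale cofun1 = precofun +
  assumes cof1_in: "\<lbrakk>i \<in> Ix \<AA>; j \<in> Ix \<AA>\<rbrakk>
      \<Longrightarrow> cof1 F i j \<in> Hom C (pb C (act_cospan \<AA> \<BB> F i j)) (A1 \<BB> (cof F i) (cof F j))"
begin

lemma c1_hom: "\<lbrakk>i \<in> Ix \<AA>; j \<in> Ix \<AA>\<rbrakk> \<Longrightarrow>
    A.c1 \<AA> \<BB> F i j \<in> A.hom (pb C (act_cospan \<AA> \<BB> F i j)) (A1 \<BB> (cof F i) (cof F j))"
  by (simp add: A.c1_def A.homI A.pb_ob[OF act_ok] cof1_in)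

lemma act_el: "\<lbrakk>i \<in> Ix \<AA>; j \<in> Ix \<AA>\<rbrakk> \<Longrightarrow> A.act \<AA> \<BB> F i j a b \<in> A.el (A1 \<BB> (cof F i) (cof F j))"
  unfolding A.act_def by (rule A.cmp_el[OF A.hom_el[OF c1_hom]])

lemma act_hom: "\<lbrakk>i \<in> Ix \<AA>; j \<in> Ix \<AA>; a \<in> A.hom w (A1 \<AA> i j); b \<in> A.hom w (A0 \<BB> (cof F i)); A.sr \<AA> i j \<cdot> a = A.c0 \<AA> \<BB> F i \<cdot> b\<rbrakk>
    \<Longrightarrow> A.act \<AA> \<BB> F i j a b \<in> A.hom w (A1 \<BB> (cof F i) (cof F j))"
  unfolding A.act_def by (rule A.cmp_hom[OF c1_hom A.mpair_hom[OF act_ok]]) simp_all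

lemma act_cmp: "\<lbrakk>i \<in> Ix \<AA>; j \<in> Ix \<AA>; a \<in> A.el (A1 \<AA> i j); b \<in> A.el (A0 \<BB> (cof F i)); A.sr \<AA> i j \<cdot> a = A.c0 \<AA> \<BB> F i \<cdot> b\<rbrakk>
    \<Longrightarrow> A.act \<AA> \<BB> F i j a b \<cdot> h = A.act \<AA> \<BB> F i j (a \<cdot> h) (b \<cdot> h)"
  using A.mpair_cmp[OF act_ok, of i j a b h] by (simp add: A.act_def A.cmp_assoc)

lemma act_pb:
  assumes i: "i \<in> Ix \<AA>" "j \<in> Ix \<AA>"
  shows "A.act \<AA> \<BB> F i j (A.pb1 (act_cospan \<AA> \<BB> F i j)) (A.pb2 (act_cospan \<AA> \<BB> F i j)) = A.c1 \<AA> \<BB> F i j"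
proof -
  note ok = act_ok[OF i]
  show ?thesis
    using A.mpair_eta[OF ok A.hom_el[OF A.ide_hom[OF A.pb_ob[OF ok]]]]
    by (simp add: A.act_def A.cmp_ide[OF A.pb_hom(1)[OF ok]] A.cmp_ide[OF A.pb_hom(2)[OF ok]] A.cmp_ide[OF c1_hom[OF i]])
qed

text \<open>The projections of \<open>act_cospan3\<close> form the generic triple: two composable
  arrows and a point over the source of the first. \<open>tg\<close> and \<open>sr\<close> are the
  source and target laws, which make the right hand side composable.\<close>

lemma cof_mul_iff:
  assumes i: "i \<in> Ix \<AA>" "j \<in> Ix \<AA>" "k \<in> Ix \<AA>"
  assumes tg: "A.c0 \<AA> \<BB> F j \<cdot> A.tg \<BB> (cof F i) (cof F j) \<cdot> A.c1 \<AA> \<BB> F i j = A.tg \<AA> i j \<cdot> A.pb1 (act_cospan \<AA> \<BB> F i j)"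
    and sr: "A.sr \<BB> (cof F j) (cof F k) \<cdot> A.c1 \<AA> \<BB> F j k = A.pb2 (act_cospan \<AA> \<BB> F j k)"
  defines "g \<equiv> A.pb1 (act_cospan3 C \<AA> \<BB> F i j k)"
    and "f \<equiv> A.pb1 (act_cospan \<AA> \<BB> F i j) \<cdot> A.pb2 (act_cospan3 C \<AA> \<BB> F i j k)"
    and "b \<equiv> A.pb2 (act_cospan \<AA> \<BB> F i j) \<cdot> A.pb2 (act_cospan3 C \<AA> \<BB> F i j k)"
  shows "g \<in> A.hom (pb C (act_cospan3 C \<AA> \<BB> F i j k)) (A1 \<AA> j k)" (is ?g)
    and "f \<in> A.hom (pb C (act_cospan3 C \<AA> \<BB> F i j k)) (A1 \<AA> i j)" (is ?f)
    and "b \<in> A.hom (pb C (act_cospan3 C \<AA> \<BB> F i j k)) (A0 \<BB> (cof F i))" (is ?b)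
    and "A.sr \<AA> j k \<cdot> g = A.tg \<AA> i j \<cdot> f" (is ?gf) and "A.sr \<AA> i j \<cdot> f = A.c0 \<AA> \<BB> F i \<cdot> b" (is ?fb)
    and "cof_mul C \<AA> \<BB> F i j k \<longleftrightarrow> A.act \<AA> \<BB> F i k (A.mu \<AA> i j k g f) b
      = A.mu \<BB> (cof F i) (cof F j) (cof F k) (A.act \<AA> \<BB> F j k g (A.tg \<BB> (cof F i) (cof F j) \<cdot> A.act \<AA> \<BB> F i j f b))
          (A.act \<AA> \<BB> F i j f b)" (is ?eq)
proof -
  let ?K = "act_cospan \<AA> \<BB> F i j" let ?T = "act_cospan3 C \<AA> \<BB> F i j k" let ?t = "pb C ?T"
  let ?i = "cof F i" let ?j = "cof F j" let ?k = "cof F k"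
  note okK = act_ok[OF i(1-2)] and okT = act3_ok[OF i]
  note K = A.pb_hom[OF okK, simplified] A.pb_square[OF okK, simplified]
  note T = A.pb_hom[OF okT, simplified] A.pb_square[OF okT, simplified leg_act3[OF i]]
  show g: ?g and f: ?f and b: ?b
    using K T by (auto simp: b_def g_def f_def intro: A.cmp_hom)
  show gf: ?gf using T(3) by (simp add: f_def g_def A.cmp_assoc)
  show fb: ?fb using A.cmp_reassoc[OF K(3), of "A.pb2 ?T"] by (simp add: b_def f_def A.cmp_assoc)
  note obs = A.pb_ob[OF okK] A.pb_ob[OF okT]
  note [simp] = i cof_in[OF i(1)] cof_in[OF i(2)] cof_in[OF i(3)] obs
  note pr = A.pr_in[OF okK, simplified] A.pr_in[OF okT, simplified]
  let ?f = "Cmp C ?t (pb C ?K) (A1 \<AA> i j) (pr1 C ?K) (pr2 C ?T)"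
  let ?b = "Cmp C ?t (pb C ?K) (A0 \<BB> ?i) (pr2 C ?K) (pr2 C ?T)"
  let ?F = "Cmp C ?t (pb C ?K) (A1 \<BB> ?i ?j) (cof1 F i j) (pr2 C ?T)"
  let ?tF = "Cmp C ?t (A1 \<BB> ?i ?j) (A0 \<BB> ?j) (tgt \<BB> ?i ?j) ?F"
  have r: "pr1 C ?T \<in> Hom C ?t (A1 \<AA> j k)" "?f \<in> Hom C ?t (A1 \<AA> i j)" "?b \<in> Hom C ?t (A0 \<BB> ?i)"
    "?F \<in> Hom C ?t (A1 \<BB> ?i ?j)" "?tF \<in> Hom C ?t (A0 \<BB> ?j)"
    by (auto intro!: A.Cmp_in pr cof1_in)
  have pbs: "A.arr (pb C ?K) (A1 \<AA> i j) (pr1 C ?K) = A.pb1 ?K" "A.arr (pb C ?K) (A0 \<BB> ?i) (pr2 C ?K) = A.pb2 ?K"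
    "A.arr ?t (A1 \<AA> j k) (pr1 C ?T) = A.pb1 ?T" "A.arr ?t (pb C ?K) (pr2 C ?T) = A.pb2 ?T"
    by (simp_all add: A.pb1_def A.pb2_def)
  have e: "A.arr ?t (A1 \<AA> j k) (pr1 C ?T) = g" "A.arr ?t (A1 \<AA> i j) ?f = f" "A.arr ?t (A0 \<BB> ?i) ?b = b"
    by (simp_all add: A.arr_Cmp pr pbs b_def g_def f_def)
  have e4: "A.arr ?t (A1 \<BB> ?i ?j) ?F = A.act \<AA> \<BB> F i j f b"
    using A.mpair_eta[OF okK A.hom_el[OF T(2)]]
    by (simp add: A.arr_Cmp pr cof1_in pbs A.act_def f_def b_def flip: A.c1_def)
  have e5: "A.arr ?t (A0 \<BB> ?j) ?tF = A.tg \<BB> ?i ?j \<cdot> A.act \<AA> \<BB> F i j f b"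
    by (simp add: A.arr_Cmp r(4) e4 A.tg_def)
  have F: "A.act \<AA> \<BB> F i j f b = A.c1 \<AA> \<BB> F i j \<cdot> A.pb2 ?T"
    using A.mpair_eta[OF okK A.hom_el[OF T(2)]] by (simp add: A.act_def f_def b_def)
  let ?M = "cmp_cospan \<AA> i j k"
  let ?Kjk = "act_cospan \<AA> \<BB> F j k"
  note okM = A.cmp_ok[OF i] and okM' = B.cmp_ok[OF cof_in[OF i(1)] cof_in[OF i(2)] cof_in[OF i(3)]]
    and okjk = act_ok[OF i(2,3)] and okik = act_ok[OF i(1,3)]
  note [simp] = A.pb_ob[OF okM] A.pb_ob[OF okM'] A.pb_ob[OF okjk] A.pb_ob[OF okik]
  note p1 = A.pair_raw[OF okM obs(2), simplified, OF r(1,2), unfolded e, OF gf]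
  let ?gf = "Cmp C ?t (pb C ?M) (A1 \<AA> i k) (mul \<AA> i j k) (pair C ?M ?t (pr1 C ?T) ?f)"
  have gf_in: "?gf \<in> Hom C ?t (A1 \<AA> i k)" and gf_eq: "A.arr ?t (A1 \<AA> i k) ?gf = A.mu \<AA> i j k g f"
    using p1 by (auto intro!: A.Cmp_in A.mul_in simp: A.arr_Cmp A.mul_in A.mu_def A.mulA_def)
  have m2: "A.sr \<AA> i k \<cdot> A.mu \<AA> i j k g f = A.c0 \<AA> \<BB> F i \<cdot> b"
    using A.sr_mu[OF i A.hom_el[OF g] A.hom_el[OF f] gf] fb by simp
  note p2 = A.pair_raw[OF okik obs(2), simplified, OF gf_in r(3), unfolded e gf_eq, OF m2]
  have m3: "A.sr \<AA> j k \<cdot> g = A.c0 \<AA> \<BB> F j \<cdot> A.tg \<BB> ?i ?j \<cdot> A.act \<AA> \<BB> F i j f b"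
    unfolding F using A.cmp_reassoc[OF tg, of "A.pb2 ?T"] gf by (simp add: f_def A.cmp_assoc)
  note p3 = A.pair_raw[OF okjk obs(2), simplified, OF r(1,5), unfolded e e5, OF m3]
  let ?G = "Cmp C ?t (pb C ?Kjk) (A1 \<BB> ?j ?k) (cof1 F j k) (pair C ?Kjk ?t (pr1 C ?T) ?tF)"
  have G_in: "?G \<in> Hom C ?t (A1 \<BB> ?j ?k)"
    and G_eq: "A.arr ?t (A1 \<BB> ?j ?k) ?G = A.act \<AA> \<BB> F j k g (A.tg \<BB> ?i ?j \<cdot> A.act \<AA> \<BB> F i j f b)"
    using p3 by (auto intro!: A.Cmp_in cof1_in simp: A.arr_Cmp cof1_in A.act_def A.c1_def)
  have m4: "A.sr \<BB> ?j ?k \<cdot> A.act \<AA> \<BB> F j k g (A.tg \<BB> ?i ?j \<cdot> A.act \<AA> \<BB> F i j f b) = A.tg \<BB> ?i ?j \<cdot> A.act \<AA> \<BB> F i j f b"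
    unfolding A.act_def[of _ _ _ j k] A.cmp_reassoc[OF sr]
    by (rule A.pb_mpair(2)[OF okjk]) (use m3 in \<open>auto intro: A.hom_el[OF g] A.cmp_el[OF A.hom_el[OF B.tg_hom]]\<close>)
  note p4 = A.pair_raw[OF okM' obs(2), simplified, OF G_in r(4), unfolded e4 G_eq, OF m4]
  show ?eq
    unfolding cof_mul_def Let_def using p2(1,4) p4(1,4)
    by (simp add: A.arr_eq_iff[OF obs(2), of "A1 \<BB> ?i ?k"] A.Cmp_in B.mul_in cof1_in A.arr_Cmp A.mu_def A.mulA_def A.act_def A.c1_def)
qed

lemma cof_idm_iff:
  assumes i: "i \<in> Ix \<AA>"
  shows "Cmp C (A0 \<BB> (cof F i)) (pb C (act_cospan \<AA> \<BB> F i i)) (A1 \<BB> (cof F i) (cof F i)) (cof1 F i i)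
            (pair C (act_cospan \<AA> \<BB> F i i) (A0 \<BB> (cof F i))
              (Cmp C (A0 \<BB> (cof F i)) (A0 \<AA> i) (A1 \<AA> i i) (idm \<AA> i) (cof0 F i)) (Idn C (A0 \<BB> (cof F i))))
        = idm \<BB> (cof F i) \<longleftrightarrow>
     A.act \<AA> \<BB> F i i (A.un \<AA> i \<cdot> A.c0 \<AA> \<BB> F i) (A.ide (A0 \<BB> (cof F i))) = A.un \<BB> (cof F i)"
proof -
  let ?b = "A0 \<BB> (cof F i)" let ?K = "act_cospan \<AA> \<BB> F i i"
  let ?s = "Cmp C ?b (A0 \<AA> i) (A1 \<AA> i i) (idm \<AA> i) (cof0 F i)"
  note ok = act_ok[OF i i]
  note [simp] = i cof_in[OF i] A.pb_ob[OF ok]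
  have s: "A.arr ?b (A1 \<AA> i i) ?s = A.un \<AA> i \<cdot> A.c0 \<AA> \<BB> F i" "?s \<in> Hom C ?b (A1 \<AA> i i)"
    by (simp_all add: A.arr_Cmp A.un_def A.c0_def A.idm_in A.Cmp_in)
  have d: "A.arr ?b ?b (Idn C ?b) = A.ide ?b"
    by (simp add: A.ide_def)
  have "A.sr \<AA> i i \<cdot> A.un \<AA> i \<cdot> A.c0 \<AA> \<BB> F i = A.c0 \<AA> \<BB> F i \<cdot> A.ide ?b"
    by (simp add: A.cmp_reassoc[OF A.sr_un] A.cmp_ide[OF c0_hom] A.ide_cmp_hom[OF c0_hom])
  then have p: "pair C ?K ?b ?s (Idn C ?b) \<in> Hom C ?b (pb C ?K)"
    "A.arr ?b (pb C ?K) (pair C ?K ?b ?s (Idn C ?b)) = A.mpair ?K (A.un \<AA> i \<cdot> A.c0 \<AA> \<BB> F i) (A.ide ?b)"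
    using A.pair_raw[OF ok, of ?b ?s "Idn C ?b"] s by (simp_all add: A.Idn_in d)
  show ?thesis
    using p by (simp add: A.arr_eq_iff[of ?b "A1 \<BB> (cof F i) (cof F i)"] A.Cmp_in cof1_in B.idm_in A.arr_Cmp A.act_def A.c1_def A.un_def)
qed

lemma src_cof1_iff:
  assumes i: "i \<in> Ix \<AA>" "j \<in> Ix \<AA>"
  shows "Cmp C (pb C (act_cospan \<AA> \<BB> F i j)) (A1 \<BB> (cof F i) (cof F j)) (A0 \<BB> (cof F i))
            (src \<BB> (cof F i) (cof F j)) (cof1 F i j) = pr2 C (act_cospan \<AA> \<BB> F i j) \<longleftrightarrow>
     A.sr \<BB> (cof F i) (cof F j) \<cdot> A.c1 \<AA> \<BB> F i j = A.pb2 (act_cospan \<AA> \<BB> F i j)" (is ?sr)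
    and "Cmp C (pb C (act_cospan \<AA> \<BB> F i j)) (A0 \<BB> (cof F j)) (A0 \<AA> j) (cof0 F j)
            (Cmp C (pb C (act_cospan \<AA> \<BB> F i j)) (A1 \<BB> (cof F i) (cof F j)) (A0 \<BB> (cof F j))
               (tgt \<BB> (cof F i) (cof F j)) (cof1 F i j))
        = Cmp C (pb C (act_cospan \<AA> \<BB> F i j)) (A1 \<AA> i j) (A0 \<AA> j) (tgt \<AA> i j) (pr1 C (act_cospan \<AA> \<BB> F i j)) \<longleftrightarrow>
     A.c0 \<AA> \<BB> F j \<cdot> A.tg \<BB> (cof F i) (cof F j) \<cdot> A.c1 \<AA> \<BB> F i j = A.tg \<AA> i j \<cdot> A.pb1 (act_cospan \<AA> \<BB> F i j)" (is ?tg)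
proof -
  let ?K = "act_cospan \<AA> \<BB> F i j"
  note ok = act_ok[OF i]
  note [simp] = i cof_in[OF i(1)] cof_in[OF i(2)] A.pb_ob[OF ok] A.pr_in[OF ok, simplified] cof1_in[OF i]
  show ?sr
    by (simp add: A.arr_eq_iff[of "pb C ?K" "A0 \<BB> (cof F i)"] A.Cmp_in A.arr_Cmp A.sr_def A.c1_def A.pb2_def)
  show ?tg
    by (simp add: A.arr_eq_iff[of "pb C ?K" "A0 \<AA> j"] A.Cmp_in A.arr_Cmp A.tg_def A.c1_def A.c0_def A.pb1_def)
qed

end

locale cofunctor = A: internal C \<AA> + B: internal C \<BB> + partite_cofunctor C \<AA> \<BB> F
  for C :: "('o, 'm) rcat" and \<AA> \<BB> :: "('i, 'o, 'm) pcat" and F :: "('i, 'm) cofun"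

sublocale cofunctor \<subseteq> cofun1 C \<AA> \<BB> F
  using cof1_total cof0_total by unfold_locales (auto simp: cof_in total_map_def)

context cofun1
begin

lemma cofunctorI:
  assumes sr: "\<And>i j w a b. \<lbrakk>i \<in> Ix \<AA>; j \<in> Ix \<AA>; a \<in> A.hom w (A1 \<AA> i j); b \<in> A.hom w (A0 \<BB> (cof F i));
        A.sr \<AA> i j \<cdot> a = A.c0 \<AA> \<BB> F i \<cdot> b\<rbrakk> \<Longrightarrow> A.sr \<BB> (cof F i) (cof F j) \<cdot> A.act \<AA> \<BB> F i j a b = b"
    and tg: "\<And>i j w a b. \<lbrakk>i \<in> Ix \<AA>; j \<in> Ix \<AA>; a \<in> A.hom w (A1 \<AA> i j); b \<in> A.hom w (A0 \<BB> (cof F i));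
        A.sr \<AA> i j \<cdot> a = A.c0 \<AA> \<BB> F i \<cdot> b\<rbrakk>
      \<Longrightarrow> A.c0 \<AA> \<BB> F j \<cdot> A.tg \<BB> (cof F i) (cof F j) \<cdot> A.act \<AA> \<BB> F i j a b = A.tg \<AA> i j \<cdot> a"
    and un: "\<And>i. i \<in> Ix \<AA> \<Longrightarrow>
      A.act \<AA> \<BB> F i i (A.un \<AA> i \<cdot> A.c0 \<AA> \<BB> F i) (A.ide (A0 \<BB> (cof F i))) = A.un \<BB> (cof F i)"
    and mu: "\<And>i j k w g f b. \<lbrakk>i \<in> Ix \<AA>; j \<in> Ix \<AA>; k \<in> Ix \<AA>; g \<in> A.hom w (A1 \<AA> j k); f \<in> A.hom w (A1 \<AA> i j);
        b \<in> A.hom w (A0 \<BB> (cof F i)); A.sr \<AA> j k \<cdot> g = A.tg \<AA> i j \<cdot> f; A.sr \<AA> i j \<cdot> f = A.c0 \<AA> \<BB> F i \<cdot> b\<rbrakk>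
      \<Longrightarrow> A.act \<AA> \<BB> F i k (A.mu \<AA> i j k g f) b
      = A.mu \<BB> (cof F i) (cof F j) (cof F k) (A.act \<AA> \<BB> F j k g (A.tg \<BB> (cof F i) (cof F j) \<cdot> A.act \<AA> \<BB> F i j f b))
          (A.act \<AA> \<BB> F i j f b)"
  shows "cofunctor C \<AA> \<BB> F"
proof -
  have pbs: "A.pb1 (act_cospan \<AA> \<BB> F i j) \<in> A.hom (pb C (act_cospan \<AA> \<BB> F i j)) (A1 \<AA> i j)"
    "A.pb2 (act_cospan \<AA> \<BB> F i j) \<in> A.hom (pb C (act_cospan \<AA> \<BB> F i j)) (A0 \<BB> (cof F i))"
    "A.sr \<AA> i j \<cdot> A.pb1 (act_cospan \<AA> \<BB> F i j) = A.c0 \<AA> \<BB> F i \<cdot> A.pb2 (act_cospan \<AA> \<BB> F i j)"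
    if "i \<in> Ix \<AA>" "j \<in> Ix \<AA>" for i j
    using A.pb_hom[OF act_ok[OF that]] A.pb_square[OF act_ok[OF that]] by simp_all
  have sr1: "A.sr \<BB> (cof F i) (cof F j) \<cdot> A.c1 \<AA> \<BB> F i j = A.pb2 (act_cospan \<AA> \<BB> F i j)"
    and tg1: "A.c0 \<AA> \<BB> F j \<cdot> A.tg \<BB> (cof F i) (cof F j) \<cdot> A.c1 \<AA> \<BB> F i j = A.tg \<AA> i j \<cdot> A.pb1 (act_cospan \<AA> \<BB> F i j)"
    if "i \<in> Ix \<AA>" "j \<in> Ix \<AA>" for i j
    using sr[OF that pbs[OF that]] tg[OF that pbs[OF that]] by (simp_all add: act_pb that)
  have "partite_cofunctor C \<AA> \<BB> F"
  proof
    fix i j k assume i: "i \<in> Ix \<AA>" "j \<in> Ix \<AA>"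
    \<comment> \<open>Totality of \<open>cof1\<close> comes from the source law: after the total map
      \<open>sr\<close> it becomes the second projection, which is total.\<close>
    have "A.rst (A.c1 \<AA> \<BB> F i j) = A.rst (A.pb2 (act_cospan \<AA> \<BB> F i j))"
      using A.rst_tot[OF B.sr_tot A.hom_el[OF c1_hom[OF i]]] i by (simp add: sr1)
    then show "total_map C (pb C (act_cospan \<AA> \<BB> F i j)) (A1 \<BB> (cof F i) (cof F j)) (cof1 F i j)"
      using A.pb_tot(2)[OF act_ok[OF i]] c1_hom[OF i] i
      by (simp add: A.total_map_iff A.pb_ob[OF act_ok[OF i]] cof1_in A.tot_def flip: A.c1_def)
    assume k: "k \<in> Ix \<AA>"
    show "cof_mul C \<AA> \<BB> F i j k"
      unfolding cof_mul_iff(6)[OF i k tg1[OF i] sr1[OF i(2) k]]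
      by (rule mu[OF i k cof_mul_iff(1-5)[OF i k tg1[OF i] sr1[OF i(2) k]]])
  qed (simp_all add: cof0_total src_cof1_iff sr1 tg1 cof_idm_iff un)
  then show ?thesis
    by (simp add: cofunctor_def A.internal_axioms B.internal_axioms)
qed

end

context cofunctor
begin

lemma sr_c1: "\<lbrakk>i \<in> Ix \<AA>; j \<in> Ix \<AA>\<rbrakk> \<Longrightarrow> A.sr \<BB> (cof F i) (cof F j) \<cdot> A.c1 \<AA> \<BB> F i j = A.pb2 (act_cospan \<AA> \<BB> F i j)"
  and tg_c1: "\<lbrakk>i \<in> Ix \<AA>; j \<in> Ix \<AA>\<rbrakk> \<Longrightarrow>
    A.c0 \<AA> \<BB> F j \<cdot> A.tg \<BB> (cof F i) (cof F j) \<cdot> A.c1 \<AA> \<BB> F i j = A.tg \<AA> i j \<cdot> A.pb1 (act_cospan \<AA> \<BB> F i j)"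
  using src_cof1[OF _ _ refl] tgt_cof1[OF _ _ refl] src_cof1_iff by blast+

context
  fixes i j a b assumes i: "i \<in> Ix \<AA>" "j \<in> Ix \<AA>"
    and ab: "a \<in> A.el (A1 \<AA> i j)" "b \<in> A.el (A0 \<BB> (cof F i))" "A.sr \<AA> i j \<cdot> a = A.c0 \<AA> \<BB> F i \<cdot> b"
begin

lemma sr_act: "A.sr \<BB> (cof F i) (cof F j) \<cdot> A.act \<AA> \<BB> F i j a b = b"
  and tg_act: "A.c0 \<AA> \<BB> F j \<cdot> A.tg \<BB> (cof F i) (cof F j) \<cdot> A.act \<AA> \<BB> F i j a b = A.tg \<AA> i j \<cdot> a"
  using A.pb_mpair[OF act_ok[OF i], of a b] ab A.cmp_reassoc[OF sr_c1[OF i]] A.cmp_reassoc[OF tg_c1[OF i]]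
  by (simp_all add: A.act_def A.cmp_assoc)

lemma rst_act: "A.rst (A.act \<AA> \<BB> F i j a b) = A.rst b"
  using A.rst_tot[OF B.sr_tot act_el[OF i, of a b]] i by (simp add: sr_act)

end

lemma act_un:
  assumes i: "i \<in> Ix \<AA>" and b: "b \<in> A.el (A0 \<BB> (cof F i))"
  shows "A.act \<AA> \<BB> F i i (A.un \<AA> i \<cdot> A.c0 \<AA> \<BB> F i \<cdot> b) b = A.un \<BB> (cof F i) \<cdot> b"
proof -
  have "A.act \<AA> \<BB> F i i (A.un \<AA> i \<cdot> A.c0 \<AA> \<BB> F i) (A.ide (A0 \<BB> (cof F i))) \<cdot> b = A.un \<BB> (cof F i) \<cdot> b"
    using cof1_idm[OF i refl refl] cof_idm_iff[OF i] by simp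
  also have "A.act \<AA> \<BB> F i i (A.un \<AA> i \<cdot> A.c0 \<AA> \<BB> F i) (A.ide (A0 \<BB> (cof F i))) \<cdot> b
      = A.act \<AA> \<BB> F i i ((A.un \<AA> i \<cdot> A.c0 \<AA> \<BB> F i) \<cdot> b) (A.ide (A0 \<BB> (cof F i)) \<cdot> b)"
    by (rule act_cmp) (use i in \<open>auto intro: A.hom_el[OF A.ide_hom] A.cmp_el[OF A.hom_el[OF A.un_hom]]
      simp: A.cmp_reassoc[OF A.sr_un] A.cmp_ide[OF c0_hom] A.ide_cmp_hom[OF c0_hom]\<close>)
  finally show ?thesis using b by (simp add: A.cmp_assoc)
qed

text \<open>As for \<open>mu_mu\<close>, the generic equation of \<open>cof_mul_iff\<close> is
  precomposed with the map \<open>x\<close> that classifies \<open>g\<close>, \<open>f\<close>,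
  \<open>b\<close>.\<close>

lemma act_mu:
  assumes i: "i \<in> Ix \<AA>" "j \<in> Ix \<AA>" "k \<in> Ix \<AA>"
    and el: "g \<in> A.el (A1 \<AA> j k)" "f \<in> A.el (A1 \<AA> i j)" "b \<in> A.el (A0 \<BB> (cof F i))"
    and eq: "A.sr \<AA> j k \<cdot> g = A.tg \<AA> i j \<cdot> f" "A.sr \<AA> i j \<cdot> f = A.c0 \<AA> \<BB> F i \<cdot> b"
  shows "A.act \<AA> \<BB> F i k (A.mu \<AA> i j k g f) b
      = A.mu \<BB> (cof F i) (cof F j) (cof F k) (A.act \<AA> \<BB> F j k g (A.tg \<BB> (cof F i) (cof F j) \<cdot> A.act \<AA> \<BB> F i j f b))
          (A.act \<AA> \<BB> F i j f b)"
proof -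
  let ?K = "act_cospan \<AA> \<BB> F i j" let ?T = "act_cospan3 C \<AA> \<BB> F i j k"
  let ?i = "cof F i" let ?j = "cof F j" let ?k = "cof F k"
  let ?g = "A.pb1 ?T" let ?f = "A.pb1 ?K \<cdot> A.pb2 ?T" let ?b = "A.pb2 ?K \<cdot> A.pb2 ?T"
  note t = cof_mul_iff[OF i tg_c1[OF i(1,2)] sr_c1[OF i(2,3)]]
  note e = A.hom_el[OF t(1)] A.hom_el[OF t(2)] A.hom_el[OF t(3)]
  define x where "x = A.mpair ?T g (A.mpair ?K f b)"
  have K: "A.pb1 ?K \<cdot> A.mpair ?K f b = f" "A.pb2 ?K \<cdot> A.mpair ?K f b = b" "A.mpair ?K f b \<in> A.el (pb C ?K)"
    using el eq by (auto intro!: A.pb_mpair[OF act_ok[OF i(1-2)]] A.mpair_el[OF act_ok[OF i(1-2)]])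
  have "A.l1 ?T \<cdot> g = A.l2 ?T \<cdot> A.mpair ?K f b"
    using K by (simp add: leg_act3[OF i] eq A.cmp_assoc)
  then have T: "A.pb1 ?T \<cdot> x = g" "A.pb2 ?T \<cdot> x = A.mpair ?K f b"
    using A.pb_mpair[OF act3_ok[OF i]] el K by (simp_all add: x_def)
  have x: "?g \<cdot> x = g" "?f \<cdot> x = f" "?b \<cdot> x = b"
    using T K by (simp_all add: A.cmp_assoc)
  let ?F = "A.act \<AA> \<BB> F i j ?f ?b"
  let ?G = "A.act \<AA> \<BB> F j k ?g (A.tg \<BB> ?i ?j \<cdot> ?F)"
  have F: "?F \<cdot> x = A.act \<AA> \<BB> F i j f b"
    using act_cmp[OF i(1,2) e(2,3) t(5), of x] x by simp
  have tF: "A.sr \<AA> j k \<cdot> ?g = A.c0 \<AA> \<BB> F j \<cdot> A.tg \<BB> ?i ?j \<cdot> ?F"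
    using tg_act[OF i(1,2) e(2,3) t(5)] t(4) by simp
  have tel: "A.tg \<BB> ?i ?j \<cdot> ?F \<in> A.el (A0 \<BB> ?j)"
    using i by (intro A.cmp_el[OF A.hom_el[OF B.tg_hom]]) auto
  have G: "?G \<cdot> x = A.act \<AA> \<BB> F j k g (A.tg \<BB> ?i ?j \<cdot> A.act \<AA> \<BB> F i j f b)"
    using act_cmp[OF i(2,3) e(1) tel tF, of x] x F by (simp add: A.cmp_assoc)
  have "A.act \<AA> \<BB> F i k (A.mu \<AA> i j k ?g ?f) ?b \<cdot> x = A.mu \<BB> ?i ?j ?k ?G ?F \<cdot> x"
    using cof1_mul[OF i] t(6) by simp
  also have "A.act \<AA> \<BB> F i k (A.mu \<AA> i j k ?g ?f) ?b \<cdot> x = A.act \<AA> \<BB> F i k (A.mu \<AA> i j k g f) b"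
    using act_cmp[OF i(1,3) A.mu_el[OF i] e(3), of ?g ?f x] A.mu_cmp[OF i e(1,2) t(4), of x]
      A.sr_mu[OF i e(1,2) t(4)] t(5) x by simp
  also have "A.mu \<BB> ?i ?j ?k ?G ?F \<cdot> x = A.mu \<BB> ?i ?j ?k (?G \<cdot> x) (?F \<cdot> x)"
    using i by (intro B.mu_cmp act_el sr_act tel tF) (auto intro: e)
  finally show ?thesis by (simp add: F G)
qed

end

section \<open>The category of partite internal categories and cofunctors\<close>

lemma mk_cofun_simps [simp]:
  "i \<in> Ix \<AA> \<Longrightarrow> cof (mk_cofun \<AA> F F0 F1) i = F i"
  "i \<in> Ix \<AA> \<Longrightarrow> cof0 (mk_cofun \<AA> F F0 F1) i = F0 i"
  "\<lbrakk>i \<in> Ix \<AA>; j \<in> Ix \<AA>\<rbrakk> \<Longrightarrow> cof1 (mk_cofun \<AA> F F0 F1) i j = F1 i j"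
  by (simp_all add: mk_cofun_def)

lemma ext_mk_cofun: "ext_cofun \<AA> (mk_cofun \<AA> F F0 F1)"
  by (auto simp: ext_cofun_def mk_cofun_def fun_eq_iff)

lemma ext_cofun_eqI:
  assumes "ext_cofun \<AA> F" "ext_cofun \<AA> G"
    and "\<And>i. i \<in> Ix \<AA> \<Longrightarrow> cof F i = cof G i" "\<And>i. i \<in> Ix \<AA> \<Longrightarrow> cof0 F i = cof0 G i"
    and "\<And>i j. \<lbrakk>i \<in> Ix \<AA>; j \<in> Ix \<AA>\<rbrakk> \<Longrightarrow> cof1 F i j = cof1 G i j"
  shows "F = G"
proof -
  have "mk_cofun \<AA> (cof F) (cof0 F) (cof1 F) = mk_cofun \<AA> (cof G) (cof0 G) (cof1 G)"
    using assms(3-5) by (auto simp: mk_cofun_def fun_eq_iff)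
  then show ?thesis using assms(1,2) by (simp add: ext_cofun_def)
qed

lemma (in restriction_category) cofunctor_eqI:
  assumes F: "cofunctor C \<AA> \<BB> F" "ext_cofun \<AA> F" and G: "cofunctor C \<AA> \<BB> G" "ext_cofun \<AA> G"
    and ob: "\<And>i. i \<in> Ix \<AA> \<Longrightarrow> cof F i = cof G i"
    and c0: "\<And>i. i \<in> Ix \<AA> \<Longrightarrow> c0 \<AA> \<BB> F i = c0 \<AA> \<BB> G i"
    and act: "\<And>i j w a b. \<lbrakk>i \<in> Ix \<AA>; j \<in> Ix \<AA>; a \<in> hom w (A1 \<AA> i j); b \<in> hom w (A0 \<BB> (cof F i));
        sr \<AA> i j \<cdot> a = c0 \<AA> \<BB> F i \<cdot> b\<rbrakk> \<Longrightarrow> act \<AA> \<BB> F i j a b = act \<AA> \<BB> G i j a b"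
  shows "F = G"
proof (rule ext_cofun_eqI[OF F(2) G(2) ob])
  interpret F: cofunctor C \<AA> \<BB> F by (rule F)
  interpret G: cofunctor C \<AA> \<BB> G by (rule G)
  show c0': "cof0 F i = cof0 G i" if i: "i \<in> Ix \<AA>" for i
    using c0[OF i] F.cof0_in[OF i] G.cof0_in[OF i] F.A.A0_in[OF i] F.B.A0_in[OF F.cof_in[OF i]]
    by (simp add: c0_def ob[OF i] arr_inj)
  show "cof1 F i j = cof1 G i j" if i: "i \<in> Ix \<AA>" "j \<in> Ix \<AA>" for i j
  proof -
    have K: "act_cospan \<AA> \<BB> F i j = act_cospan \<AA> \<BB> G i j"
      by (simp add: act_cospan_def ob c0' i)
    have "c1 \<AA> \<BB> F i j = c1 \<AA> \<BB> G i j"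
      using act[OF i pb_hom(1)[OF F.act_ok[OF i], simplified] pb_hom(2)[OF F.act_ok[OF i], simplified]
          pb_square[OF F.act_ok[OF i], simplified]] F.act_pb[OF i] G.act_pb[OF i] K by simp
    then show ?thesis
      unfolding c1_def using F.cof1_in[OF i] G.cof1_in[OF i] pb_ob[OF F.act_ok[OF i]]
        F.B.A1_in[OF F.cof_in[OF i(1)] F.cof_in[OF i(2)]]
      by (simp add: K ob i arr_inj)
  qed
qed

context internal
begin

abbreviation "I \<equiv> id_cofun C \<AA>"

lemma id_cofun_simps: "i \<in> Ix \<AA> \<Longrightarrow> cof I i = i" "i \<in> Ix \<AA> \<Longrightarrow> c0 \<AA> \<AA> I i = ide (A0 \<AA> i)"
  "\<lbrakk>i \<in> Ix \<AA>; j \<in> Ix \<AA>\<rbrakk> \<Longrightarrow> cof1 I i j = pr1 C (act_cospan \<AA> \<AA> I i j)"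
  by (simp_all add: id_cofun_def c0_def ide_def act_cospan_def)

lemma id_cofun1: "cofun1 C \<AA> \<AA> I"
proof -
  interpret I: precofun C \<AA> \<AA> I
  proof
    show "total_map C (A0 \<AA> (cof I i)) (A0 \<AA> i) (cof0 I i)" if "i \<in> Ix \<AA>" for i
      using that ide_tot[of "A0 \<AA> i"] by (simp add: id_cofun_def total_map_iff Idn_in ide_def)
  qed (simp add: id_cofun_simps)
  show ?thesis
    using pr_in(1)[OF I.act_ok] by unfold_locales (simp add: id_cofun_simps)
qed

lemma act_id:
  assumes i: "i \<in> Ix \<AA>" "j \<in> Ix \<AA>" and "a \<in> el (A1 \<AA> i j)" "b \<in> el (A0 \<AA> i)" "sr \<AA> i j \<cdot> a = b"
  shows "act \<AA> \<AA> I i j a b = a"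
proof -
  interpret I: cofun1 C \<AA> \<AA> I by (rule id_cofun1)
  have "c1 \<AA> \<AA> I i j = pb1 (act_cospan \<AA> \<AA> I i j)"
    using i by (simp add: c1_def pb1_def id_cofun_simps)
  moreover have "pb1 (act_cospan \<AA> \<AA> I i j) \<cdot> mpair (act_cospan \<AA> \<AA> I i j) a b = a"
    using assms by (intro pb_mpair[OF I.act_ok]) (simp_all add: id_cofun_simps)
  ultimately show ?thesis by (simp add: act_def)
qed

lemma id_cofunctor: "cofunctor C \<AA> \<AA> I"
proof -
  interpret I: cofun1 C \<AA> \<AA> I by (rule id_cofun1)
  show ?thesis
  proof (rule I.cofunctorI)
    fix i assume i: "i \<in> Ix \<AA>"
    then show "act \<AA> \<AA> I i i (un \<AA> i \<cdot> c0 \<AA> \<AA> I i) (ide (A0 \<AA> (cof I i))) = un \<AA> (cof I i)"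
      by (simp add: id_cofun_simps act_id cmp_ide[OF un_hom] hom_el[OF un_hom] hom_el[OF ide_hom] sr_un)
  next
    fix i j w a b assume i: "i \<in> Ix \<AA>" "j \<in> Ix \<AA>" and a: "a \<in> hom w (A1 \<AA> i j)" "b \<in> hom w (A0 \<AA> (cof I i))"
      "sr \<AA> i j \<cdot> a = c0 \<AA> \<AA> I i \<cdot> b"
    then have "sr \<AA> i j \<cdot> a = b" "act \<AA> \<AA> I i j a b = a"
      by (simp_all add: id_cofun_simps act_id hom_el)
    then show "sr \<AA> (cof I i) (cof I j) \<cdot> act \<AA> \<AA> I i j a b = b"
      "c0 \<AA> \<AA> I j \<cdot> tg \<AA> (cof I i) (cof I j) \<cdot> act \<AA> \<AA> I i j a b = tg \<AA> i j \<cdot> a"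
      using i a by (simp_all add: id_cofun_simps hom_cmp_el[OF tg_hom])
  next
    fix i j k w g f b assume i: "i \<in> Ix \<AA>" "j \<in> Ix \<AA>" "k \<in> Ix \<AA>" and a: "g \<in> hom w (A1 \<AA> j k)" "f \<in> hom w (A1 \<AA> i j)"
      "b \<in> hom w (A0 \<AA> (cof I i))" "sr \<AA> j k \<cdot> g = tg \<AA> i j \<cdot> f" "sr \<AA> i j \<cdot> f = c0 \<AA> \<AA> I i \<cdot> b"
    then have e: "g \<in> el (A1 \<AA> j k)" "f \<in> el (A1 \<AA> i j)" "b \<in> el (A0 \<AA> i)"
      and b: "sr \<AA> i j \<cdot> f = b" by (auto simp: id_cofun_simps hom_el)
    have t: "tg \<AA> i j \<cdot> f \<in> el (A0 \<AA> j)" using i by (intro hom_cmp_el[OF tg_hom])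
    have "act \<AA> \<AA> I i k (mu \<AA> i j k g f) b = mu \<AA> i j k g f"
      using sr_mu[OF i e(1,2) a(4)] b by (intro act_id i mu_el e) simp
    moreover have "act \<AA> \<AA> I i j f b = f" by (rule act_id[OF i(1,2) e(2,3) b])
    moreover have "act \<AA> \<AA> I j k g (tg \<AA> i j \<cdot> f) = g" by (rule act_id[OF i(2,3) e(1) t a(4)])
    ultimately show "act \<AA> \<AA> I i k (mu \<AA> i j k g f) b = mu \<AA> (cof I i) (cof I j) (cof I k)
       (act \<AA> \<AA> I j k g (tg \<AA> (cof I i) (cof I j) \<cdot> act \<AA> \<AA> I i j f b)) (act \<AA> \<AA> I i j f b)"
      using i by (simp add: id_cofun_simps)
  qed
qed

end

locale cofunctor_pair = F: cofunctor C \<AA> \<BB> F + G: cofunctor C \<BB> \<DD> G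
  for C :: "('o, 'm) rcat" and \<AA> \<BB> \<DD> :: "('i, 'o, 'm) pcat" and F G :: "('i, 'm) cofun"
begin

notation F.A.cmp (infixr "\<cdot>" 70)

abbreviation "GF \<equiv> comp_cofun C \<AA> \<BB> \<DD> G F"

lemma comp_cof [simp]: "i \<in> Ix \<AA> \<Longrightarrow> cof GF i = cof G (cof F i)"
  by (simp add: comp_cofun_def Let_def)

lemma comp_cof0: "i \<in> Ix \<AA> \<Longrightarrow> cof0 GF i =
    Cmp C (A0 \<DD> (cof G (cof F i))) (A0 \<BB> (cof F i)) (A0 \<AA> i) (cof0 F i) (cof0 G (cof F i))"
  by (simp add: comp_cofun_def Let_def)

lemma comp_c0: "i \<in> Ix \<AA> \<Longrightarrow> F.A.c0 \<AA> \<DD> GF i = F.A.c0 \<AA> \<BB> F i \<cdot> F.A.c0 \<BB> \<DD> G (cof F i)"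
  by (simp add: F.A.c0_def comp_cof0 F.A.arr_Cmp)

lemma comp_pre: "precofun C \<AA> \<DD> GF"
proof
  show "total_map C (A0 \<DD> (cof GF i)) (A0 \<AA> i) (cof0 GF i)" if i: "i \<in> Ix \<AA>" for i
  proof -
    have "cof0 GF i \<in> Hom C (A0 \<DD> (cof GF i)) (A0 \<AA> i)"
      using i by (auto simp: comp_cof0 intro: F.A.Cmp_in)
    moreover have "F.A.c0 \<AA> \<DD> GF i \<in> F.A.tot (A0 \<DD> (cof GF i)) (A0 \<AA> i)"
      using i F.A.cmp_tot[OF F.c0_tot G.c0_tot] by (simp add: comp_c0)
    ultimately show ?thesis using i by (simp add: F.A.total_map_iff F.A.c0_def)
  qed
qed simp

lemma comp_cof1:
  assumes i: "i \<in> Ix \<AA>" "j \<in> Ix \<AA>"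
  defines "K \<equiv> act_cospan \<AA> \<DD> GF i j"
  shows "cof1 GF i j \<in> Hom C (pb C K) (A1 \<DD> (cof GF i) (cof GF j))" (is ?in)
    and "F.A.arr (pb C K) (A1 \<DD> (cof GF i) (cof GF j)) (cof1 GF i j) =
      F.A.act \<BB> \<DD> G (cof F i) (cof F j) (F.A.act \<AA> \<BB> F i j (F.A.pb1 K) (F.A.c0 \<BB> \<DD> G (cof F i) \<cdot> F.A.pb2 K)) (F.A.pb2 K)" (is ?eq)
proof -
  interpret H: precofun C \<AA> \<DD> GF by (rule comp_pre)
  let ?i = "cof F i" and ?j = "cof F j"
  let ?d = "A0 \<DD> (cof G ?i)" let ?KF = "act_cospan \<AA> \<BB> F i j" let ?KG = "act_cospan \<BB> \<DD> G ?i ?j"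
  note ok = H.act_ok[OF i, folded K_def] and okF = F.act_ok[OF i] and okG = G.act_ok[OF F.cof_in[OF i(1)] F.cof_in[OF i(2)]]
  note [simp] = i F.A.pb_ob[OF ok] F.A.pb_ob[OF okF] F.A.pb_ob[OF okG]
  have Ks: "ob1 K = A1 \<AA> i j" "ob2 K = ?d" by (simp_all add: K_def)
  note pr = F.A.pr_in[OF ok, unfolded Ks]
  note p = F.A.pb_hom[OF ok, unfolded Ks]
  have sq: "F.A.sr \<AA> i j \<cdot> F.A.pb1 K = F.A.c0 \<AA> \<BB> F i \<cdot> F.A.c0 \<BB> \<DD> G ?i \<cdot> F.A.pb2 K"
    using F.A.pb_square[OF ok] by (simp add: K_def comp_c0 F.A.cmp_assoc)
  let ?Gc = "Cmp C (pb C K) ?d (A0 \<BB> ?i) (cof0 G ?i) (pr2 C K)"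
  have Gc: "?Gc \<in> Hom C (pb C K) (A0 \<BB> ?i)" "F.A.arr (pb C K) (A0 \<BB> ?i) ?Gc = F.A.c0 \<BB> \<DD> G ?i \<cdot> F.A.pb2 K"
    using pr by (auto intro: F.A.Cmp_in simp: F.A.arr_Cmp F.A.c0_def F.A.pb2_def Ks)
  have a: "F.A.arr (pb C K) (A1 \<AA> i j) (pr1 C K) = F.A.pb1 K" "F.A.arr (pb C K) ?d (pr2 C K) = F.A.pb2 K"
    by (simp_all add: F.A.pb1_def F.A.pb2_def Ks)
  note q = F.A.pair_raw[OF okF, of "pb C K" "pr1 C K" ?Gc, simplified, unfolded a Gc(2), OF pr(1) Gc(1) sq]
  let ?Fac = "Cmp C (pb C K) (pb C ?KF) (A1 \<BB> ?i ?j) (cof1 F i j) (pair C ?KF (pb C K) (pr1 C K) ?Gc)"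
  let ?f = "F.A.act \<AA> \<BB> F i j (F.A.pb1 K) (F.A.c0 \<BB> \<DD> G ?i \<cdot> F.A.pb2 K)"
  have Fac: "?Fac \<in> Hom C (pb C K) (A1 \<BB> ?i ?j)" "F.A.arr (pb C K) (A1 \<BB> ?i ?j) ?Fac = ?f"
    using q(1,4) F.cof1_in[OF i] by (auto intro!: F.A.Cmp_in simp: F.A.arr_Cmp F.A.act_def F.A.c1_def)
  have sq2: "F.A.sr \<BB> ?i ?j \<cdot> ?f = F.A.c0 \<BB> \<DD> G ?i \<cdot> F.A.pb2 K"
    using i by (intro F.sr_act sq F.A.hom_el[OF p(1)] F.A.cmp_el[OF F.A.hom_el[OF G.c0_hom]]) auto
  note r = F.A.pair_raw[OF okG, of "pb C K" ?Fac "pr2 C K", simplified, unfolded a Fac(2), OF Fac(1) pr(2) sq2]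
  have Kr: "\<lparr>ob1 = A1 \<AA> i j, ob2 = ?d, base = A0 \<AA> i, leg1 = src \<AA> i j,
       leg2 = Cmp C ?d (A0 \<BB> ?i) (A0 \<AA> i) (cof0 F i) (cof0 G ?i)\<rparr> = K"
    by (simp add: K_def act_cospan_def comp_cof0)
  have e: "cof1 GF i j = Cmp C (pb C K) (pb C ?KG) (A1 \<DD> (cof G ?i) (cof G ?j)) (cof1 G ?i ?j)
      (pair C ?KG (pb C K) ?Fac (pr2 C K))"
    by (simp add: comp_cofun_def Let_def Kr)
  have c: "cof1 G ?i ?j \<in> Hom C (pb C ?KG) (A1 \<DD> (cof G ?i) (cof G ?j))" by (intro G.cof1_in) auto
  show ?in unfolding e using r(1) c by (auto intro!: F.A.Cmp_in)
  show ?eq unfolding e using r(1,4) c by (simp add: F.A.arr_Cmp F.A.act_def[of _ _ G] F.A.c1_def[of _ _ G])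
qed

lemma comp_cofun1: "cofun1 C \<AA> \<DD> GF"
proof -
  interpret H: precofun C \<AA> \<DD> GF by (rule comp_pre)
  show ?thesis by unfold_locales (rule comp_cof1)
qed

text \<open>\<open>comp_cofun\<close> prescribes this value at the generic matching pair, the
  projections of the pullback; precomposing with \<open>?m\<close> gives it at \<open>a\<close>,
  \<open>c\<close>.\<close>

lemma act_comp:
  assumes i: "i \<in> Ix \<AA>" "j \<in> Ix \<AA>" and el: "a \<in> F.A.el (A1 \<AA> i j)" "c \<in> F.A.el (A0 \<DD> (cof G (cof F i)))"
    and eq: "F.A.sr \<AA> i j \<cdot> a = F.A.c0 \<AA> \<BB> F i \<cdot> F.A.c0 \<BB> \<DD> G (cof F i) \<cdot> c"
  shows "F.A.act \<AA> \<DD> GF i j a c =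
    F.A.act \<BB> \<DD> G (cof F i) (cof F j) (F.A.act \<AA> \<BB> F i j a (F.A.c0 \<BB> \<DD> G (cof F i) \<cdot> c)) c"
proof -
  interpret H: cofun1 C \<AA> \<DD> GF by (rule comp_cofun1)
  let ?K = "act_cospan \<AA> \<DD> GF i j" let ?i = "cof F i" and ?j = "cof F j"
  note ok = H.act_ok[OF i]
  note [simp] = i
  have p: "F.A.pb1 ?K \<in> F.A.el (A1 \<AA> i j)" "F.A.pb2 ?K \<in> F.A.el (A0 \<DD> (cof G ?i))"
    using F.A.pb_hom[OF ok] by (auto intro: F.A.hom_el)
  have sq: "F.A.sr \<AA> i j \<cdot> F.A.pb1 ?K = F.A.c0 \<AA> \<BB> F i \<cdot> F.A.c0 \<BB> \<DD> G ?i \<cdot> F.A.pb2 ?K"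
    using F.A.pb_square[OF ok] by (simp add: comp_c0 F.A.cmp_assoc)
  have g: "F.A.c0 \<BB> \<DD> G ?i \<cdot> x \<in> F.A.el (A0 \<BB> ?i)" for x
    by (intro F.A.cmp_el[OF F.A.hom_el[OF G.c0_hom]]) simp
  let ?f = "F.A.act \<AA> \<BB> F i j (F.A.pb1 ?K) (F.A.c0 \<BB> \<DD> G ?i \<cdot> F.A.pb2 ?K)"
  let ?m = "F.A.mpair ?K a c"
  have m: "F.A.pb1 ?K \<cdot> ?m = a" "F.A.pb2 ?K \<cdot> ?m = c"
    using F.A.pb_mpair[OF ok, of a c] el eq by (simp_all add: comp_c0 F.A.cmp_assoc)
  have "F.A.act \<AA> \<DD> GF i j a c = F.A.act \<BB> \<DD> G ?i ?j ?f (F.A.pb2 ?K) \<cdot> ?m"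
    by (simp add: F.A.act_def[of _ _ GF] F.A.c1_def[of _ _ GF] comp_cof1(2)[OF i] del: comp_cof)
  also have "\<dots> = F.A.act \<BB> \<DD> G ?i ?j (?f \<cdot> ?m) (F.A.pb2 ?K \<cdot> ?m)"
    by (intro G.act_cmp F.act_el p F.sr_act g sq) auto
  also have "?f \<cdot> ?m = F.A.act \<AA> \<BB> F i j (F.A.pb1 ?K \<cdot> ?m) ((F.A.c0 \<BB> \<DD> G ?i \<cdot> F.A.pb2 ?K) \<cdot> ?m)"
    by (intro F.act_cmp p g sq) auto
  finally show ?thesis by (simp add: m F.A.cmp_assoc)
qed

text \<open>Each law is the law of \<open>G\<close> evaluated at the element that \<open>F\<close>
  produces from \<open>f\<close> and the image of \<open>c\<close> under \<open>G\<close>. The laws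
  of \<open>F\<close> describe the source, target and product of that element.\<close>

lemma comp_cofunctor: "cofunctor C \<AA> \<DD> GF"
proof -
  interpret H: cofun1 C \<AA> \<DD> GF by (rule comp_cofun1)
  have g: "F.A.c0 \<BB> \<DD> G i \<cdot> x \<in> F.A.el (A0 \<BB> i)" if "i \<in> Ix \<BB>" for x i
    by (intro F.A.cmp_el[OF F.A.hom_el[OF G.c0_hom]] that)
  show ?thesis
  proof (rule H.cofunctorI)
    fix i assume i: "i \<in> Ix \<AA>"
    let ?c = "A0 \<DD> (cof G (cof F i))"
    have "F.A.act \<AA> \<DD> GF i i (F.A.un \<AA> i \<cdot> F.A.c0 \<AA> \<DD> GF i) (F.A.ide ?c) =
      F.A.act \<BB> \<DD> G (cof F i) (cof F i)
        (F.A.act \<AA> \<BB> F i i (F.A.un \<AA> i \<cdot> F.A.c0 \<AA> \<DD> GF i) (F.A.c0 \<BB> \<DD> G (cof F i) \<cdot> F.A.ide ?c)) (F.A.ide ?c)"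
      using i by (intro act_comp F.A.cmp_el[OF F.A.hom_el[OF F.A.un_hom]] F.A.hom_el[OF F.A.ide_hom])
        (auto simp: F.A.cmp_reassoc[OF F.A.sr_un] comp_c0 F.A.cmp_ide[OF G.c0_hom]
          F.A.ide_cmp[OF F.A.cmp_el[OF F.A.hom_el[OF F.c0_hom]]])
    also have "\<dots> = F.A.un \<DD> (cof G (cof F i))"
      using i F.act_un[OF i g, of "F.A.ide ?c"] G.act_un[of "cof F i" "F.A.ide ?c"]
      by (simp add: comp_c0 F.A.cmp_ide[OF G.c0_hom] F.A.cmp_ide[OF G.B.un_hom] F.A.hom_el[OF F.A.ide_hom])
    finally show "F.A.act \<AA> \<DD> GF i i (F.A.un \<AA> i \<cdot> F.A.c0 \<AA> \<DD> GF i) (F.A.ide (A0 \<DD> (cof GF i))) = F.A.un \<DD> (cof GF i)"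
      using i by simp
  next
    fix i j w a c assume i: "i \<in> Ix \<AA>" "j \<in> Ix \<AA>" and a: "a \<in> F.A.hom w (A1 \<AA> i j)" "c \<in> F.A.hom w (A0 \<DD> (cof GF i))"
      "F.A.sr \<AA> i j \<cdot> a = F.A.c0 \<AA> \<DD> GF i \<cdot> c"
    note [simp] = i
    have e: "a \<in> F.A.el (A1 \<AA> i j)" "c \<in> F.A.el (A0 \<DD> (cof G (cof F i)))"
      and eq: "F.A.sr \<AA> i j \<cdot> a = F.A.c0 \<AA> \<BB> F i \<cdot> F.A.c0 \<BB> \<DD> G (cof F i) \<cdot> c"
      using a by (auto intro: F.A.hom_el simp: comp_c0 F.A.cmp_assoc)
    let ?f = "F.A.act \<AA> \<BB> F i j a (F.A.c0 \<BB> \<DD> G (cof F i) \<cdot> c)"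
    have f: "F.A.sr \<BB> (cof F i) (cof F j) \<cdot> ?f = F.A.c0 \<BB> \<DD> G (cof F i) \<cdot> c"
      "F.A.c0 \<AA> \<BB> F j \<cdot> F.A.tg \<BB> (cof F i) (cof F j) \<cdot> ?f = F.A.tg \<AA> i j \<cdot> a"
      by (auto intro!: F.sr_act F.tg_act e g eq)
    have fe: "?f \<in> F.A.el (A1 \<BB> (cof F i) (cof F j))" by (intro F.act_el) auto
    show "F.A.sr \<DD> (cof GF i) (cof GF j) \<cdot> F.A.act \<AA> \<DD> GF i j a c = c"
      "F.A.c0 \<AA> \<DD> GF j \<cdot> F.A.tg \<DD> (cof GF i) (cof GF j) \<cdot> F.A.act \<AA> \<DD> GF i j a c = F.A.tg \<AA> i j \<cdot> a"
      using G.sr_act[OF _ _ fe e(2) f(1)] G.tg_act[OF _ _ fe e(2) f(1)] f(2)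
      by (simp_all add: act_comp[OF i e eq] comp_c0 F.A.cmp_assoc)
  next
    fix i j k w h f c assume i: "i \<in> Ix \<AA>" "j \<in> Ix \<AA>" "k \<in> Ix \<AA>" and a: "h \<in> F.A.hom w (A1 \<AA> j k)" "f \<in> F.A.hom w (A1 \<AA> i j)"
      "c \<in> F.A.hom w (A0 \<DD> (cof GF i))" "F.A.sr \<AA> j k \<cdot> h = F.A.tg \<AA> i j \<cdot> f" "F.A.sr \<AA> i j \<cdot> f = F.A.c0 \<AA> \<DD> GF i \<cdot> c"
    note [simp] = i
    let ?i = "cof F i" let ?j = "cof F j" let ?k = "cof F k"
    have e: "h \<in> F.A.el (A1 \<AA> j k)" "f \<in> F.A.el (A1 \<AA> i j)" "c \<in> F.A.el (A0 \<DD> (cof G ?i))"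
      and eq: "F.A.sr \<AA> i j \<cdot> f = F.A.c0 \<AA> \<BB> F i \<cdot> F.A.c0 \<BB> \<DD> G ?i \<cdot> c"
      using a by (auto intro: F.A.hom_el simp: comp_c0 F.A.cmp_assoc)
    let ?b = "F.A.c0 \<BB> \<DD> G ?i \<cdot> c"
    let ?f = "F.A.act \<AA> \<BB> F i j f ?b"
    let ?h = "F.A.act \<AA> \<BB> F j k h (F.A.tg \<BB> ?i ?j \<cdot> ?f)"
    let ?ff = "F.A.act \<BB> \<DD> G ?i ?j ?f c"
    have fe: "?f \<in> F.A.el (A1 \<BB> ?i ?j)" by (intro F.act_el) auto
    have he: "?h \<in> F.A.el (A1 \<BB> ?j ?k)" by (intro F.act_el) auto
    have te: "F.A.tg \<BB> ?i ?j \<cdot> x \<in> F.A.el (A0 \<BB> ?j)" for x by (intro F.A.cmp_el[OF F.A.hom_el[OF F.B.tg_hom]]) auto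
    have te': "F.A.tg \<DD> (cof G ?i) (cof G ?j) \<cdot> x \<in> F.A.el (A0 \<DD> (cof G ?j))" for x by (intro F.A.cmp_el[OF F.A.hom_el[OF G.B.tg_hom]]) auto
    have sf: "F.A.sr \<BB> ?i ?j \<cdot> ?f = ?b" by (intro F.sr_act e g eq) auto
    have tf: "F.A.c0 \<AA> \<BB> F j \<cdot> F.A.tg \<BB> ?i ?j \<cdot> ?f = F.A.tg \<AA> i j \<cdot> f" by (intro F.tg_act e g eq) auto
    have sh: "F.A.sr \<BB> ?j ?k \<cdot> ?h = F.A.tg \<BB> ?i ?j \<cdot> ?f" by (intro F.sr_act e te) (auto simp: tf a(4))
    have tff: "F.A.c0 \<BB> \<DD> G ?j \<cdot> F.A.tg \<DD> (cof G ?i) (cof G ?j) \<cdot> ?ff = F.A.tg \<BB> ?i ?j \<cdot> ?f"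
      by (intro G.tg_act fe e sf) auto
    have m: "F.A.sr \<AA> i k \<cdot> F.A.mu \<AA> i j k h f = F.A.c0 \<AA> \<BB> F i \<cdot> ?b"
      using F.A.sr_mu[OF i e(1,2) a(4)] eq by simp
    have "F.A.act \<AA> \<DD> GF i k (F.A.mu \<AA> i j k h f) c
        = F.A.act \<BB> \<DD> G ?i ?k (F.A.act \<AA> \<BB> F i k (F.A.mu \<AA> i j k h f) ?b) c"
      by (intro act_comp F.A.mu_el e m) auto
    also have "F.A.act \<AA> \<BB> F i k (F.A.mu \<AA> i j k h f) ?b = F.A.mu \<BB> ?i ?j ?k ?h ?f"
      by (intro F.act_mu e g a eq) auto
    also have "F.A.act \<BB> \<DD> G ?i ?k (F.A.mu \<BB> ?i ?j ?k ?h ?f) c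
      = F.A.mu \<DD> (cof G ?i) (cof G ?j) (cof G ?k)
          (F.A.act \<BB> \<DD> G ?j ?k ?h (F.A.tg \<DD> (cof G ?i) (cof G ?j) \<cdot> ?ff)) ?ff"
      by (intro G.act_mu he fe e sh sf) auto
    also have "?ff = F.A.act \<AA> \<DD> GF i j f c" by (rule act_comp[symmetric]) (auto intro: e eq)
    also have "F.A.act \<BB> \<DD> G ?j ?k ?h (F.A.tg \<DD> (cof G ?i) (cof G ?j) \<cdot> F.A.act \<AA> \<DD> GF i j f c)
      = F.A.act \<AA> \<DD> GF j k h (F.A.tg \<DD> (cof G ?i) (cof G ?j) \<cdot> F.A.act \<AA> \<DD> GF i j f c)"
    proof -
      have ff: "F.A.act \<AA> \<DD> GF i j f c = ?ff" by (rule act_comp) (auto intro: e eq)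
      show ?thesis unfolding ff
        by (rule trans[OF _ act_comp[symmetric]]) (auto intro: e te' simp: tff tf a(4))
    qed
    finally show "F.A.act \<AA> \<DD> GF i k (F.A.mu \<AA> i j k h f) c = F.A.mu \<DD> (cof GF i) (cof GF j) (cof GF k)
       (F.A.act \<AA> \<DD> GF j k h (F.A.tg \<DD> (cof GF i) (cof GF j) \<cdot> F.A.act \<AA> \<DD> GF i j f c)) (F.A.act \<AA> \<DD> GF i j f c)"
      by simp
  qed
qed

lemma comp_ext: "ext_cofun \<AA> GF"
  by (simp add: comp_cofun_def Let_def ext_mk_cofun)

end

lemma pCat_simps [simp]: "Idn (pCat \<kappa> C) = id_cofun C" "Cmp (pCat \<kappa> C) = comp_cofun C"
  by (simp_all add: pCat_def)

context restriction_category
begin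

lemma pCat_Ob: "\<AA> \<in> Ob (pCat \<kappa> C) \<longleftrightarrow> internal C \<AA> \<and> |Ix \<AA>| <o \<kappa>"
  by (simp add: pCat_def internal_def restriction_category_axioms)

lemma pCat_Hom: "\<lbrakk>\<AA> \<in> Ob (pCat \<kappa> C); \<BB> \<in> Ob (pCat \<kappa> C)\<rbrakk> \<Longrightarrow>
    F \<in> Hom (pCat \<kappa> C) \<AA> \<BB> \<longleftrightarrow> cofunctor C \<AA> \<BB> F \<and> ext_cofun \<AA> F"
  by (auto simp: pCat_Ob cofunctor_def) (simp_all add: pCat_def)

text \<open>\<open>cofunctor_eqI\<close> reduces the category laws to values of \<open>act\<close>,
  where \<open>act_comp\<close> and \<open>act_id\<close> turn them into nested evaluations that
  coincide.\<close>

lemma category_pCat: "category (pCat \<kappa> C)" (is "category ?C")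
proof
  fix \<AA> assume "\<AA> \<in> Ob ?C"
  then show "Idn ?C \<AA> \<in> Hom ?C \<AA> \<AA>"
    using internal.id_cofunctor[of C \<AA>] by (simp add: pCat_Hom) (simp add: pCat_Ob id_cofun_def ext_mk_cofun)
next
  fix \<AA> \<BB> \<DD> F G assume ob: "\<AA> \<in> Ob ?C" "\<BB> \<in> Ob ?C" "\<DD> \<in> Ob ?C"
    and "F \<in> Hom ?C \<AA> \<BB>" "G \<in> Hom ?C \<BB> \<DD>"
  then interpret cofunctor_pair C \<AA> \<BB> \<DD> F G by (simp add: pCat_Hom cofunctor_pair_def)
  show "Cmp ?C \<AA> \<BB> \<DD> G F \<in> Hom ?C \<AA> \<DD>"
    using ob by (simp add: pCat_Hom comp_cofunctor comp_ext)
next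
  fix \<AA> \<BB> F assume ob: "\<AA> \<in> Ob ?C" "\<BB> \<in> Ob ?C" and F: "F \<in> Hom ?C \<AA> \<BB>"
  then interpret F: cofunctor C \<AA> \<BB> F by (simp add: pCat_Hom)
  have ext: "ext_cofun \<AA> F" using ob F by (simp add: pCat_Hom)
  interpret L: cofunctor_pair C \<AA> \<AA> \<BB> "id_cofun C \<AA>" F
    by (simp add: cofunctor_pair_def F.A.id_cofunctor F.cofunctor_axioms)
  interpret R: cofunctor_pair C \<AA> \<BB> \<BB> F "id_cofun C \<BB>"
    by (simp add: cofunctor_pair_def F.B.id_cofunctor F.cofunctor_axioms)
  have "L.GF = F"
  proof (rule cofunctor_eqI[OF L.comp_cofunctor L.comp_ext F.cofunctor_axioms ext])
    show c: "cof L.GF i = cof F i" "c0 \<AA> \<BB> L.GF i = c0 \<AA> \<BB> F i" if "i \<in> Ix \<AA>" for i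
      using that by (simp_all add: L.comp_c0 F.A.id_cofun_simps ide_cmp_hom[OF F.c0_hom])
    show "act \<AA> \<BB> L.GF i j a b = act \<AA> \<BB> F i j a b"
      if i: "i \<in> Ix \<AA>" "j \<in> Ix \<AA>" and a: "a \<in> hom w (A1 \<AA> i j)" "b \<in> hom w (A0 \<BB> (cof L.GF i))"
        "sr \<AA> i j \<cdot> a = c0 \<AA> \<BB> L.GF i \<cdot> b" for i j w a b
    proof -
      have b: "b \<in> el (A0 \<BB> (cof F i))" and s: "sr \<AA> i j \<cdot> a = c0 \<AA> \<BB> F i \<cdot> b" and ce: "c0 \<AA> \<BB> F i \<cdot> b \<in> el (A0 \<AA> i)"
        using a c[OF i(1)] i by (auto intro: hom_el hom_cmp_el[OF F.c0_hom])
      have "act \<AA> \<BB> L.GF i j a b = act \<AA> \<BB> F i j (act \<AA> \<AA> (id_cofun C \<AA>) i j a (c0 \<AA> \<BB> F i \<cdot> b)) b"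
        using L.act_comp[OF i hom_el[OF a(1)], of b] i b s ce by (simp add: F.A.id_cofun_simps)
      then show ?thesis using F.A.act_id[OF i hom_el[OF a(1)] ce s] by simp
    qed
  qed
  then show "Cmp ?C \<AA> \<AA> \<BB> F (Idn ?C \<AA>) = F" by simp
  have "R.GF = F"
  proof (rule cofunctor_eqI[OF R.comp_cofunctor R.comp_ext F.cofunctor_axioms ext])
    show c: "cof R.GF i = cof F i" "c0 \<AA> \<BB> R.GF i = c0 \<AA> \<BB> F i" if "i \<in> Ix \<AA>" for i
      using that by (simp_all add: R.comp_c0 F.B.id_cofun_simps cmp_ide[OF F.c0_hom])
    show "act \<AA> \<BB> R.GF i j a b = act \<AA> \<BB> F i j a b"
      if i: "i \<in> Ix \<AA>" "j \<in> Ix \<AA>" and a: "a \<in> hom w (A1 \<AA> i j)" "b \<in> hom w (A0 \<BB> (cof R.GF i))"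
        "sr \<AA> i j \<cdot> a = c0 \<AA> \<BB> R.GF i \<cdot> b" for i j w a b
    proof -
      have b: "b \<in> el (A0 \<BB> (cof F i))" and s: "sr \<AA> i j \<cdot> a = c0 \<AA> \<BB> F i \<cdot> b"
        using a c[OF i(1)] i by (auto intro: hom_el)
      have "act \<AA> \<BB> R.GF i j a b = act \<BB> \<BB> (id_cofun C \<BB>) (cof F i) (cof F j) (act \<AA> \<BB> F i j a b) b"
        using R.act_comp[OF i hom_el[OF a(1)], of b] i b s by (simp add: F.B.id_cofun_simps)
      also have "\<dots> = act \<AA> \<BB> F i j a b"
        using i b s by (intro F.B.act_id F.act_el F.sr_act hom_el[OF a(1)]) auto
      finally show ?thesis .
    qed
  qed
  then show "Cmp ?C \<AA> \<BB> \<BB> (Idn ?C \<BB>) F = F" by simp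
next
  fix \<AA> \<BB> \<DD> \<EE> F G H assume ob: "\<AA> \<in> Ob ?C" "\<BB> \<in> Ob ?C" "\<DD> \<in> Ob ?C" "\<EE> \<in> Ob ?C"
    and h: "F \<in> Hom ?C \<AA> \<BB>" "G \<in> Hom ?C \<BB> \<DD>" "H \<in> Hom ?C \<DD> \<EE>"
  interpret F: cofunctor C \<AA> \<BB> F using ob h by (simp add: pCat_Hom)
  interpret G: cofunctor C \<BB> \<DD> G using ob h by (simp add: pCat_Hom)
  interpret H: cofunctor C \<DD> \<EE> H using ob h by (simp add: pCat_Hom)
  interpret GF: cofunctor_pair C \<AA> \<BB> \<DD> F G
    by (simp add: cofunctor_pair_def F.cofunctor_axioms G.cofunctor_axioms)
  interpret HG: cofunctor_pair C \<BB> \<DD> \<EE> G H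
    by (simp add: cofunctor_pair_def H.cofunctor_axioms G.cofunctor_axioms)
  interpret L: cofunctor_pair C \<AA> \<DD> \<EE> GF.GF H
    by (simp add: cofunctor_pair_def GF.comp_cofunctor H.cofunctor_axioms)
  interpret R: cofunctor_pair C \<AA> \<BB> \<EE> F HG.GF
    by (simp add: cofunctor_pair_def HG.comp_cofunctor F.cofunctor_axioms)
  have "L.GF = R.GF"
  proof (rule cofunctor_eqI[OF L.comp_cofunctor L.comp_ext R.comp_cofunctor R.comp_ext])
    show "cof L.GF i = cof R.GF i" "c0 \<AA> \<EE> L.GF i = c0 \<AA> \<EE> R.GF i" if "i \<in> Ix \<AA>" for i
      using that by (simp_all add: L.comp_c0 R.comp_c0 HG.comp_c0 GF.comp_c0 cmp_assoc)
    show "act \<AA> \<EE> L.GF i j a d = act \<AA> \<EE> R.GF i j a d"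
      if i: "i \<in> Ix \<AA>" "j \<in> Ix \<AA>" and a: "a \<in> hom w (A1 \<AA> i j)" "d \<in> hom w (A0 \<EE> (cof L.GF i))"
        "sr \<AA> i j \<cdot> a = c0 \<AA> \<EE> L.GF i \<cdot> d" for i j w a d
    proof -
      note [simp] = i
      let ?i = "cof F i" let ?j = "cof F j"
      let ?Hd = "c0 \<DD> \<EE> H (cof G ?i) \<cdot> d" let ?GHd = "c0 \<BB> \<DD> G ?i \<cdot> ?Hd"
      have s: "sr \<AA> i j \<cdot> a = c0 \<AA> \<BB> F i \<cdot> ?GHd"
        using a(3) by (simp add: L.comp_c0 GF.comp_c0 cmp_assoc)
      have e: "a \<in> el (A1 \<AA> i j)" "d \<in> el (A0 \<EE> (cof H (cof G ?i)))" "?Hd \<in> el (A0 \<DD> (cof G ?i))" "?GHd \<in> el (A0 \<BB> ?i)"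
        using a by (auto intro: hom_el hom_cmp_el[OF G.c0_hom] hom_cmp_el[OF H.c0_hom])
      have fe: "act \<AA> \<BB> F i j a ?GHd \<in> el (A1 \<BB> ?i ?j)" by (intro F.act_el) auto
      have sf: "sr \<BB> ?i ?j \<cdot> act \<AA> \<BB> F i j a ?GHd = ?GHd" by (intro F.sr_act e s) auto
      have "act \<AA> \<EE> L.GF i j a d = act \<DD> \<EE> H (cof G ?i) (cof G ?j) (act \<AA> \<DD> GF.GF i j a ?Hd) d"
        using L.act_comp[OF i e(1), of d] e s by (simp add: GF.comp_c0 cmp_assoc)
      also have "act \<AA> \<DD> GF.GF i j a ?Hd = act \<BB> \<DD> G ?i ?j (act \<AA> \<BB> F i j a ?GHd) ?Hd"
        by (intro GF.act_comp e s) auto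
      also have "act \<DD> \<EE> H (cof G ?i) (cof G ?j) (act \<BB> \<DD> G ?i ?j (act \<AA> \<BB> F i j a ?GHd) ?Hd) d
        = act \<BB> \<EE> HG.GF ?i ?j (act \<AA> \<BB> F i j a ?GHd) d"
        by (rule HG.act_comp[symmetric]) (use fe e sf in auto)
      also have "\<dots> = act \<AA> \<EE> R.GF i j a d"
        using R.act_comp[OF i e(1), of d] e s by (simp add: HG.comp_c0 cmp_assoc)
      finally show ?thesis .
    qed
  qed
  then show "Cmp ?C \<AA> \<DD> \<EE> H (Cmp ?C \<AA> \<BB> \<DD> G F) = Cmp ?C \<AA> \<BB> \<EE> (Cmp ?C \<BB> \<DD> \<EE> H G) F"
    by simp
qed

end

section \<open>The category of restriction categories over a restriction category\<close>

lemma mk_ftor_simps [simp]: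
  "x \<in> Ob A \<Longrightarrow> FOb (mk_ftor A F0 F1) x = F0 x"
  "\<lbrakk>x \<in> Ob A; y \<in> Ob A; f \<in> Hom A x y\<rbrakk> \<Longrightarrow> FHom (mk_ftor A F0 F1) x y f = F1 x y f"
  by (simp_all add: mk_ftor_def)

lemma ext_mk_ftor [simp]: "ext_ftor A (mk_ftor A F0 F1)"
  by (auto simp: ext_ftor_def mk_ftor_def fun_eq_iff)

lemma ext_comp_id [simp]: "ext_ftor A (comp_ftor A G F)" "ext_ftor A (id_ftor A)"
  by (simp_all add: comp_ftor_def id_ftor_def)

lemma ext_ftor_eqI:
  assumes "ext_ftor A F" "ext_ftor A G"
    and "\<And>x. x \<in> Ob A \<Longrightarrow> FOb F x = FOb G x"
    and "\<And>x y f. \<lbrakk>x \<in> Ob A; y \<in> Ob A; f \<in> Hom A x y\<rbrakk> \<Longrightarrow> FHom F x y f = FHom G x y f"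
  shows "F = G"
proof -
  have "mk_ftor A (FOb F) (FHom F) = mk_ftor A (FOb G) (FHom G)"
    using assms(3,4) by (auto simp: mk_ftor_def fun_eq_iff)
  then show ?thesis using assms(1,2) by (simp add: ext_ftor_def)
qed

lemma over_map_iff: "over_map C (A, P) (B, Q) (F, \<alpha>) \<longleftrightarrow>
     restriction_functor A B F \<and> ext_ftor A F \<and>
     nat_trans A C (comp_ftor A Q F) P \<alpha> \<and> \<alpha> \<in> extensional (Ob A) \<and>
     (\<forall>x\<in>Ob A. total_map C (FOb Q (FOb F x)) (FOb P x) (\<alpha> x))"
  by (simp add: over_map_def)

lemma over_comp_pair: "over_comp C (A, P) (B, Q) (D, R) (G, \<beta>) (F, \<alpha>) = (comp_ftor A G F,
        \<lambda>x\<in>Ob A. Cmp C (FOb R (FOb G (FOb F x))) (FOb Q (FOb F x)) (FOb P x) (\<alpha> x) (\<beta> (FOb F x)))"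
  by (simp add: over_comp_def)

lemma rCat_over_simps [simp]: "Idn (rCat_over \<kappa> C) = over_id C" "Cmp (rCat_over \<kappa> C) = over_comp C"
  "Hom (rCat_over \<kappa> C) X Y = {f. over_map C X Y f}" "Ob (rCat_over \<kappa> C) = {X. over_object \<kappa> C X}"
  by (simp_all add: rCat_over_def)

lemma restriction_functor_comp:
  assumes "restriction_category A" "restriction_functor A B F" "restriction_functor B D G"
  shows "restriction_functor A D (comp_ftor A G F)"
proof -
  interpret A: restriction_category A by fact
  interpret F: restriction_functor A B F by fact
  interpret G: restriction_functor B D G by fact
  show ?thesis
    by unfold_locales (auto simp: A.Idn_in A.Cmp_in A.Rst_in F.FOb_in G.FOb_in F.FHom_in G.FHom_in
      F.FHom_Idn G.FHom_Idn F.FHom_Cmp G.FHom_Cmp F.FHom_Rst G.FHom_Rst)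
qed

context restriction_category
begin

lemma over_mapD:
  assumes "over_map C (A, P) (B, Q) (F, \<alpha>)" "restriction_functor A C P" "restriction_functor B C Q"
  shows "restriction_functor A B F" "ext_ftor A F" "\<alpha> \<in> extensional (Ob A)"
    "x \<in> Ob A \<Longrightarrow> \<alpha> x \<in> Hom C (FOb Q (FOb F x)) (FOb P x)"
    "x \<in> Ob A \<Longrightarrow> arr (FOb Q (FOb F x)) (FOb P x) (\<alpha> x) \<in> tot (FOb Q (FOb F x)) (FOb P x)"
    "\<lbrakk>x \<in> Ob A; y \<in> Ob A; f \<in> Hom A x y\<rbrakk> \<Longrightarrow>
      arr (FOb Q (FOb F y)) (FOb P y) (\<alpha> y) \<cdot> arr (FOb Q (FOb F x)) (FOb Q (FOb F y)) (FHom Q (FOb F x) (FOb F y) (FHom F x y f))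
    = arr (FOb P x) (FOb P y) (FHom P x y f) \<cdot> arr (FOb Q (FOb F x)) (FOb P x) (\<alpha> x)"
proof -
  interpret P: restriction_functor A C P by fact
  interpret Q: restriction_functor B C Q by fact
  interpret F: restriction_functor A B F using assms(1) by (simp add: over_map_iff)
  show "restriction_functor A B F" "ext_ftor A F" "\<alpha> \<in> extensional (Ob A)"
    using assms(1) by (simp_all add: over_map_iff)
  have tot: "total_map C (FOb Q (FOb F x)) (FOb P x) (\<alpha> x)" if "x \<in> Ob A" for x
    using assms(1) that by (simp add: over_map_iff)
  then have h: "\<alpha> x \<in> Hom C (FOb Q (FOb F x)) (FOb P x)" if "x \<in> Ob A" for x
    using that by (simp add: total_map_def)
  then show "x \<in> Ob A \<Longrightarrow> \<alpha> x \<in> Hom C (FOb Q (FOb F x)) (FOb P x)" .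
  show "x \<in> Ob A \<Longrightarrow> arr (FOb Q (FOb F x)) (FOb P x) (\<alpha> x) \<in> tot (FOb Q (FOb F x)) (FOb P x)"
    by (rule arr_tot[OF tot]) (auto intro: P.FOb_in Q.FOb_in F.FOb_in)
  assume f: "x \<in> Ob A" "y \<in> Ob A" "f \<in> Hom A x y"
  have "Cmp C (FOb Q (FOb F x)) (FOb Q (FOb F y)) (FOb P y) (\<alpha> y) (FHom Q (FOb F x) (FOb F y) (FHom F x y f))
      = Cmp C (FOb Q (FOb F x)) (FOb P x) (FOb P y) (FHom P x y f) (\<alpha> x)"
    using assms(1) f by (auto simp: over_map_iff nat_trans_def)
  then have "arr (FOb Q (FOb F x)) (FOb P y) (Cmp C (FOb Q (FOb F x)) (FOb Q (FOb F y)) (FOb P y) (\<alpha> y) (FHom Q (FOb F x) (FOb F y) (FHom F x y f)))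
      = arr (FOb Q (FOb F x)) (FOb P y) (Cmp C (FOb Q (FOb F x)) (FOb P x) (FOb P y) (FHom P x y f) (\<alpha> x))"
    by simp
  then show "arr (FOb Q (FOb F y)) (FOb P y) (\<alpha> y) \<cdot> arr (FOb Q (FOb F x)) (FOb Q (FOb F y)) (FHom Q (FOb F x) (FOb F y) (FHom F x y f))
    = arr (FOb P x) (FOb P y) (FHom P x y f) \<cdot> arr (FOb Q (FOb F x)) (FOb P x) (\<alpha> x)"
    using f h by (simp add: arr_Cmp P.FOb_in Q.FOb_in F.FOb_in P.FHom_in Q.FHom_in F.FHom_in)
qed

lemma over_mapI:
  assumes "restriction_functor A B F" "ext_ftor A F" "\<alpha> \<in> extensional (Ob A)"
    "restriction_functor A C P" "restriction_functor B C Q"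
    and tot: "\<And>x. x \<in> Ob A \<Longrightarrow> total_map C (FOb Q (FOb F x)) (FOb P x) (\<alpha> x)"
    and nat: "\<And>x y f. \<lbrakk>x \<in> Ob A; y \<in> Ob A; f \<in> Hom A x y\<rbrakk> \<Longrightarrow>
      arr (FOb Q (FOb F y)) (FOb P y) (\<alpha> y) \<cdot> arr (FOb Q (FOb F x)) (FOb Q (FOb F y)) (FHom Q (FOb F x) (FOb F y) (FHom F x y f))
    = arr (FOb P x) (FOb P y) (FHom P x y f) \<cdot> arr (FOb Q (FOb F x)) (FOb P x) (\<alpha> x)"
  shows "over_map C (A, P) (B, Q) (F, \<alpha>)"
proof -
  interpret P: restriction_functor A C P by fact
  interpret Q: restriction_functor B C Q by fact
  interpret F: restriction_functor A B F by fact
  have h: "\<alpha> x \<in> Hom C (FOb Q (FOb F x)) (FOb P x)" if "x \<in> Ob A" for x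
    using tot[OF that] by (simp add: total_map_def)
  have "nat_trans A C (comp_ftor A Q F) P \<alpha>"
    unfolding nat_trans_def
  proof (intro conjI ballI)
    fix x y f assume f: "x \<in> Ob A" "y \<in> Ob A" "f \<in> Hom A x y"
    have "Cmp C (FOb Q (FOb F x)) (FOb Q (FOb F y)) (FOb P y) (\<alpha> y) (FHom Q (FOb F x) (FOb F y) (FHom F x y f))
      = Cmp C (FOb Q (FOb F x)) (FOb P x) (FOb P y) (FHom P x y f) (\<alpha> x)"
      by (rule arr_inj[of "FOb Q (FOb F x)" "FOb P y"])
        (use f h nat[OF f] in \<open>simp_all add: Cmp_in arr_Cmp P.FOb_in Q.FOb_in F.FOb_in P.FHom_in Q.FHom_in F.FHom_in\<close>)
    then show "Cmp C (FOb (comp_ftor A Q F) x) (FOb (comp_ftor A Q F) y) (FOb P y) (\<alpha> y) (FHom (comp_ftor A Q F) x y f) =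
           Cmp C (FOb (comp_ftor A Q F) x) (FOb P x) (FOb P y) (FHom P x y f) (\<alpha> x)"
      using f by simp
  qed (use h in simp)
  then show ?thesis using assms(1-3) tot by (simp add: over_map_iff)
qed

lemma category_rCat_over: "category (rCat_over \<kappa> C)" (is "category ?R")
proof
  fix X :: "('a, 'o, 'm) over" assume "X \<in> Ob ?R"
  then obtain A P where X: "X = (A, P)" and "restriction_category A" and P: "restriction_functor A C P"
    by (cases X) (auto simp: over_object_def)
  then interpret A: restriction_category A by simp
  interpret P: restriction_functor A C P by fact
  have id: "restriction_functor A A (id_ftor A)"
    by unfold_locales (auto simp: A.Idn_in A.Cmp_in A.Rst_in)
  show "Idn ?R X \<in> Hom ?R X X"
    unfolding X using P id
    by (auto simp: over_id_def P.FOb_in P.FHom_in total_map_iff Idn_in ide_tot ide_cmp_hom[OF homI] cmp_ide[OF homI] simp flip: ide_def intro!: over_mapI)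
next
  fix X Y Z :: "('a, 'o, 'm) over" and f g assume "X \<in> Ob ?R" "Y \<in> Ob ?R" "Z \<in> Ob ?R"
    "f \<in> Hom ?R X Y" "g \<in> Hom ?R Y Z"
  then obtain A P B Q D R F \<alpha> G \<beta> where e: "X = (A, P)" "Y = (B, Q)" "Z = (D, R)" "f = (F, \<alpha>)" "g = (G, \<beta>)"
    and A: "restriction_category A"
    and P: "restriction_functor A C P" and Q: "restriction_functor B C Q" and R: "restriction_functor D C R"
    and f: "over_map C (A, P) (B, Q) (F, \<alpha>)" and g: "over_map C (B, Q) (D, R) (G, \<beta>)"
    by (cases X; cases Y; cases Z; cases f; cases g) (auto simp: over_object_def)
  note f = over_mapD[OF f P Q] and g = over_mapD[OF g Q R]
  interpret P: restriction_functor A C P by fact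
  interpret Q: restriction_functor B C Q by fact
  interpret R: restriction_functor D C R by fact
  interpret F: restriction_functor A B F by (rule f)
  interpret G: restriction_functor B D G by (rule g)
  note [simp] = P.FOb_in Q.FOb_in R.FOb_in F.FOb_in G.FOb_in P.FHom_in Q.FHom_in R.FHom_in F.FHom_in G.FHom_in
  have "over_map C (A, P) (D, R) (over_comp C (A, P) (B, Q) (D, R) (G, \<beta>) (F, \<alpha>))"
    unfolding over_comp_pair
  proof (rule over_mapI[OF restriction_functor_comp[OF A f(1) g(1)] _ _ P R])
    fix x assume x: "x \<in> Ob A"
    have t: "arr (FOb Q (FOb F x)) (FOb P x) (\<alpha> x) \<cdot> arr (FOb R (FOb G (FOb F x))) (FOb Q (FOb F x)) (\<beta> (FOb F x))
        \<in> tot (FOb R (FOb G (FOb F x))) (FOb P x)"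
      using x f(5) g(5) by (intro cmp_tot) auto
    show "total_map C (FOb R (FOb (comp_ftor A G F) x)) (FOb P x)
          ((\<lambda>x\<in>Ob A. Cmp C (FOb R (FOb G (FOb F x))) (FOb Q (FOb F x)) (FOb P x) (\<alpha> x) (\<beta> (FOb F x))) x)"
      using x t f(4) g(4) by (simp add: total_map_iff Cmp_in arr_Cmp)
  next
    fix x y h assume h: "x \<in> Ob A" "y \<in> Ob A" "h \<in> Hom A x y"
    note n = f(6)[OF h] g(6)[OF F.FOb_in[OF h(1)] F.FOb_in[OF h(2)] F.FHom_in[OF h]]
    show "arr (FOb R (FOb (comp_ftor A G F) y)) (FOb P y)
         ((\<lambda>x\<in>Ob A. Cmp C (FOb R (FOb G (FOb F x))) (FOb Q (FOb F x)) (FOb P x) (\<alpha> x) (\<beta> (FOb F x))) y) \<cdot>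
        arr (FOb R (FOb (comp_ftor A G F) x)) (FOb R (FOb (comp_ftor A G F) y))
         (FHom R (FOb (comp_ftor A G F) x) (FOb (comp_ftor A G F) y) (FHom (comp_ftor A G F) x y h)) =
        arr (FOb P x) (FOb P y) (FHom P x y h) \<cdot> arr (FOb R (FOb (comp_ftor A G F) x)) (FOb P x)
         ((\<lambda>x\<in>Ob A. Cmp C (FOb R (FOb G (FOb F x))) (FOb Q (FOb F x)) (FOb P x) (\<alpha> x) (\<beta> (FOb F x))) x)"
      using h f(4) g(4) n by (simp add: arr_Cmp cmp_assoc) (metis cmp_assoc)
  qed auto
  then show "Cmp ?R X Y Z g f \<in> Hom ?R X Z"
    by (simp add: e)
next
  fix X Y :: "('a, 'o, 'm) over" and f assume "X \<in> Ob ?R" "Y \<in> Ob ?R" "f \<in> Hom ?R X Y"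
  then obtain A P B Q F \<alpha> where e: "X = (A, P)" "Y = (B, Q)" "f = (F, \<alpha>)" and A: "restriction_category A" "restriction_category B"
    and P: "restriction_functor A C P" and Q: "restriction_functor B C Q"
    and f: "over_map C (A, P) (B, Q) (F, \<alpha>)"
    by (cases X; cases Y; cases f) (auto simp: over_object_def)
  note f = over_mapD[OF f P Q]
  interpret A: restriction_category A by fact
  interpret B: restriction_category B by fact
  interpret P: restriction_functor A C P by fact
  interpret Q: restriction_functor B C Q by fact
  interpret F: restriction_functor A B F by (rule f)
  note [simp] = P.FOb_in Q.FOb_in F.FOb_in P.FHom_in Q.FHom_in F.FHom_in f(2,4) Cmp_Idn Idn_Cmp
  have "comp_ftor A F (id_ftor A) = F" "comp_ftor A (id_ftor B) F = F"
    by (rule ext_ftor_eqI[of A]; simp)+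
  moreover have "(\<lambda>x\<in>Ob A. Cmp C (FOb Q (FOb F (FOb (id_ftor A) x))) (FOb P (FOb (id_ftor A) x)) (FOb P x) ((\<lambda>x\<in>Ob A. Idn C (FOb P x)) x) (\<alpha> (FOb (id_ftor A) x))) = \<alpha>"
    "(\<lambda>x\<in>Ob A. Cmp C (FOb Q (FOb (id_ftor B) (FOb F x))) (FOb Q (FOb F x)) (FOb P x) (\<alpha> x) ((\<lambda>x\<in>Ob B. Idn C (FOb Q x)) (FOb F x))) = \<alpha>"
    by (rule extensionalityI[of _ "Ob A"]; simp add: f(3))+
  ultimately show "Cmp ?R X X Y f (Idn ?R X) = f" "Cmp ?R X Y Y (Idn ?R Y) f = f"
    by (simp_all add: e over_id_def over_comp_pair)
next
  fix X Y Z W :: "('a, 'o, 'm) over" and f g h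
  assume "X \<in> Ob ?R" "Y \<in> Ob ?R" "Z \<in> Ob ?R" "W \<in> Ob ?R"
    "f \<in> Hom ?R X Y" "g \<in> Hom ?R Y Z" "h \<in> Hom ?R Z W"
  then obtain A P B Q D R E S F \<alpha> G \<beta> H \<gamma> where e: "X = (A, P)" "Y = (B, Q)" "Z = (D, R)" "W = (E, S)"
      "f = (F, \<alpha>)" "g = (G, \<beta>)" "h = (H, \<gamma>)"
    and P: "restriction_functor A C P" and Q: "restriction_functor B C Q" and R: "restriction_functor D C R"
    and S: "restriction_functor E C S"
    and f: "over_map C (A, P) (B, Q) (F, \<alpha>)" and g: "over_map C (B, Q) (D, R) (G, \<beta>)" and h: "over_map C (D, R) (E, S) (H, \<gamma>)"
    by (cases X; cases Y; cases Z; cases W; cases f; cases g; cases h) (auto simp: over_object_def)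
  note f = over_mapD[OF f P Q] and g = over_mapD[OF g Q R] and h = over_mapD[OF h R S]
  interpret P: restriction_functor A C P by fact
  interpret Q: restriction_functor B C Q by fact
  interpret R: restriction_functor D C R by fact
  interpret S: restriction_functor E C S by fact
  interpret F: restriction_functor A B F by (rule f)
  interpret G: restriction_functor B D G by (rule g)
  interpret H: restriction_functor D E H by (rule h)
  note [simp] = P.FOb_in Q.FOb_in R.FOb_in S.FOb_in F.FOb_in G.FOb_in H.FOb_in F.FHom_in G.FHom_in H.FHom_in
  have "comp_ftor A H (comp_ftor A G F) = comp_ftor A (comp_ftor B H G) F"
    by (rule ext_ftor_eqI[of A]) simp_all
  then show "Cmp ?R X Z W h (Cmp ?R X Y Z g f) = Cmp ?R X Y W (Cmp ?R Y Z W h g) f"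
    using f(4) g(4) h(4) by (auto simp: e over_comp_pair Cmp_assoc intro!: restrict_ext)
qed

end

section \<open>Partial sections\<close>

context internal
begin

definition sec :: "'i \<Rightarrow> 'i \<Rightarrow> ('o, 'm) arrow set" where
  "sec i j = {s \<in> hom (A0 \<AA> i) (A1 \<AA> i j). sr \<AA> i j \<cdot> s = rst s}"

text \<open>Composition of \<open>Phi_cat\<close> in object-free form. The factor \<open>s\<close>
  is cut down to where \<open>t\<close> is defined on its target, because \<open>mu\<close> pairs
  only elements whose source and target agree as partial maps.\<close>

definition pcomp :: "'i \<Rightarrow> 'i \<Rightarrow> 'i \<Rightarrow> ('o, 'm) arrow \<Rightarrow> ('o, 'm) arrow \<Rightarrow> ('o, 'm) arrow" where
  "pcomp i j k t s = mu \<AA> i j k (t \<cdot> tg \<AA> i j \<cdot> s) (s \<cdot> rst (t \<cdot> tg \<AA> i j \<cdot> s))"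

lemma sec_hom: "s \<in> sec i j \<Longrightarrow> s \<in> hom (A0 \<AA> i) (A1 \<AA> i j)"
  and sr_sec: "s \<in> sec i j \<Longrightarrow> sr \<AA> i j \<cdot> s = rst s"
  by (simp_all add: sec_def)

lemma sec_el: "s \<in> sec i j \<Longrightarrow> s \<cdot> x \<in> el (A1 \<AA> i j)"
  by (rule hom_cmp_el[OF sec_hom])

text \<open>The section law along an arbitrary \<open>x\<close>, with the restriction moved to the
  right by \<open>rst_swap\<close>. In this form it supplies the matching conditions for
  \<open>mu\<close> and \<open>act\<close>.\<close>

lemma sr_sec_cmp: "s \<in> sec i j \<Longrightarrow> sr \<AA> i j \<cdot> s \<cdot> x = x \<cdot> rst (s \<cdot> x)"
  by (metis cmp_reassoc sr_sec rst_swap)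

lemma Phi_Hom: "\<lbrakk>i \<in> Ix \<AA>; j \<in> Ix \<AA>\<rbrakk> \<Longrightarrow> s \<in> Hom (Phi_cat C \<AA>) i j \<longleftrightarrow>
    s \<in> Hom C (A0 \<AA> i) (A1 \<AA> i j) \<and> arr (A0 \<AA> i) (A1 \<AA> i j) s \<in> sec i j"
  by (auto simp: Phi_cat_def partial_section_def sec_def homI sr_def arr_eq_iff[of "A0 \<AA> i" "A0 \<AA> i"] Cmp_in Rst_in arr_Cmp arr_Rst)

lemma sec_mor: "\<lbrakk>i \<in> Ix \<AA>; j \<in> Ix \<AA>; s \<in> sec i j\<rbrakk> \<Longrightarrow> mor s \<in> Hom (Phi_cat C \<AA>) i j"
  by (simp add: Phi_Hom mor_in sec_hom arr_mor)

lemma Phi_simps [simp]: "Ob (Phi_cat C \<AA>) = Ix \<AA>" "Idn (Phi_cat C \<AA>) = idm \<AA>"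
  by (simp_all add: Phi_cat_def)

lemma pcomp_props:
  assumes i: "i \<in> Ix \<AA>" "j \<in> Ix \<AA>" "k \<in> Ix \<AA>" and s: "s \<in> sec i j" and t: "t \<in> sec j k"
  shows "sr \<AA> j k \<cdot> t \<cdot> tg \<AA> i j \<cdot> s = tg \<AA> i j \<cdot> s \<cdot> rst (t \<cdot> tg \<AA> i j \<cdot> s)" (is ?m)
    and "pcomp i j k t s \<in> sec i k" (is ?sec)
    and "tg \<AA> i k \<cdot> pcomp i j k t s = tg \<AA> j k \<cdot> t \<cdot> tg \<AA> i j \<cdot> s" (is ?tg)
    and "rst (pcomp i j k t s) = rst (t \<cdot> tg \<AA> i j \<cdot> s)" (is ?rst)
proof -
  show m: ?m using sr_sec_cmp[OF t, of "tg \<AA> i j \<cdot> s"] by (simp add: cmp_assoc)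
  note e = sec_el[OF t] sec_el[OF s]
  have h: "t \<cdot> tg \<AA> i j \<cdot> s \<in> hom (A0 \<AA> i) (A1 \<AA> j k)"
    using sec_hom[OF s] sec_hom[OF t] tg_hom[OF i(1,2)] by (auto intro: cmp_hom)
  then have h': "s \<cdot> rst (t \<cdot> tg \<AA> i j \<cdot> s) \<in> hom (A0 \<AA> i) (A1 \<AA> i j)"
    using sec_hom[OF s] by (auto intro: cmp_hom rst_hom)
  show r: ?rst unfolding pcomp_def by (rule rst_mu(2)[OF i e m])
  show ?tg unfolding pcomp_def by (rule tg_mu[OF i e m])
  have "sr \<AA> i k \<cdot> pcomp i j k t s = rst s \<cdot> rst (t \<cdot> tg \<AA> i j \<cdot> s)"
    unfolding pcomp_def by (simp add: sr_mu[OF i e m] cmp_reassoc[OF sr_sec[OF s]])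
  also have "\<dots> = rst (t \<cdot> tg \<AA> i j \<cdot> s)"
    using rst_cmp_rst_right[of "t \<cdot> tg \<AA> i j" s] by (simp add: cmp_assoc rst_comm[of s])
  finally show ?sec using mu_hom[OF i h h' m] r by (simp add: sec_def pcomp_def)
qed

lemma un_sec: "i \<in> Ix \<AA> \<Longrightarrow> un \<AA> i \<in> sec i i"
  by (simp add: sec_def un_hom sr_un tot_rst[OF un_tot])

lemma sec_idem: "\<lbrakk>s \<in> sec i j; e \<in> idem (A0 \<AA> i)\<rbrakk> \<Longrightarrow> s \<cdot> e \<in> sec i j"
  unfolding sec_def by (auto intro: cmp_hom idem_hom simp: rst_cmp_idem cmp_reassoc)

text \<open>The restriction idempotents of \<open>Phi_cat\<close> are of the form
  \<open>un \<AA> i \<cdot> e\<close>, so this identifies restriction in \<open>Phi_cat\<close> with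
  restriction in \<open>C\<close>. The target of \<open>un \<AA> i \<cdot> e\<close> is
  \<open>e\<close>, and the right unit law of \<open>mu\<close> does the rest.\<close>

lemma pcomp_idem:
  assumes i: "i \<in> Ix \<AA>" "j \<in> Ix \<AA>" and s: "s \<in> sec i j" and e: "e \<in> idem (A0 \<AA> i)"
  shows "pcomp i i j s (un \<AA> i \<cdot> e) = s \<cdot> e"
proof -
  have "tg \<AA> i i \<cdot> un \<AA> i \<cdot> e = e"
    using i e by (simp add: cmp_reassoc[OF tg_un] ide_cmp_hom[OF idem_hom])
  moreover have "(un \<AA> i \<cdot> e) \<cdot> rst (s \<cdot> e) = un \<AA> i \<cdot> sr \<AA> i j \<cdot> s \<cdot> e"
    using sr_sec_cmp[OF s, of e] by (simp add: cmp_assoc)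
  ultimately show ?thesis unfolding pcomp_def using mu_un[OF i sec_el[OF s]] by simp
qed

lemma pcomp_un: "\<lbrakk>i \<in> Ix \<AA>; j \<in> Ix \<AA>; s \<in> sec i j\<rbrakk> \<Longrightarrow> pcomp i i j s (un \<AA> i) = s"
  using pcomp_idem[of i j s "ide (A0 \<AA> i)"] by (simp add: ide_idem cmp_ide[OF un_hom] cmp_ide[OF sec_hom])

lemma idem_pcomp:
  assumes i: "i \<in> Ix \<AA>" "j \<in> Ix \<AA>" and s: "s \<in> sec i j" and e: "e \<in> idem (A0 \<AA> j)"
  shows "pcomp i j j (un \<AA> j \<cdot> e) s = s \<cdot> rst (e \<cdot> tg \<AA> i j \<cdot> s)"
proof -
  let ?r = "rst (e \<cdot> tg \<AA> i j \<cdot> s)"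
  have "e \<cdot> tg \<AA> i j \<cdot> s = tg \<AA> i j \<cdot> s \<cdot> ?r"
    using rst_swap[of e "tg \<AA> i j \<cdot> s"] e by (simp add: idem_rst cmp_assoc)
  moreover have "rst (un \<AA> j \<cdot> e \<cdot> tg \<AA> i j \<cdot> s) = ?r"
    using i by (intro rst_tot[OF un_tot]) (auto intro: hom_cmp_el[OF idem_hom[OF e]])
  ultimately show ?thesis
    unfolding pcomp_def using un_mu[OF i sec_el[OF s, of ?r]] by (simp add: cmp_assoc)
qed

lemma un_pcomp:
  assumes i: "i \<in> Ix \<AA>" "j \<in> Ix \<AA>" and s: "s \<in> sec i j"
  shows "pcomp i j j (un \<AA> j) s = s"
proof -
  have "rst (ide (A0 \<AA> j) \<cdot> tg \<AA> i j \<cdot> s) = rst s"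
    using ide_cmp_hom[OF cmp_hom[OF tg_hom[OF i] sec_hom[OF s]]] rst_tot[OF tg_tot[OF i] hom_el[OF sec_hom[OF s]]] by simp
  then show ?thesis
    using idem_pcomp[OF i s, of "ide (A0 \<AA> j)"] i
    by (simp add: ide_idem cmp_ide[OF un_hom] hom_rst[OF sec_hom[OF s]])
qed

text \<open>Both composites are defined exactly on \<open>?e\<close>, where all three sections can
  be followed in turn. Restricted to \<open>?e\<close> the cut-downs inside \<open>pcomp\<close> can
  be absorbed, and what remains is \<open>mu_mu\<close> at one composable triple.\<close>

lemma pcomp_assoc:
  assumes i: "i \<in> Ix \<AA>" "j \<in> Ix \<AA>" "k \<in> Ix \<AA>" "l \<in> Ix \<AA>" and f: "f \<in> sec i j" and g: "g \<in> sec j k" and h: "h \<in> sec k l"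
  shows "pcomp i k l h (pcomp i j k g f) = pcomp i j l (pcomp j k l h g) f"
proof -
  let ?\<tau> = "tg \<AA> i j" and ?\<tau>' = "tg \<AA> j k"
  let ?e = "rst (h \<cdot> ?\<tau>' \<cdot> g \<cdot> ?\<tau> \<cdot> f)" and ?e' = "rst (g \<cdot> ?\<tau> \<cdot> f)"
  have ee: "?e' \<cdot> ?e = ?e"
    using rst_cmp_rst_right[of "h \<cdot> ?\<tau>'" "g \<cdot> ?\<tau> \<cdot> f"] by (simp add: cmp_assoc rst_comm)
  note pf = pcomp_props[OF i(1-3) f g] and pg = pcomp_props[OF i(2-4) g h]
  have "pcomp i k l h (pcomp i j k g f) = mu \<AA> i k l (h \<cdot> ?\<tau>' \<cdot> g \<cdot> ?\<tau> \<cdot> f) (pcomp i j k g f \<cdot> ?e)"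
    unfolding pcomp_def[of i k l] by (simp add: pf(3))
  also have "pcomp i j k g f \<cdot> ?e = mu \<AA> i j k ((g \<cdot> ?\<tau> \<cdot> f) \<cdot> ?e) ((f \<cdot> ?e') \<cdot> ?e)"
    unfolding pcomp_def by (rule mu_cmp[OF i(1-3) sec_el[OF g] sec_el[OF f] pf(1)])
  also have "(f \<cdot> ?e') \<cdot> ?e = f \<cdot> ?e" by (simp add: cmp_assoc ee)
  finally have 1: "pcomp i k l h (pcomp i j k g f) =
      mu \<AA> i k l (h \<cdot> ?\<tau>' \<cdot> g \<cdot> ?\<tau> \<cdot> f) (mu \<AA> i j k ((g \<cdot> ?\<tau> \<cdot> f) \<cdot> ?e) (f \<cdot> ?e))" .
  have sw: "rst (h \<cdot> ?\<tau>' \<cdot> g) \<cdot> ?\<tau> \<cdot> f = ?\<tau> \<cdot> f \<cdot> ?e"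
    using rst_swap[of "h \<cdot> ?\<tau>' \<cdot> g" "?\<tau> \<cdot> f"] by (simp add: cmp_assoc)
  have "rst (pcomp j k l h g \<cdot> ?\<tau> \<cdot> f) = rst (rst (pcomp j k l h g) \<cdot> ?\<tau> \<cdot> f)" by simp
  also have "\<dots> = ?e" unfolding pg(4) by (simp add: cmp_assoc)
  finally have r: "rst (pcomp j k l h g \<cdot> ?\<tau> \<cdot> f) = ?e" .
  have "pcomp j k l h g \<cdot> ?\<tau> \<cdot> f = mu \<AA> j k l ((h \<cdot> ?\<tau>' \<cdot> g) \<cdot> ?\<tau> \<cdot> f) ((g \<cdot> rst (h \<cdot> ?\<tau>' \<cdot> g)) \<cdot> ?\<tau> \<cdot> f)"
    unfolding pcomp_def by (rule mu_cmp[OF i(2-4) sec_el[OF h] sec_el[OF g] pg(1)])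
  then have c: "pcomp j k l h g \<cdot> ?\<tau> \<cdot> f = mu \<AA> j k l (h \<cdot> ?\<tau>' \<cdot> g \<cdot> ?\<tau> \<cdot> f) ((g \<cdot> ?\<tau> \<cdot> f) \<cdot> ?e)"
    by (simp add: cmp_assoc sw)
  have 2: "pcomp i j l (pcomp j k l h g) f = mu \<AA> i j l (mu \<AA> j k l (h \<cdot> ?\<tau>' \<cdot> g \<cdot> ?\<tau> \<cdot> f) ((g \<cdot> ?\<tau> \<cdot> f) \<cdot> ?e)) (f \<cdot> ?e)"
    unfolding pcomp_def[of i j l] c by (simp add: r flip: c)
  show ?thesis
    unfolding 1 2
  proof (rule mu_mu[OF i])
    show "sr \<AA> k l \<cdot> h \<cdot> ?\<tau>' \<cdot> g \<cdot> ?\<tau> \<cdot> f = ?\<tau>' \<cdot> (g \<cdot> ?\<tau> \<cdot> f) \<cdot> ?e"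
      using sr_sec_cmp[OF h] by (simp add: cmp_assoc)
    show "sr \<AA> j k \<cdot> (g \<cdot> ?\<tau> \<cdot> f) \<cdot> ?e = ?\<tau> \<cdot> f \<cdot> ?e"
      using cmp_reassoc[OF pf(1), of ?e] by (simp add: cmp_assoc ee)
  qed (auto intro: sec_el[OF h] sec_el[OF f] cmp_el[OF sec_el[OF g]])
qed

lemma arr_Phi_Cmp:
  assumes i: "i \<in> Ix \<AA>" "j \<in> Ix \<AA>" "k \<in> Ix \<AA>"
    and s: "s \<in> Hom (Phi_cat C \<AA>) i j" and t: "t \<in> Hom (Phi_cat C \<AA>) j k"
  shows "Cmp (Phi_cat C \<AA>) i j k t s \<in> Hom C (A0 \<AA> i) (A1 \<AA> i k)" (is ?in)
    and "arr (A0 \<AA> i) (A1 \<AA> i k) (Cmp (Phi_cat C \<AA>) i j k t s) =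
      pcomp i j k (arr (A0 \<AA> j) (A1 \<AA> j k) t) (arr (A0 \<AA> i) (A1 \<AA> i j) s)" (is ?eq)
proof -
  let ?K = "cmp_cospan \<AA> i j k" let ?t = "arr (A0 \<AA> j) (A1 \<AA> j k) t" let ?s = "arr (A0 \<AA> i) (A1 \<AA> i j) s"
  note ok = cmp_ok[OF i]
  have s': "s \<in> Hom C (A0 \<AA> i) (A1 \<AA> i j)" "?s \<in> sec i j" and t': "t \<in> Hom C (A0 \<AA> j) (A1 \<AA> j k)" "?t \<in> sec j k"
    using s t i by (auto simp: Phi_Hom)
  note [simp] = i pb_ob[OF ok] s'(1) t'(1)
  let ?u = "Cmp C (A1 \<AA> i j) (A0 \<AA> j) (A1 \<AA> j k) t (tgt \<AA> i j)"
  let ?r = "Rst C (A1 \<AA> i j) (A1 \<AA> j k) ?u"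
  have u: "?u \<in> Hom C (A1 \<AA> i j) (A1 \<AA> j k)" "?r \<in> Hom C (A1 \<AA> i j) (A1 \<AA> i j)"
    by (auto intro!: Cmp_in Rst_in)
  have au: "arr (A1 \<AA> i j) (A1 \<AA> j k) ?u = ?t \<cdot> tg \<AA> i j" "arr (A1 \<AA> i j) (A1 \<AA> i j) ?r = rst (?t \<cdot> tg \<AA> i j)"
    using u by (simp_all add: arr_Cmp arr_Rst tg_def)
  have m: "sr \<AA> j k \<cdot> ?t \<cdot> tg \<AA> i j = tg \<AA> i j \<cdot> rst (?t \<cdot> tg \<AA> i j)"
    by (rule sr_sec_cmp[OF t'(2)])
  note p = pair_raw[OF ok, of "A1 \<AA> i j" ?u ?r, simplified, unfolded au, OF u m]
  let ?p = "tgt_pull C \<AA> i j k t"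
  have P: "?p \<in> Hom C (A1 \<AA> i j) (pb C ?K)" "arr (A1 \<AA> i j) (pb C ?K) ?p = mpair ?K (?t \<cdot> tg \<AA> i j) (rst (?t \<cdot> tg \<AA> i j))"
    using p(1,4) by (simp_all add: tgt_pull_def Let_def)
  have e: "Cmp (Phi_cat C \<AA>) i j k t s = Cmp C (A0 \<AA> i) (pb C ?K) (A1 \<AA> i k) (mul \<AA> i j k) (Cmp C (A0 \<AA> i) (A1 \<AA> i j) (pb C ?K) ?p s)"
    by (simp add: Phi_cat_def Let_def)
  show ?in unfolding e using P mul_in[OF i] by (auto intro!: Cmp_in)
  have rel: "rst (?t \<cdot> tg \<AA> i j) \<in> el (A1 \<AA> i j)"
    using rst_hom[OF cmp_hom[OF sec_hom[OF t'(2)] tg_hom[OF i(1,2)]]] by (rule hom_el)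
  have "arr (A0 \<AA> i) (A1 \<AA> i k) (Cmp (Phi_cat C \<AA>) i j k t s) = mulA \<AA> i j k \<cdot> mpair ?K (?t \<cdot> tg \<AA> i j) (rst (?t \<cdot> tg \<AA> i j)) \<cdot> ?s"
    unfolding e using P mul_in[OF i] by (simp add: arr_Cmp Cmp_in mulA_def)
  also have "\<dots> = mu \<AA> i j k ((?t \<cdot> tg \<AA> i j) \<cdot> ?s) (rst (?t \<cdot> tg \<AA> i j) \<cdot> ?s)"
    using mu_cmp[OF i sec_el[OF t'(2)] rel m] by (simp add: mu_def cmp_assoc)
  also have "\<dots> = pcomp i j k ?t ?s"
    using rst_swap[of "?t \<cdot> tg \<AA> i j" ?s] by (simp add: pcomp_def cmp_assoc)
  finally show ?eq .
qed

lemma arr_Phi_Rst: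
  assumes i: "i \<in> Ix \<AA>" "j \<in> Ix \<AA>" and s: "s \<in> Hom (Phi_cat C \<AA>) i j"
  shows "Rst (Phi_cat C \<AA>) i j s \<in> Hom C (A0 \<AA> i) (A1 \<AA> i i)"
    and "arr (A0 \<AA> i) (A1 \<AA> i i) (Rst (Phi_cat C \<AA>) i j s) = un \<AA> i \<cdot> rst (arr (A0 \<AA> i) (A1 \<AA> i j) s)"
  using assms by (auto simp: Phi_cat_def partial_section_def arr_Cmp arr_Rst un_def Rst_in idm_in intro!: Cmp_in)

lemma restriction_category_Phi: "restriction_category (Phi_cat C \<AA>)"
proof -
  let ?P = "Phi_cat C \<AA>"
  let ?a = "\<lambda>i j s. arr (A0 \<AA> i) (A1 \<AA> i j) s"
  have eqI: "s = t" if "i \<in> Ix \<AA>" "j \<in> Ix \<AA>" "s \<in> Hom ?P i j" "t \<in> Hom ?P i j" "?a i j s = ?a i j t" for i j s t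
    using that by (auto simp: Phi_Hom intro: arr_inj)
  have sec: "?a i j s \<in> sec i j" "rst (?a i j s) \<in> idem (A0 \<AA> i)" if "i \<in> Ix \<AA>" "j \<in> Ix \<AA>" "s \<in> Hom ?P i j" for i j s
    using that rst_in_idem[OF sec_hom, of "?a i j s" i j] by (auto simp: Phi_Hom)
  have cin: "Cmp ?P i j k t s \<in> Hom ?P i k" if "i \<in> Ix \<AA>" "j \<in> Ix \<AA>" "k \<in> Ix \<AA>" "s \<in> Hom ?P i j" "t \<in> Hom ?P j k" for i j k s t
    using that arr_Phi_Cmp[OF that] pcomp_props(2)[OF that(1-3) sec(1)[OF that(1,2,4)] sec(1)[OF that(2,3,5)]] by (simp add: Phi_Hom)
  have iin: "idm \<AA> i \<in> Hom ?P i i" if "i \<in> Ix \<AA>" for i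
    using that un_sec[OF that] by (simp add: Phi_Hom idm_in un_def)
  have rin: "Rst ?P i j s \<in> Hom ?P i i" if "i \<in> Ix \<AA>" "j \<in> Ix \<AA>" "s \<in> Hom ?P i j" for i j s
    using that arr_Phi_Rst[OF that] sec_idem[OF un_sec[OF that(1)] sec(2)[OF that]] by (simp add: Phi_Hom)
  note [simp] = cin iin rin arr_Phi_Cmp(2) arr_Phi_Rst(2)
  have iun: "?a i i (idm \<AA> i) = un \<AA> i" for i by (simp add: un_def)
  note [simp] = iun
  show ?thesis
  proof (unfold_locales, goal_cases)
    case (1 x)
    then show ?case by simp
  next
    case (2 x y z f g)
    then show ?case by simp
  next
    case (3 x y f)
    show ?case by (rule eqI[of x y]) (use 3 in \<open>simp_all add: pcomp_un sec\<close>)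
  next
    case (4 x y f)
    show ?case by (rule eqI[of x y]) (use 4 in \<open>simp_all add: un_pcomp sec\<close>)
  next
    case (5 w x y z f g h)
    show ?case by (rule eqI[of w z]) (use 5 in \<open>simp_all add: pcomp_assoc sec\<close>)
  next
    case (6 x y f)
    then show ?case by simp
  next
    case (7 x y f)
    show ?case
      by (rule eqI[of x y]) (use 7 in \<open>simp_all add: pcomp_idem sec hom_rst[OF sec_hom[OF sec(1)]]\<close>)
  next
    case (8 x y z f g)
    show ?case
      by (rule eqI[of x x])
        (use 8 in \<open>simp_all add: pcomp_idem sec sec_idem un_sec cmp_assoc rst_comm\<close>)
  next
    case (9 x y z f g)
    show ?case
      by (rule eqI[of x x])
        (use 9 in \<open>simp_all add: pcomp_idem sec sec_idem un_sec cmp_assoc rst_cmp_idem\<close>)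
  next
    case (10 x y z f g)
    show ?case
    proof (rule eqI[of x y])
      have "rst (pcomp x y z (?a y z g) (?a x y f)) \<in> idem (A0 \<AA> x)"
        using 10 by (intro rst_in_idem[OF sec_hom[OF pcomp_props(2)]]) (auto simp: sec)
      then show "?a x y (Cmp ?P x y y (Rst ?P y z g) f) = ?a x y (Cmp ?P x x y f (Rst ?P x z (Cmp ?P x y z g f)))"
        using 10 by (simp add: pcomp_idem idem_pcomp sec pcomp_props(4))
    qed (use 10 in auto)
  qed
qed

end

section \<open>The functor \<open>\<Phi>\<close>\<close>

context internal
begin

lemma Phi_proj_simps:
  "i \<in> Ix \<AA> \<Longrightarrow> FOb (Phi_proj C \<AA>) i = A0 \<AA> i"
  "\<lbrakk>i \<in> Ix \<AA>; j \<in> Ix \<AA>; s \<in> Hom (Phi_cat C \<AA>) i j\<rbrakk> \<Longrightarrow> FHom (Phi_proj C \<AA>) i j s \<in> Hom C (A0 \<AA> i) (A0 \<AA> j)"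
  "\<lbrakk>i \<in> Ix \<AA>; j \<in> Ix \<AA>; s \<in> Hom (Phi_cat C \<AA>) i j\<rbrakk> \<Longrightarrow>
    arr (A0 \<AA> i) (A0 \<AA> j) (FHom (Phi_proj C \<AA>) i j s) = tg \<AA> i j \<cdot> arr (A0 \<AA> i) (A1 \<AA> i j) s"
  by (auto simp: Phi_proj_def Phi_Hom arr_Cmp tg_def intro: Cmp_in)

lemma restriction_functor_Phi_proj: "restriction_functor (Phi_cat C \<AA>) C (Phi_proj C \<AA>)"
proof -
  let ?P = "Phi_cat C \<AA>"
  interpret P: restriction_category ?P by (rule restriction_category_Phi)
  let ?a = "\<lambda>i j s. arr (A0 \<AA> i) (A1 \<AA> i j) s"
  have sec: "?a i j s \<in> sec i j" if "i \<in> Ix \<AA>" "j \<in> Ix \<AA>" "s \<in> Hom ?P i j" for i j s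
    using that by (auto simp: Phi_Hom)
  show ?thesis
  proof (unfold_locales, goal_cases)
    case (3 x)
    then have "idm \<AA> x \<in> Hom ?P x x" using P.Idn_in by simp
    with 3 show ?case
      by (intro arr_inj[of "A0 \<AA> x" "A0 \<AA> x"]) (auto simp: Phi_proj_simps Idn_in tg_un simp flip: un_def ide_def)
  next
    case (4 x y z f g)
    then have i: "x \<in> Ix \<AA>" "y \<in> Ix \<AA>" "z \<in> Ix \<AA>" by auto
    have c: "Cmp ?P x y z g f \<in> Hom ?P x z" using 4 by (intro P.Cmp_in) auto
    have "arr (A0 \<AA> x) (A0 \<AA> z) (FHom (Phi_proj C \<AA>) x z (Cmp ?P x y z g f)) =
       arr (A0 \<AA> x) (A0 \<AA> z) (Cmp C (A0 \<AA> x) (A0 \<AA> y) (A0 \<AA> z) (FHom (Phi_proj C \<AA>) y z g) (FHom (Phi_proj C \<AA>) x y f))"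
      using i 4 c by (simp add: Phi_proj_simps arr_Cmp arr_Phi_Cmp(2) pcomp_props(3) sec cmp_assoc)
    then have "FHom (Phi_proj C \<AA>) x z (Cmp ?P x y z g f) =
       Cmp C (A0 \<AA> x) (A0 \<AA> y) (A0 \<AA> z) (FHom (Phi_proj C \<AA>) y z g) (FHom (Phi_proj C \<AA>) x y f)"
      by (rule arr_inj) (use i 4 c in \<open>auto intro: Phi_proj_simps Cmp_in\<close>)
    then show ?case using i by (simp add: Phi_proj_simps(1))
  next
    case (5 x y f)
    then have i: "x \<in> Ix \<AA>" "y \<in> Ix \<AA>" by auto
    have c: "Rst ?P x y f \<in> Hom ?P x x" using 5 by (intro P.Rst_in) auto
    have h: "rst (?a x y f) \<in> hom (A0 \<AA> x) (A0 \<AA> x)" using rst_hom[OF sec_hom[OF sec]] i 5 by blast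
    have "arr (A0 \<AA> x) (A0 \<AA> x) (FHom (Phi_proj C \<AA>) x x (Rst ?P x y f)) =
       arr (A0 \<AA> x) (A0 \<AA> x) (Rst C (A0 \<AA> x) (A0 \<AA> y) (FHom (Phi_proj C \<AA>) x y f))"
      using i 5 c h by (simp add: Phi_proj_simps arr_Rst arr_Phi_Rst(2) cmp_reassoc[OF tg_un] ide_cmp_hom rst_tot[OF tg_tot hom_el[OF sec_hom[OF sec]]])
    then have "FHom (Phi_proj C \<AA>) x x (Rst ?P x y f) = Rst C (A0 \<AA> x) (A0 \<AA> y) (FHom (Phi_proj C \<AA>) x y f)"
      by (rule arr_inj) (use i 5 c in \<open>auto intro: Phi_proj_simps Rst_in\<close>)
    then show ?case using i by (simp add: Phi_proj_simps(1))
  qed (auto simp: Phi_proj_simps)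
qed

text \<open>Partial sections are particular arrows of \<open>C\<close>, so the hom-sets of
  \<open>Phi_cat\<close> inherit their bound from local smallness of \<open>C\<close>.\<close>

lemma over_object_Phi:
  assumes "|Ix \<AA>| <o \<kappa>" "locally_small \<kappa> C"
  shows "over_object \<kappa> C (Phi_cat C \<AA>, Phi_proj C \<AA>)"
proof -
  have "|Hom (Phi_cat C \<AA>) i j| <o \<kappa>" if i: "i \<in> Ix \<AA>" "j \<in> Ix \<AA>" for i j
  proof -
    have "|Hom (Phi_cat C \<AA>) i j| \<le>o |Hom C (A0 \<AA> i) (A1 \<AA> i j)|"
      by (rule card_of_mono1) (use i in \<open>auto simp: Phi_Hom\<close>)
    then show ?thesis using assms(2) i by (auto simp: locally_small_def intro: ordLeq_ordLess_trans)
  qed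
  then show ?thesis
    using assms(1) restriction_category_Phi restriction_functor_Phi_proj
    by (simp add: over_object_def small_cat_def locally_small_def)
qed

end

context cofunctor
begin

notation A.cmp (infixr "\<cdot>" 70)

text \<open>The action of \<open>Phi_map\<close> on object-free sections. The second coordinate is
  the identity of \<open>A0 \<BB> (cof F i)\<close> cut down to the preimage of the domain of
  \<open>s\<close>, which makes the pair match.\<close>

definition phi :: "'i \<Rightarrow> 'i \<Rightarrow> ('o, 'm) arrow \<Rightarrow> ('o, 'm) arrow" where
  "phi i j s = A.act \<AA> \<BB> F i j (s \<cdot> A.c0 \<AA> \<BB> F i) (A.rst (s \<cdot> A.c0 \<AA> \<BB> F i))"

lemma phi_props:
  assumes i: "i \<in> Ix \<AA>" "j \<in> Ix \<AA>" and s: "s \<in> A.sec i j"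
  shows "A.sr \<AA> i j \<cdot> s \<cdot> A.c0 \<AA> \<BB> F i = A.c0 \<AA> \<BB> F i \<cdot> A.rst (s \<cdot> A.c0 \<AA> \<BB> F i)" (is ?m)
    and "A.rst (s \<cdot> A.c0 \<AA> \<BB> F i) \<in> A.idem (A0 \<BB> (cof F i))" (is ?id)
    and "phi i j s \<in> B.sec (cof F i) (cof F j)" (is ?sec)
    and "A.c0 \<AA> \<BB> F j \<cdot> A.tg \<BB> (cof F i) (cof F j) \<cdot> phi i j s = A.tg \<AA> i j \<cdot> s \<cdot> A.c0 \<AA> \<BB> F i" (is ?tg)
    and "A.rst (phi i j s) = A.rst (s \<cdot> A.c0 \<AA> \<BB> F i)" (is ?rst)
proof -
  show m: ?m by (rule A.sr_sec_cmp[OF s])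
  have h: "s \<cdot> A.c0 \<AA> \<BB> F i \<in> A.hom (A0 \<BB> (cof F i)) (A1 \<AA> i j)"
    by (rule A.cmp_hom[OF A.sec_hom[OF s] c0_hom[OF i(1)]])
  show ?id by (rule A.rst_in_idem[OF h])
  note e = A.hom_el[OF h] A.hom_el[OF A.rst_hom[OF h]]
  show ?rst unfolding phi_def using rst_act[OF i e m] by simp
  then show ?sec
    unfolding B.sec_def using act_hom[OF i h A.rst_hom[OF h] m] sr_act[OF i e m] by (simp add: phi_def)
  show ?tg unfolding phi_def by (rule tg_act[OF i e m])
qed

lemma phi_cmp: "\<lbrakk>i \<in> Ix \<AA>; j \<in> Ix \<AA>; s \<in> A.sec i j\<rbrakk> \<Longrightarrow>
    phi i j s \<cdot> x = A.act \<AA> \<BB> F i j (s \<cdot> A.c0 \<AA> \<BB> F i \<cdot> x) (x \<cdot> A.rst (s \<cdot> A.c0 \<AA> \<BB> F i \<cdot> x))"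
  unfolding phi_def using phi_props(1,2)[of i j s] A.rst_swap[of "s \<cdot> A.c0 \<AA> \<BB> F i" x]
  by (simp add: act_cmp A.sec_el A.hom_el[OF A.idem_hom] A.cmp_assoc)

lemma phi_idem:
  assumes i: "i \<in> Ix \<AA>" "j \<in> Ix \<AA>" and s: "s \<in> A.sec i j" and e: "e \<in> A.idem (A0 \<AA> i)"
  shows "phi i j (s \<cdot> e) = phi i j s \<cdot> A.rst (e \<cdot> A.c0 \<AA> \<BB> F i)"
proof -
  let ?c = "A.c0 \<AA> \<BB> F i"
  define r where "r = A.rst (e \<cdot> ?c)"
  have ec: "e \<cdot> ?c = ?c \<cdot> r" using A.rst_swap[of e ?c] e by (simp add: A.idem_rst r_def)
  have "A.rst (s \<cdot> ?c \<cdot> r) = A.rst (s \<cdot> ?c) \<cdot> r"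
    using A.rst_cmp_rst[of "s \<cdot> ?c" "e \<cdot> ?c"] by (simp add: A.cmp_assoc r_def)
  moreover have "r \<cdot> A.rst (s \<cdot> ?c) \<cdot> r = A.rst (s \<cdot> ?c) \<cdot> r"
    unfolding r_def A.rst_left_comm[of "e \<cdot> ?c"] by simp
  ultimately have "r \<cdot> A.rst (s \<cdot> ?c \<cdot> r) = A.rst (s \<cdot> ?c \<cdot> r)" by simp
  then show ?thesis
    unfolding phi_cmp[OF i s] r_def[symmetric] by (simp add: phi_def A.cmp_assoc ec)
qed

lemma phi_un: "i \<in> Ix \<AA> \<Longrightarrow> phi i i (A.un \<AA> i) = A.un \<BB> (cof F i)"
proof -
  assume i: "i \<in> Ix \<AA>"
  let ?c = "A.c0 \<AA> \<BB> F i"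
  have "A.rst (A.un \<AA> i \<cdot> ?c) = A.ide (A0 \<BB> (cof F i))"
    using A.rst_tot[OF A.un_tot A.hom_el[OF c0_hom]] A.tot_rst[OF c0_tot] i by simp
  then show ?thesis unfolding phi_def
    using act_un[OF i A.hom_el[OF A.ide_hom]] i by (simp add: A.cmp_ide[OF c0_hom] A.cmp_ide[OF B.un_hom])
qed

text \<open>Let \<open>?r\<close> be the preimage, along the object component of \<open>F\<close>,
  of the domain of the composite section. Over \<open>?r\<close> the composite is a plain
  \<open>mu\<close>, so \<open>act_mu\<close> applies; the two factors it produces are
  \<open>phi\<close> of \<open>t\<close> and of \<open>s\<close> restricted to the same domain,
  which is the cut-down built into \<open>B.pcomp\<close>.\<close>

lemma phi_pcomp:
  assumes i: "i \<in> Ix \<AA>" "j \<in> Ix \<AA>" "k \<in> Ix \<AA>" and s: "s \<in> A.sec i j" and t: "t \<in> A.sec j k"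
  shows "phi i k (A.pcomp i j k t s) = B.pcomp (cof F i) (cof F j) (cof F k) (phi j k t) (phi i j s)"
proof -
  let ?\<tau> = "A.tg \<AA> i j" and ?\<tau>' = "A.tg \<BB> (cof F i) (cof F j)" let ?c = "A.c0 \<AA> \<BB> F i"
  let ?r = "A.rst (t \<cdot> ?\<tau> \<cdot> s \<cdot> ?c)"
  note p = A.pcomp_props[OF i s t] and ps = phi_props[OF i(1,2) s] and pt = phi_props[OF i(2,3) t]
  have h: "t \<cdot> ?\<tau> \<cdot> s \<cdot> ?c \<in> A.hom (A0 \<BB> (cof F i)) (A1 \<AA> j k)"
    by (rule A.cmp_hom[OF A.sec_hom[OF t] A.cmp_hom[OF A.tg_hom[OF i(1,2)] A.cmp_hom[OF A.sec_hom[OF s] c0_hom[OF i(1)]]]])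
  have re: "?r \<in> A.idem (A0 \<BB> (cof F i))" by (rule A.rst_in_idem[OF h])
  have sr: "A.rst (s \<cdot> ?c) \<cdot> ?r = ?r"
    using A.rst_cmp_rst_right[of "t \<cdot> ?\<tau>" "s \<cdot> ?c"] by (simp add: A.cmp_assoc A.rst_comm)
  have "A.rst (A.pcomp i j k t s \<cdot> ?c) = A.rst (A.rst (A.pcomp i j k t s) \<cdot> ?c)" by simp
  then have r: "A.rst (A.pcomp i j k t s \<cdot> ?c) = ?r" unfolding p(4) by (simp add: A.cmp_assoc)
  have "A.rst (t \<cdot> ?\<tau> \<cdot> s) \<cdot> ?c = ?c \<cdot> ?r"
    using A.rst_swap[of "t \<cdot> ?\<tau> \<cdot> s" ?c] by (simp add: A.cmp_assoc)
  then have m: "A.pcomp i j k t s \<cdot> ?c = A.mu \<AA> i j k (t \<cdot> ?\<tau> \<cdot> s \<cdot> ?c) (s \<cdot> ?c \<cdot> ?r)"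
    unfolding A.pcomp_def using A.mu_cmp[OF i A.sec_el[OF t] A.sec_el[OF s] p(1)] by (simp add: A.cmp_assoc)
  have f: "A.sr \<AA> i j \<cdot> s \<cdot> ?c \<cdot> ?r = ?c \<cdot> ?r"
    using A.cmp_reassoc[OF ps(1), of ?r] by (simp add: A.cmp_assoc sr)
  have g: "A.sr \<AA> j k \<cdot> t \<cdot> ?\<tau> \<cdot> s \<cdot> ?c = ?\<tau> \<cdot> s \<cdot> ?c \<cdot> ?r"
    using A.sr_sec_cmp[OF t, of "?\<tau> \<cdot> s \<cdot> ?c"] by (simp add: A.cmp_assoc)
  have af: "A.act \<AA> \<BB> F i j (s \<cdot> ?c \<cdot> ?r) ?r = phi i j s \<cdot> ?r"
  proof -
    have "A.rst (s \<cdot> ?c \<cdot> ?r) = ?r" using A.rst_cmp_idem[OF re, of "s \<cdot> ?c"] sr by (simp add: A.cmp_assoc)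
    then show ?thesis using phi_cmp[OF i(1,2) s, of ?r] by simp
  qed
  have "phi i k (A.pcomp i j k t s) = A.act \<AA> \<BB> F i k (A.mu \<AA> i j k (t \<cdot> ?\<tau> \<cdot> s \<cdot> ?c) (s \<cdot> ?c \<cdot> ?r)) ?r"
    by (simp add: phi_def r m flip: m)
  also have "\<dots> = A.mu \<BB> (cof F i) (cof F j) (cof F k) (A.act \<AA> \<BB> F j k (t \<cdot> ?\<tau> \<cdot> s \<cdot> ?c) (?\<tau>' \<cdot> phi i j s \<cdot> ?r)) (phi i j s \<cdot> ?r)"
    using act_mu[OF i A.sec_el[OF t] A.sec_el[OF s] A.hom_el[OF A.idem_hom[OF re]] g f] by (simp add: af)
  also have "A.act \<AA> \<BB> F j k (t \<cdot> ?\<tau> \<cdot> s \<cdot> ?c) (?\<tau>' \<cdot> phi i j s \<cdot> ?r) = phi j k t \<cdot> ?\<tau>' \<cdot> phi i j s"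
    using phi_cmp[OF i(2,3) t, of "?\<tau>' \<cdot> phi i j s"] by (simp add: ps(4) A.cmp_assoc)
  finally have e: "phi i k (A.pcomp i j k t s) = A.mu \<BB> (cof F i) (cof F j) (cof F k) (phi j k t \<cdot> ?\<tau>' \<cdot> phi i j s) (phi i j s \<cdot> ?r)" .
  have "A.rst (phi j k t \<cdot> ?\<tau>' \<cdot> phi i j s) = A.rst (A.rst (phi j k t) \<cdot> ?\<tau>' \<cdot> phi i j s)" by simp
  also have "\<dots> = ?r" unfolding pt(5) by (simp add: A.cmp_assoc ps(4))
  finally show ?thesis unfolding e B.pcomp_def by simp
qed

lemma arr_Phi_map:
  assumes i: "i \<in> Ix \<AA>" "j \<in> Ix \<AA>" and s: "s \<in> Hom (Phi_cat C \<AA>) i j"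
  shows "FHom (fst (Phi_map C \<AA> \<BB> F)) i j s \<in> Hom C (A0 \<BB> (cof F i)) (A1 \<BB> (cof F i) (cof F j))" (is ?in)
    and "A.arr (A0 \<BB> (cof F i)) (A1 \<BB> (cof F i) (cof F j)) (FHom (fst (Phi_map C \<AA> \<BB> F)) i j s) =
      phi i j (A.arr (A0 \<AA> i) (A1 \<AA> i j) s)" (is ?eq)
    and "FHom (fst (Phi_map C \<AA> \<BB> F)) i j s \<in> Hom (Phi_cat C \<BB>) (cof F i) (cof F j)"
proof -
  let ?b = "A0 \<BB> (cof F i)" let ?s = "A.arr (A0 \<AA> i) (A1 \<AA> i j) s" let ?K = "act_cospan \<AA> \<BB> F i j"
  have s': "s \<in> Hom C (A0 \<AA> i) (A1 \<AA> i j)" "?s \<in> A.sec i j"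
    using s i by (auto simp: A.Phi_Hom)
  note ok = act_ok[OF i]
  note [simp] = i A.pb_ob[OF ok] s'(1)
  let ?u = "Cmp C ?b (A0 \<AA> i) (A1 \<AA> i j) s (cof0 F i)"
  have u: "?u \<in> Hom C ?b (A1 \<AA> i j)" "Rst C ?b (A1 \<AA> i j) ?u \<in> Hom C ?b ?b"
    by (auto intro!: A.Cmp_in A.Rst_in)
  have au: "A.arr ?b (A1 \<AA> i j) ?u = ?s \<cdot> A.c0 \<AA> \<BB> F i" "A.arr ?b ?b (Rst C ?b (A1 \<AA> i j) ?u) = A.rst (?s \<cdot> A.c0 \<AA> \<BB> F i)"
    using u by (simp_all add: A.arr_Cmp A.arr_Rst A.c0_def)
  note p = A.pair_raw[OF ok, of ?b ?u "Rst C ?b (A1 \<AA> i j) ?u", simplified, unfolded au, OF u phi_props(1)[OF i s'(2)]]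
  have e: "FHom (fst (Phi_map C \<AA> \<BB> F)) i j s = Cmp C ?b (pb C ?K) (A1 \<BB> (cof F i) (cof F j)) (cof1 F i j)
      (pair C ?K ?b ?u (Rst C ?b (A1 \<AA> i j) ?u))"
    using s by (simp add: Phi_map_def Let_def)
  show 1: ?in unfolding e using p(1) cof1_in[OF i] by (auto intro!: A.Cmp_in)
  show 2: ?eq unfolding e using p(1,4) cof1_in[OF i] by (simp add: A.arr_Cmp phi_def A.act_def A.c1_def)
  show "FHom (fst (Phi_map C \<AA> \<BB> F)) i j s \<in> Hom (Phi_cat C \<BB>) (cof F i) (cof F j)"
    using 1 2 phi_props(3)[OF i s'(2)] by (simp add: B.Phi_Hom)
qed

lemma Phi_map_ob: "i \<in> Ix \<AA> \<Longrightarrow> FOb (fst (Phi_map C \<AA> \<BB> F)) i = cof F i"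
  "i \<in> Ix \<AA> \<Longrightarrow> snd (Phi_map C \<AA> \<BB> F) i = cof0 F i"
  "snd (Phi_map C \<AA> \<BB> F) \<in> extensional (Ix \<AA>)" "ext_ftor (Phi_cat C \<AA>) (fst (Phi_map C \<AA> \<BB> F))"
  by (simp_all add: Phi_map_def)

lemma over_map_Phi: "over_map C (Phi_cat C \<AA>, Phi_proj C \<AA>) (Phi_cat C \<BB>, Phi_proj C \<BB>) (Phi_map C \<AA> \<BB> F)"
proof -
  let ?F = "fst (Phi_map C \<AA> \<BB> F)" let ?A = "Phi_cat C \<AA>" let ?B = "Phi_cat C \<BB>"
  interpret PA: restriction_category ?A by (rule A.restriction_category_Phi)
  interpret PB: restriction_category ?B by (rule B.restriction_category_Phi)
  let ?a = "\<lambda>i j s. A.arr (A0 \<AA> i) (A1 \<AA> i j) s"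
  let ?b = "\<lambda>i j s. A.arr (A0 \<BB> i) (A1 \<BB> i j) s"
  have sec: "?a i j s \<in> A.sec i j" if "i \<in> Ix \<AA>" "j \<in> Ix \<AA>" "s \<in> Hom ?A i j" for i j s
    using that by (auto simp: A.Phi_Hom)
  have eqI: "s = t" if "i \<in> Ix \<BB>" "j \<in> Ix \<BB>" "s \<in> Hom ?B i j" "t \<in> Hom ?B i j" "?b i j s = ?b i j t" for i j s t
    using that by (auto simp: B.Phi_Hom intro: A.arr_inj)
  note [simp] = Phi_map_ob arr_Phi_map PA.Cmp_in[simplified] PA.Idn_in[simplified] PA.Rst_in[simplified]
    PB.Cmp_in[simplified] PB.Idn_in[simplified] PB.Rst_in[simplified] sec
  have F: "restriction_functor ?A ?B ?F"
  proof (unfold_locales, goal_cases)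
    case (3 x)
    then show ?case
      by (intro eqI[of "cof F x" "cof F x"]) (auto simp: phi_un simp flip: A.un_def)
  next
    case (4 x y z f g)
    then show ?case
      by (intro eqI[of "cof F x" "cof F z"]) (auto simp: phi_pcomp A.arr_Phi_Cmp B.arr_Phi_Cmp)
  next
    case (5 x y f)
    have "?b (cof F x) (cof F x) (FHom ?F x x (Rst ?A x y f)) = ?b (cof F x) (cof F x) (Rst ?B (cof F x) (cof F y) (FHom ?F x y f))"
      using 5 phi_idem[of x x "A.un \<AA> x" "A.rst (?a x y f)"] phi_props(5)[of x y "?a x y f"]
      by (simp add: A.arr_Phi_Rst B.arr_Phi_Rst phi_un A.un_sec A.rst_in_idem[OF A.sec_hom[OF sec]])
    with 5 show ?case
      by (intro eqI[of "cof F x" "cof F x"]) auto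
  qed auto
  have "over_map C (?A, Phi_proj C \<AA>) (?B, Phi_proj C \<BB>) (?F, snd (Phi_map C \<AA> \<BB> F))"
  proof (rule A.over_mapI[OF F _ _ A.restriction_functor_Phi_proj B.restriction_functor_Phi_proj])
    show "total_map C (FOb (Phi_proj C \<BB>) (FOb ?F x)) (FOb (Phi_proj C \<AA>) x) (snd (Phi_map C \<AA> \<BB> F) x)"
      if "x \<in> Ob ?A" for x using that by (simp add: A.Phi_proj_simps B.Phi_proj_simps cof0_total)
    fix x y f assume f: "x \<in> Ob ?A" "y \<in> Ob ?A" "f \<in> Hom ?A x y"
    then show "A.arr (FOb (Phi_proj C \<BB>) (FOb ?F y)) (FOb (Phi_proj C \<AA>) y) (snd (Phi_map C \<AA> \<BB> F) y) \<cdot>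
        A.arr (FOb (Phi_proj C \<BB>) (FOb ?F x)) (FOb (Phi_proj C \<BB>) (FOb ?F y)) (FHom (Phi_proj C \<BB>) (FOb ?F x) (FOb ?F y) (FHom ?F x y f)) =
        A.arr (FOb (Phi_proj C \<AA>) x) (FOb (Phi_proj C \<AA>) y) (FHom (Phi_proj C \<AA>) x y f) \<cdot>
        A.arr (FOb (Phi_proj C \<BB>) (FOb ?F x)) (FOb (Phi_proj C \<AA>) x) (snd (Phi_map C \<AA> \<BB> F) x)"
      using phi_props(4)[of x y "?a x y f"]
      by (simp add: A.Phi_proj_simps B.Phi_proj_simps A.cmp_assoc flip: A.c0_def)
  qed (auto simp: Phi_map_ob)
  then show ?thesis by simp
qed

end

lemma Phi_simps [simp]: "FOb (Phi C) \<AA> = (Phi_cat C \<AA>, Phi_proj C \<AA>)" "FHom (Phi C) = Phi_map C"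
  by (simp_all add: Phi_def)

section \<open>Functoriality of \<Phi>\<close>

context restriction_category
begin

lemma le_antisym:
  assumes "u \<cdot> rst v = v" "v \<cdot> rst u = u"
  shows "u = v"
proof -
  have "rst v = rst u \<cdot> rst v" "rst u = rst v \<cdot> rst u"
    using arg_cong[OF assms(1), of rst] arg_cong[OF assms(2), of rst] by simp_all
  then have r: "rst u = rst v" by (simp add: rst_comm)
  have "v \<cdot> rst v = (u \<cdot> rst v) \<cdot> rst v" by (simp only: assms(1))
  also have "\<dots> = u \<cdot> rst v" by (simp add: cmp_assoc)
  finally show ?thesis using assms r by simp
qed

lemma Phi_map_eqI:
  assumes "internal C \<AA>" "internal C \<BB>" "over_map C (Phi_cat C \<AA>, P) (Phi_cat C \<BB>, Q) m" "over_map C (Phi_cat C \<AA>, P) (Phi_cat C \<BB>, Q) n"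
    and "\<And>i. i \<in> Ix \<AA> \<Longrightarrow> FOb (fst m) i = FOb (fst n) i" "\<And>i. i \<in> Ix \<AA> \<Longrightarrow> snd m i = snd n i"
    and "\<And>i j s. \<lbrakk>i \<in> Ix \<AA>; j \<in> Ix \<AA>; s \<in> Hom (Phi_cat C \<AA>) i j\<rbrakk> \<Longrightarrow>
       arr (A0 \<BB> (FOb (fst m) i)) (A1 \<BB> (FOb (fst m) i) (FOb (fst m) j)) (FHom (fst m) i j s)
     = arr (A0 \<BB> (FOb (fst m) i)) (A1 \<BB> (FOb (fst m) i) (FOb (fst m) j)) (FHom (fst n) i j s)"
  shows "m = n"
proof -
  interpret A: internal C \<AA> by fact
  interpret B: internal C \<BB> by fact
  obtain F \<alpha> G \<beta> where mn: "m = (F, \<alpha>)" "n = (G, \<beta>)" by (cases m; cases n)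
  note m = assms(3)[unfolded mn over_map_iff] note n = assms(4)[unfolded mn over_map_iff]
  interpret F: restriction_functor "Phi_cat C \<AA>" "Phi_cat C \<BB>" F using m by simp
  interpret G: restriction_functor "Phi_cat C \<AA>" "Phi_cat C \<BB>" G using n by simp
  have "F = G"
  proof (rule ext_ftor_eqI[of "Phi_cat C \<AA>"])
    show "FHom F x y f = FHom G x y f" if f: "x \<in> Ob (Phi_cat C \<AA>)" "y \<in> Ob (Phi_cat C \<AA>)" "f \<in> Hom (Phi_cat C \<AA>) x y" for x y f
    proof (rule arr_inj)
      show "arr (A0 \<BB> (FOb F x)) (A1 \<BB> (FOb F x) (FOb F y)) (FHom F x y f) = arr (A0 \<BB> (FOb F x)) (A1 \<BB> (FOb F x) (FOb F y)) (FHom G x y f)"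
        using assms(7)[of x y f] f by (simp add: mn)
    qed (use f F.FHom_in[OF f] G.FHom_in[OF f] F.FOb_in[of x] F.FOb_in[of y] assms(5)[unfolded mn] in \<open>auto simp: B.Phi_Hom\<close>)
  qed (use m n assms(5) in \<open>auto simp: mn\<close>)
  moreover have "\<alpha> = \<beta>"
    by (rule extensionalityI[of _ "Ix \<AA>"]) (use m n assms(6) in \<open>auto simp: mn\<close>)
  ultimately show ?thesis by (simp add: mn)
qed

lemma cat_functor_Phi:
  assumes "locally_small \<kappa> C"
  shows "cat_functor (pCat \<kappa> C) (rCat_over \<kappa> C) (Phi C)"
proof
  fix \<AA> assume "\<AA> \<in> Ob (pCat \<kappa> C)"
  then interpret A: internal C \<AA> by (simp add: pCat_Ob)
  show ob: "FOb (Phi C) \<AA> \<in> Ob (rCat_over \<kappa> C)"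
    using \<open>\<AA> \<in> Ob (pCat \<kappa> C)\<close> A.over_object_Phi[OF _ assms] by (simp add: pCat_Ob)
  interpret R: category "rCat_over \<kappa> C" by (rule category_rCat_over)
  interpret I: cofunctor C \<AA> \<AA> "id_cofun C \<AA>" by (rule A.id_cofunctor)
  have c0: "cof0 A.I i = Idn C (A0 \<AA> i)" if "i \<in> Ix \<AA>" for i
    using that by (simp add: id_cofun_def)
  have "Phi_map C \<AA> \<AA> (id_cofun C \<AA>) = over_id C (FOb (Phi C) \<AA>)"
  proof (rule Phi_map_eqI)
    show "over_map C (Phi_cat C \<AA>, Phi_proj C \<AA>) (Phi_cat C \<AA>, Phi_proj C \<AA>) (over_id C (FOb (Phi C) \<AA>))"
      using R.Idn_in[OF ob] by simp
    fix i j s assume i: "i \<in> Ix \<AA>" "j \<in> Ix \<AA>" and s: "s \<in> Hom (Phi_cat C \<AA>) i j"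
    let ?s = "arr (A0 \<AA> i) (A1 \<AA> i j) s"
    have sec: "?s \<in> A.sec i j" using i s by (simp add: A.Phi_Hom)
    have "I.phi i j ?s = ?s"
      unfolding I.phi_def using i sec rst_hom[OF A.sec_hom[OF sec]]
      by (simp add: A.id_cofun_simps cmp_ide[OF A.sec_hom[OF sec]] A.act_id hom_el hom_el[OF A.sec_hom[OF sec]] A.sr_sec)
    then show "arr (A0 \<AA> (FOb (fst (Phi_map C \<AA> \<AA> A.I)) i)) (A1 \<AA> (FOb (fst (Phi_map C \<AA> \<AA> A.I)) i) (FOb (fst (Phi_map C \<AA> \<AA> A.I)) j))
        (FHom (fst (Phi_map C \<AA> \<AA> A.I)) i j s) =
       arr (A0 \<AA> (FOb (fst (Phi_map C \<AA> \<AA> A.I)) i)) (A1 \<AA> (FOb (fst (Phi_map C \<AA> \<AA> A.I)) i) (FOb (fst (Phi_map C \<AA> \<AA> A.I)) j))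
        (FHom (fst (over_id C (FOb (Phi C) \<AA>))) i j s)"
      using I.arr_Phi_map(2)[OF i s] i s by (simp add: I.Phi_map_ob A.id_cofun_simps over_id_def)
  qed (use I.over_map_Phi A.internal_axioms c0 in \<open>auto simp: I.Phi_map_ob A.id_cofun_simps over_id_def A.Phi_proj_simps\<close>)
  then show "FHom (Phi C) \<AA> \<AA> (Idn (pCat \<kappa> C) \<AA>) = Idn (rCat_over \<kappa> C) (FOb (Phi C) \<AA>)"
    by simp
next
  fix \<AA> \<BB> F assume "\<AA> \<in> Ob (pCat \<kappa> C)" "\<BB> \<in> Ob (pCat \<kappa> C)" "F \<in> Hom (pCat \<kappa> C) \<AA> \<BB>"
  then interpret F: cofunctor C \<AA> \<BB> F by (simp add: pCat_Hom)
  show "FHom (Phi C) \<AA> \<BB> F \<in> Hom (rCat_over \<kappa> C) (FOb (Phi C) \<AA>) (FOb (Phi C) \<BB>)"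
    using F.over_map_Phi by simp
next
  fix \<AA> \<BB> \<DD> F G assume ob: "\<AA> \<in> Ob (pCat \<kappa> C)" "\<BB> \<in> Ob (pCat \<kappa> C)" "\<DD> \<in> Ob (pCat \<kappa> C)"
    and h: "F \<in> Hom (pCat \<kappa> C) \<AA> \<BB>" "G \<in> Hom (pCat \<kappa> C) \<BB> \<DD>"
  interpret F: cofunctor C \<AA> \<BB> F using ob h by (simp add: pCat_Hom)
  interpret G: cofunctor C \<BB> \<DD> G using ob h by (simp add: pCat_Hom)
  interpret GF: cofunctor_pair C \<AA> \<BB> \<DD> F G
    by (simp add: cofunctor_pair_def F.cofunctor_axioms G.cofunctor_axioms)
  interpret H: cofunctor C \<AA> \<DD> GF.GF by (rule GF.comp_cofunctor)
  let ?P = "\<lambda>\<AA>. (Phi_cat C \<AA>, Phi_proj C \<AA>)"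
  let ?c = "over_comp C (?P \<AA>) (?P \<BB>) (?P \<DD>) (Phi_map C \<BB> \<DD> G) (Phi_map C \<AA> \<BB> F)"
  obtain F' \<alpha> G' \<beta> where FG: "Phi_map C \<AA> \<BB> F = (F', \<alpha>)" "Phi_map C \<BB> \<DD> G = (G', \<beta>)" by fastforce
  have c: "?c = (comp_ftor (Phi_cat C \<AA>) G' F', \<lambda>x\<in>Ix \<AA>. Cmp C (A0 \<DD> (cof G (cof F x))) (A0 \<BB> (cof F x)) (A0 \<AA> x) (cof0 F x) (cof0 G (cof F x)))"
    unfolding FG over_comp_pair using F.Phi_map_ob[unfolded FG fst_conv snd_conv] G.Phi_map_ob[unfolded FG fst_conv snd_conv]
    by (auto simp: F.A.Phi_proj_simps F.B.Phi_proj_simps G.B.Phi_proj_simps intro!: restrict_ext)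
  have "Phi_map C \<AA> \<DD> GF.GF = ?c"
  proof (rule Phi_map_eqI)
    have "over_map C (?P \<AA>) (?P \<BB>) (Phi_map C \<AA> \<BB> F)" "over_map C (?P \<BB>) (?P \<DD>) (Phi_map C \<BB> \<DD> G)"
      by (rule F.over_map_Phi G.over_map_Phi)+
    moreover have "over_object \<kappa> C (?P \<AA>)" "over_object \<kappa> C (?P \<BB>)" "over_object \<kappa> C (?P \<DD>)"
      using ob assms by (auto simp: pCat_Ob intro: internal.over_object_Phi)
    ultimately show "over_map C (?P \<AA>) (?P \<DD>) ?c"
      using category.Cmp_in[OF category_rCat_over[of \<kappa>], of "?P \<AA>" "?P \<BB>" "?P \<DD>"] by simp
    fix i j s assume i: "i \<in> Ix \<AA>" "j \<in> Ix \<AA>" and s: "s \<in> Hom (Phi_cat C \<AA>) i j"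
    let ?s = "arr (A0 \<AA> i) (A1 \<AA> i j) s" let ?i = "cof F i" let ?j = "cof F j"
    note [simp] = i
    have sec: "?s \<in> F.A.sec i j" using i s by (simp add: F.A.Phi_Hom)
    have fs: "FHom F' i j s \<in> Hom (Phi_cat C \<BB>) ?i ?j" "arr (A0 \<BB> ?i) (A1 \<BB> ?i ?j) (FHom F' i j s) = F.phi i j ?s"
      using F.arr_Phi_map[OF i s] by (simp_all add: FG)
    let ?c = "c0 \<AA> \<BB> F i" let ?d = "c0 \<BB> \<DD> G ?i"
    note ps = F.phi_props[OF i sec]
    have "G.phi ?i ?j (F.phi i j ?s) = act \<BB> \<DD> G ?i ?j (F.phi i j ?s \<cdot> ?d) (rst (F.phi i j ?s \<cdot> ?d))"
      by (simp add: G.phi_def)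
    also have "rst (F.phi i j ?s \<cdot> ?d) = rst (rst (F.phi i j ?s) \<cdot> ?d)" by simp
    also have "\<dots> = rst (?s \<cdot> ?c \<cdot> ?d)" unfolding ps(5) by (simp add: cmp_assoc)
    also have "F.phi i j ?s \<cdot> ?d = act \<AA> \<BB> F i j (?s \<cdot> ?c \<cdot> ?d) (?d \<cdot> rst (?s \<cdot> ?c \<cdot> ?d))"
      by (rule F.phi_cmp[OF i sec])
    also have "act \<BB> \<DD> G ?i ?j (act \<AA> \<BB> F i j (?s \<cdot> ?c \<cdot> ?d) (?d \<cdot> rst (?s \<cdot> ?c \<cdot> ?d))) (rst (?s \<cdot> ?c \<cdot> ?d))
      = act \<AA> \<DD> GF.GF i j (?s \<cdot> ?c \<cdot> ?d) (rst (?s \<cdot> ?c \<cdot> ?d))"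
    proof (rule GF.act_comp[symmetric, OF i F.A.sec_el[OF sec]])
      have "?s \<cdot> ?c \<cdot> ?d \<in> hom (A0 \<DD> (cof G ?i)) (A1 \<AA> i j)"
        by (intro cmp_hom[OF F.A.sec_hom[OF sec]] cmp_hom[OF F.c0_hom] G.c0_hom) auto
      then show "rst (?s \<cdot> ?c \<cdot> ?d) \<in> el (A0 \<DD> (cof G ?i))" by (rule hom_el[OF rst_hom])
      show "sr \<AA> i j \<cdot> ?s \<cdot> ?c \<cdot> ?d = ?c \<cdot> ?d \<cdot> rst (?s \<cdot> ?c \<cdot> ?d)"
        using F.A.sr_sec_cmp[OF sec, of "?c \<cdot> ?d"] by (simp add: cmp_assoc)
    qed
    also have "\<dots> = H.phi i j ?s" by (simp add: H.phi_def GF.comp_c0)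
    finally have "G.phi ?i ?j (F.phi i j ?s) = H.phi i j ?s" .
    moreover have "FHom G' ?i ?j (FHom F' i j s) = FHom (fst (Phi_map C \<BB> \<DD> G)) ?i ?j (FHom F' i j s)" by (simp add: FG)
    ultimately have e: "arr (A0 \<DD> (cof G ?i)) (A1 \<DD> (cof G ?i) (cof G ?j)) (FHom G' ?i ?j (FHom F' i j s)) = H.phi i j ?s"
      using G.arr_Phi_map(2)[OF _ _ fs(1)] fs(2) by simp
    have F'o: "FOb F' i = ?i" "FOb F' j = ?j" using F.Phi_map_ob(1) i by (simp_all add: FG)
    let ?H = "fst (Phi_map C \<AA> \<DD> GF.GF)"
    show "arr (A0 \<DD> (FOb ?H i)) (A1 \<DD> (FOb ?H i) (FOb ?H j)) (FHom ?H i j s) =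
       arr (A0 \<DD> (FOb ?H i)) (A1 \<DD> (FOb ?H i) (FOb ?H j)) (FHom (fst (over_comp C (?P \<AA>) (?P \<BB>) (?P \<DD>) (Phi_map C \<BB> \<DD> G) (Phi_map C \<AA> \<BB> F))) i j s)"
      unfolding c using H.arr_Phi_map(2)[OF i s] s by (simp add: H.Phi_map_ob F'o e)
  qed (use H.over_map_Phi F.A.internal_axioms G.B.internal_axioms F.Phi_map_ob[unfolded FG fst_conv snd_conv]
      G.Phi_map_ob[unfolded FG fst_conv snd_conv] in \<open>auto simp: H.Phi_map_ob c GF.comp_cof0\<close>)
  then show "FHom (Phi C) \<AA> \<DD> (Cmp (pCat \<kappa> C) \<AA> \<BB> \<DD> G F) =
       Cmp (rCat_over \<kappa> C) (FOb (Phi C) \<AA>) (FOb (Phi C) \<BB>) (FOb (Phi C) \<DD>) (FHom (Phi C) \<BB> \<DD> G) (FHom (Phi C) \<AA> \<BB> F)"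
    by simp
qed

end

section \<open>Joins and hyperconnectedness of \<open>\<Phi>\<close>\<close>

locale jinternal = join_restriction_category C + internal C \<AA> for C :: "('o, 'm) rcat" and \<AA> :: "('i, 'o, 'm) pcat"
begin

text \<open>Given a join f in \<open>Phi_cat\<close>, the family is bounded in \<open>C\<close> and
  so has a join m there. As m is below f, it is f restricted to \<open>rst m\<close>, hence itself a
  section and an upper bound in \<open>Phi_cat\<close>; minimality of f and antisymmetry give m =
  f.\<close>

lemma Phi_is_join_iff:
  assumes i: "i \<in> Ix \<AA>" "j \<in> Ix \<AA>" and S: "S \<subseteq> Hom (Phi_cat C \<AA>) i j" and f: "f \<in> Hom (Phi_cat C \<AA>) i j"
  shows "is_join (Phi_cat C \<AA>) i j S f \<longleftrightarrow> lub (A0 \<AA> i) (A1 \<AA> i j) (arr (A0 \<AA> i) (A1 \<AA> i j) ` S) (arr (A0 \<AA> i) (A1 \<AA> i j) f)"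
    (is "?J \<longleftrightarrow> ?L")
proof -
  let ?P = "Phi_cat C \<AA>" let ?a = "arr (A0 \<AA> i) (A1 \<AA> i j)"
  interpret P: restriction_category ?P by (rule restriction_category_Phi)
  have le: "map_le ?P i j s t \<longleftrightarrow> ?a t \<cdot> rst (?a s) = ?a s" if "s \<in> Hom ?P i j" "t \<in> Hom ?P i j" for s t
  proof -
    have r: "Rst ?P i j s \<in> Hom ?P i i" using that i by (simp add: P.Rst_in)
    have c: "Cmp ?P i i j t (Rst ?P i j s) \<in> Hom ?P i j" using that i r by (simp add: P.Cmp_in)
    have sec: "?a t \<in> sec i j" "?a s \<in> sec i j" using that i by (simp_all add: Phi_Hom)
    have "?a (Cmp ?P i i j t (Rst ?P i j s)) = ?a t \<cdot> rst (?a s)"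
      using that i r by (simp add: arr_Phi_Cmp arr_Phi_Rst pcomp_idem sec rst_in_idem[OF sec_hom[OF sec(2)]])
    moreover have "s = Cmp ?P i i j t (Rst ?P i j s) \<longleftrightarrow> ?a s = ?a (Cmp ?P i i j t (Rst ?P i j s))"
      using that c i by (intro arr_eq_iff) (auto simp: Phi_Hom)
    ultimately show ?thesis by (auto simp: map_le_def)
  qed
  have sub: "Hom ?P i j \<subseteq> Hom C (A0 \<AA> i) (A1 \<AA> i j)" using i by (auto simp: Phi_Hom)
  have ah: "?a s \<in> hom (A0 \<AA> i) (A1 \<AA> i j)" if "s \<in> Hom ?P i j" for s
    using that sub i by (auto intro: homI)
  show ?thesis
  proof
    assume L: ?L
    show ?J unfolding is_join_def
    proof (intro conjI ballI impI f)
      show "map_le ?P i j s f" if "s \<in> S" for s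
        using lub_upper[OF L, of "?a s"] that S f by (auto simp: le)
      show "map_le ?P i j f h" if h: "h \<in> Hom ?P i j" "\<forall>s\<in>S. map_le ?P i j s h" for h
        using lub_least[OF L ah[OF h(1)]] h S f le by (auto simp: subset_eq)
    qed
  next
    assume J: ?J
    have up: "?a f \<cdot> rst (?a s) = ?a s" if "s \<in> S" for s
      using J le[of s f] that S f by (auto simp: is_join_def)
    have "\<exists>m. lub (A0 \<AA> i) (A1 \<AA> i j) (?a ` S) m"
    proof (rule lub_exists)
      show "u \<cdot> rst v = v \<cdot> rst u" if "u \<in> ?a ` S" "v \<in> ?a ` S" for u v
        using that up by (auto intro!: below_compatible[of "?a f"])
    qed (use i S ah in auto)
    then obtain m where m: "lub (A0 \<AA> i) (A1 \<AA> i j) (?a ` S) m" ..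
    note mh = lub_hom[OF m]
    have fm: "?a f \<cdot> rst m = m" by (rule lub_least[OF m ah[OF f]]) (auto simp: up)
    then have "m \<in> sec i j" using sec_idem[OF _ rst_in_idem[OF mh], of "?a f" j] f i by (simp add: Phi_Hom)
    then have m': "mor m \<in> Hom ?P i j" "?a (mor m) = m" using i mh by (auto simp: sec_mor arr_mor)
    have "map_le ?P i j f (mor m)"
      using J m' lub_upper[OF m] S unfolding is_join_def by (auto simp: le subset_eq)
    then have "m \<cdot> rst (?a f) = ?a f" using m' f by (simp add: le)
    then have "m = ?a f" using fm by (rule le_antisym)
    then show ?L using m by simp
  qed
qed

lemma join_restriction_Phi: "join_restriction_category (Phi_cat C \<AA>)"
proof -
  let ?P = "Phi_cat C \<AA>" let ?a = "\<lambda>i j s. arr (A0 \<AA> i) (A1 \<AA> i j) s"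
  interpret P: restriction_category ?P by (rule restriction_category_Phi)
  show ?thesis
  proof (unfold_locales, goal_cases)
    case (1 i j S)
    then have i: "i \<in> Ix \<AA>" "j \<in> Ix \<AA>" and S: "S \<subseteq> Hom ?P i j" by auto
    have sec: "?a i j s \<in> sec i j" if "s \<in> S" for s using that S i by (auto simp: Phi_Hom)
    have comp: "?a i j s \<cdot> rst (?a i j t) = ?a i j t \<cdot> rst (?a i j s)" if st: "s \<in> S" "t \<in> S" for s t
    proof -
      have h: "s \<in> Hom ?P i j" "t \<in> Hom ?P i j" using st S by auto
      then have r: "Rst ?P i j s \<in> Hom ?P i i" "Rst ?P i j t \<in> Hom ?P i i" using i by (simp_all add: P.Rst_in)
      have "?a i j (Cmp ?P i i j s (Rst ?P i j t)) = ?a i j (Cmp ?P i i j t (Rst ?P i j s))"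
        using 1(4)[OF st] by (simp add: compatible_def)
      then show ?thesis
        using h i r st by (simp add: arr_Phi_Cmp arr_Phi_Rst pcomp_idem sec rst_in_idem[OF sec_hom[OF sec]])
    qed
    have "\<exists>m. lub (A0 \<AA> i) (A1 \<AA> i j) (?a i j ` S) m"
      by (rule lub_exists) (use i sec comp in \<open>auto intro: sec_hom\<close>)
    then obtain m where m: "lub (A0 \<AA> i) (A1 \<AA> i j) (?a i j ` S) m" ..
    note mh = lub_hom[OF m]
    \<comment> \<open>The join taken in \<open>C\<close> is again a partial section: the section
      equation holds on the domain of each member, and these cover the domain of
      \<open>m\<close>.\<close>
    have "sr \<AA> i j \<cdot> m = rst m"
    proof (rule lub_eqI[OF lub_rst[OF m]])
      show "sr \<AA> i j \<cdot> m \<in> hom (A0 \<AA> i) (A0 \<AA> i)" "rst m \<in> hom (A0 \<AA> i) (A0 \<AA> i)"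
        using mh i by (auto intro: cmp_hom sr_hom rst_hom)
      show "rst ` ?a i j ` S \<subseteq> idem (A0 \<AA> i)" using sec by (auto intro: rst_in_idem[OF sec_hom])
      fix e assume "e \<in> rst ` ?a i j ` S"
      then obtain s where s: "s \<in> S" "e = rst (?a i j s)" by auto
      then have u: "m \<cdot> e = ?a i j s" using lub_upper[OF m] by auto
      then have "rst m \<cdot> e = e" using s by (metis rst_cmp_rst)
      then show "(sr \<AA> i j \<cdot> m) \<cdot> e = rst m \<cdot> e"
        using u s sr_sec[OF sec[OF s(1)]] by (simp add: cmp_assoc)
    qed (use mh in \<open>auto simp: cmp_assoc cmp_rst_self[OF hom_el]\<close>)
    then have "m \<in> sec i j" using mh by (simp add: sec_def)
    then have "mor m \<in> Hom ?P i j" "?a i j (mor m) = m" using i mh by (auto simp: sec_mor arr_mor)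
    then show ?case using m by (intro exI[of _ "mor m"]) (simp add: Phi_is_join_iff[OF i S])
  next
    case (2 w x y S f h)
    then have i: "w \<in> Ix \<AA>" "x \<in> Ix \<AA>" "y \<in> Ix \<AA>" and S: "S \<subseteq> Hom ?P x y" by auto
    have f: "f \<in> Hom ?P x y" using 2(6) by (simp add: is_join_def)
    have L: "lub (A0 \<AA> x) (A1 \<AA> x y) (?a x y ` S) (?a x y f)"
      using 2(6) Phi_is_join_iff[OF i(2,3) S f] by simp
    let ?h = "?a w x h" let ?\<tau> = "tg \<AA> w x"
    have hs: "?h \<in> sec w x" using 2(7) i by (simp add: Phi_Hom)
    have ss: "?a x y s \<in> sec x y" if "s \<in> insert f S" for s using that S f i by (auto simp: Phi_Hom)
    have c: "Cmp ?P w x y s h \<in> Hom ?P w y" "?a w y (Cmp ?P w x y s h) = pcomp w x y (?a x y s) ?h" if "s \<in> insert f S" for s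
      using that S f i 2(7) by (auto simp: arr_Phi_Cmp intro!: P.Cmp_in)
    have pc: "pcomp w x y (?a x y s) ?h \<in> sec w y" "rst (pcomp w x y (?a x y s) ?h) = rst (?a x y s \<cdot> ?\<tau> \<cdot> ?h)"
       "sr \<AA> x y \<cdot> ?a x y s \<cdot> ?\<tau> \<cdot> ?h = ?\<tau> \<cdot> ?h \<cdot> rst (?a x y s \<cdot> ?\<tau> \<cdot> ?h)" if "s \<in> insert f S" for s
      using pcomp_props[OF i hs ss[OF that]] by auto
    let ?f = "?a x y f"
    \<comment> \<open>Precomposition in \<open>Phi_cat\<close> involves \<open>mu\<close> and is not
      precomposition in \<open>C\<close>. By \<open>lubI\<close> it is enough that the proposed join
      is an upper bound and that the domains join up; the latter is stability in \<open>C\<close>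
      along \<open>?\<tau> \<cdot> ?h\<close>.\<close>
    have "lub (A0 \<AA> w) (A1 \<AA> w y) ((\<lambda>s. pcomp w x y (?a x y s) ?h) ` S) (pcomp w x y ?f ?h)"
    proof (rule lubI)
      have th: "?\<tau> \<cdot> ?h \<in> hom (A0 \<AA> w) (A0 \<AA> x)" using i hs by (auto intro: cmp_hom tg_hom sec_hom)
      have "lub (A0 \<AA> w) (A0 \<AA> w) (rst ` (\<lambda>s. s \<cdot> ?\<tau> \<cdot> ?h) ` ?a x y ` S) (rst (?f \<cdot> ?\<tau> \<cdot> ?h))"
        by (rule lub_rst[OF lub_precomp[OF L th]])
      then show "lub (A0 \<AA> w) (A0 \<AA> w) (rst ` (\<lambda>s. pcomp w x y (?a x y s) ?h) ` S) (rst (pcomp w x y ?f ?h))"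
        using pc(2) by (simp add: image_image cong: image_cong)
      fix u assume "u \<in> (\<lambda>s. pcomp w x y (?a x y s) ?h) ` S"
      then obtain s where s: "s \<in> S" "u = pcomp w x y (?a x y s) ?h" by auto
      let ?s = "?a x y s" let ?r = "rst (?s \<cdot> ?\<tau> \<cdot> ?h)"
      have le: "?f \<cdot> rst ?s = ?s" using lub_upper[OF L] s by auto
      have e: "?f \<cdot> ?\<tau> \<cdot> ?h \<cdot> ?r = ?s \<cdot> ?\<tau> \<cdot> ?h"
      proof -
        have "?f \<cdot> ?\<tau> \<cdot> ?h \<cdot> ?r = ?f \<cdot> rst ?s \<cdot> ?\<tau> \<cdot> ?h" using rst_swap[of ?s "?\<tau> \<cdot> ?h"] by (simp add: cmp_assoc)
        then show ?thesis by (simp add: cmp_reassoc[OF le])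
      qed
      then have e2: "rst (?f \<cdot> ?\<tau> \<cdot> ?h) \<cdot> ?r = ?r" by (metis cmp_assoc rst_cmp_rst)
      have "pcomp w x y ?f ?h \<cdot> ?r = mu \<AA> w x y ((?f \<cdot> ?\<tau> \<cdot> ?h) \<cdot> ?r) ((?h \<cdot> rst (?f \<cdot> ?\<tau> \<cdot> ?h)) \<cdot> ?r)"
        unfolding pcomp_def using pc(3)[of f] by (intro mu_cmp[OF i]) (auto intro: sec_el[OF ss] sec_el[OF hs])
      also have "\<dots> = pcomp w x y ?s ?h" by (simp add: cmp_assoc e e2 pcomp_def)
      finally show "pcomp w x y ?f ?h \<cdot> rst u = u" using s pc(2)[of s] by simp
    qed (use pc(1) in \<open>auto intro: sec_hom\<close>)
    moreover have "?a w y ` (\<lambda>s. Cmp ?P w x y s h) ` S = (\<lambda>s. pcomp w x y (?a x y s) ?h) ` S"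
      using c(2) by (simp add: image_image cong: image_cong)
    ultimately show ?case
      using c by (subst Phi_is_join_iff[OF i(1,3)]) auto
  qed
qed

text \<open>A restriction idempotent \<open>s\<close> of \<open>Phi_cat\<close> has the form
  \<open>un \<AA> x\<close> composed with its own restriction, and the target map takes this to that
  restriction. So the inverse sends an idempotent e of \<open>C\<close> to
  \<open>un \<AA> x \<cdot> e\<close>.\<close>

lemma hyperconnected_Phi: "hyperconnected (Phi_cat C \<AA>) C (Phi_proj C \<AA>)"
  unfolding hyperconnected_def
proof
  fix x assume "x \<in> Ob (Phi_cat C \<AA>)"
  then have x: "x \<in> Ix \<AA>" by simp
  let ?P = "Phi_cat C \<AA>" let ?a = "arr (A0 \<AA> x) (A1 \<AA> x x)"
  have I: "s \<in> rst_idems ?P x \<longleftrightarrow> s \<in> Hom ?P x x \<and> un \<AA> x \<cdot> rst (?a s) = ?a s" for s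
  proof (cases "s \<in> Hom ?P x x")
    case True
    then have "Rst ?P x x s = s \<longleftrightarrow> ?a (Rst ?P x x s) = ?a s"
      using x arr_Phi_Rst(1)[OF x x True] by (intro arr_eq_iff) (auto simp: Phi_Hom)
    then show ?thesis using True x by (simp add: rst_idems_def arr_Phi_Rst)
  qed (simp add: rst_idems_def)
  have p: "arr (A0 \<AA> x) (A0 \<AA> x) (FHom (Phi_proj C \<AA>) x x s) = rst (?a s)" if s: "s \<in> rst_idems ?P x" for s
  proof -
    have h: "s \<in> Hom ?P x x" "un \<AA> x \<cdot> rst (?a s) = ?a s" using s I by auto
    then have r: "rst (?a s) \<in> hom (A0 \<AA> x) (A0 \<AA> x)" using x by (auto simp: Phi_Hom intro: rst_hom sec_hom)
    have "arr (A0 \<AA> x) (A0 \<AA> x) (FHom (Phi_proj C \<AA>) x x s) = tg \<AA> x x \<cdot> un \<AA> x \<cdot> rst (?a s)"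
      using h x by (simp add: Phi_proj_simps)
    also have "\<dots> = rst (?a s)" using x r by (simp add: cmp_reassoc[OF tg_un] ide_cmp_hom)
    finally show ?thesis .
  qed
  have "bij_betw (FHom (Phi_proj C \<AA>) x x) (rst_idems ?P x) (rst_idems C (A0 \<AA> x))"
    unfolding bij_betw_def
  proof (intro conjI equalityI subsetI)
    show "inj_on (FHom (Phi_proj C \<AA>) x x) (rst_idems ?P x)"
    proof (rule inj_onI)
      fix s t assume st: "s \<in> rst_idems ?P x" "t \<in> rst_idems ?P x" "FHom (Phi_proj C \<AA>) x x s = FHom (Phi_proj C \<AA>) x x t"
      then have "rst (?a s) = rst (?a t)" using p by metis
      then have "?a s = ?a t" using st I by metis
      then show "s = t" by (rule arr_inj) (use st x in \<open>auto simp: I Phi_Hom\<close>)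
    qed
  next
    fix e assume "e \<in> FHom (Phi_proj C \<AA>) x x ` rst_idems ?P x"
    then obtain s where s: "s \<in> rst_idems ?P x" "e = FHom (Phi_proj C \<AA>) x x s" by auto
    then have "s \<in> Hom ?P x x" using I by simp
    then show "e \<in> rst_idems C (A0 \<AA> x)"
      using s p[OF s(1)] x rst_in_idem[OF sec_hom, of "?a s" x x] by (simp add: rst_idems_iff Phi_proj_simps Phi_Hom)
  next
    fix e assume e: "e \<in> rst_idems C (A0 \<AA> x)"
    let ?e = "arr (A0 \<AA> x) (A0 \<AA> x) e"
    have ei: "?e \<in> idem (A0 \<AA> x)" "e \<in> Hom C (A0 \<AA> x) (A0 \<AA> x)" using e x by (auto simp: rst_idems_iff)
    define s where "s = mor (un \<AA> x \<cdot> ?e)"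
    have "un \<AA> x \<cdot> ?e \<in> sec x x" by (rule sec_idem[OF un_sec[OF x] ei(1)])
    then have s: "s \<in> Hom ?P x x" "?a s = un \<AA> x \<cdot> ?e" unfolding s_def using x by (auto simp: sec_mor arr_mor[OF sec_hom])
    have r: "rst (un \<AA> x \<cdot> ?e) = ?e"
      using rst_tot[OF un_tot[OF x] hom_el[OF idem_hom[OF ei(1)]]] ei(1) by (simp add: idem_rst)
    have sI: "s \<in> rst_idems ?P x" using s r by (simp add: I)
    have "FHom (Phi_proj C \<AA>) x x s = e"
      by (rule arr_inj[of "A0 \<AA> x" "A0 \<AA> x"]) (use p[OF sI] s r x ei in \<open>auto simp: Phi_proj_simps\<close>)
    then show "e \<in> FHom (Phi_proj C \<AA>) x x ` rst_idems ?P x" using sI by blast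
  qed
  then show "bij_betw (FHom (Phi_proj C \<AA>) x x) (rst_idems ?P x) (rst_idems C (FOb (Phi_proj C \<AA>) x))"
    using x by (simp add: Phi_proj_simps)
qed

lemma join_hyperconnected_Phi: "join_hyperconnected C (Phi_cat C \<AA>, Phi_proj C \<AA>)"
  by (simp add: join_hyperconnected_def join_restriction_Phi hyperconnected_Phi)

end

section \<open>Glueings\<close>

locale glue_loc = join_restriction_category C for C :: "('o, 'm) rcat" +
  fixes x :: 'o and I :: "'k set" and \<phi> a p q s
  assumes x_ob [simp]: "x \<in> Ob C" and glue: "is_glueing C x I \<phi> a p q s"
begin

abbreviation "pA \<equiv> arr a x p"
abbreviation "qA k \<equiv> arr a x (q k)"
abbreviation "sA k \<equiv> arr x a (s k)"
abbreviation "phiA k l \<equiv> arr x x (\<phi> k l)"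

lemma a_ob [simp]: "a \<in> Ob C"
  using glue by (simp add: is_glueing_def)

lemma p_tot: "pA \<in> tot a x"
  using glue by (simp add: is_glueing_def local_homeo_def arr_tot)

lemma raw_in: "k \<in> I \<Longrightarrow> q k \<in> Hom C a x" "k \<in> I \<Longrightarrow> s k \<in> Hom C x a"
  using glue by (auto simp: is_glueing_def partial_inverse_def)

lemma q_hom: "k \<in> I \<Longrightarrow> qA k \<in> hom a x" and s_hom: "k \<in> I \<Longrightarrow> sA k \<in> hom x a"
  using raw_in by (auto simp: homI)

lemma s_q: "k \<in> I \<Longrightarrow> sA k \<cdot> qA k = rst (qA k)" and q_s_self: "k \<in> I \<Longrightarrow> qA k \<cdot> sA k = rst (sA k)"
proof -
  assume k: "k \<in> I"
  have "Cmp C a x a (s k) (q k) = Rst C a x (q k)" "Cmp C x a x (q k) (s k) = Rst C x a (s k)"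
    using glue k by (simp_all add: is_glueing_def partial_inverse_def)
  then have "arr a a (Cmp C a x a (s k) (q k)) = arr a a (Rst C a x (q k))"
    "arr x x (Cmp C x a x (q k) (s k)) = arr x x (Rst C x a (s k))" by simp_all
  then show "sA k \<cdot> qA k = rst (qA k)" "qA k \<cdot> sA k = rst (sA k)"
    using raw_in[OF k] by (simp_all add: arr_Cmp arr_Rst)
qed

lemma q_s: "\<lbrakk>k \<in> I; l \<in> I\<rbrakk> \<Longrightarrow> qA l \<cdot> sA k = phiA k l"
  using glue raw_in by (simp add: is_glueing_def arr_Cmp)

lemma lub_q: "lub a x (qA ` I) pA"
proof -
  have "is_join C a x (q ` I) p" "p \<in> Hom C a x"
    using glue by (auto simp: is_glueing_def is_join_def)
  moreover have "q ` I \<subseteq> Hom C a x" using raw_in by auto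
  ultimately have "lub a x (arr a x ` q ` I) pA" by (simp add: lub_iff)
  then show ?thesis by (simp add: image_image)
qed

lemma p_rst_q: "k \<in> I \<Longrightarrow> pA \<cdot> rst (qA k) = qA k"
  using lub_upper[OF lub_q] by blast

lemma rst_q_s: "k \<in> I \<Longrightarrow> rst (qA k) \<cdot> sA k = sA k"
  using rst_swap[of "qA k" "sA k"] hom_rst[OF s_hom] by (simp add: q_s_self)

lemma p_s: "k \<in> I \<Longrightarrow> pA \<cdot> sA k = rst (sA k)"
  using cmp_reassoc[OF p_rst_q, of k "sA k"] by (simp add: rst_q_s q_s_self)

lemma cov_q: "cov a (ide a) I (\<lambda>k. rst (qA k))"
  using cov_lub[OF lub_q] tot_rst[OF p_tot] by simp

lemma cov_el: "b \<in> hom w a \<Longrightarrow> cov w (rst b) I (\<lambda>k. rst (qA k \<cdot> b))"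
  using cov_pull[OF cov_q, of b w] by (simp add: ide_cmp_hom)

lemma p_local: "k \<in> I \<Longrightarrow> pA \<cdot> b \<cdot> rst (qA k \<cdot> b) = qA k \<cdot> b"
  using rst_swap[of "qA k" b] cmp_reassoc[OF p_rst_q, of k b] by (simp add: cmp_assoc)

text \<open>\<open>rst (qA k \<cdot> b)\<close> is the part on which \<open>b\<close> lies in the
  piece \<open>k\<close>. There \<open>sA k \<cdot> qA k\<close> acts as the identity and
  \<open>qA k\<close> agrees with \<open>pA\<close>, so \<open>b\<close> is recovered from its image
  in the base.\<close>

lemma el_local: "k \<in> I \<Longrightarrow> b \<cdot> rst (qA k \<cdot> b) = sA k \<cdot> pA \<cdot> b \<cdot> rst (qA k \<cdot> b)"
  using rst_swap[of "qA k" b] cmp_reassoc[OF s_q, of k b] by (simp add: p_local)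

lemma el_local_below:
  assumes "k \<in> I" "e = rst (qA k \<cdot> b) \<cdot> e"
  shows "b \<cdot> e = sA k \<cdot> pA \<cdot> b \<cdot> e" "pA \<cdot> b \<cdot> e = qA k \<cdot> b \<cdot> e"
proof -
  have "(b \<cdot> rst (qA k \<cdot> b)) \<cdot> e = (sA k \<cdot> pA \<cdot> b \<cdot> rst (qA k \<cdot> b)) \<cdot> e"
    by (simp only: el_local[OF assms(1), of b, symmetric])
  moreover have "(pA \<cdot> b \<cdot> rst (qA k \<cdot> b)) \<cdot> e = (qA k \<cdot> b) \<cdot> e" by (simp only: p_local[OF assms(1)])
  ultimately show "b \<cdot> e = sA k \<cdot> pA \<cdot> b \<cdot> e" "pA \<cdot> b \<cdot> e = qA k \<cdot> b \<cdot> e"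
    using assms(2) by (simp_all add: cmp_assoc)
qed

text \<open>Where \<open>b\<close> lies in both pieces it equals \<open>sA k\<close> of its base
  point, and \<open>qA l\<close> sends it back to that base point; the composite
  \<open>qA l \<cdot> sA k\<close> is the atlas idempotent.\<close>

lemma phi_overlap:
  assumes k: "k \<in> I" and l: "l \<in> I" and e: "e = rst (qA k \<cdot> b) \<cdot> e" "e = rst (qA l \<cdot> b) \<cdot> e"
  shows "phiA k l \<cdot> pA \<cdot> b \<cdot> e = pA \<cdot> b \<cdot> e"
proof -
  have "phiA k l \<cdot> pA \<cdot> b \<cdot> e = qA l \<cdot> sA k \<cdot> pA \<cdot> b \<cdot> e"
    using cmp_reassoc[OF q_s[OF k l], of "pA \<cdot> b \<cdot> e"] by simp
  then show ?thesis
    using el_local_below(1)[OF k e(1)] el_local_below(2)[OF l e(2)] by simp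
qed

lemma glue_eq:
  assumes "b \<in> hom w a" "u \<in> hom w z" "v \<in> hom w z" "u \<cdot> rst b = u" "v \<cdot> rst b = v"
    and "\<And>k. k \<in> I \<Longrightarrow> u \<cdot> rst (qA k \<cdot> b) = v \<cdot> rst (qA k \<cdot> b)"
  shows "u = v"
  by (rule cov_eq[OF cov_el[OF assms(1)]]) (fact assms)+

text \<open>The idempotents \<open>sA k \<cdot> qA k\<close> cover the identity of \<open>a\<close>,
  so the composites with the sections determine a map.\<close>

lemma map_eq:
  assumes u: "u \<in> hom a z" and v: "v \<in> hom a z" and eq: "\<And>k. k \<in> I \<Longrightarrow> u \<cdot> sA k = v \<cdot> sA k"
  shows "u = v"
proof (rule cov_eq[OF cov_q u v])
  show "u \<cdot> ide a = u" "v \<cdot> ide a = v" using u v by (simp_all add: cmp_ide)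
  fix k assume k: "k \<in> I"
  have "u \<cdot> sA k \<cdot> qA k = v \<cdot> sA k \<cdot> qA k" using cmp_reassoc[OF eq[OF k], of "qA k"] by (simp add: cmp_assoc)
  then show "u \<cdot> rst (qA k) = v \<cdot> rst (qA k)" by (simp add: s_q[OF k])
qed

text \<open>By symmetry of the atlas \<open>phiA k l\<close> may be read as
  \<open>qA k \<cdot> sA l\<close>, so \<open>sA k \<cdot> phiA k l\<close> is \<open>sA l\<close>
  restricted to where it meets the piece \<open>k\<close>.\<close>

lemma s_phi:
  assumes "local_atlas C x I \<phi>" "k \<in> I" "l \<in> I"
  shows "sA k \<cdot> phiA k l = sA l \<cdot> phiA k l" "phiA k l \<in> idem x"
proof -
  have s: "\<phi> k l = \<phi> l k" and i: "\<phi> k l \<in> rst_idems C x" using assms by (auto simp: local_atlas_def)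
  show i': "phiA k l \<in> idem x" using i by (simp add: rst_idems_iff)
  have "sA k \<cdot> phiA k l = sA k \<cdot> qA k \<cdot> sA l" using q_s[of l k] assms(2,3) by (simp add: s)
  also have "\<dots> = rst (qA k) \<cdot> sA l" using cmp_reassoc[OF s_q[OF assms(2)], of "sA l"] by simp
  also have "\<dots> = sA l \<cdot> phiA k l" using rst_swap[of "qA k" "sA l"] q_s[of l k] assms(2,3) idem_rst[OF i'] by (simp add: s)
  finally show "sA k \<cdot> phiA k l = sA l \<cdot> phiA k l" .
qed

end

section \<open>Glueings of equality loci\<close>

locale over_loc = join_restriction_category C + A: restriction_category A + P: restriction_functor A C P
  for C :: "('o, 'm) rcat" and A :: "('i, 'm) rcat" and P :: "('i, 'm, 'o, 'm) ftor"
begin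

no_notation A.cmp (infixr "\<cdot>" 70)

definition Pa :: "'i \<Rightarrow> 'i \<Rightarrow> 'm \<Rightarrow> ('o, 'm) arrow" where
  "Pa i j f = arr (FOb P i) (FOb P j) (FHom P i j f)"

text \<open>The idempotents of \<open>A\<close> whose images are joined in \<open>eq_locus\<close>.
  Only the join of the images is formed, in \<open>C\<close>; facts about the locus pass through the
  individual members, on which \<open>f\<close> and \<open>g\<close> really agree.\<close>

definition Eq :: "'i \<Rightarrow> 'i \<Rightarrow> 'm \<Rightarrow> 'm \<Rightarrow> 'm set" where
  "Eq i j f g = {e \<in> rst_idems A i. map_le A i i e (Cmp A i i i (Rst A i j f) (Rst A i j g)) \<and>
     Cmp A i i j f e = Cmp A i i j g e}"

definition loc :: "'i \<Rightarrow> 'i \<Rightarrow> 'm \<Rightarrow> 'm \<Rightarrow> ('o, 'm) arrow" where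
  "loc i j f g = arr (FOb P i) (FOb P i) (eq_locus C (A, P) i j f g)"

lemma P_ob [simp]: "i \<in> Ob A \<Longrightarrow> FOb P i \<in> Ob C"
  by (rule P.FOb_in)

lemma Pa_hom: "\<lbrakk>i \<in> Ob A; j \<in> Ob A; f \<in> Hom A i j\<rbrakk> \<Longrightarrow> Pa i j f \<in> hom (FOb P i) (FOb P j)"
  by (simp add: Pa_def homI P.FHom_in)

lemma Pa_Idn: "i \<in> Ob A \<Longrightarrow> Pa i i (Idn A i) = ide (FOb P i)"
  by (simp add: Pa_def P.FHom_Idn ide_def)

lemma Pa_Cmp: "\<lbrakk>i \<in> Ob A; j \<in> Ob A; k \<in> Ob A; f \<in> Hom A i j; g \<in> Hom A j k\<rbrakk> \<Longrightarrow>
    Pa i k (Cmp A i j k g f) = Pa j k g \<cdot> Pa i j f"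
  by (simp add: Pa_def P.FHom_Cmp arr_Cmp P.FHom_in)

lemma Pa_Rst: "\<lbrakk>i \<in> Ob A; j \<in> Ob A; f \<in> Hom A i j\<rbrakk> \<Longrightarrow> Pa i i (Rst A i j f) = rst (Pa i j f)"
  by (simp add: Pa_def P.FHom_Rst arr_Rst P.FHom_in)

lemma Pa_idem: "\<lbrakk>i \<in> Ob A; e \<in> rst_idems A i\<rbrakk> \<Longrightarrow> Pa i i e \<in> idem (FOb P i)"
  using Pa_Rst[of i i e] Pa_hom[of i i e] by (simp add: rst_idems_def idem_def)

context
  fixes i j assumes ij: "i \<in> Ob A" "j \<in> Ob A"
begin

lemma EqD:
  assumes "f \<in> Hom A i j" "g \<in> Hom A i j" and e: "e \<in> Eq i j f g"
  shows "e \<in> rst_idems A i" "e \<in> Hom A i i" "Rst A i i e = e" "Cmp A i i j f e = Cmp A i i j g e"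
    "Cmp A i i i (Cmp A i i i (Rst A i j f) (Rst A i j g)) e = e"
    "Pa i i e \<in> idem (FOb P i)" "rst (Pa i j f) \<cdot> Pa i i e = Pa i i e" "rst (Pa i j g) \<cdot> Pa i i e = Pa i i e"
proof -
  show e': "e \<in> rst_idems A i" "e \<in> Hom A i i" "Rst A i i e = e" "Cmp A i i j f e = Cmp A i i j g e"
    using e by (auto simp: Eq_def rst_idems_def)
  show le: "Cmp A i i i (Cmp A i i i (Rst A i j f) (Rst A i j g)) e = e"
    using e e' by (simp add: Eq_def map_le_def)
  show "Pa i i e \<in> idem (FOb P i)" by (rule Pa_idem[OF ij(1) e'(1)])
  have "Pa i i (Cmp A i i i (Cmp A i i i (Rst A i j f) (Rst A i j g)) e) = rst (Pa i j f) \<cdot> rst (Pa i j g) \<cdot> Pa i i e"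
    using ij e' assms(1,2) by (simp add: Pa_Cmp Pa_Rst A.Rst_in A.Cmp_in cmp_assoc)
  then have *: "Pa i i e = rst (Pa i j f) \<cdot> rst (Pa i j g) \<cdot> Pa i i e" by (simp add: le)
  show "rst (Pa i j f) \<cdot> Pa i i e = Pa i i e" by (subst (1 2) *) simp
  show "rst (Pa i j g) \<cdot> Pa i i e = Pa i i e" by (subst (1 2) *) (simp add: rst_left_comm)
qed

lemma EqI:
  assumes "f \<in> Hom A i j" "g \<in> Hom A i j" "e \<in> rst_idems A i" "Cmp A i i j f e = Cmp A i i j g e"
    "Cmp A i i i (Rst A i j f) e = e" "Cmp A i i i (Rst A i j g) e = e"
  shows "e \<in> Eq i j f g"
proof -
  have e: "e \<in> Hom A i i" "Rst A i i e = e" using assms(3) by (auto simp: rst_idems_def)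
  have "Cmp A i i i (Cmp A i i i (Rst A i j f) (Rst A i j g)) e = e"
    using ij assms e by (simp flip: A.Cmp_assoc add: A.Rst_in)
  then show ?thesis using assms e by (simp add: Eq_def map_le_def)
qed

lemma rst_idems_cmp:
  assumes "e \<in> rst_idems A i" "e' \<in> rst_idems A i"
  shows "Cmp A i i i e e' \<in> rst_idems A i" "Cmp A i i i e e' = Cmp A i i i e' e"
  using assms ij A.Rst_Cmp_Rst[of i i i e' e] A.Rst_commute[of i i i e e'] by (auto simp: rst_idems_def A.Cmp_in)

lemma Eq_sym: "\<lbrakk>f \<in> Hom A i j; g \<in> Hom A i j\<rbrakk> \<Longrightarrow> Eq i j f g = Eq i j g f"
  using A.Rst_commute[of i j j f g] ij by (auto simp: Eq_def)

lemma Eq_below: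
  assumes f: "f \<in> Hom A i j" and g: "g \<in> Hom A i j" and e: "e \<in> Eq i j f g"
  shows "Cmp A i i i (Rst A i j f) e = e" "Cmp A i i i (Rst A i j g) e = e"
proof -
  note d = EqD[OF f g e]
  let ?f = "Rst A i j f" and ?g = "Rst A i j g"
  have rr: "?f \<in> Hom A i i" "?g \<in> Hom A i i" using ij f g by (auto intro: A.Rst_in)
  have ff: "Cmp A i i i ?f ?f = ?f" "Cmp A i i i ?g ?g = ?g"
    using ij f g A.Rst_Cmp_Rst[of i j j f f] A.Rst_Cmp_Rst[of i j j g g] A.Cmp_Rst[of i j f] A.Cmp_Rst[of i j g] by simp_all
  have gf: "Cmp A i i i ?f ?g = Cmp A i i i ?g ?f" using A.Rst_commute ij f g by blast
  have "Cmp A i i i ?f e = Cmp A i i i ?f (Cmp A i i i (Cmp A i i i ?f ?g) e)" by (simp add: d(5))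
  also have "\<dots> = Cmp A i i i (Cmp A i i i (Cmp A i i i ?f ?f) ?g) e"
    using ij rr d(2) by (simp add: A.Cmp_assoc A.Cmp_in)
  finally show "Cmp A i i i ?f e = e" by (simp add: ff d(5))
  have "Cmp A i i i ?g e = Cmp A i i i ?g (Cmp A i i i (Cmp A i i i ?g ?f) e)" using d(5) gf by simp
  also have "\<dots> = Cmp A i i i (Cmp A i i i (Cmp A i i i ?g ?g) ?f) e"
    using ij rr d(2) by (simp add: A.Cmp_assoc A.Cmp_in)
  finally show "Cmp A i i i ?g e = e" using ff d(5) gf by simp
qed

lemma Eq_trans:
  assumes f: "f \<in> Hom A i j" and g: "g \<in> Hom A i j" and h: "h \<in> Hom A i j"
    and e: "e \<in> Eq i j f g" and e': "e' \<in> Eq i j g h"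
  shows "Cmp A i i i e e' \<in> Eq i j f h"
proof (rule EqI[OF f h])
  note d = EqD[OF f g e] and d' = EqD[OF g h e']
  show i: "Cmp A i i i e e' \<in> rst_idems A i" by (rule rst_idems_cmp(1)[OF d(1) d'(1)])
  note c = rst_idems_cmp(2)[OF d(1) d'(1)]
  have "Cmp A i i j f (Cmp A i i i e e') = Cmp A i i j g (Cmp A i i i e' e)"
    using ij f g d d' by (simp add: A.Cmp_assoc flip: c)
  also have "\<dots> = Cmp A i i j h (Cmp A i i i e' e)" using ij g h d d' by (simp add: A.Cmp_assoc)
  finally show "Cmp A i i j f (Cmp A i i i e e') = Cmp A i i j h (Cmp A i i i e e')" by (simp add: c)
  show "Cmp A i i i (Rst A i j f) (Cmp A i i i e e') = Cmp A i i i e e'"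
    using ij f d d' by (simp add: A.Cmp_assoc A.Rst_in Eq_below[OF f g e])
  show "Cmp A i i i (Rst A i j h) (Cmp A i i i e e') = Cmp A i i i e e'"
    unfolding c using ij h d d' by (simp add: A.Cmp_assoc A.Rst_in Eq_below[OF g h e'])
qed

lemma Rst_idem: "f \<in> Hom A i j \<Longrightarrow> Rst A i j f \<in> rst_idems A i"
  using ij A.Rst_in[of i j f] A.rst_in_idem[OF A.homI[OF ij]]
  by (simp add: A.rst_idems_iff[OF ij(1)] A.arr_Rst)

lemma Eq_refl: "f \<in> Hom A i j \<Longrightarrow> Rst A i j f \<in> Eq i j f f"
  by (rule EqI) (use ij A.Rst_Cmp_Rst[of i j j f f] A.Cmp_Rst[of i j f] Rst_idem in auto)

text \<open>Restriction idempotents commute, so the join in the definition of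
  \<open>eq_locus\<close> exists and \<open>Join\<close> denotes it. From here on the locus is used
  through its cover by the images of \<open>Eq\<close>.\<close>

lemma loc_props:
  assumes f: "f \<in> Hom A i j" and g: "g \<in> Hom A i j"
  shows "eq_locus C (A, P) i j f g \<in> Hom C (FOb P i) (FOb P i)"
    and "cov (FOb P i) (loc i j f g) (Eq i j f g) (Pa i i)"
proof -
  let ?S = "{FHom P i i e | e. e \<in> rst_idems A i \<and>
        map_le A i i e (Cmp A i i i (Rst A i j f) (Rst A i j g)) \<and> Cmp A i i j f e = Cmp A i i j g e}"
  have S: "?S = FHom P i i ` Eq i j f g" by (auto simp: Eq_def)
  have sub: "?S \<subseteq> Hom C (FOb P i) (FOb P i)"
    unfolding S using ij EqD(2)[OF f g] by (auto intro: P.FHom_in)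
  have "\<exists>d. cov (FOb P i) d (Eq i j f g) (Pa i i)"
    by (rule cov_exists) (use ij EqD(6)[OF f g] in auto)
  then obtain d where d: "cov (FOb P i) d (Eq i j f g) (Pa i i)" ..
  have im: "arr (FOb P i) (FOb P i) ` ?S = Pa i i ` Eq i j f g"
    unfolding S by (auto simp: image_image Pa_def)
  have dh: "d \<in> hom (FOb P i) (FOb P i)" using covD(1)[OF d] by (rule idem_hom)
  have "lub (FOb P i) (FOb P i) (arr (FOb P i) (FOb P i) ` ?S) (arr (FOb P i) (FOb P i) (mor d))"
    unfolding im arr_mor[OF dh] by (rule covD(3)[OF d])
  then have J: "is_join C (FOb P i) (FOb P i) ?S (mor d)"
    using lub_iff[OF P_ob P_ob sub mor_in[OF dh]] ij by simp
  have "Join C (FOb P i) (FOb P i) ?S = mor d"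
    unfolding Join_def using J by (rule the_equality) (use is_join_unique[OF P_ob P_ob sub _ J] ij in blast)
  then have e: "eq_locus C (A, P) i j f g = mor d" by (simp add: eq_locus_def)
  show "eq_locus C (A, P) i j f g \<in> Hom C (FOb P i) (FOb P i)" unfolding e by (rule mor_in[OF dh])
  show "cov (FOb P i) (loc i j f g) (Eq i j f g) (Pa i i)"
    using d unfolding loc_def e by (simp add: arr_mor[OF dh])
qed

text \<open>The largest member of the cover is available in \<open>A\<close>:
  \<open>Rst A i j f\<close> belongs to \<open>Eq i j f f\<close>.\<close>

lemma loc_self: "f \<in> Hom A i j \<Longrightarrow> loc i j f f = rst (Pa i j f)"
proof -
  assume f: "f \<in> Hom A i j"
  note c = loc_props(2)[OF f f]
  have r: "rst (Pa i j f) \<in> idem (FOb P i)" by (rule rst_in_idem[OF Pa_hom[OF ij f]])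
  have 1: "rst (Pa i j f) \<cdot> loc i j f f = loc i j f f"
    by (rule cov_least[OF c r]) (rule EqD(7)[OF f f])
  have "loc i j f f \<cdot> rst (Pa i j f) = rst (Pa i j f)"
    using covD(4)[OF c Eq_refl[OF f]] ij f by (simp add: Pa_Rst)
  then show ?thesis using 1 idem_comm[OF r covD(1)[OF c]] by simp
qed

lemma local_atlas_eq_locus: "local_atlas C (FOb P i) (Hom A i j) (eq_locus C (A, P) i j)"
  unfolding local_atlas_def
proof (intro conjI ballI)
  fix f g assume fg: "f \<in> Hom A i j" "g \<in> Hom A i j"
  show "eq_locus C (A, P) i j f g \<in> rst_idems C (FOb P i)"
    using loc_props[OF fg] covD(1)[of _ "loc i j f g"] ij by (auto simp: rst_idems_iff loc_def)
  show "eq_locus C (A, P) i j f g = eq_locus C (A, P) i j g f"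
    using Eq_sym[OF fg] unfolding eq_locus_def prod.case Eq_def by (intro arg_cong[of _ _ "Join C (FOb P i) (FOb P i)"]) blast
next
  fix f g h assume fgh: "f \<in> Hom A i j" "g \<in> Hom A i j" "h \<in> Hom A i j"
  let ?c = "loc i j f h"
  note cf = loc_props(2)[OF fgh(1,2)] and cg = loc_props(2)[OF fgh(2,3)] and cc = loc_props(2)[OF fgh(1,3)]
  have ci: "?c \<in> idem (FOb P i)" by (rule covD(1)[OF cc])
  \<comment> \<open>The cocycle inequality is tested on the products of an e' of
    \<open>Eq i j g h\<close> with an e of \<open>Eq i j f g\<close>, covering one locus at a time;
    for such a product it is transitivity of agreement in \<open>A\<close>.\<close>
  have "?c \<cdot> loc i j g h \<cdot> loc i j f g = loc i j g h \<cdot> loc i j f g"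
  proof (rule cov_least[OF cov_meet[OF cg covD(1)[OF cf]] ci])
    fix e' assume e': "e' \<in> Eq i j g h"
    have pe': "Pa i i e' \<in> idem (FOb P i)" by (rule covD(2)[OF cg e'])
    have "?c \<cdot> loc i j f g \<cdot> Pa i i e' = loc i j f g \<cdot> Pa i i e'"
    proof (rule cov_least[OF cov_meet[OF cf pe'] ci])
      fix e assume e: "e \<in> Eq i j f g"
      have "Pa i i (Cmp A i i i e e') = Pa i i e \<cdot> Pa i i e'"
        using EqD(2)[OF fgh(1,2) e] EqD(2)[OF fgh(2,3) e'] ij by (simp add: Pa_Cmp)
      then show "?c \<cdot> Pa i i e \<cdot> Pa i i e' = Pa i i e \<cdot> Pa i i e'"
        using covD(4)[OF cc Eq_trans[OF fgh e e']] by simp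
    qed
    then show "?c \<cdot> Pa i i e' \<cdot> loc i j f g = Pa i i e' \<cdot> loc i j f g"
      by (simp add: idem_comm[OF pe' covD(1)[OF cf]])
  qed
  then show "map_le C (FOb P i) (FOb P i) (Cmp C (FOb P i) (FOb P i) (FOb P i) (eq_locus C (A, P) i j g h) (eq_locus C (A, P) i j f g))
        (eq_locus C (A, P) i j f h)"
    using loc_props(1) fgh ij cmp_idem[OF covD(1)[OF cg] covD(1)[OF cf]]
    by (simp add: map_le_iff Cmp_in arr_Cmp idem_rst flip: loc_def)
qed

end
end

locale glued = over_loc C A P
  for C :: "('o, 'm) rcat" and A :: "('i, 'm) rcat" and P :: "('i, 'm, 'o, 'm) ftor" +
  fixes G :: "'i \<Rightarrow> 'i \<Rightarrow> 'o" and p :: "'i \<Rightarrow> 'i \<Rightarrow> 'm" and q s :: "'i \<Rightarrow> 'i \<Rightarrow> 'm \<Rightarrow> 'm"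
  assumes glueing: "\<lbrakk>i \<in> Ob A; j \<in> Ob A\<rbrakk> \<Longrightarrow>
    is_glueing C (FOb P i) (Hom A i j) (eq_locus C (A, P) i j) (G i j) (p i j) (q i j) (s i j)"
begin

definition "pa i j = arr (G i j) (FOb P i) (p i j)"
definition "qa i j f = arr (G i j) (FOb P i) (q i j f)"
definition "sa i j f = arr (FOb P i) (G i j) (s i j f)"

context
  fixes i j assumes ij: "i \<in> Ob A" "j \<in> Ob A"
begin

lemma glue_loc: "glue_loc C (FOb P i) (Hom A i j) (eq_locus C (A, P) i j) (G i j) (p i j) (q i j) (s i j)"
  using glueing[OF ij] ij by (simp add: glue_loc_def glue_loc_axioms_def join_restriction_category_axioms)

lemmas G_ob [simp] = glue_loc.a_ob[OF glue_loc]
lemmas pa_tot = glue_loc.p_tot[OF glue_loc, folded pa_def]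
lemmas raw_in = glue_loc.raw_in[OF glue_loc]
lemmas qa_hom = glue_loc.q_hom[OF glue_loc, folded qa_def]
lemmas sa_hom = glue_loc.s_hom[OF glue_loc, folded sa_def]
lemmas sa_qa = glue_loc.s_q[OF glue_loc, folded qa_def sa_def]
lemmas qa_sa = glue_loc.q_s[OF glue_loc, folded qa_def sa_def loc_def]
lemmas cov_el = glue_loc.cov_el[OF glue_loc, folded qa_def]
lemmas el_local = glue_loc.el_local[OF glue_loc, folded pa_def qa_def sa_def]
lemmas pa_local = glue_loc.p_local[OF glue_loc, folded pa_def qa_def sa_def]
lemmas glue_eq = glue_loc.glue_eq[OF glue_loc, folded qa_def]
lemmas map_eq = glue_loc.map_eq[OF glue_loc, folded sa_def]

lemma rst_sa: "f \<in> Hom A i j \<Longrightarrow> rst (sa i j f) = rst (Pa i j f)"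
  using qa_sa[of f f] glue_loc.q_s_self[OF glue_loc, folded qa_def sa_def] loc_self[OF ij] by simp

lemma pa_sa: "f \<in> Hom A i j \<Longrightarrow> pa i j \<cdot> sa i j f = rst (Pa i j f)"
  using glue_loc.p_s[OF glue_loc, folded pa_def sa_def] rst_sa by simp

text \<open>\<open>qa\<close> takes its values in the domain of \<open>sa\<close>, which is the
  domain of \<open>Pa\<close>, so composing with \<open>Pa\<close> shrinks nothing.\<close>

lemma rst_Pa_qa: "f \<in> Hom A i j \<Longrightarrow> rst (Pa i j f \<cdot> qa i j f \<cdot> a) = rst (qa i j f \<cdot> a)"
proof -
  assume f: "f \<in> Hom A i j"
  have "rst (sa i j f \<cdot> qa i j f) = rst (qa i j f)" by (simp add: sa_qa[OF f])
  then have "rst (rst (Pa i j f) \<cdot> qa i j f) = rst (qa i j f)"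
    unfolding rst_sa[OF f, symmetric] by (simp only: rst_rst_cmp)
  then have "rst (Pa i j f \<cdot> qa i j f) = rst (qa i j f)" by (simp only: rst_rst_cmp)
  then have "rst (rst (Pa i j f \<cdot> qa i j f) \<cdot> a) = rst (rst (qa i j f) \<cdot> a)" by simp
  then show ?thesis by (simp add: cmp_assoc)
qed

text \<open>The image of \<open>e\<close> lies in the locus of \<open>f\<close> and
  \<open>g\<close>, on which the glueing identifies the two sections.\<close>

lemma sa_Eq:
  assumes f: "f \<in> Hom A i j" and g: "g \<in> Hom A i j" and e: "e \<in> Eq i j f g"
  shows "sa i j f \<cdot> Pa i i e = sa i j g \<cdot> Pa i i e"
proof -
  have c: "qa i j g \<cdot> sa i j f \<cdot> Pa i i e = Pa i i e"
    using covD(4)[OF loc_props(2)[OF ij f g] e] qa_sa[OF f g] by (simp flip: cmp_assoc)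
  have "sa i j g \<cdot> Pa i i e = rst (qa i j g) \<cdot> sa i j f \<cdot> Pa i i e"
    using cmp_reassoc[OF sa_qa[OF g], of "sa i j f \<cdot> Pa i i e"] by (simp add: c)
  also have "\<dots> = (sa i j f \<cdot> Pa i i e) \<cdot> rst (qa i j g \<cdot> sa i j f \<cdot> Pa i i e)" by (rule rst_swap)
  also have "\<dots> = sa i j f \<cdot> Pa i i e"
    unfolding c using EqD(6)[OF ij f g e] by (simp add: cmp_assoc idem_rst idem_idem)
  finally show ?thesis by simp
qed

text \<open>The arrows \<open>f\<close> and \<open>f\<close> after \<open>e\<close> agree on
  \<open>?d\<close>, the meet of \<open>e\<close> with the domain of \<open>f\<close>, which is all
  of the domain of the second arrow. So \<open>?d\<close> belongs to \<open>Eq\<close> of the two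
  and \<open>sa_Eq\<close> transports one section to the other.\<close>

lemma sa_cmp_idem:
  assumes f: "f \<in> Hom A i j" and e: "e \<in> rst_idems A i"
  shows "sa i j (Cmp A i i j f e) = sa i j f \<cdot> Pa i i e"
proof -
  have e': "e \<in> Hom A i i" "Rst A i i e = e" using e by (auto simp: rst_idems_def)
  let ?g = "Cmp A i i j f e" let ?d = "Cmp A i i i (Rst A i j f) e"
  note [simp] = ij f e'
  have g: "?g \<in> Hom A i j" by (auto intro: A.Cmp_in)
  have Rg: "Rst A i j ?g = ?d" using A.Rst_Cmp_Rst[of i i j e f] by simp
  have R: "Rst A i j f \<in> rst_idems A i" by (rule Rst_idem) auto
  have di: "?d \<in> rst_idems A i" by (rule rst_idems_cmp(1)[OF ij R e])
  have dd: "Cmp A i i i ?d ?d = ?d"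
    using di A.Cmp_Rst[of i i ?d] by (auto simp: rst_idems_def)
  have ee: "Cmp A i i i e e = e" using A.Cmp_Rst[of i i e] by simp
  have ff: "Cmp A i i i (Rst A i j f) (Rst A i j f) = Rst A i j f"
    using A.Rst_Cmp_Rst[of i j j f f] A.Cmp_Rst[of i j f] by simp
  have E: "?d \<in> Eq i j ?g f"
  proof (rule EqI[OF ij g f di])
    have "Cmp A i i j ?g ?d = Cmp A i i j f (Cmp A i i i e ?d)"
      by (simp add: A.Cmp_assoc A.Cmp_in A.Rst_in)
    also have "Cmp A i i i e ?d = Cmp A i i i ?d e" by (rule rst_idems_cmp(2)[OF ij e di])
    also have "\<dots> = ?d" using ee by (simp add: A.Rst_in flip: A.Cmp_assoc)
    finally show "Cmp A i i j ?g ?d = Cmp A i i j f ?d" .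
    show "Cmp A i i i (Rst A i j ?g) ?d = ?d" by (simp add: Rg dd)
    show "Cmp A i i i (Rst A i j f) ?d = ?d" using ff by (simp add: A.Cmp_assoc A.Rst_in)
  qed
  have Pd: "Pa i i ?d = rst (Pa i j f) \<cdot> Pa i i e" by (simp add: Pa_Cmp Pa_Rst A.Rst_in)
  have "rst (sa i j ?g) = Pa i i ?d" using rst_sa[OF g] g by (simp add: Rg flip: Pa_Rst)
  then have "sa i j ?g = sa i j ?g \<cdot> Pa i i ?d" using hom_rst[OF sa_hom[OF g]] by simp
  also have "\<dots> = sa i j f \<cdot> Pa i i ?d" by (rule sa_Eq[OF g f E])
  also have "\<dots> = (sa i j f \<cdot> rst (sa i j f)) \<cdot> Pa i i e" by (simp add: Pd rst_sa cmp_assoc)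
  finally show ?thesis using hom_rst[OF sa_hom[OF f]] by simp
qed

text \<open>\<open>d\<close> is the part on which \<open>a\<close> lies in the pieces of both
  \<open>f\<close> and \<open>g\<close>, so its image in the base lies in their locus. Pulling the
  cover of the locus by \<open>Eq i j f g\<close> back along that image covers \<open>d\<close>, and
  on the member for \<open>e\<close> the image lies in \<open>e\<close>.\<close>

lemma overlap_cov:
  assumes a: "a \<in> hom w (G i j)" and f: "f \<in> Hom A i j" and g: "g \<in> Hom A i j"
  defines "d \<equiv> rst (qa i j f \<cdot> a) \<cdot> rst (qa i j g \<cdot> a)"
  shows "cov w d (Eq i j f g) (\<lambda>e. rst (Pa i i e \<cdot> pa i j \<cdot> a \<cdot> d))"
    and "e \<in> Eq i j f g \<Longrightarrow> Pa i i e \<cdot> pa i j \<cdot> a \<cdot> rst (Pa i i e \<cdot> pa i j \<cdot> a \<cdot> d)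
       = pa i j \<cdot> a \<cdot> rst (Pa i i e \<cdot> pa i j \<cdot> a \<cdot> d)"
proof -
  let ?y = "pa i j \<cdot> a \<cdot> d"
  have ih: "rst (qa i j h \<cdot> a) \<in> idem w" if "h \<in> Hom A i j" for h
    by (rule rst_in_idem[OF cmp_hom[OF qa_hom[OF that] a]])
  have d: "d \<in> idem w" unfolding d_def by (intro cmp_idem ih f g)
  have y: "?y \<in> hom w (FOb P i)" by (intro cmp_hom[OF tot_hom[OF pa_tot]] cmp_hom[OF a] idem_hom d)
  have s1: "sa i j f \<cdot> ?y = a \<cdot> d" unfolding d_def using arg_cong[OF el_local[OF f, of a], of "\<lambda>x. x \<cdot> rst (qa i j g \<cdot> a)"] by (simp only: cmp_assoc)
  have y2: "?y = qa i j g \<cdot> a \<cdot> d"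
  proof -
    have "?y = (pa i j \<cdot> a \<cdot> rst (qa i j g \<cdot> a)) \<cdot> rst (qa i j f \<cdot> a)"
      unfolding d_def by (simp add: cmp_assoc rst_comm)
    also have "\<dots> = (qa i j g \<cdot> a) \<cdot> rst (qa i j g \<cdot> a) \<cdot> rst (qa i j f \<cdot> a)"
      unfolding pa_local[OF g] using hom_rst[OF cmp_hom[OF qa_hom[OF g] a]] by (simp flip: cmp_assoc)
    finally show ?thesis unfolding d_def by (simp add: cmp_assoc rst_comm)
  qed
  have l: "loc i j f g \<cdot> ?y = ?y"
    using cmp_reassoc[OF qa_sa[OF f g], of ?y] s1 y2 by simp
  have ry: "rst ?y = d"
  proof -
    have "rst ?y = rst ((qa i j g \<cdot> a) \<cdot> d)" unfolding y2 by (simp add: cmp_assoc)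
    also have "\<dots> = rst (qa i j g \<cdot> a) \<cdot> d" by (rule rst_cmp_idem[OF d])
    also have "\<dots> = d" unfolding d_def rst_comm[of "qa i j f \<cdot> a"] by simp
    finally show ?thesis .
  qed
  show "cov w d (Eq i j f g) (\<lambda>e. rst (Pa i i e \<cdot> ?y))"
    using cov_pull[OF loc_props(2)[OF ij f g] y] l ry by simp
  assume e: "e \<in> Eq i j f g"
  note pe = EqD(6)[OF ij f g e]
  have sw: "Pa i i e \<cdot> ?y = ?y \<cdot> rst (Pa i i e \<cdot> ?y)"
    using rst_swap[of "Pa i i e" ?y] idem_rst[OF pe] by simp
  have "rst ?y \<cdot> rst (Pa i i e \<cdot> ?y) = rst (Pa i i e \<cdot> ?y)" by (rule trans[OF rst_comm rst_cmp_rst_right])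
  then have dr: "d \<cdot> rst (Pa i i e \<cdot> ?y) = rst (Pa i i e \<cdot> ?y)" by (simp only: ry)
  have m: "pa i j \<cdot> a \<cdot> rst (Pa i i e \<cdot> ?y) = Pa i i e \<cdot> ?y"
    by (rule trans[OF _ sw[symmetric]]) (simp only: cmp_assoc dr)
  show "Pa i i e \<cdot> pa i j \<cdot> a \<cdot> rst (Pa i i e \<cdot> ?y) = pa i j \<cdot> a \<cdot> rst (Pa i i e \<cdot> ?y)"
    unfolding m using cmp_reassoc[OF idem_idem[OF pe], of ?y] by simp
qed

text \<open>The universal property of the glueing in a form stable under pullback: it builds maps on
  the domain of any \<open>a\<close> into the glueing. The premise on \<open>r\<close> says that the
  base point of \<open>a\<close> stays in \<open>e\<close> throughout \<open>r\<close>; by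
  \<open>overlap_cov\<close> such \<open>r\<close> cover each overlap, so agreement has to be known
  only there.\<close>

lemma glue_ext:
  assumes a: "a \<in> hom w (G i j)" and z: "z \<in> Ob C" and u: "\<And>f. f \<in> Hom A i j \<Longrightarrow> u f \<in> hom w z"
    and comp: "\<And>f g e r. \<lbrakk>f \<in> Hom A i j; g \<in> Hom A i j; e \<in> Eq i j f g; r \<in> idem w;
        Pa i i e \<cdot> pa i j \<cdot> a \<cdot> r = pa i j \<cdot> a \<cdot> r\<rbrakk> \<Longrightarrow> u f \<cdot> r = u g \<cdot> r"
  shows "\<exists>v\<in>hom w z. v \<cdot> rst a = v \<and> (\<forall>f\<in>Hom A i j. v \<cdot> rst (qa i j f \<cdot> a) = u f \<cdot> rst (qa i j f \<cdot> a)) \<and>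
     ((\<forall>f\<in>Hom A i j. rst (u f) \<cdot> rst (qa i j f \<cdot> a) = rst (qa i j f \<cdot> a)) \<longrightarrow> rst v = rst a)"
proof (rule glue_exists[OF cov_el[OF a] z u])
  fix f g assume f: "f \<in> Hom A i j" and g: "g \<in> Hom A i j"
  let ?d = "rst (qa i j f \<cdot> a) \<cdot> rst (qa i j g \<cdot> a)"
  note c = overlap_cov[OF a f g]
  have d: "?d \<in> idem w" by (rule covD(1)[OF c(1)])
  have uh: "u f \<cdot> ?d \<in> hom w z" "u g \<cdot> ?d \<in> hom w z" by (rule cmp_hom[OF u idem_hom[OF d]]; fact)+
  have "u f \<cdot> ?d = u g \<cdot> ?d"
  proof (rule cov_eq[OF c(1) uh])
    show "(u f \<cdot> ?d) \<cdot> ?d = u f \<cdot> ?d" "(u g \<cdot> ?d) \<cdot> ?d = u g \<cdot> ?d"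
      by (simp_all only: cmp_assoc[of "u f"] cmp_assoc[of "u g"] idem_idem[OF d])
    fix e assume e: "e \<in> Eq i j f g"
    let ?r = "rst (Pa i i e \<cdot> pa i j \<cdot> a \<cdot> ?d)"
    have "?d \<cdot> ?r = ?r" by (rule covD(4)[OF c(1) e])
    then show "(u f \<cdot> ?d) \<cdot> ?r = (u g \<cdot> ?d) \<cdot> ?r"
      using comp[OF f g e covD(2)[OF c(1) e] c(2)[OF e]] by (simp only: cmp_assoc[of "u f"] cmp_assoc[of "u g"])
  qed
  then show "u f \<cdot> rst (qa i j f \<cdot> a) \<cdot> rst (qa i j g \<cdot> a) = u g \<cdot> rst (qa i j f \<cdot> a) \<cdot> rst (qa i j g \<cdot> a)" .
qed

text \<open>The case of \<open>glue_ext\<close> where \<open>a\<close> is the identity, with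
  \<open>u f\<close> transported from the base by \<open>pa\<close>. The condition
  \<open>dom\<close> ensures that composing with the section \<open>sa\<close> returns
  \<open>u f\<close> undiminished.\<close>

lemma map_ext:
  assumes z: "z \<in> Ob C" and u: "\<And>f. f \<in> Hom A i j \<Longrightarrow> u f \<in> hom (FOb P i) z"
    and comp: "\<And>f g e. \<lbrakk>f \<in> Hom A i j; g \<in> Hom A i j; e \<in> Eq i j f g\<rbrakk> \<Longrightarrow> u f \<cdot> Pa i i e = u g \<cdot> Pa i i e"
    and dom: "\<And>f. f \<in> Hom A i j \<Longrightarrow> u f \<cdot> rst (Pa i j f) = u f"
  shows "\<exists>v\<in>hom (G i j) z. \<forall>f\<in>Hom A i j. v \<cdot> sa i j f = u f"
proof -
  let ?w = "G i j" let ?a = "ide ?w"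
  have a: "?a \<in> hom ?w ?w" by (simp add: ide_hom)
  have pa: "pa i j \<cdot> ?a = pa i j" "\<And>f. f \<in> Hom A i j \<Longrightarrow> qa i j f \<cdot> ?a = qa i j f"
    by (simp_all add: cmp_ide[OF tot_hom[OF pa_tot]] cmp_ide[OF qa_hom])
  have "\<exists>v\<in>hom ?w z. v \<cdot> rst ?a = v \<and> (\<forall>f\<in>Hom A i j. v \<cdot> rst (qa i j f \<cdot> ?a) = (u f \<cdot> pa i j) \<cdot> rst (qa i j f \<cdot> ?a)) \<and>
     ((\<forall>f\<in>Hom A i j. rst (u f \<cdot> pa i j) \<cdot> rst (qa i j f \<cdot> ?a) = rst (qa i j f \<cdot> ?a)) \<longrightarrow> rst v = rst ?a)"
  proof (rule glue_ext[OF a z])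
    show "u f \<cdot> pa i j \<in> hom ?w z" if "f \<in> Hom A i j" for f by (rule cmp_hom[OF u[OF that] tot_hom[OF pa_tot]])
    fix f g e r assume fge: "f \<in> Hom A i j" "g \<in> Hom A i j" "e \<in> Eq i j f g" and r: "r \<in> idem ?w"
      and er: "Pa i i e \<cdot> pa i j \<cdot> ?a \<cdot> r = pa i j \<cdot> ?a \<cdot> r"
    have ar: "?a \<cdot> r = r" by (rule ide_cmp_hom[OF idem_hom[OF r]])
    show "(u f \<cdot> pa i j) \<cdot> r = (u g \<cdot> pa i j) \<cdot> r"
      using cmp_reassoc[OF comp[OF fge], of "pa i j \<cdot> r"] er by (simp add: cmp_assoc ar)
  qed
  then obtain v where v: "v \<in> hom ?w z" "\<And>f. f \<in> Hom A i j \<Longrightarrow> v \<cdot> rst (qa i j f) = (u f \<cdot> pa i j) \<cdot> rst (qa i j f)"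
    by (auto simp: pa)
  have "v \<cdot> sa i j f = u f" if f: "f \<in> Hom A i j" for f
  proof -
    have rs: "rst (qa i j f) \<cdot> sa i j f = sa i j f" using glue_loc.rst_q_s[OF glue_loc f, folded qa_def sa_def] .
    have "v \<cdot> sa i j f = (v \<cdot> rst (qa i j f)) \<cdot> sa i j f" by (simp add: cmp_assoc rs)
    also have "\<dots> = u f \<cdot> pa i j \<cdot> sa i j f" by (simp add: v(2)[OF f] cmp_assoc rs)
    finally show ?thesis by (simp add: pa_sa[OF f] dom[OF f])
  qed
  then show ?thesis using v(1) by blast
qed

end
end

section \<open>Internal categories presented by a category over the base\<close>

text \<open>The premise \<open>r\<close> says that the composite is defined wherever
  \<open>s \<cdot> x\<close> is, so the cut-down in \<open>pcomp\<close> disappears along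
  \<open>x\<close>.\<close>

lemma (in internal) pcomp_cmp:
  assumes i: "i \<in> Ix \<AA>" "j \<in> Ix \<AA>" "k \<in> Ix \<AA>" and s: "s \<in> sec i j" and t: "t \<in> sec j k"
    and r: "rst (t \<cdot> tg \<AA> i j \<cdot> s \<cdot> x) = rst (s \<cdot> x)"
  shows "pcomp i j k t s \<cdot> x = mu \<AA> i j k (t \<cdot> tg \<AA> i j \<cdot> s \<cdot> x) (s \<cdot> x)"
proof -
  have "pcomp i j k t s \<cdot> x = mu \<AA> i j k ((t \<cdot> tg \<AA> i j \<cdot> s) \<cdot> x) ((s \<cdot> rst (t \<cdot> tg \<AA> i j \<cdot> s)) \<cdot> x)"
    unfolding pcomp_def by (rule mu_cmp[OF i sec_el[OF t] sec_el[OF s] pcomp_props(1)[OF i s t]])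
  also have "(s \<cdot> rst (t \<cdot> tg \<AA> i j \<cdot> s)) \<cdot> x = (s \<cdot> x) \<cdot> rst (s \<cdot> x)"
    using rst_swap[of "t \<cdot> tg \<AA> i j \<cdot> s" x] r by (simp add: cmp_assoc)
  also have "\<dots> = s \<cdot> x" by (rule cmp_rst_self[OF sec_el[OF s]])
  finally show ?thesis by (simp add: cmp_assoc)
qed

text \<open>The sections \<open>s\<close> and their inverses \<open>q\<close> are parameters, so the
  locale covers both the chosen glueings behind \<open>Psi_ob\<close> and a source-etale category
  over its own partial sections, where \<open>s\<close> is the identity.\<close>

locale presentation = jinternal C \<BB> + glued C A P "A1 \<BB>" "src \<BB>" q s
  for C :: "('o, 'm) rcat" and A :: "('i, 'm) rcat" and P :: "('i, 'm, 'o, 'm) ftor"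
    and \<BB> :: "('i, 'o, 'm) pcat" and q s +
  assumes Ix_eq: "Ix \<BB> = Ob A" and A0_eq: "i \<in> Ob A \<Longrightarrow> A0 \<BB> i = FOb P i"
    and tg_sa: "\<lbrakk>i \<in> Ob A; j \<in> Ob A; f \<in> Hom A i j\<rbrakk> \<Longrightarrow> tg \<BB> i j \<cdot> sa i j f = Pa i j f"
    and sa_Idn: "i \<in> Ob A \<Longrightarrow> sa i i (Idn A i) = un \<BB> i"
    and sa_Cmp: "\<lbrakk>i \<in> Ob A; j \<in> Ob A; k \<in> Ob A; f \<in> Hom A i j; g \<in> Hom A j k\<rbrakk> \<Longrightarrow>
      sa i k (Cmp A i j k g f) = pcomp i j k (sa j k g) (sa i j f)"
begin

no_notation A.cmp (infixr "\<cdot>" 70)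

definition unit_map :: "('i, 'm) over_map" where
  "unit_map = (mk_ftor A (\<lambda>i. i) s, \<lambda>i\<in>Ob A. Idn C (FOb P i))"

lemma pa_sr: "i \<in> Ob A \<Longrightarrow> pa i j = sr \<BB> i j"
  by (simp add: pa_def sr_def A0_eq)

lemma sa_sec: "\<lbrakk>i \<in> Ob A; j \<in> Ob A; f \<in> Hom A i j\<rbrakk> \<Longrightarrow> sa i j f \<in> sec i j"
  unfolding sec_def using sa_hom[of i j f] pa_sa[of i j f] rst_sa[of i j f] by (simp add: A0_eq pa_sr)

lemma sa_Rst: "\<lbrakk>i \<in> Ob A; j \<in> Ob A; f \<in> Hom A i j\<rbrakk> \<Longrightarrow> sa i i (Rst A i j f) = un \<BB> i \<cdot> rst (Pa i j f)"
  using sa_cmp_idem[of i i "Idn A i" "Rst A i j f"] Rst_idem[of i j f]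
  by (simp add: A.Idn_in A.Idn_Cmp A.Rst_in sa_Idn Pa_Rst)

lemma unit_over_map: "over_map C (A, P) (Phi_cat C \<BB>, Phi_proj C \<BB>) unit_map"
proof -
  let ?F = "mk_ftor A (\<lambda>i. i) s"
  interpret B: restriction_category "Phi_cat C \<BB>" by (rule restriction_category_Phi)
  note [simp] = Ix_eq A.Idn_in A.Cmp_in A.Rst_in
  have sin: "s i j f \<in> Hom (Phi_cat C \<BB>) i j" "arr (A0 \<BB> i) (A1 \<BB> i j) (s i j f) = sa i j f"
    if "i \<in> Ob A" "j \<in> Ob A" "f \<in> Hom A i j" for i j f
    using that sa_sec[OF that] raw_in(2)[OF that] by (auto simp: Phi_Hom sa_def A0_eq)
  have eqI: "x = y" if "i \<in> Ob A" "j \<in> Ob A" "x \<in> Hom (Phi_cat C \<BB>) i j" "y \<in> Hom (Phi_cat C \<BB>) i j"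
    "arr (A0 \<BB> i) (A1 \<BB> i j) x = arr (A0 \<BB> i) (A1 \<BB> i j) y" for i j x y
    using that by (auto simp: Phi_Hom intro: arr_inj)
  have F: "restriction_functor A (Phi_cat C \<BB>) ?F"
  proof (unfold_locales, goal_cases)
    case (3 x)
    then show ?case using B.Idn_in[of x] by (intro eqI[of x x]) (auto simp: sin sa_Idn simp flip: un_def)
  next
    case (4 x y z f g)
    then show ?case using B.Cmp_in[of x y z "s x y f" "s y z g"]
      by (intro eqI[of x z]) (auto simp: sin sa_Cmp arr_Phi_Cmp)
  next
    case (5 x y f)
    then show ?case using B.Rst_in[of x y "s x y f"]
      by (intro eqI[of x x]) (auto simp: sin arr_Phi_Rst sa_Rst rst_sa)
  qed (auto simp: sin)
  show ?thesis
    unfolding unit_map_def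
  proof (rule over_mapI[OF F _ _ P.restriction_functor_axioms restriction_functor_Phi_proj])
    fix x assume x: "x \<in> Ob A"
    then show "total_map C (FOb (Phi_proj C \<BB>) (FOb ?F x)) (FOb P x) ((\<lambda>i\<in>Ob A. Idn C (FOb P i)) x)"
      using ide_tot[OF P_ob[OF x]] by (simp add: Phi_proj_simps A0_eq total_map_iff Idn_in ide_def)
  next
    fix x y f assume f: "x \<in> Ob A" "y \<in> Ob A" "f \<in> Hom A x y"
    have "Pa x y f \<in> hom (FOb P x) (FOb P y)" by (rule Pa_hom[OF f])
    then show "arr (FOb (Phi_proj C \<BB>) (FOb ?F y)) (FOb P y) ((\<lambda>i\<in>Ob A. Idn C (FOb P i)) y) \<cdot>
        arr (FOb (Phi_proj C \<BB>) (FOb ?F x)) (FOb (Phi_proj C \<BB>) (FOb ?F y))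
          (FHom (Phi_proj C \<BB>) (FOb ?F x) (FOb ?F y) (FHom ?F x y f)) =
        arr (FOb P x) (FOb P y) (FHom P x y f) \<cdot>
        arr (FOb (Phi_proj C \<BB>) (FOb ?F x)) (FOb P x) ((\<lambda>i\<in>Ob A. Idn C (FOb P i)) x)"
      using f sin[OF f] by (simp add: Phi_proj_simps A0_eq[symmetric] tg_sa)
        (simp add: A0_eq Phi_proj_simps ide_cmp_hom cmp_ide flip: ide_def Pa_def)
  qed auto
qed

end

section \<open>The cofunctor induced by a map over the base\<close>

locale presentation_map = presentation C A P \<BB> q s + D: internal C \<DD>
  for C :: "('o, 'm) rcat" and A :: "('i, 'm) rcat" and P :: "('i, 'm, 'o, 'm) ftor"
    and \<BB> \<DD> :: "('i, 'o, 'm) pcat" and q s +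
  fixes F :: "('i, 'm, 'i, 'm) ftor" and \<alpha> :: "'i \<Rightarrow> 'm"
  assumes over: "over_map C (A, P) (Phi_cat C \<DD>, Phi_proj C \<DD>) (F, \<alpha>)"
begin

no_notation A.cmp (infixr "\<cdot>" 70)

sublocale F: restriction_functor A "Phi_cat C \<DD>" F
  using over by (simp add: over_map_iff)

definition "Fa i j f = arr (A0 \<DD> (FOb F i)) (A1 \<DD> (FOb F i) (FOb F j)) (FHom F i j f)"
definition "al i = arr (A0 \<DD> (FOb F i)) (FOb P i) (\<alpha> i)"

lemma F_ob [simp]: "i \<in> Ob A \<Longrightarrow> FOb F i \<in> Ix \<DD>"
  using F.FOb_in by simp

lemmas om = over_mapD[OF over P.restriction_functor_axioms D.restriction_functor_Phi_proj]

lemma al_tot: "i \<in> Ob A \<Longrightarrow> al i \<in> tot (A0 \<DD> (FOb F i)) (FOb P i)"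
  using om(5)[of i] by (simp add: al_def D.Phi_proj_simps)

lemmas al_hom = al_tot[THEN tot_hom]

lemma Fa_sec: "\<lbrakk>i \<in> Ob A; j \<in> Ob A; f \<in> Hom A i j\<rbrakk> \<Longrightarrow> Fa i j f \<in> D.sec (FOb F i) (FOb F j)"
  using F.FHom_in[of i j f] by (simp add: D.Phi_Hom Fa_def)

lemma Fa_Idn: "i \<in> Ob A \<Longrightarrow> Fa i i (Idn A i) = un \<DD> (FOb F i)"
  by (simp add: Fa_def F.FHom_Idn un_def)

lemma Fa_Cmp: "\<lbrakk>i \<in> Ob A; j \<in> Ob A; k \<in> Ob A; f \<in> Hom A i j; g \<in> Hom A j k\<rbrakk> \<Longrightarrow>
    Fa i k (Cmp A i j k g f) = D.pcomp (FOb F i) (FOb F j) (FOb F k) (Fa j k g) (Fa i j f)"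
  by (simp add: Fa_def F.FHom_Cmp D.arr_Phi_Cmp F.FHom_in)

lemma al_Fa: "\<lbrakk>i \<in> Ob A; j \<in> Ob A; f \<in> Hom A i j\<rbrakk> \<Longrightarrow>
    al j \<cdot> tg \<DD> (FOb F i) (FOb F j) \<cdot> Fa i j f = Pa i j f \<cdot> al i"
  using om(6)[of i j f] F.FHom_in[of i j f] by (simp add: D.Phi_proj_simps al_def Fa_def Pa_def)

text \<open>The component \<open>al j\<close> and the target map are total, so
  \<open>Fa i j f\<close> and its composite with them have the same domain; by naturality that
  composite is \<open>Pa i j f \<cdot> al i\<close>.\<close>

lemma rst_Fa: "\<lbrakk>i \<in> Ob A; j \<in> Ob A; f \<in> Hom A i j\<rbrakk> \<Longrightarrow> rst (Fa i j f \<cdot> x) = rst (Pa i j f \<cdot> al i \<cdot> x)"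
proof -
  assume f: "i \<in> Ob A" "j \<in> Ob A" "f \<in> Hom A i j"
  have "rst (Pa i j f \<cdot> al i \<cdot> x) = rst (al j \<cdot> tg \<DD> (FOb F i) (FOb F j) \<cdot> Fa i j f \<cdot> x)"
    using cmp_reassoc[OF al_Fa[OF f], of x] by (simp add: cmp_assoc)
  also have "\<dots> = rst (tg \<DD> (FOb F i) (FOb F j) \<cdot> Fa i j f \<cdot> x)"
    using f by (intro rst_tot[OF al_tot] hom_cmp_el[OF D.tg_hom]) auto
  also have "\<dots> = rst (Fa i j f \<cdot> x)"
    using f by (intro rst_tot[OF D.tg_tot] D.sec_el[OF Fa_sec]) auto
  finally show ?thesis by simp
qed

lemma Fa_idem:
  assumes f: "i \<in> Ob A" "j \<in> Ob A" "f \<in> Hom A i j" and e: "e \<in> rst_idems A i"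
  shows "Fa i j (Cmp A i i j f e) = Fa i j f \<cdot> rst (Pa i i e \<cdot> al i)"
proof -
  have e': "e \<in> Hom A i i" "Rst A i i e = e" using e by (auto simp: rst_idems_def)
  have "Fa i i e = un \<DD> (FOb F i) \<cdot> rst (Fa i i e)"
    using F.FHom_Rst[OF f(1) f(1) e'(1)] f e' D.arr_Phi_Rst(2)[of "FOb F i" "FOb F i" "FHom F i i e"] F.FHom_in[of i i e]
    by (simp add: Fa_def)
  moreover have "rst (Fa i i e) = rst (Pa i i e \<cdot> al i)"
    using rst_Fa[OF f(1) f(1) e'(1), of "ide (A0 \<DD> (FOb F i))"] f
    by (simp add: cmp_ide[OF al_hom] cmp_ide[OF D.sec_hom[OF Fa_sec[OF f(1) f(1) e'(1)]]])
  moreover have "rst (Fa i i e) \<in> idem (A0 \<DD> (FOb F i))"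
    by (rule rst_in_idem[OF D.sec_hom[OF Fa_sec[OF f(1) f(1) e'(1)]]])
  ultimately show ?thesis
    using Fa_Cmp[OF f(1) f(1,2) e'(1) f(3)] D.pcomp_idem[OF _ _ Fa_sec[OF f], of "rst (Fa i i e)"] f by simp
qed

definition "HH w = mk_cofun \<BB> (FOb F) \<alpha> w"

lemma HH_simps [simp]: "i \<in> Ob A \<Longrightarrow> cof (HH w) i = FOb F i" "i \<in> Ob A \<Longrightarrow> cof0 (HH w) i = \<alpha> i"
  "\<lbrakk>i \<in> Ob A; j \<in> Ob A\<rbrakk> \<Longrightarrow> cof1 (HH w) i j = w i j" "i \<in> Ob A \<Longrightarrow> c0 \<BB> \<DD> (HH w) i = al i"
  by (simp_all add: HH_def Ix_eq c0_def al_def A0_eq)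

lemma precofun_HH: "precofun C \<BB> \<DD> (HH w)"
proof
  show "cof (HH w) i \<in> Ix \<DD>" "total_map C (A0 \<DD> (cof (HH w) i)) (A0 \<BB> i) (cof0 (HH w) i)" if "i \<in> Ix \<BB>" for i
    using that al_tot[of i] om(4)[of i] by (simp_all add: Ix_eq A0_eq total_map_iff al_def D.Phi_proj_simps)
qed

text \<open>The pullback carrying the arrow part is named before the arrow part is constructed;
  \<open>undefined\<close> may stand for the latter because the cospan does not involve it.\<close>

definition "KK = act_cospan \<BB> \<DD> (HH undefined)"

lemma act_cospan_HH: "i \<in> Ob A \<Longrightarrow> act_cospan \<BB> \<DD> (HH w) i j = KK i j"
  by (simp add: KK_def act_cospan_def)

context
  fixes i j assumes ij: "i \<in> Ob A" "j \<in> Ob A"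
begin

lemma KK_ok: "cospan_ok (KK i j)"
  and KK_simps [simp]: "ob1 (KK i j) = A1 \<BB> i j" "ob2 (KK i j) = A0 \<DD> (FOb F i)" "l1 (KK i j) = sr \<BB> i j" "l2 (KK i j) = al i"
proof -
  interpret H: precofun C \<BB> \<DD> "HH undefined" by (rule precofun_HH)
  show "cospan_ok (KK i j)" unfolding KK_def by (rule H.act_ok) (simp_all add: Ix_eq ij)
  show "ob1 (KK i j) = A1 \<BB> i j" "ob2 (KK i j) = A0 \<DD> (FOb F i)" "l1 (KK i j) = sr \<BB> i j" "l2 (KK i j) = al i"
    unfolding KK_def using ij by simp_all
qed

text \<open>Where \<open>a\<close> lies in the piece of \<open>f\<close>, its source lies in the
  domain of \<open>f\<close>. This source is also \<open>al i \<cdot> b\<close>, and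
  \<open>rst_Fa\<close> says that \<open>Fa i j f\<close> is then defined on
  \<open>b\<close>.\<close>

lemma Fa_local:
  assumes f: "f \<in> Hom A i j" and ab: "sr \<BB> i j \<cdot> a = al i \<cdot> b"
  shows "rst (Fa i j f \<cdot> b) \<cdot> rst (qa i j f \<cdot> a) = rst (qa i j f \<cdot> a)"
proof -
  have "rst (Fa i j f \<cdot> b) \<cdot> rst (qa i j f \<cdot> a) = rst ((Pa i j f \<cdot> pa i j \<cdot> a) \<cdot> rst (qa i j f \<cdot> a))"
    by (simp add: rst_Fa[OF ij f] pa_sr ij ab)
  also have "(Pa i j f \<cdot> pa i j \<cdot> a) \<cdot> rst (qa i j f \<cdot> a) = Pa i j f \<cdot> qa i j f \<cdot> a"
    using pa_local[OF ij f, of a] by (simp add: cmp_assoc)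
  finally show ?thesis using rst_Pa_qa[OF ij f] by simp
qed

text \<open>On the piece of \<open>f\<close> the value at a pair (a, b) is forced to be
  \<open>Fa i j f\<close> at b. If the source of a lies in an e of \<open>Eq i j f g\<close>, this
  equals the value of \<open>F\<close> on \<open>f\<close> after e at b, which is also
  \<open>g\<close> after e; hence \<open>glue_ext\<close> applies.\<close>

lemma ex_cof1: "\<exists>v\<in>hom (pb C (KK i j)) (A1 \<DD> (FOb F i) (FOb F j)).
    \<forall>f\<in>Hom A i j. v \<cdot> rst (qa i j f \<cdot> pb1 (KK i j)) = (Fa i j f \<cdot> pb2 (KK i j)) \<cdot> rst (qa i j f \<cdot> pb1 (KK i j))"
proof -
  let ?a = "pb1 (KK i j)" and ?b = "pb2 (KK i j)"
  have ab: "?a \<in> hom (pb C (KK i j)) (A1 \<BB> i j)" "?b \<in> hom (pb C (KK i j)) (A0 \<DD> (FOb F i))" "sr \<BB> i j \<cdot> ?a = al i \<cdot> ?b"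
    using pb_hom[OF KK_ok] pb_square[OF KK_ok] by simp_all
  have "\<exists>v\<in>hom (pb C (KK i j)) (A1 \<DD> (FOb F i) (FOb F j)). v \<cdot> rst ?a = v \<and>
      (\<forall>f\<in>Hom A i j. v \<cdot> rst (qa i j f \<cdot> ?a) = (Fa i j f \<cdot> ?b) \<cdot> rst (qa i j f \<cdot> ?a)) \<and>
     ((\<forall>f\<in>Hom A i j. rst (Fa i j f \<cdot> ?b) \<cdot> rst (qa i j f \<cdot> ?a) = rst (qa i j f \<cdot> ?a)) \<longrightarrow> rst v = rst ?a)"
  proof (rule glue_ext[OF ij ab(1)])
    show "A1 \<DD> (FOb F i) (FOb F j) \<in> Ob C" using ij by simp
    show "Fa i j f \<cdot> ?b \<in> hom (pb C (KK i j)) (A1 \<DD> (FOb F i) (FOb F j))" if "f \<in> Hom A i j" for f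
      by (rule cmp_hom[OF D.sec_hom[OF Fa_sec[OF ij that]] ab(2)])
    fix f g e r assume f: "f \<in> Hom A i j" and g: "g \<in> Hom A i j" and e: "e \<in> Eq i j f g"
      and r: "r \<in> idem (pb C (KK i j))" and er: "Pa i i e \<cdot> pa i j \<cdot> ?a \<cdot> r = pa i j \<cdot> ?a \<cdot> r"
    note d = EqD[OF ij f g e]
    have "pa i j \<cdot> ?a \<cdot> r = al i \<cdot> ?b \<cdot> r" using cmp_reassoc[OF ab(3), of r] by (simp add: pa_sr ij cmp_assoc)
    then have "rst (Pa i i e \<cdot> al i \<cdot> ?b \<cdot> r) = rst (al i \<cdot> ?b \<cdot> r)" using er by simp
    also have "\<dots> = rst (?b \<cdot> r)" by (rule rst_tot[OF al_tot[OF ij(1)] hom_cmp_el[OF ab(2)]])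
    finally have "rst (Pa i i e \<cdot> al i) \<cdot> ?b \<cdot> r = ?b \<cdot> r"
      using rst_swap[of "Pa i i e \<cdot> al i" "?b \<cdot> r"] cmp_rst_self[OF hom_cmp_el[OF ab(2), of r]] by (simp add: cmp_assoc)
    then have *: "Fa i j h \<cdot> ?b \<cdot> r = Fa i j (Cmp A i i j h e) \<cdot> ?b \<cdot> r" if "h \<in> Hom A i j" for h
      by (simp add: Fa_idem[OF ij that d(1)] cmp_assoc)
    show "(Fa i j f \<cdot> ?b) \<cdot> r = (Fa i j g \<cdot> ?b) \<cdot> r"
      using *[OF f] *[OF g] by (simp add: d(4) cmp_assoc)
  qed
  then show ?thesis by blast
qed

end

definition "vv i j = (SOME v. v \<in> hom (pb C (KK i j)) (A1 \<DD> (FOb F i) (FOb F j)) \<and>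
    (\<forall>f\<in>Hom A i j. v \<cdot> rst (qa i j f \<cdot> pb1 (KK i j)) = (Fa i j f \<cdot> pb2 (KK i j)) \<cdot> rst (qa i j f \<cdot> pb1 (KK i j))))"

lemma vv: assumes "i \<in> Ob A" "j \<in> Ob A"
  shows "vv i j \<in> hom (pb C (KK i j)) (A1 \<DD> (FOb F i) (FOb F j))"
    "f \<in> Hom A i j \<Longrightarrow> vv i j \<cdot> rst (qa i j f \<cdot> pb1 (KK i j)) = (Fa i j f \<cdot> pb2 (KK i j)) \<cdot> rst (qa i j f \<cdot> pb1 (KK i j))"
proof -
  have "\<exists>v. v \<in> hom (pb C (KK i j)) (A1 \<DD> (FOb F i) (FOb F j)) \<and>
    (\<forall>f\<in>Hom A i j. v \<cdot> rst (qa i j f \<cdot> pb1 (KK i j)) = (Fa i j f \<cdot> pb2 (KK i j)) \<cdot> rst (qa i j f \<cdot> pb1 (KK i j)))"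
    using ex_cof1[OF assms] by blast
  from someI_ex[OF this] show "vv i j \<in> hom (pb C (KK i j)) (A1 \<DD> (FOb F i) (FOb F j))"
    "f \<in> Hom A i j \<Longrightarrow> vv i j \<cdot> rst (qa i j f \<cdot> pb1 (KK i j)) = (Fa i j f \<cdot> pb2 (KK i j)) \<cdot> rst (qa i j f \<cdot> pb1 (KK i j))"
    unfolding vv_def by blast+
qed

definition "H = HH (\<lambda>i j. mor (vv i j))"

lemma H_simps [simp]: "i \<in> Ob A \<Longrightarrow> cof H i = FOb F i" "i \<in> Ob A \<Longrightarrow> cof0 H i = \<alpha> i"
  "i \<in> Ob A \<Longrightarrow> c0 \<BB> \<DD> H i = al i" "i \<in> Ob A \<Longrightarrow> act_cospan \<BB> \<DD> H i j = KK i j"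
  by (simp_all add: H_def act_cospan_HH)

lemma cofun1_H: "cofun1 C \<BB> \<DD> H"
proof -
  interpret H: precofun C \<BB> \<DD> H unfolding H_def by (rule precofun_HH)
  show ?thesis
    by unfold_locales (simp add: Ix_eq act_cospan_HH H_def mor_in[OF vv(1)])
qed

interpretation H: cofun1 C \<BB> \<DD> H by (rule cofun1_H)

no_notation A.cmp (infixr "\<cdot>" 70)

lemma c1_H: "\<lbrakk>i \<in> Ob A; j \<in> Ob A\<rbrakk> \<Longrightarrow> c1 \<BB> \<DD> H i j = vv i j"
  by (simp add: c1_def) (simp add: H_def arr_mor[OF vv(1)])

lemma act_H_local:
  assumes ij: "i \<in> Ob A" "j \<in> Ob A" and f: "f \<in> Hom A i j"
    and a: "a \<in> el (A1 \<BB> i j)" and b: "b \<in> el (A0 \<DD> (FOb F i))" and ab: "sr \<BB> i j \<cdot> a = al i \<cdot> b"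
  shows "act \<BB> \<DD> H i j a b \<cdot> rst (qa i j f \<cdot> a) = Fa i j f \<cdot> b \<cdot> rst (qa i j f \<cdot> a)"
proof -
  let ?K = "KK i j" let ?m = "mpair ?K a b"
  have m: "pb1 ?K \<cdot> ?m = a" "pb2 ?K \<cdot> ?m = b"
    using pb_mpair[OF KK_ok[OF ij], of a b] assms by simp_all
  have sw: "rst (qa i j f \<cdot> pb1 ?K) \<cdot> ?m = ?m \<cdot> rst (qa i j f \<cdot> a)"
    using rst_swap[of "qa i j f \<cdot> pb1 ?K" ?m] by (simp add: cmp_assoc m)
  have "(vv i j \<cdot> rst (qa i j f \<cdot> pb1 ?K)) \<cdot> ?m = ((Fa i j f \<cdot> pb2 ?K) \<cdot> rst (qa i j f \<cdot> pb1 ?K)) \<cdot> ?m"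
    by (simp only: vv(2)[OF ij f])
  then show ?thesis
    using cmp_reassoc[OF m(2)] by (simp add: act_def c1_H[OF ij] ij cmp_assoc sw)
qed

text \<open>\<open>a = sa i j f \<cdot> sr \<BB> i j \<cdot> a\<close> says that the generalised element \<open>a\<close> lies on the section \<open>f\<close>.\<close>

lemma on_section:
  assumes ij: "i \<in> Ob A" "j \<in> Ob A" and f: "f \<in> Hom A i j" and a: "a = sa i j f \<cdot> sr \<BB> i j \<cdot> a"
  shows "rst (qa i j f \<cdot> a) = rst a"
proof -
  have "qa i j f \<cdot> a = qa i j f \<cdot> sa i j f \<cdot> sr \<BB> i j \<cdot> a" using a by simp
  also have "\<dots> = rst (sa i j f) \<cdot> sr \<BB> i j \<cdot> a"
    using cmp_reassoc[OF qa_sa[OF ij f f]] loc_self[OF ij f] rst_sa[OF ij f] by simp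
  finally have "rst (qa i j f \<cdot> a) = rst (sa i j f \<cdot> sr \<BB> i j \<cdot> a)" by simp
  then show ?thesis using a by simp
qed

lemma act_H_sec:
  assumes ij: "i \<in> Ob A" "j \<in> Ob A" and f: "f \<in> Hom A i j"
    and a: "a \<in> el (A1 \<BB> i j)" and b: "b \<in> el (A0 \<DD> (FOb F i))" and ab: "sr \<BB> i j \<cdot> a = al i \<cdot> b"
    and s: "a = sa i j f \<cdot> sr \<BB> i j \<cdot> a"
  shows "act \<BB> \<DD> H i j a b = Fa i j f \<cdot> b" "rst (Fa i j f \<cdot> b) = rst a" "rst b = rst a"
proof -
  note r = on_section[OF ij f s]
  have "rst (sr \<BB> i j \<cdot> a) = rst a" using ij by (intro rst_tot[OF sr_tot] a) (auto simp: Ix_eq)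
  then show rb: "rst b = rst a" using rst_tot[OF al_tot[OF ij(1)] b] ab by simp
  have "act \<BB> \<DD> H i j a b \<cdot> rst a = act \<BB> \<DD> H i j (a \<cdot> rst a) (b \<cdot> rst a)"
    using ij a b ab by (intro H.act_cmp) (auto simp: Ix_eq)
  also have "\<dots> = act \<BB> \<DD> H i j a b" using cmp_rst_self[OF a] cmp_rst_self[OF b] unfolding rb by simp
  finally show "act \<BB> \<DD> H i j a b = Fa i j f \<cdot> b"
    using act_H_local[OF ij f a b ab] cmp_rst_self[OF b] by (simp add: r rb)
  have "rst (Fa i j f \<cdot> b) \<cdot> rst a = rst a" using Fa_local[OF ij f ab] by (simp add: r)
  moreover have "rst (Fa i j f \<cdot> b) \<cdot> rst b = rst (Fa i j f \<cdot> b)" by (rule rst_cmp_rst_right)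
  ultimately show "rst (Fa i j f \<cdot> b) = rst a" by (simp add: rb)
qed

lemma el_section:
  assumes ij: "i \<in> Ob A" "j \<in> Ob A" and f: "f \<in> Hom A i j" and e: "e = rst (qa i j f \<cdot> a) \<cdot> e"
  shows "a \<cdot> e = sa i j f \<cdot> sr \<BB> i j \<cdot> a \<cdot> e"
proof -
  have "(a \<cdot> rst (qa i j f \<cdot> a)) \<cdot> e = (sa i j f \<cdot> pa i j \<cdot> a \<cdot> rst (qa i j f \<cdot> a)) \<cdot> e"
    by (simp only: el_local[OF ij f, of a, symmetric])
  then show ?thesis using e by (simp add: cmp_assoc pa_sr ij)
qed

context
  fixes i j w a b assumes ij: "i \<in> Ob A" "j \<in> Ob A"
    and a: "a \<in> hom w (A1 \<BB> i j)" and b: "b \<in> hom w (A0 \<DD> (FOb F i))" and ab: "sr \<BB> i j \<cdot> a = al i \<cdot> b"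
begin

lemma act_H_hom: "act \<BB> \<DD> H i j a b \<in> hom w (A1 \<DD> (FOb F i) (FOb F j))"
  using H.act_hom[of i j a w b] a b ab ij by (simp add: Ix_eq)

lemma rst_matching: "rst a = rst b"
  using rst_tot[OF sr_tot hom_el[OF a]] rst_tot[OF al_tot[OF ij(1)] hom_el[OF b]] ij ab by (simp add: Ix_eq)

lemma act_H_cmp: "act \<BB> \<DD> H i j a b \<cdot> r = act \<BB> \<DD> H i j (a \<cdot> r) (b \<cdot> r)"
  using H.act_cmp[of i j a b r] a b ab ij by (simp add: Ix_eq hom_el)

lemma act_H_rst: "act \<BB> \<DD> H i j a b \<cdot> rst a = act \<BB> \<DD> H i j a b"
  unfolding act_H_cmp using hom_rst[OF a] hom_rst[OF b] rst_matching by simp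

lemma sr_act_H: "sr \<DD> (FOb F i) (FOb F j) \<cdot> act \<BB> \<DD> H i j a b = b"
proof (rule glue_eq[OF ij a])
  show "sr \<DD> (FOb F i) (FOb F j) \<cdot> act \<BB> \<DD> H i j a b \<in> hom w (A0 \<DD> (FOb F i))"
    using ij by (intro cmp_hom[OF D.sr_hom act_H_hom]) auto
  show "(sr \<DD> (FOb F i) (FOb F j) \<cdot> act \<BB> \<DD> H i j a b) \<cdot> rst a = sr \<DD> (FOb F i) (FOb F j) \<cdot> act \<BB> \<DD> H i j a b"
    by (simp add: cmp_assoc act_H_rst)
  show "b \<cdot> rst a = b" using hom_rst[OF b] by (simp add: rst_matching)
  fix f assume f: "f \<in> Hom A i j"
  let ?r = "rst (qa i j f \<cdot> a)"
  have "rst (Fa i j f \<cdot> b \<cdot> ?r) = ?r"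
    using Fa_local[OF ij f ab] rst_cmp_rst[of "Fa i j f \<cdot> b" "qa i j f \<cdot> a"] by (simp add: cmp_assoc)
  then have "b \<cdot> ?r \<cdot> rst (Fa i j f \<cdot> b \<cdot> ?r) = b \<cdot> ?r" by simp
  then show "(sr \<DD> (FOb F i) (FOb F j) \<cdot> act \<BB> \<DD> H i j a b) \<cdot> ?r = b \<cdot> ?r"
    using D.sr_sec_cmp[OF Fa_sec[OF ij f], of "b \<cdot> ?r"]
    by (simp add: cmp_assoc act_H_local[OF ij f hom_el[OF a] hom_el[OF b] ab])
qed (rule b)

lemma tg_act_H: "al j \<cdot> tg \<DD> (FOb F i) (FOb F j) \<cdot> act \<BB> \<DD> H i j a b = tg \<BB> i j \<cdot> a"
proof (rule glue_eq[OF ij a])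
  let ?t = "tg \<DD> (FOb F i) (FOb F j)"
  show "al j \<cdot> ?t \<cdot> act \<BB> \<DD> H i j a b \<in> hom w (FOb P j)"
    using ij by (intro cmp_hom[OF al_hom cmp_hom[OF D.tg_hom act_H_hom]]) auto
  show "tg \<BB> i j \<cdot> a \<in> hom w (FOb P j)"
    using ij cmp_hom[OF tg_hom a] by (simp add: Ix_eq A0_eq)
  show "(al j \<cdot> ?t \<cdot> act \<BB> \<DD> H i j a b) \<cdot> rst a = al j \<cdot> ?t \<cdot> act \<BB> \<DD> H i j a b" "(tg \<BB> i j \<cdot> a) \<cdot> rst a = tg \<BB> i j \<cdot> a"
    using hom_el[OF a] by (simp_all add: cmp_assoc act_H_rst)
  fix f assume f: "f \<in> Hom A i j"
  let ?r = "rst (qa i j f \<cdot> a)"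
  have "(al j \<cdot> ?t \<cdot> act \<BB> \<DD> H i j a b) \<cdot> ?r = al j \<cdot> ?t \<cdot> Fa i j f \<cdot> b \<cdot> ?r"
    by (simp add: cmp_assoc act_H_local[OF ij f hom_el[OF a] hom_el[OF b] ab])
  also have "\<dots> = Pa i j f \<cdot> al i \<cdot> b \<cdot> ?r"
    using cmp_reassoc[OF al_Fa[OF ij f], of "b \<cdot> ?r"] by (simp add: cmp_assoc)
  also have "\<dots> = Pa i j f \<cdot> sr \<BB> i j \<cdot> a \<cdot> ?r" using cmp_reassoc[OF ab, of ?r] by (simp add: cmp_assoc)
  also have "\<dots> = tg \<BB> i j \<cdot> sa i j f \<cdot> sr \<BB> i j \<cdot> a \<cdot> ?r"
    using cmp_reassoc[OF tg_sa[OF ij f]] by simp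
  also have "\<dots> = tg \<BB> i j \<cdot> a \<cdot> ?r" using el_section[OF ij f, of ?r a] by simp
  finally show "(al j \<cdot> ?t \<cdot> act \<BB> \<DD> H i j a b) \<cdot> ?r = (tg \<BB> i j \<cdot> a) \<cdot> ?r" by (simp add: cmp_assoc)
qed

end

lemma cofunctor_H: "cofunctor C \<BB> \<DD> H"
proof (rule H.cofunctorI, goal_cases)
  case (1 i j w a b)
  then show ?case using sr_act_H[of i j a w b] by (simp add: Ix_eq)
next
  case (2 i j w a b)
  then show ?case using tg_act_H[of i j a w b] by (simp add: Ix_eq)
next
  case (3 i)
  then have i: "i \<in> Ob A" by (simp add: Ix_eq)
  let ?d = "A0 \<DD> (FOb F i)"
  have "act \<BB> \<DD> H i i (un \<BB> i \<cdot> al i) (ide ?d) = Fa i i (Idn A i) \<cdot> ide ?d"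
  proof (rule act_H_sec(1)[OF i i])
    show "sr \<BB> i i \<cdot> un \<BB> i \<cdot> al i = al i \<cdot> ide ?d"
      using 3 i by (simp add: cmp_reassoc[OF sr_un] cmp_ide[OF al_hom] ide_cmp_hom[OF al_hom] A0_eq)
    then show "un \<BB> i \<cdot> al i = sa i i (Idn A i) \<cdot> sr \<BB> i i \<cdot> un \<BB> i \<cdot> al i"
      using i by (simp add: sa_Idn cmp_ide[OF al_hom])
  qed (use i 3 in \<open>auto intro: A.Idn_in hom_cmp_el[OF un_hom] hom_el[OF ide_hom]\<close>)
  then show ?case using i by (simp add: Fa_Idn cmp_ide[OF D.un_hom])
next
  case (4 i j k w g f b)
  then have i: "i \<in> Ob A" "j \<in> Ob A" "k \<in> Ob A" and gf: "sr \<BB> j k \<cdot> g = tg \<BB> i j \<cdot> f" and fb: "sr \<BB> i j \<cdot> f = al i \<cdot> b"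
    and b: "b \<in> hom w (A0 \<DD> (FOb F i))"
    by (simp_all add: Ix_eq)
  have ix: "i \<in> Ix \<BB>" "j \<in> Ix \<BB>" "k \<in> Ix \<BB>" using i by (simp_all add: Ix_eq)
  let ?i = "FOb F i" let ?j = "FOb F j" let ?k = "FOb F k"
  note d = F_ob[OF i(1)] F_ob[OF i(2)] F_ob[OF i(3)]
  \<comment> \<open>Both sides are abstracted over the triple, so that restricting them to an
    idempotent means restricting the three arguments.\<close>
  define L where "L = (\<lambda>g f b. act \<BB> \<DD> H i k (mu \<BB> i j k g f) b)"
  define R where "R = (\<lambda>g f b. mu \<DD> ?i ?j ?k (act \<BB> \<DD> H j k g (tg \<DD> ?i ?j \<cdot> act \<BB> \<DD> H i j f b)) (act \<BB> \<DD> H i j f b))"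
  \<comment> \<open>If \<open>f\<close> lies on the section of \<phi> and \<open>g\<close> on that
    of \<gamma>, their product lies on the section of the composite in \<open>A\<close>, and both
    sides become \<open>F\<close> of that composite at \<open>b\<close>.\<close>
  have sec: "L g f b = R g f b" if el: "g \<in> el (A1 \<BB> j k)" "f \<in> el (A1 \<BB> i j)" "b \<in> el (A0 \<DD> ?i)"
    and gf: "sr \<BB> j k \<cdot> g = tg \<BB> i j \<cdot> f" and fb: "sr \<BB> i j \<cdot> f = al i \<cdot> b"
    and \<phi>: "\<phi> \<in> Hom A i j" "f = sa i j \<phi> \<cdot> sr \<BB> i j \<cdot> f" and \<gamma>: "\<gamma> \<in> Hom A j k" "g = sa j k \<gamma> \<cdot> sr \<BB> j k \<cdot> g"
    for g f b \<phi> \<gamma>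
  proof -
    let ?y = "sr \<BB> i j \<cdot> f" let ?\<gamma>\<phi> = "Cmp A i j k \<gamma> \<phi>"
    note aF = act_H_sec[OF i(1,2) \<phi>(1) el(2,3) fb \<phi>(2)]
    have c: "?\<gamma>\<phi> \<in> Hom A i k" using i \<phi> \<gamma> by (intro A.Cmp_in) auto
    have t: "tg \<BB> i j \<cdot> f = Pa i j \<phi> \<cdot> ?y"
      using cmp_reassoc[OF tg_sa[OF i(1,2) \<phi>(1)], of ?y] \<phi>(2) by simp
    have g: "g = sa j k \<gamma> \<cdot> tg \<BB> i j \<cdot> sa i j \<phi> \<cdot> ?y" using \<gamma>(2) gf \<phi>(2) by simp
    have rgf: "rst g = rst f"
      using rst_tot[OF sr_tot el(1)] rst_tot[OF tg_tot el(2)] ix by (simp add: gf)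
    have m: "mu \<BB> i j k g f = sa i k ?\<gamma>\<phi> \<cdot> ?y"
      using pcomp_cmp[OF ix sa_sec[OF i(1,2) \<phi>(1)] sa_sec[OF i(2,3) \<gamma>(1)], of ?y] rgf g \<phi>(2)
      by (simp add: sa_Cmp[OF i \<phi>(1) \<gamma>(1)])
    have me: "mu \<BB> i j k g f \<in> el (A1 \<BB> i k)" by (rule mu_el[OF ix])
    have ms: "sr \<BB> i k \<cdot> mu \<BB> i j k g f = ?y" by (rule sr_mu[OF ix el(1,2) gf])
    have L: "L g f b = Fa i k ?\<gamma>\<phi> \<cdot> b"
      unfolding L_def by (rule act_H_sec(1)[OF i(1,3) c me el(3)]) (use m ms fb in simp_all)
    have te: "tg \<DD> ?i ?j \<cdot> Fa i j \<phi> \<cdot> b \<in> el (A0 \<DD> ?j)" by (rule hom_cmp_el[OF D.tg_hom[OF d(1,2)]])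
    have tg: "sr \<BB> j k \<cdot> g = al j \<cdot> tg \<DD> ?i ?j \<cdot> Fa i j \<phi> \<cdot> b"
      using cmp_reassoc[OF al_Fa[OF i(1,2) \<phi>(1)], of b] by (simp add: gf t fb cmp_assoc)
    note aG = act_H_sec[OF i(2,3) \<gamma>(1) el(1) te tg \<gamma>(2)]
    have "R g f b = mu \<DD> ?i ?j ?k (Fa j k \<gamma> \<cdot> tg \<DD> ?i ?j \<cdot> Fa i j \<phi> \<cdot> b) (Fa i j \<phi> \<cdot> b)"
      unfolding R_def aF(1) aG(1) ..
    also have "\<dots> = D.pcomp ?i ?j ?k (Fa j k \<gamma>) (Fa i j \<phi>) \<cdot> b"
      by (rule D.pcomp_cmp[symmetric, OF d Fa_sec[OF i(1,2) \<phi>(1)] Fa_sec[OF i(2,3) \<gamma>(1)]]) (simp add: aG(2) aF(2) rgf)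
    also have "\<dots> = Fa i k ?\<gamma>\<phi> \<cdot> b" by (simp add: Fa_Cmp[OF i \<phi>(1) \<gamma>(1)])
    finally show ?thesis using L by simp
  qed
  note g = 4(4) and f = 4(5)
  have t: "sr \<BB> j k \<cdot> g = al j \<cdot> tg \<DD> ?i ?j \<cdot> act \<BB> \<DD> H i j f b"
    using tg_act_H[OF i(1,2) f b fb] gf by simp
  have ah: "act \<BB> \<DD> H i j f b \<in> hom w (A1 \<DD> ?i ?j)" by (rule act_H_hom[OF i(1,2) f b fb])
  have th: "tg \<DD> ?i ?j \<cdot> act \<BB> \<DD> H i j f b \<in> hom w (A0 \<DD> ?j)" by (rule cmp_hom[OF D.tg_hom[OF d(1,2)] ah])
  have ag: "act \<BB> \<DD> H j k g (tg \<DD> ?i ?j \<cdot> act \<BB> \<DD> H i j f b) \<in> hom w (A1 \<DD> ?j ?k)" by (rule act_H_hom[OF i(2,3) g th t])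
  have mh: "mu \<BB> i j k g f \<in> hom w (A1 \<BB> i k)" by (rule mu_hom[OF ix g f gf])
  have ms: "sr \<BB> i k \<cdot> mu \<BB> i j k g f = al i \<cdot> b" using sr_mu[OF ix hom_el[OF g] hom_el[OF f] gf] fb by simp
  note sa = sr_act_H[OF i(2,3) g th t]
  have Lh: "L g f b \<in> hom w (A1 \<DD> ?i ?k)" unfolding L_def by (rule act_H_hom[OF i(1,3) mh b ms])
  have Rh: "R g f b \<in> hom w (A1 \<DD> ?i ?k)" unfolding R_def by (rule D.mu_hom[OF d ag ah sa])
  have Lr: "L g f b \<cdot> r = L (g \<cdot> r) (f \<cdot> r) (b \<cdot> r)" for r
    unfolding L_def using act_H_cmp[OF i(1,3) mh b ms, of r] mu_cmp[OF ix hom_el[OF g] hom_el[OF f] gf, of r] by simp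
  have Rr: "R g f b \<cdot> r = R (g \<cdot> r) (f \<cdot> r) (b \<cdot> r)" for r
    unfolding R_def using D.mu_cmp[OF d hom_el[OF ag] hom_el[OF ah] sa, of r] act_H_cmp[OF i(2,3) g th t, of r]
      act_H_cmp[OF i(1,2) f b fb, of r] by (simp add: cmp_assoc)
  have rf: "rst g = rst f" "rst b = rst f"
    using rst_tot[OF sr_tot hom_el[OF g]] rst_tot[OF tg_tot hom_el[OF f]] ix rst_matching[OF i(1,2) f b fb] by (simp_all add: gf)
  have self: "g \<cdot> rst f = g" "f \<cdot> rst f = f" "b \<cdot> rst f = b"
    using hom_rst[OF g] hom_rst[OF f] hom_rst[OF b] by (simp_all add: rf)
  have "L g f b = R g f b"
  \<comment> \<open>The domain is covered by the pieces in which \<open>f\<close> lies, and each of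
    these by the pieces in which \<open>g\<close> lies; \<open>e\<close> is the meet of one of
    each.\<close>
  proof (rule glue_eq[OF i(1,2) f Lh Rh])
    show "L g f b \<cdot> rst f = L g f b" "R g f b \<cdot> rst f = R g f b" by (simp_all add: Lr Rr self)
    fix \<phi> assume \<phi>: "\<phi> \<in> Hom A i j"
    let ?r = "rst (qa i j \<phi> \<cdot> f)"
    have ri: "?r \<in> idem w" by (rule rst_in_idem[OF cmp_hom[OF qa_hom[OF i(1,2) \<phi>] f]])
    have rr: "?r \<cdot> rst g = ?r" unfolding rf(1) by simp
    show "L g f b \<cdot> ?r = R g f b \<cdot> ?r"
    proof (rule glue_eq[OF i(2,3) g])
      show "L g f b \<cdot> ?r \<in> hom w (A1 \<DD> ?i ?k)" "R g f b \<cdot> ?r \<in> hom w (A1 \<DD> ?i ?k)"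
        by (rule cmp_hom[OF Lh idem_hom[OF ri]] cmp_hom[OF Rh idem_hom[OF ri]])+
      show "(L g f b \<cdot> ?r) \<cdot> rst g = L g f b \<cdot> ?r" "(R g f b \<cdot> ?r) \<cdot> rst g = R g f b \<cdot> ?r"
        by (simp_all only: cmp_assoc rr)
      fix \<gamma> assume \<gamma>: "\<gamma> \<in> Hom A j k"
      define e where "e = ?r \<cdot> rst (qa j k \<gamma> \<cdot> g)"
      have e1: "e = ?r \<cdot> e" and e2: "e = rst (qa j k \<gamma> \<cdot> g) \<cdot> e"
        unfolding e_def by (simp_all add: rst_left_comm[of "qa j k \<gamma> \<cdot> g"])
      have "L (g \<cdot> e) (f \<cdot> e) (b \<cdot> e) = R (g \<cdot> e) (f \<cdot> e) (b \<cdot> e)"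
      proof (rule sec[OF _ _ _ _ _ \<phi> _ \<gamma>])
        show "f \<cdot> e = sa i j \<phi> \<cdot> sr \<BB> i j \<cdot> f \<cdot> e" by (rule el_section[OF i(1,2) \<phi> e1])
        show "g \<cdot> e = sa j k \<gamma> \<cdot> sr \<BB> j k \<cdot> g \<cdot> e" by (rule el_section[OF i(2,3) \<gamma> e2])
        show "sr \<BB> j k \<cdot> g \<cdot> e = tg \<BB> i j \<cdot> f \<cdot> e" "sr \<BB> i j \<cdot> f \<cdot> e = al i \<cdot> b \<cdot> e"
          using cmp_reassoc[OF gf, of e] cmp_reassoc[OF fb, of e] by (simp_all add: cmp_assoc)
      qed (rule hom_cmp_el[OF g] hom_cmp_el[OF f] hom_cmp_el[OF b])+
      then show "(L g f b \<cdot> ?r) \<cdot> rst (qa j k \<gamma> \<cdot> g) = (R g f b \<cdot> ?r) \<cdot> rst (qa j k \<gamma> \<cdot> g)"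
        using Lr[of e] Rr[of e] by (simp only: cmp_assoc flip: e_def)
    qed
  qed
  then show ?case using i by (simp add: L_def R_def)
qed

lemma ext_H: "ext_cofun \<BB> H"
  by (simp add: H_def HH_def ext_mk_cofun)

lemma over_comp_unit:
  assumes K: "cofunctor C \<BB> \<DD> K"
  shows "over_comp C (A, P) (Phi_cat C \<BB>, Phi_proj C \<BB>) (Phi_cat C \<DD>, Phi_proj C \<DD>) (Phi_map C \<BB> \<DD> K) unit_map
      = (mk_ftor A (cof K) (\<lambda>i j f. FHom (fst (Phi_map C \<BB> \<DD> K)) i j (s i j f)), \<lambda>i\<in>Ob A. cof0 K i)"
proof -
  interpret K: cofunctor C \<BB> \<DD> K by (rule K)
  obtain K' \<beta> where e: "Phi_map C \<BB> \<DD> K = (K', \<beta>)" by fastforce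
  note k = K.Phi_map_ob[unfolded e fst_conv snd_conv Ix_eq]
  have "comp_ftor A K' (mk_ftor A (\<lambda>i. i) s) = mk_ftor A (cof K) (\<lambda>i j f. FHom K' i j (s i j f))"
    by (rule ext_ftor_eqI[of A]) (simp_all add: k)
  moreover have "Cmp C (A0 \<DD> (cof K i)) (FOb P i) (FOb P i) (Idn C (FOb P i)) (cof0 K i) = cof0 K i" if "i \<in> Ob A" for i
    using that K.cof0_in[of i] K.cof_in[of i] by (simp add: Ix_eq A0_eq Idn_Cmp)
  ultimately show ?thesis
    using K.cof_in by (auto simp: e unit_map_def over_comp_pair k Ix_eq D.Phi_proj_simps Phi_proj_simps A0_eq intro!: restrict_ext)
qed

text \<open>Factorisation through the unit means prescribed object data and prescribed values of
  \<open>phi\<close> on the generators \<open>sa\<close>. The values are compared inside one hom-set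
  of \<open>C\<close>, which is the reason for the case distinction on the object parts.\<close>

lemma over_comp_unit_iff:
  assumes K: "cofunctor C \<BB> \<DD> K"
  shows "over_comp C (A, P) (Phi_cat C \<BB>, Phi_proj C \<BB>) (Phi_cat C \<DD>, Phi_proj C \<DD>) (Phi_map C \<BB> \<DD> K) unit_map = (F, \<alpha>)
    \<longleftrightarrow> (\<forall>i\<in>Ob A. cof K i = FOb F i \<and> cof0 K i = \<alpha> i) \<and>
      (\<forall>i\<in>Ob A. \<forall>j\<in>Ob A. \<forall>f\<in>Hom A i j. cofunctor.phi C \<BB> \<DD> K i j (sa i j f) = Fa i j f)"
proof -
  interpret K: cofunctor C \<BB> \<DD> K by (rule K)
  let ?M = "\<lambda>i j f. FHom (fst (Phi_map C \<BB> \<DD> K)) i j (s i j f)"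
  have sin: "s i j f \<in> Hom (Phi_cat C \<BB>) i j" "arr (A0 \<BB> i) (A1 \<BB> i j) (s i j f) = sa i j f"
    if "i \<in> Ob A" "j \<in> Ob A" "f \<in> Hom A i j" for i j f
    using that sa_sec[OF that] raw_in(2)[OF that] by (auto simp: Phi_Hom sa_def A0_eq Ix_eq)
  have M: "?M i j f \<in> Hom C (A0 \<DD> (cof K i)) (A1 \<DD> (cof K i) (cof K j))"
     "arr (A0 \<DD> (cof K i)) (A1 \<DD> (cof K i) (cof K j)) (?M i j f) = K.phi i j (sa i j f)"
    if "i \<in> Ob A" "j \<in> Ob A" "f \<in> Hom A i j" for i j f
    using K.arr_Phi_map[OF _ _ sin(1)[OF that]] that by (simp_all add: Ix_eq sin)
  have F: "mk_ftor A (cof K) ?M = F \<longleftrightarrow> (\<forall>i\<in>Ob A. cof K i = FOb F i) \<and> (\<forall>i\<in>Ob A. \<forall>j\<in>Ob A. \<forall>f\<in>Hom A i j. ?M i j f = FHom F i j f)"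
    (is "?l \<longleftrightarrow> ?r")
  proof
    assume l: ?l
    show ?r unfolding l[symmetric] by simp
  next
    assume ?r
    then show ?l by (intro ext_ftor_eqI[of A]) (simp_all add: om(2))
  qed
  have a: "(\<lambda>i\<in>Ob A. cof0 K i) = \<alpha> \<longleftrightarrow> (\<forall>i\<in>Ob A. cof0 K i = \<alpha> i)"
    using om(3) by (auto intro: extensionalityI[of _ "Ob A"])
  have m: "?M i j f = FHom F i j f \<longleftrightarrow> K.phi i j (sa i j f) = Fa i j f"
    if "i \<in> Ob A" "j \<in> Ob A" "f \<in> Hom A i j" and c: "\<forall>i\<in>Ob A. cof K i = FOb F i" for i j f
    using that M[OF that(1-3)] F.FHom_in[OF that(1-3)]
    by (subst arr_eq_iff[of "A0 \<DD> (FOb F i)" "A1 \<DD> (FOb F i) (FOb F j)"]) (auto simp: D.Phi_Hom Fa_def)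
  show ?thesis
  proof (cases "\<forall>i\<in>Ob A. cof K i = FOb F i")
    case True
    then show ?thesis
      unfolding over_comp_unit[OF K] prod.inject F a by (simp add: m[OF _ _ _ True] conj_commute)
  next
    case False
    then show ?thesis
      unfolding over_comp_unit[OF K] prod.inject F a by blast
  qed
qed

lemma phi_H:
  assumes ij: "i \<in> Ob A" "j \<in> Ob A" and f: "f \<in> Hom A i j"
  shows "cofunctor.phi C \<BB> \<DD> H i j (sa i j f) = Fa i j f"
proof -
  interpret HC: cofunctor C \<BB> \<DD> H by (rule cofunctor_H)
  let ?r = "rst (sa i j f \<cdot> al i)"
  have h: "sa i j f \<cdot> al i \<in> hom (A0 \<DD> (FOb F i)) (A1 \<BB> i j)" by (rule cmp_hom[OF sa_hom[OF ij f] al_hom[OF ij(1)]])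
  have m: "sr \<BB> i j \<cdot> sa i j f \<cdot> al i = al i \<cdot> ?r" by (rule sr_sec_cmp[OF sa_sec[OF ij f]])
  have "act \<BB> \<DD> H i j (sa i j f \<cdot> al i) ?r = Fa i j f \<cdot> ?r"
  proof (rule act_H_sec(1)[OF ij f hom_el[OF h] hom_el[OF rst_hom[OF h]] m])
    show "sa i j f \<cdot> al i = sa i j f \<cdot> sr \<BB> i j \<cdot> sa i j f \<cdot> al i"
      unfolding m using hom_rst[OF h] by (simp add: cmp_assoc)
  qed
  moreover have "?r = rst (Fa i j f)"
  proof -
    have "?r = rst (rst (sa i j f) \<cdot> al i)" by simp
    also have "\<dots> = rst (Pa i j f \<cdot> al i)" unfolding rst_sa[OF ij f] by simp
    also have "\<dots> = rst (Fa i j f)"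
      using rst_Fa[OF ij f, of "ide (A0 \<DD> (FOb F i))"] ij by (simp add: cmp_ide[OF al_hom] cmp_ide[OF D.sec_hom[OF Fa_sec[OF ij f]]])
    finally show ?thesis .
  qed
  ultimately show ?thesis
    using hom_rst[OF D.sec_hom[OF Fa_sec[OF ij f]]] ij by (simp add: HC.phi_def)
qed

text \<open>Every matching pair is covered by parts where the arrow lies on a section of some
  \<open>f\<close>, and there the value of \<open>K\<close> is determined by \<open>phi\<close> at
  \<open>sa i j f\<close>.\<close>

lemma H_unique:
  assumes K: "cofunctor C \<BB> \<DD> K" "ext_cofun \<BB> K"
    and ob: "\<And>i. i \<in> Ob A \<Longrightarrow> cof K i = FOb F i" "\<And>i. i \<in> Ob A \<Longrightarrow> cof0 K i = \<alpha> i"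
    and phi: "\<And>i j f. \<lbrakk>i \<in> Ob A; j \<in> Ob A; f \<in> Hom A i j\<rbrakk> \<Longrightarrow> cofunctor.phi C \<BB> \<DD> K i j (sa i j f) = Fa i j f"
  shows "K = H"
proof (rule cofunctor_eqI[OF K cofunctor_H ext_H])
  interpret K: cofunctor C \<BB> \<DD> K by (rule K)
  have c0K: "c0 \<BB> \<DD> K i = al i" if "i \<in> Ob A" for i using that by (simp add: c0_def al_def A0_eq ob)
  show "cof K i = cof H i" "c0 \<BB> \<DD> K i = c0 \<BB> \<DD> H i" if "i \<in> Ix \<BB>" for i
    using that by (simp_all add: Ix_eq ob c0K)
  fix i j w a b assume i: "i \<in> Ix \<BB>" "j \<in> Ix \<BB>" and a: "a \<in> hom w (A1 \<BB> i j)" and b': "b \<in> hom w (A0 \<DD> (cof K i))"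
    and ab': "sr \<BB> i j \<cdot> a = c0 \<BB> \<DD> K i \<cdot> b"
  have ij: "i \<in> Ob A" "j \<in> Ob A" using i by (simp_all add: Ix_eq)
  have b: "b \<in> hom w (A0 \<DD> (FOb F i))" and ab: "sr \<BB> i j \<cdot> a = al i \<cdot> b" using b' ab' ij by (simp_all add: ob c0K)
  have ra: "rst a = rst b" by (rule rst_matching[OF ij a b ab])
  have Kr: "act \<BB> \<DD> K i j a b \<cdot> r = act \<BB> \<DD> K i j (a \<cdot> r) (b \<cdot> r)" for r
    by (rule K.act_cmp[OF i hom_el[OF a] hom_el[OF b'] ab'])
  show "act \<BB> \<DD> K i j a b = act \<BB> \<DD> H i j a b"
  proof (rule glue_eq[OF ij a _ act_H_hom[OF ij a b ab] _ act_H_rst[OF ij a b ab]])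
    show "act \<BB> \<DD> K i j a b \<in> hom w (A1 \<DD> (FOb F i) (FOb F j))"
      using K.act_hom[OF i a b' ab'] ij by (simp add: ob)
    show "act \<BB> \<DD> K i j a b \<cdot> rst a = act \<BB> \<DD> K i j a b"
      unfolding Kr using hom_rst[OF a] hom_rst[OF b] ra by simp
    fix f assume f: "f \<in> Hom A i j"
    let ?r = "rst (qa i j f \<cdot> a)"
    \<comment> \<open>On the piece of \<open>f\<close> the arrow is the section
      \<open>sa i j f\<close> at its source, and the source is \<open>al i \<cdot> b\<close>; this
      is the shape to which \<open>K.phi_cmp\<close> applies.\<close>
    have ar: "a \<cdot> ?r = sa i j f \<cdot> al i \<cdot> b \<cdot> ?r"
      using el_section[OF ij f, of ?r a] cmp_reassoc[OF ab, of ?r] by (simp add: cmp_assoc)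
    have "rst (a \<cdot> ?r) = rst a \<cdot> ?r" by simp
    also have "\<dots> = ?r" by (rule trans[OF rst_comm rst_cmp_rst_right])
    finally have rr: "rst (sa i j f \<cdot> al i \<cdot> b \<cdot> ?r) = ?r" by (simp only: ar)
    have "act \<BB> \<DD> K i j a b \<cdot> ?r = act \<BB> \<DD> K i j (sa i j f \<cdot> al i \<cdot> b \<cdot> ?r) ((b \<cdot> ?r) \<cdot> rst (sa i j f \<cdot> al i \<cdot> b \<cdot> ?r))"
      unfolding Kr rr by (simp only: ar cmp_assoc rst_idem)
    also have "\<dots> = Fa i j f \<cdot> b \<cdot> ?r"
      using K.phi_cmp[OF i sa_sec[OF ij f], of "b \<cdot> ?r"] by (simp only: phi[OF ij f] c0K[OF ij(1)])
    finally show "act \<BB> \<DD> K i j a b \<cdot> ?r = act \<BB> \<DD> H i j a b \<cdot> ?r"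
      by (simp only: act_H_local[OF ij f hom_el[OF a] hom_el[OF b] ab])
  qed
qed

lemma universal: "\<exists>!K. (cofunctor C \<BB> \<DD> K \<and> ext_cofun \<BB> K) \<and>
    over_comp C (A, P) (Phi_cat C \<BB>, Phi_proj C \<BB>) (Phi_cat C \<DD>, Phi_proj C \<DD>) (Phi_map C \<BB> \<DD> K) unit_map = (F, \<alpha>)"
proof (rule ex1I[of _ H])
  show "(cofunctor C \<BB> \<DD> H \<and> ext_cofun \<BB> H) \<and>
    over_comp C (A, P) (Phi_cat C \<BB>, Phi_proj C \<BB>) (Phi_cat C \<DD>, Phi_proj C \<DD>) (Phi_map C \<BB> \<DD> H) unit_map = (F, \<alpha>)"
    using over_comp_unit_iff[OF cofunctor_H] cofunctor_H ext_H phi_H by simp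
  fix K assume K: "(cofunctor C \<BB> \<DD> K \<and> ext_cofun \<BB> K) \<and>
    over_comp C (A, P) (Phi_cat C \<BB>, Phi_proj C \<BB>) (Phi_cat C \<DD>, Phi_proj C \<DD>) (Phi_map C \<BB> \<DD> K) unit_map = (F, \<alpha>)"
  then show "K = H" using over_comp_unit_iff[of K] by (intro H_unique) auto
qed

end

lemma (in presentation) unit_universal:
  assumes "internal C \<DD>" "over_map C (A, P) (Phi_cat C \<DD>, Phi_proj C \<DD>) m"
  shows "\<exists>!K. (cofunctor C \<BB> \<DD> K \<and> ext_cofun \<BB> K) \<and>
    over_comp C (A, P) (Phi_cat C \<BB>, Phi_proj C \<BB>) (Phi_cat C \<DD>, Phi_proj C \<DD>) (Phi_map C \<BB> \<DD> K) unit_map = m"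
proof -
  obtain F \<alpha> where m: "m = (F, \<alpha>)" by (cases m)
  interpret D: internal C \<DD> by fact
  interpret presentation_map C A P \<BB> \<DD> q s F \<alpha>
    by unfold_locales (use assms(2) m in simp)
  show ?thesis using universal by (simp add: m)
qed

section \<open>Pullbacks of glueings\<close>

text \<open>
  The pullback of a glueing of \<open>\<phi>\<close> along a total map \<open>g\<close> is the glueing of the atlas
  \<open>\<psi> k l = rst (\<phi> k l \<cdot> g)\<close>.
\<close>

lemma (in restriction_category) idem_swap: "c \<in> idem x \<Longrightarrow> c \<cdot> g = g \<cdot> rst (c \<cdot> g)"
  using rst_swap[of c g] by (simp add: idem_rst)

lemma (in restriction_category) idem_rst_cmp:
  assumes "d \<in> idem x"
  shows "rst (c \<cdot> g) \<cdot> rst (d \<cdot> g) = rst (c \<cdot> d \<cdot> g)"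
proof -
  have "rst (c \<cdot> d \<cdot> g) = rst ((c \<cdot> g) \<cdot> rst (d \<cdot> g))"
    by (subst idem_swap[OF assms]) (simp add: cmp_assoc)
  then show ?thesis by simp
qed

locale glue_pullback = join_restriction_category C + E: glue_loc C x I \<phi> a p q s + E': glue_loc C y I \<psi> a' p' q' s'
  for C :: "('o, 'm) rcat" and x y :: 'o and I :: "'k set" and \<phi> a p q s and \<psi> a' p' q' s' +
  fixes g :: 'm
  assumes g_tot: "total_map C y x g" and atlas: "local_atlas C x I \<phi>"
    and psi: "\<lbrakk>k \<in> I; l \<in> I\<rbrakk> \<Longrightarrow> E'.phiA k l = rst (E.phiA k l \<cdot> arr y x g)"
begin

abbreviation "gA \<equiv> arr y x g"

lemma gA_tot: "gA \<in> tot y x"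
  using g_tot by (simp add: arr_tot)

lemmas gA_hom = gA_tot[THEN tot_hom]

lemma phi_idem: "\<lbrakk>k \<in> I; l \<in> I\<rbrakk> \<Longrightarrow> E.phiA k l \<in> idem x"
  by (rule E.s_phi(2)[OF atlas])

lemma psi_swap: "\<lbrakk>k \<in> I; l \<in> I\<rbrakk> \<Longrightarrow> E.phiA k l \<cdot> gA \<cdot> z = gA \<cdot> E'.phiA k l \<cdot> z"
proof -
  assume k: "k \<in> I" "l \<in> I"
  have "(E.phiA k l \<cdot> gA) \<cdot> z = (gA \<cdot> rst (E.phiA k l \<cdot> gA)) \<cdot> z"
    by (simp only: idem_swap[OF phi_idem[OF k], of gA, symmetric])
  then show ?thesis by (simp add: psi[OF k] cmp_assoc)
qed

text \<open>\<psi> is the preimage of \<phi> along \<open>gA\<close>. Totality of \<open>gA\<close>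
  ensures that no part of \<open>v\<close> is lost when membership is tested after
  \<open>gA\<close>.\<close>

lemma psi_fixed:
  assumes k: "k \<in> I" "l \<in> I" and v: "v \<in> el y" and f: "E.phiA k l \<cdot> gA \<cdot> v = gA \<cdot> v"
  shows "E'.phiA k l \<cdot> v = v"
proof -
  have "rst (E.phiA k l \<cdot> gA) \<cdot> v = v \<cdot> rst (E.phiA k l \<cdot> gA \<cdot> v)"
    using rst_swap[of "E.phiA k l \<cdot> gA" v] by (simp add: cmp_assoc)
  then show ?thesis using f v rst_tot[OF gA_tot v] by (simp add: psi[OF k])
qed

lemma phi_self: "k \<in> I \<Longrightarrow> E.phiA k k = rst (E.sA k)" "k \<in> I \<Longrightarrow> E'.phiA k k = rst (E'.sA k)"
  using E.q_s[of k k] E.q_s_self[of k] E'.q_s[of k k] E'.q_s_self[of k] by simp_all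

lemma s_psi: "\<lbrakk>k \<in> I; l \<in> I\<rbrakk> \<Longrightarrow> E'.sA k \<cdot> E'.phiA k l = E'.sA l \<cdot> E'.phiA k l"
proof -
  assume k: "k \<in> I" and l: "l \<in> I"
  have "\<phi> k l = \<phi> l k" using atlas k l by (auto simp: local_atlas_def)
  then have c: "E'.phiA k l = E'.phiA l k" using psi[OF k l] psi[OF l k] by simp
  have i: "E'.phiA k l \<in> idem y"
    unfolding psi[OF k l] by (rule rst_in_idem[OF cmp_hom[OF idem_hom[OF phi_idem[OF k l]] gA_hom]])
  have "E'.sA k \<cdot> E'.phiA k l = E'.sA k \<cdot> E'.qA k \<cdot> E'.sA l" using E'.q_s[OF l k] by (simp add: c)
  also have "\<dots> = rst (E'.qA k) \<cdot> E'.sA l" using cmp_reassoc[OF E'.s_q[OF k], of "E'.sA l"] by simp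
  also have "\<dots> = E'.sA l \<cdot> E'.phiA k l" using rst_swap[of "E'.qA k" "E'.sA l"] E'.q_s[OF l k] idem_rst[OF i] by (simp add: c)
  finally show ?thesis .
qed

text \<open>The projection to \<open>a\<close> is glued from the maps that send a point of the piece
  \<open>k\<close> of \<open>a'\<close> down to \<open>y\<close>, along \<open>gA\<close> to
  \<open>x\<close>, and up by the section \<open>k\<close>.\<close>

lemma ex_leg: "\<exists>r\<in>hom a' a. \<forall>k\<in>I. r \<cdot> rst (E'.qA k) = E.sA k \<cdot> gA \<cdot> E'.qA k"
proof -
  let ?u = "\<lambda>k. E.sA k \<cdot> gA \<cdot> E'.qA k"
  have "\<exists>v\<in>hom a' a. v \<cdot> ide a' = v \<and> (\<forall>k\<in>I. v \<cdot> rst (E'.qA k) = ?u k \<cdot> rst (E'.qA k)) \<and>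
     ((\<forall>k\<in>I. rst (?u k) \<cdot> rst (E'.qA k) = rst (E'.qA k)) \<longrightarrow> rst v = ide a')"
  proof (rule glue_exists[OF E'.cov_q])
    show "a \<in> Ob C" by simp
    show "?u k \<in> hom a' a" if "k \<in> I" for k
      by (rule cmp_hom[OF E.s_hom[OF that] cmp_hom[OF gA_hom E'.q_hom[OF that]]])
    fix k l assume k: "k \<in> I" and l: "l \<in> I"
    let ?e = "rst (E'.qA k) \<cdot> rst (E'.qA l)" let ?b = "ide a'"
    have be: "?b \<cdot> ?e = ?e" using rst_hom[OF E'.q_hom[OF k]] rst_hom[OF E'.q_hom[OF l]] by (intro ide_cmp_hom cmp_hom)
    have bq: "E'.qA m \<cdot> ?b = E'.qA m" if "m \<in> I" for m by (rule cmp_ide[OF E'.q_hom[OF that]])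
    have e1: "?e = rst (E'.qA k \<cdot> ?b) \<cdot> ?e" by (simp add: bq[OF k])
    have e2: "?e = rst (E'.qA l \<cdot> ?b) \<cdot> ?e" by (simp add: bq[OF l] rst_left_comm[of "E'.qA l"])
    let ?z = "E'.pA \<cdot> ?e"
    \<comment> \<open>On the overlap of two pieces both \<open>E'.qA\<close> agree with the
      projection \<open>E'.pA\<close>. Its image lies in \<psi>, hence after \<open>gA\<close> in
      \<phi>, where the sections \<open>k\<close> and \<open>l\<close> of \<open>a\<close>
      coincide.\<close>
    have z: "E'.qA k \<cdot> ?e = ?z" "E'.qA l \<cdot> ?e = ?z"
      using E'.el_local_below(2)[OF k e1] E'.el_local_below(2)[OF l e2] by (simp_all add: be)
    have pz: "E'.phiA k l \<cdot> ?z = ?z" using E'.phi_overlap[OF k l e1 e2] by (simp add: be)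
    have gz: "gA \<cdot> ?z = E.phiA k l \<cdot> gA \<cdot> ?z" using psi_swap[OF k l, of ?z] pz by simp
    have "E.sA k \<cdot> gA \<cdot> ?z = E.sA l \<cdot> gA \<cdot> ?z"
      using cmp_reassoc[OF E.s_phi(1)[OF atlas k l], of "gA \<cdot> ?z"] gz by (simp add: cmp_assoc)
    then show "?u k \<cdot> rst (E'.qA k) \<cdot> rst (E'.qA l) = ?u l \<cdot> rst (E'.qA k) \<cdot> rst (E'.qA l)"
      by (simp add: cmp_assoc z)
  qed
  moreover have "?u k \<cdot> rst (E'.qA k) = ?u k" if "k \<in> I" for k
    using cmp_rst_self[OF hom_el[OF E'.q_hom[OF that]]] by (simp add: cmp_assoc)
  ultimately show ?thesis by auto
qed

lemma is_pullback: "\<exists>a' r p'. is_pullback C \<lparr>ob1 = a, ob2 = y, base = x, leg1 = p, leg2 = g\<rparr> a' r p'"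
proof -
  from ex_leg obtain r where r: "r \<in> hom a' a" and rq: "\<And>k. k \<in> I \<Longrightarrow> r \<cdot> rst (E'.qA k) = E.sA k \<cdot> gA \<cdot> E'.qA k"
    by blast
  have ra: "arr a' a (mor r) = r" "mor r \<in> Hom C a' a" using r by (simp_all add: arr_mor mor_in)
  have raw: "p \<in> Hom C a x" "g \<in> Hom C y x" "p' \<in> Hom C a' y"
    using E.glue E'.glue g_tot by (auto simp: is_glueing_def local_homeo_def total_map_def)
  have sqloc: "E.pA \<cdot> E.sA k \<cdot> gA \<cdot> E'.qA k = gA \<cdot> E'.qA k" if k: "k \<in> I" for k
  proof -
    have "E.pA \<cdot> E.sA k \<cdot> gA \<cdot> E'.qA k = gA \<cdot> E'.phiA k k \<cdot> E'.qA k"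
      using cmp_reassoc[OF E.p_s[OF k]] psi_swap[OF k k] by (simp add: phi_self[OF k])
    also have "E'.phiA k k \<cdot> E'.qA k = E'.qA k \<cdot> rst (E'.qA k)"
      unfolding phi_self(2)[OF k] using rst_swap[of "E'.sA k" "E'.qA k"] E'.s_q[OF k] by simp
    finally show ?thesis using cmp_rst_self[OF hom_el[OF E'.q_hom[OF k]]] by simp
  qed
  have sq: "E.pA \<cdot> r = gA \<cdot> E'.pA"
  proof (rule cov_eq[OF E'.cov_q])
    show "E.pA \<cdot> r \<in> hom a' x" "gA \<cdot> E'.pA \<in> hom a' x"
      using cmp_hom[OF tot_hom[OF E.p_tot] r] cmp_hom[OF gA_hom tot_hom[OF E'.p_tot]] by simp_all
    then show "(E.pA \<cdot> r) \<cdot> ide a' = E.pA \<cdot> r" "(gA \<cdot> E'.pA) \<cdot> ide a' = gA \<cdot> E'.pA"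
      by (simp_all only: cmp_ide)
    show "(E.pA \<cdot> r) \<cdot> rst (E'.qA k) = (gA \<cdot> E'.pA) \<cdot> rst (E'.qA k)" if "k \<in> I" for k
      by (simp add: cmp_assoc rq[OF that] sqloc[OF that] E'.p_rst_q[OF that])
  qed
  \<comment> \<open>The piece \<open>k\<close> of \<open>a'\<close> is the preimage under
    \<open>r\<close> of the piece \<open>k\<close> of \<open>a\<close>; uniqueness of mediating maps
    rests on this.\<close>
  have qr: "E.qA k \<cdot> r = gA \<cdot> E'.qA k" if k: "k \<in> I" for k
  proof (rule cov_eq[OF E'.cov_q])
    show "E.qA k \<cdot> r \<in> hom a' x" "gA \<cdot> E'.qA k \<in> hom a' x"
      using cmp_hom[OF E.q_hom[OF k] r] cmp_hom[OF gA_hom E'.q_hom[OF k]] by simp_all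
    then show "(E.qA k \<cdot> r) \<cdot> ide a' = E.qA k \<cdot> r" "(gA \<cdot> E'.qA k) \<cdot> ide a' = gA \<cdot> E'.qA k"
      by (simp_all only: cmp_ide)
    fix l assume l: "l \<in> I"
    have "(E.qA k \<cdot> r) \<cdot> rst (E'.qA l) = E.phiA l k \<cdot> gA \<cdot> E'.qA l"
      using cmp_reassoc[OF E.q_s[OF l k]] by (simp add: cmp_assoc rq[OF l])
    also have "\<dots> = gA \<cdot> E'.qA k \<cdot> E'.sA l \<cdot> E'.qA l"
      using psi_swap[OF l k, of "E'.qA l"] cmp_reassoc[OF E'.q_s[OF l k], of "E'.qA l"] by simp
    finally show "(E.qA k \<cdot> r) \<cdot> rst (E'.qA l) = (gA \<cdot> E'.qA k) \<cdot> rst (E'.qA l)"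
      by (simp add: cmp_assoc E'.s_q[OF l])
  qed
  have rs: "r \<cdot> E'.sA k = E.sA k \<cdot> gA \<cdot> E'.phiA k k" if k: "k \<in> I" for k
    using cmp_reassoc[OF rq[OF k], of "E'.sA k"] E'.rst_q_s[OF k] E'.q_s_self[OF k] by (simp add: cmp_assoc phi_self[OF k])
  have univ: "\<exists>!h. h \<in> hom w a' \<and> r \<cdot> h = u \<and> E'.pA \<cdot> h = v"
    if u: "u \<in> hom w a" and v: "v \<in> hom w y" and uv: "E.pA \<cdot> u = gA \<cdot> v" for w u v
  proof -
    have ruv: "rst u = rst v"
      using rst_tot[OF E.p_tot hom_el[OF u]] rst_tot[OF gA_tot hom_el[OF v]] uv by simp
    \<comment> \<open>Where \<open>u\<close> lies in the piece \<open>k\<close>, \<open>v\<close>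
      lies in the domain of the section \<open>k\<close> of \<open>a'\<close>.\<close>
    have self: "E'.phiA k k \<cdot> v \<cdot> rst (E.qA k \<cdot> u) = v \<cdot> rst (E.qA k \<cdot> u)" if k: "k \<in> I" for k
    proof (rule psi_fixed[OF k k])
      show "v \<cdot> rst (E.qA k \<cdot> u) \<in> el y" by (rule cmp_el[OF hom_el[OF v]])
      have "E.phiA k k \<cdot> E.pA \<cdot> u \<cdot> rst (E.qA k \<cdot> u) = E.pA \<cdot> u \<cdot> rst (E.qA k \<cdot> u)"
        by (rule E.phi_overlap[OF k k]) simp_all
      then show "E.phiA k k \<cdot> gA \<cdot> v \<cdot> rst (E.qA k \<cdot> u) = gA \<cdot> v \<cdot> rst (E.qA k \<cdot> u)"
        using cmp_reassoc[OF uv, of "rst (E.qA k \<cdot> u)"] by (simp add: cmp_assoc)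
    qed
    \<comment> \<open>The mediating map is glued over the pieces in which \<open>u\<close> lies,
      with value the section \<open>k\<close> of \<open>a'\<close> at \<open>v\<close>.\<close>
    have "\<exists>h\<in>hom w a'. h \<cdot> rst u = h \<and> (\<forall>k\<in>I. h \<cdot> rst (E.qA k \<cdot> u) = (E'.sA k \<cdot> v) \<cdot> rst (E.qA k \<cdot> u)) \<and>
      ((\<forall>k\<in>I. rst (E'.sA k \<cdot> v) \<cdot> rst (E.qA k \<cdot> u) = rst (E.qA k \<cdot> u)) \<longrightarrow> rst h = rst u)"
    proof (rule glue_exists[OF E.cov_el[OF u]])
      show "a' \<in> Ob C" by simp
      show "E'.sA k \<cdot> v \<in> hom w a'" if "k \<in> I" for k by (rule cmp_hom[OF E'.s_hom[OF that] v])
      fix k l assume k: "k \<in> I" and l: "l \<in> I"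
      let ?e = "rst (E.qA k \<cdot> u) \<cdot> rst (E.qA l \<cdot> u)"
      have "E.phiA k l \<cdot> E.pA \<cdot> u \<cdot> ?e = E.pA \<cdot> u \<cdot> ?e"
        by (rule E.phi_overlap[OF k l]) (simp_all add: rst_left_comm[of "E.qA l \<cdot> u"])
      then have "E.phiA k l \<cdot> gA \<cdot> v \<cdot> ?e = gA \<cdot> v \<cdot> ?e"
        using cmp_reassoc[OF uv, of ?e] by (simp add: cmp_assoc)
      then have "E'.phiA k l \<cdot> v \<cdot> ?e = v \<cdot> ?e" by (rule psi_fixed[OF k l cmp_el[OF hom_el[OF v]]])
      then show "(E'.sA k \<cdot> v) \<cdot> rst (E.qA k \<cdot> u) \<cdot> rst (E.qA l \<cdot> u) = (E'.sA l \<cdot> v) \<cdot> rst (E.qA k \<cdot> u) \<cdot> rst (E.qA l \<cdot> u)"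
        using cmp_reassoc[OF s_psi[OF k l], of "v \<cdot> ?e"] by (simp add: cmp_assoc)
    qed
    then obtain h where h: "h \<in> hom w a'" "h \<cdot> rst u = h"
      and hk: "\<And>k. k \<in> I \<Longrightarrow> h \<cdot> rst (E.qA k \<cdot> u) = E'.sA k \<cdot> v \<cdot> rst (E.qA k \<cdot> u)"
      by (auto simp: cmp_assoc)
    have "E'.pA \<cdot> h = v"
    proof (rule E.glue_eq[OF u _ v])
      show "E'.pA \<cdot> h \<in> hom w y" by (rule cmp_hom[OF tot_hom[OF E'.p_tot] h(1)])
      show "(E'.pA \<cdot> h) \<cdot> rst u = E'.pA \<cdot> h" by (simp add: cmp_assoc h(2))
      show "v \<cdot> rst u = v" using cmp_rst_self[OF hom_el[OF v]] by (simp add: ruv)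
      fix k assume k: "k \<in> I"
      have "(E'.pA \<cdot> h) \<cdot> rst (E.qA k \<cdot> u) = E'.phiA k k \<cdot> v \<cdot> rst (E.qA k \<cdot> u)"
        using cmp_reassoc[OF E'.p_s[OF k], of "v \<cdot> rst (E.qA k \<cdot> u)"] by (simp add: cmp_assoc hk[OF k] phi_self[OF k])
      then show "(E'.pA \<cdot> h) \<cdot> rst (E.qA k \<cdot> u) = v \<cdot> rst (E.qA k \<cdot> u)" by (simp add: self[OF k])
    qed
    moreover have "r \<cdot> h = u"
    proof (rule E.glue_eq[OF u _ u])
      show "r \<cdot> h \<in> hom w a" by (rule cmp_hom[OF r h(1)])
      show "(r \<cdot> h) \<cdot> rst u = r \<cdot> h" by (simp add: cmp_assoc h(2))
      show "u \<cdot> rst u = u" by (rule cmp_rst_self[OF hom_el[OF u]])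
      fix k assume k: "k \<in> I"
      have "(r \<cdot> h) \<cdot> rst (E.qA k \<cdot> u) = E.sA k \<cdot> gA \<cdot> v \<cdot> rst (E.qA k \<cdot> u)"
        using cmp_reassoc[OF rs[OF k], of "v \<cdot> rst (E.qA k \<cdot> u)"] by (simp add: cmp_assoc hk[OF k] self[OF k])
      also have "\<dots> = u \<cdot> rst (E.qA k \<cdot> u)"
        using E.el_local[OF k, of u] cmp_reassoc[OF uv, of "rst (E.qA k \<cdot> u)"] by (simp add: cmp_assoc)
      finally show "(r \<cdot> h) \<cdot> rst (E.qA k \<cdot> u) = u \<cdot> rst (E.qA k \<cdot> u)" .
    qed
    moreover have "h1 = h2" if h1: "h1 \<in> hom w a' \<and> r \<cdot> h1 = u \<and> E'.pA \<cdot> h1 = v"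
      and h2: "h2 \<in> hom w a' \<and> r \<cdot> h2 = u \<and> E'.pA \<cdot> h2 = v" for h1 h2
    proof -
      \<comment> \<open>Any mediating map has the local form used for existence: by
        \<open>qr\<close> it lies in the piece \<open>k\<close> of \<open>a'\<close> exactly where
        \<open>u\<close> lies in the piece \<open>k\<close> of \<open>a\<close>.\<close>
      have *: "h \<cdot> rst u = h" "\<And>k. k \<in> I \<Longrightarrow> h \<cdot> rst (E.qA k \<cdot> u) = E'.sA k \<cdot> v \<cdot> rst (E.qA k \<cdot> u)"
        if h: "h \<in> hom w a'" "r \<cdot> h = u" "E'.pA \<cdot> h = v" for h
      proof -
        have "rst u = rst h" using rst_tot[OF E'.p_tot hom_el[OF h(1)]] h(3) ruv by simp
        then show "h \<cdot> rst u = h" using cmp_rst_self[OF hom_el[OF h(1)]] by simp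
        fix k assume k: "k \<in> I"
        have "E.qA k \<cdot> u = gA \<cdot> E'.qA k \<cdot> h" using cmp_reassoc[OF qr[OF k], of h] h(2) by (simp add: cmp_assoc)
        then have "rst (E.qA k \<cdot> u) = rst (E'.qA k \<cdot> h)"
          using rst_tot[OF gA_tot cmp_el[OF hom_el[OF E'.q_hom[OF k]]]] by simp
        then show "h \<cdot> rst (E.qA k \<cdot> u) = E'.sA k \<cdot> v \<cdot> rst (E.qA k \<cdot> u)"
          using E'.el_local[OF k, of h] cmp_reassoc[OF h(3), of "rst (E'.qA k \<cdot> h)"] by simp
      qed
      show ?thesis
        by (rule E.glue_eq[OF u, of h1 a' h2]) (use h1 h2 * in auto)
    qed
    ultimately show ?thesis using h(1) by blast
  qed
  have "is_pullback C \<lparr>ob1 = a, ob2 = y, base = x, leg1 = p, leg2 = g\<rparr> a' (mor r) p'"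
    unfolding is_pullback_def cospan.simps
  proof (intro conjI ballI impI)
    show "Cmp C a' a x p (mor r) = Cmp C a' y x g p'"
      by (rule arr_inj[of a' x]) (use raw ra sq in \<open>auto simp: arr_Cmp intro: Cmp_in\<close>)
    fix w u v assume w: "w \<in> Ob C" and u: "u \<in> Hom C w a" and v: "v \<in> Hom C w y" and eq: "Cmp C w a x p u = Cmp C w y x g v"
    have "arr w x (Cmp C w a x p u) = arr w x (Cmp C w y x g v)" by (simp add: eq)
    then have uv: "E.pA \<cdot> arr w a u = gA \<cdot> arr w y v" using w u v raw by (simp add: arr_Cmp)
    from univ[OF homI[OF w _ u] homI[OF w _ v] uv]
    obtain h where h: "h \<in> hom w a'" "r \<cdot> h = arr w a u" "E'.pA \<cdot> h = arr w y v"
      and hu: "\<And>h'. h' \<in> hom w a' \<and> r \<cdot> h' = arr w a u \<and> E'.pA \<cdot> h' = arr w y v \<Longrightarrow> h' = h"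
      by auto
    have key: "h' \<in> Hom C w a' \<and> Cmp C w a' a (mor r) h' = u \<and> Cmp C w a' y p' h' = v \<longleftrightarrow>
        h' \<in> Hom C w a' \<and> r \<cdot> arr w a' h' = arr w a u \<and> E'.pA \<cdot> arr w a' h' = arr w y v" for h'
    proof (cases "h' \<in> Hom C w a'")
      case True
      then have c: "Cmp C w a' a (mor r) h' \<in> Hom C w a" "Cmp C w a' y p' h' \<in> Hom C w y"
        using w raw ra by (auto intro: Cmp_in)
      show ?thesis
        unfolding arr_eq_iff[OF w E.a_ob c(1) u] arr_eq_iff[OF w E'.x_ob c(2) v]
        using True w raw ra by (simp add: arr_Cmp)
    qed simp
    show "\<exists>!h'. h' \<in> Hom C w a' \<and> Cmp C w a' a (mor r) h' = u \<and> Cmp C w a' y p' h' = v"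
      unfolding key
    proof (rule ex1I[of _ "mor h"])
      show "mor h \<in> Hom C w a' \<and> r \<cdot> arr w a' (mor h) = arr w a u \<and> E'.pA \<cdot> arr w a' (mor h) = arr w y v"
        using h by (simp add: mor_in arr_mor)
      fix h' assume h': "h' \<in> Hom C w a' \<and> r \<cdot> arr w a' h' = arr w a u \<and> E'.pA \<cdot> arr w a' h' = arr w y v"
      then have "arr w a' h' = h" using w by (intro hu) (simp add: homI)
      then show "h' = mor h" using h' w by (metis mor_arr E'.a_ob)
    qed
  qed (use raw ra in auto)
  then show ?thesis by blast
qed

end

context over_loc
begin

no_notation A.cmp (infixr "\<cdot>" 70)

text \<open>The atlas pulled back to \<open>y\<close> is indexed by the same set
  \<open>Hom A i j\<close>, so smallness of the hom-set again provides a glueing, and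
  \<open>glue_pullback\<close> shows that this glueing is the pullback. The atlas axioms transfer
  because preimages of idempotents preserve meets (\<open>idem_rst_cmp\<close>).\<close>

lemma glueing_pullback:
  assumes ij: "i \<in> Ob A" "j \<in> Ob A" and glue: "is_glueing C (FOb P i) (Hom A i j) (eq_locus C (A, P) i j) a p q s"
    and lg: "has_local_glueings \<kappa> C" and small: "|Hom A i j| <o \<kappa>" and y: "y \<in> Ob C" and g: "total_map C y (FOb P i) g"
  shows "\<exists>b r p'. is_pullback C \<lparr>ob1 = a, ob2 = y, base = FOb P i, leg1 = p, leg2 = g\<rparr> b r p'"
proof -
  let ?g = "arr y (FOb P i) g" let ?I = "Hom A i j"
  define \<psi> where "\<psi> = (\<lambda>f f'. mor (rst (loc i j f f' \<cdot> ?g)))"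
  have gt: "?g \<in> tot y (FOb P i)" using g y ij by (simp add: arr_tot)
  note at = local_atlas_eq_locus[OF ij]
  have li: "loc i j f f' \<in> idem (FOb P i)" if "f \<in> ?I" "f' \<in> ?I" for f f'
    by (rule covD(1)[OF loc_props(2)[OF ij that]])
  have \<psi>h: "rst (loc i j f f' \<cdot> ?g) \<in> idem y" if "f \<in> ?I" "f' \<in> ?I" for f f'
    by (rule rst_in_idem[OF cmp_hom[OF idem_hom[OF li[OF that]] tot_hom[OF gt]]])
  have \<psi>a: "arr y y (\<psi> f f') = rst (loc i j f f' \<cdot> ?g)" "\<psi> f f' \<in> Hom C y y" if "f \<in> ?I" "f' \<in> ?I" for f f'
    unfolding \<psi>_def using idem_hom[OF \<psi>h[OF that]] by (simp_all add: arr_mor mor_in)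
  have lsym: "loc i j f f' = loc i j f' f" if "f \<in> ?I" "f' \<in> ?I" for f f'
    using at that by (simp add: local_atlas_def loc_def)
  have ltrans: "loc i j f f'' \<cdot> loc i j f' f'' \<cdot> loc i j f f' = loc i j f' f'' \<cdot> loc i j f f'"
    if f: "f \<in> ?I" "f' \<in> ?I" "f'' \<in> ?I" for f f' f''
  proof -
    have "map_le C (FOb P i) (FOb P i) (Cmp C (FOb P i) (FOb P i) (FOb P i) (eq_locus C (A, P) i j f' f'') (eq_locus C (A, P) i j f f'))
        (eq_locus C (A, P) i j f f'')" using at f unfolding local_atlas_def by blast
    then show ?thesis
      using loc_props(1)[OF ij] f ij cmp_idem[OF li li, of f' f'' f f']
      by (simp add: map_le_iff Cmp_in arr_Cmp idem_rst flip: loc_def)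
  qed
  have "local_atlas C y ?I \<psi>"
    unfolding local_atlas_def
  proof (intro conjI ballI)
    fix f f' assume f: "f \<in> ?I" "f' \<in> ?I"
    show "\<psi> f f' \<in> rst_idems C y" using \<psi>a[OF f] \<psi>h[OF f] y by (simp add: rst_idems_iff)
    show "\<psi> f f' = \<psi> f' f" unfolding \<psi>_def using lsym[OF f] by simp
  next
    fix f f' f'' assume f: "f \<in> ?I" "f' \<in> ?I" "f'' \<in> ?I"
    have "rst (loc i j f f'' \<cdot> ?g) \<cdot> rst (loc i j f' f'' \<cdot> ?g) \<cdot> rst (loc i j f f' \<cdot> ?g)
        = rst (loc i j f' f'' \<cdot> ?g) \<cdot> rst (loc i j f f' \<cdot> ?g)"
      using cmp_reassoc[OF ltrans[OF f], of ?g]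
      by (simp only: idem_rst_cmp[OF li[OF f(1,2)]] idem_rst_cmp[OF cmp_idem[OF li[OF f(2,3)] li[OF f(1,2)]], unfolded cmp_assoc] cmp_assoc)
    then show "map_le C y y (Cmp C y y y (\<psi> f' f'') (\<psi> f f')) (\<psi> f f'')"
      using \<psi>a f y \<psi>h by (simp add: map_le_iff Cmp_in arr_Cmp)
  qed
  then obtain b p' q' s' where g': "is_glueing C y ?I \<psi> b p' q' s'"
    using lg small y unfolding has_local_glueings_def by blast
  interpret glue_pullback C "FOb P i" y ?I "eq_locus C (A, P) i j" a p q s \<psi> b p' q' s' g
    by unfold_locales (use ij glue y g' g at \<psi>a in \<open>simp_all add: loc_def\<close>)
  show ?thesis by (rule is_pullback)
qed

end

section \<open>The internal category presented by a category over the base\<close>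

lemma (in pgraph) arr_tgt_pull:
  assumes i: "i \<in> Ix \<AA>" "j \<in> Ix \<AA>" "k \<in> Ix \<AA>" and t: "t \<in> Hom C (A0 \<AA> j) (A1 \<AA> j k)"
  defines "ta \<equiv> arr (A0 \<AA> j) (A1 \<AA> j k) t"
  assumes s: "sr \<AA> j k \<cdot> ta = rst ta"
  shows "tgt_pull C \<AA> i j k t \<in> Hom C (A1 \<AA> i j) (pb C (cmp_cospan \<AA> i j k))"
    and "arr (A1 \<AA> i j) (pb C (cmp_cospan \<AA> i j k)) (tgt_pull C \<AA> i j k t)
      = mpair (cmp_cospan \<AA> i j k) (ta \<cdot> tg \<AA> i j) (rst (ta \<cdot> tg \<AA> i j))"
    and "sr \<AA> j k \<cdot> ta \<cdot> tg \<AA> i j = tg \<AA> i j \<cdot> rst (ta \<cdot> tg \<AA> i j)"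
proof -
  note ok = cmp_ok[OF i]
  note [simp] = i pb_ob[OF ok] t
  let ?u = "Cmp C (A1 \<AA> i j) (A0 \<AA> j) (A1 \<AA> j k) t (tgt \<AA> i j)"
  let ?r = "Rst C (A1 \<AA> i j) (A1 \<AA> j k) ?u"
  have u: "?u \<in> Hom C (A1 \<AA> i j) (A1 \<AA> j k)" "?r \<in> Hom C (A1 \<AA> i j) (A1 \<AA> i j)"
    by (auto intro!: Cmp_in Rst_in)
  have au: "arr (A1 \<AA> i j) (A1 \<AA> j k) ?u = ta \<cdot> tg \<AA> i j" "arr (A1 \<AA> i j) (A1 \<AA> i j) ?r = rst (ta \<cdot> tg \<AA> i j)"
    using u by (simp_all add: arr_Cmp arr_Rst tg_def ta_def)
  show m: "sr \<AA> j k \<cdot> ta \<cdot> tg \<AA> i j = tg \<AA> i j \<cdot> rst (ta \<cdot> tg \<AA> i j)"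
    using cmp_reassoc[OF s, of "tg \<AA> i j"] rst_swap[of ta "tg \<AA> i j"] by simp
  note p = pair_raw[OF ok, of "A1 \<AA> i j" ?u ?r, simplified, unfolded au, OF u m]
  show "tgt_pull C \<AA> i j k t \<in> Hom C (A1 \<AA> i j) (pb C (cmp_cospan \<AA> i j k))"
    "arr (A1 \<AA> i j) (pb C (cmp_cospan \<AA> i j k)) (tgt_pull C \<AA> i j k t)
      = mpair (cmp_cospan \<AA> i j k) (ta \<cdot> tg \<AA> i j) (rst (ta \<cdot> tg \<AA> i j))"
    using p(1,4) by (simp_all add: tgt_pull_def Let_def)
qed

text \<open>A record of how the parts of \<open>Psi_ob\<close> are specified. For \<open>mul\<close>
  only its defining description is given; that a unique such map exists is proved inside the locale,
  on pullbacks that the first-stage data provide.\<close>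

locale psi_base = glued C A P "A1 \<BB>" "src \<BB>" q s
  for C :: "('o, 'm) rcat" and A :: "('i, 'm) rcat" and P :: "('i, 'm, 'o, 'm) ftor"
    and \<BB> :: "('i, 'o, 'm) pcat" and q s +
  assumes Ix_eq: "Ix \<BB> = Ob A" and A0_eq: "A0 \<BB> = FOb P"
    and tgt_spec: "\<lbrakk>i \<in> Ob A; j \<in> Ob A\<rbrakk> \<Longrightarrow> tgt \<BB> i j \<in> Hom C (A1 \<BB> i j) (FOb P j) \<and>
      (\<forall>f\<in>Hom A i j. Cmp C (FOb P i) (A1 \<BB> i j) (FOb P j) (tgt \<BB> i j) (s i j f) = FHom P i j f)"
    and idm_eq: "i \<in> Ob A \<Longrightarrow> idm \<BB> i = s i i (Idn A i)"
    and pullbacks: "\<lbrakk>i \<in> Ob A; j \<in> Ob A; y \<in> Ob C; total_map C y (FOb P i) g\<rbrakk>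
      \<Longrightarrow> \<exists>a p q. is_pullback C
            \<lparr>ob1 = A1 \<BB> i j, ob2 = y, base = FOb P i, leg1 = src \<BB> i j, leg2 = g\<rparr> a p q"
    and mul_eq: "\<lbrakk>i \<in> Ob A; j \<in> Ob A; k \<in> Ob A\<rbrakk> \<Longrightarrow> mul \<BB> i j k =
      (THE m. m \<in> Hom C (pb C (cmp_cospan \<BB> i j k)) (A1 \<BB> i k) \<and>
        (\<forall>f\<in>Hom A i j. \<forall>g\<in>Hom A j k.
           Cmp C (FOb P i) (pb C (cmp_cospan \<BB> i j k)) (A1 \<BB> i k) m
             (Cmp C (FOb P i) (A1 \<BB> i j) (pb C (cmp_cospan \<BB> i j k)) (tgt_pull C \<BB> i j k (s j k g)) (s i j f))
           = s i k (Cmp A i j k g f)))"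
begin

no_notation A.cmp (infixr "\<cdot>" 70)

lemma pa_sr: "pa i j = sr \<BB> i j"
  by (simp add: pa_def sr_def A0_eq)

lemma tg_sa: "\<lbrakk>i \<in> Ob A; j \<in> Ob A; f \<in> Hom A i j\<rbrakk> \<Longrightarrow> tg \<BB> i j \<cdot> sa i j f = Pa i j f"
  using tgt_spec[of i j] raw_in(2)[of i j f]
  by (simp add: tg_def sa_def Pa_def A0_eq flip: arr_Cmp)

text \<open>Totality is tested on sections by \<open>map_eq\<close>: the composite of the target
  with \<open>sa i j f\<close> is \<open>Pa i j f\<close>, which has the same domain as
  \<open>sa i j f\<close>.\<close>

lemma tgt_total: "\<lbrakk>i \<in> Ob A; j \<in> Ob A\<rbrakk> \<Longrightarrow> total_map C (A1 \<BB> i j) (FOb P j) (tgt \<BB> i j)"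
proof -
  assume ij: "i \<in> Ob A" "j \<in> Ob A"
  let ?t = "tg \<BB> i j"
  have th: "?t \<in> hom (A1 \<BB> i j) (FOb P j)" using tgt_spec[OF ij] ij by (simp add: tg_def A0_eq homI)
  have "rst ?t = ide (A1 \<BB> i j)"
  proof (rule map_eq[OF ij])
    show "rst ?t \<in> hom (A1 \<BB> i j) (A1 \<BB> i j)" by (rule rst_hom[OF th])
    show "ide (A1 \<BB> i j) \<in> hom (A1 \<BB> i j) (A1 \<BB> i j)" using ij by (simp add: ide_hom)
    fix f assume f: "f \<in> Hom A i j"
    have "rst ?t \<cdot> sa i j f = sa i j f \<cdot> rst (sa i j f)"
      using rst_swap[of ?t "sa i j f"] by (simp add: tg_sa[OF ij f] rst_sa[OF ij f])
    then show "rst ?t \<cdot> sa i j f = ide (A1 \<BB> i j) \<cdot> sa i j f"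
      using hom_rst[OF sa_hom[OF ij f]] ide_cmp_hom[OF sa_hom[OF ij f]] by simp
  qed
  then show ?thesis using tgt_spec[OF ij] ij th by (simp add: total_map_iff tot_def tg_def A0_eq)
qed

lemma un_sa: "i \<in> Ob A \<Longrightarrow> un \<BB> i = sa i i (Idn A i)"
  by (simp add: un_def sa_def idm_eq A0_eq)

lemma pgraph: "pgraph C \<BB>"
proof (unfold_locales, goal_cases)
  case (3 i j)
  then show ?case using pa_tot[of i j] glueing[of i j]
    by (simp add: Ix_eq A0_eq is_glueing_def local_homeo_def)
next
  case (7 i)
  then have i: "i \<in> Ob A" by (simp add: Ix_eq)
  have "sr \<BB> i i \<cdot> un \<BB> i = ide (FOb P i)" using pa_sa[OF i i A.Idn_in[OF i]] i by (simp add: pa_sr un_sa Pa_Idn)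
  then show ?case
    using i raw_in(2)[OF i i A.Idn_in[OF i]] glueing[OF i i]
    by (intro arr_inj[of "FOb P i" "FOb P i"])
      (auto simp: A0_eq idm_eq Idn_in arr_Cmp sr_def un_def ide_def is_glueing_def local_homeo_def total_map_def intro: Cmp_in)
next
  case (8 i)
  then have i: "i \<in> Ob A" by (simp add: Ix_eq)
  have "tg \<BB> i i \<cdot> un \<BB> i = ide (FOb P i)" using tg_sa[OF i i A.Idn_in[OF i]] i by (simp add: un_sa Pa_Idn)
  then show ?case
    using i raw_in(2)[OF i i A.Idn_in[OF i]] tgt_spec[OF i i]
    by (intro arr_inj[of "FOb P i" "FOb P i"])
      (auto simp: A0_eq idm_eq Idn_in arr_Cmp tg_def un_def ide_def intro: Cmp_in)
qed (auto simp: Ix_eq A0_eq tgt_total idm_eq A.Idn_in intro: raw_in pullbacks)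

end

sublocale psi_base \<subseteq> pgraph C \<BB>
  by (rule pgraph)

context psi_base
begin

no_notation A.cmp (infixr "\<cdot>" 70)

definition "T i j k g = mpair (cmp_cospan \<BB> i j k) (sa j k g \<cdot> tg \<BB> i j) (rst (sa j k g \<cdot> tg \<BB> i j))"

lemma sa_dom:
  assumes ijk: "i \<in> Ob A" "j \<in> Ob A" "k \<in> Ob A" and f: "f \<in> Hom A i j" and g: "g \<in> Hom A j k"
  shows "Cmp A i j k g f \<in> Hom A i k" "rst (sa i k (Cmp A i j k g f)) = rst (Pa j k g \<cdot> Pa i j f)"
    "rst (sa j k g \<cdot> Pa i j f \<cdot> x) = rst (Pa j k g \<cdot> Pa i j f \<cdot> x)"
    "sa i k (Cmp A i j k g f) \<cdot> rst (Pa j k g \<cdot> Pa i j f) = sa i k (Cmp A i j k g f)"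
    "sa i k (Cmp A i j k g f) \<cdot> rst (Pa i j f) = sa i k (Cmp A i j k g f)"
proof -
  show c: "Cmp A i j k g f \<in> Hom A i k" using ijk f g by (simp add: A.Cmp_in)
  show r: "rst (sa i k (Cmp A i j k g f)) = rst (Pa j k g \<cdot> Pa i j f)"
    using rst_sa[OF ijk(1,3) c] Pa_Cmp[OF ijk f g] by simp
  have "rst (sa j k g \<cdot> Pa i j f \<cdot> x) = rst (rst (sa j k g) \<cdot> Pa i j f \<cdot> x)" by simp
  then show "rst (sa j k g \<cdot> Pa i j f \<cdot> x) = rst (Pa j k g \<cdot> Pa i j f \<cdot> x)"
    unfolding rst_sa[OF ijk(2,3) g] by simp
  show s: "sa i k (Cmp A i j k g f) \<cdot> rst (Pa j k g \<cdot> Pa i j f) = sa i k (Cmp A i j k g f)"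
    using hom_rst[OF sa_hom[OF ijk(1,3) c]] by (simp add: r)
  have "(sa i k (Cmp A i j k g f) \<cdot> rst (Pa j k g \<cdot> Pa i j f)) \<cdot> rst (Pa i j f) = sa i k (Cmp A i j k g f) \<cdot> rst (Pa j k g \<cdot> Pa i j f)"
    by (simp add: cmp_assoc)
  then show "sa i k (Cmp A i j k g f) \<cdot> rst (Pa i j f) = sa i k (Cmp A i j k g f)" by (simp only: s)
qed

text \<open>\<open>y\<close> is a point that \<open>f\<close> carries into \<open>e\<close>. By the
  restriction axiom, \<open>f\<close> restricted to the domain of e f equals e f, so at
  \<open>y\<close> the section of the composite depends on \<open>g\<close> only through
  \<open>g\<close> after \<open>e\<close>, which is also \<open>g'\<close> after
  \<open>e\<close>.\<close>

lemma sa_comp_Eq: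
  assumes ijk: "i \<in> Ob A" "j \<in> Ob A" "k \<in> Ob A" and f: "f \<in> Hom A i j" and g: "g \<in> Hom A j k" "g' \<in> Hom A j k"
    and e: "e \<in> Eq j k g g'" and y: "Pa j j e \<cdot> Pa i j f \<cdot> y = Pa i j f \<cdot> y"
  shows "sa i k (Cmp A i j k g f) \<cdot> y = sa i k (Cmp A i j k g' f) \<cdot> y"
proof -
  note d = EqD[OF ijk(2,3) g e]
  have ef: "Cmp A i j j e f \<in> Hom A i j" using ijk f d by (simp add: A.Cmp_in)
  let ?d = "Rst A i j (Cmp A i j j e f)"
  have d_in: "?d \<in> rst_idems A i" "?d \<in> Hom A i i" using Rst_idem[OF ijk(1,2) ef] A.Rst_in[OF ijk(1,2) ef] by auto
  have fd: "Cmp A i i j f ?d = Cmp A i j j e f" using A.Rst_Cmp[of i j j f e] ijk f d by simp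
  have Pd: "Pa i i ?d = rst (Pa j j e \<cdot> Pa i j f)"
    using ijk f d ef by (simp add: Pa_Rst Pa_Cmp)
  have *: "sa i k (Cmp A i j k h f) \<cdot> y = sa i k (Cmp A i j k (Cmp A j j k h e) f) \<cdot> y" if h: "h \<in> Hom A j k" for h
  proof -
    note sd = sa_dom[OF ijk f h]
    have "Cmp A i j k (Cmp A j j k h e) f = Cmp A i i k (Cmp A i j k h f) ?d"
      using ijk f h d d_in A.Cmp_assoc[of i j j k f e h] A.Cmp_assoc[of i i j k ?d f h] fd by simp
    then have "sa i k (Cmp A i j k (Cmp A j j k h e) f) \<cdot> y = sa i k (Cmp A i j k h f) \<cdot> rst (Pa j j e \<cdot> Pa i j f) \<cdot> y"
      using sa_cmp_idem[OF ijk(1,3) sd(1) d_in(1)] by (simp add: Pd cmp_assoc)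
    also have "rst (Pa j j e \<cdot> Pa i j f) \<cdot> y = y \<cdot> rst (Pa i j f \<cdot> y)"
      using rst_swap[of "Pa j j e \<cdot> Pa i j f" y] by (simp add: cmp_assoc y)
    also have "\<dots> = rst (Pa i j f) \<cdot> y" by (simp add: rst_swap)
    finally show ?thesis using cmp_reassoc[OF sd(5), of y] by simp
  qed
  show ?thesis using *[OF g(1)] *[OF g(2)] by (simp add: d(4))
qed

text \<open>The multiplication is built in two stages. With \<open>g\<close> fixed, composing on the
  left respects agreement on an \<open>e\<close> of \<open>Eq\<close>, because h e may be formed
  before composing with \<open>g\<close>; so the sections of the composites glue.\<close>

lemma ex_left_mul:
  assumes ijk: "i \<in> Ob A" "j \<in> Ob A" "k \<in> Ob A" and g: "g \<in> Hom A j k"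
  shows "\<exists>R\<in>hom (A1 \<BB> i j) (A1 \<BB> i k). \<forall>f\<in>Hom A i j. R \<cdot> sa i j f = sa i k (Cmp A i j k g f)"
proof (rule map_ext[OF ijk(1,2)])
  show "A1 \<BB> i k \<in> Ob C" using ijk by simp
  show "sa i k (Cmp A i j k g f) \<in> hom (FOb P i) (A1 \<BB> i k)" if "f \<in> Hom A i j" for f
    by (rule sa_hom[OF ijk(1,3) sa_dom(1)[OF ijk that g]])
  show "sa i k (Cmp A i j k g f) \<cdot> rst (Pa i j f) = sa i k (Cmp A i j k g f)" if "f \<in> Hom A i j" for f
    by (rule sa_dom(5)[OF ijk that g])
  fix f f' e assume f: "f \<in> Hom A i j" "f' \<in> Hom A i j" and e: "e \<in> Eq i j f f'"
  note d = EqD[OF ijk(1,2) f e]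
  have "sa i k (Cmp A i j k g h) \<cdot> Pa i i e = sa i k (Cmp A i j k g (Cmp A i i j h e))" if h: "h \<in> Hom A i j" for h
    using sa_cmp_idem[OF ijk(1,3) sa_dom(1)[OF ijk h g] d(1)] A.Cmp_assoc[of i i j k e h g] ijk g h d by simp
  then show "sa i k (Cmp A i j k g f) \<cdot> Pa i i e = sa i k (Cmp A i j k g f') \<cdot> Pa i i e"
    using f by (simp add: d(4))
qed

context
  fixes i j k assumes ijk: "i \<in> Ob A" "j \<in> Ob A" "k \<in> Ob A"
begin

lemma ix: "i \<in> Ix \<BB>" "j \<in> Ix \<BB>" "k \<in> Ix \<BB>"
  using ijk by (simp_all add: Ix_eq)

lemma sr_sa_cmp: "g \<in> Hom A j k \<Longrightarrow> sr \<BB> j k \<cdot> sa j k g \<cdot> x = x \<cdot> rst (sa j k g \<cdot> x)"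
  using cmp_reassoc[OF pa_sa[OF ijk(2,3)], of g x] rst_swap[of "sa j k g" x] by (simp add: pa_sr rst_sa[OF ijk(2,3)])

lemma T_props:
  assumes g: "g \<in> Hom A j k"
  shows "sr \<BB> j k \<cdot> sa j k g \<cdot> tg \<BB> i j = tg \<BB> i j \<cdot> rst (sa j k g \<cdot> tg \<BB> i j)"
    and "T i j k g \<in> hom (A1 \<BB> i j) (pb C (cmp_cospan \<BB> i j k))"
    and "pb1 (cmp_cospan \<BB> i j k) \<cdot> T i j k g = sa j k g \<cdot> tg \<BB> i j"
    and "pb2 (cmp_cospan \<BB> i j k) \<cdot> T i j k g = rst (sa j k g \<cdot> tg \<BB> i j)"
    and "rst (T i j k g) = rst (sa j k g \<cdot> tg \<BB> i j)"
    and "T i j k g \<cdot> x = mpair (cmp_cospan \<BB> i j k) (sa j k g \<cdot> tg \<BB> i j \<cdot> x) (x \<cdot> rst (sa j k g \<cdot> tg \<BB> i j \<cdot> x))"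
proof -
  note ok = cmp_ok[OF ix]
  show m: "sr \<BB> j k \<cdot> sa j k g \<cdot> tg \<BB> i j = tg \<BB> i j \<cdot> rst (sa j k g \<cdot> tg \<BB> i j)" by (rule sr_sa_cmp[OF g])
  have h: "sa j k g \<cdot> tg \<BB> i j \<in> hom (A1 \<BB> i j) (A1 \<BB> j k)"
    using cmp_hom[OF sa_hom[OF ijk(2,3) g], of "tg \<BB> i j"] tg_hom[OF ix(1,2)] by (simp add: A0_eq)
  note e = hom_el[OF h] hom_el[OF rst_hom[OF h]]
  show "T i j k g \<in> hom (A1 \<BB> i j) (pb C (cmp_cospan \<BB> i j k))"
    unfolding T_def using h rst_hom[OF h] m by (intro mpair_hom[OF ok]) simp_all
  show "pb1 (cmp_cospan \<BB> i j k) \<cdot> T i j k g = sa j k g \<cdot> tg \<BB> i j" "pb2 (cmp_cospan \<BB> i j k) \<cdot> T i j k g = rst (sa j k g \<cdot> tg \<BB> i j)"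
    unfolding T_def using e m by (intro pb_mpair[OF ok]; simp)+
  show "rst (T i j k g) = rst (sa j k g \<cdot> tg \<BB> i j)"
    unfolding T_def using e m by (intro rst_mpair[OF ok]) simp_all
  show "T i j k g \<cdot> x = mpair (cmp_cospan \<BB> i j k) (sa j k g \<cdot> tg \<BB> i j \<cdot> x) (x \<cdot> rst (sa j k g \<cdot> tg \<BB> i j \<cdot> x))"
    unfolding T_def using mpair_cmp[OF ok, of "sa j k g \<cdot> tg \<BB> i j" "rst (sa j k g \<cdot> tg \<BB> i j)" x] e m
      rst_swap[of "sa j k g \<cdot> tg \<BB> i j" x] by (simp add: cmp_assoc)
qed

lemma mpair_on_section:
  assumes g: "g \<in> Hom A j k" and y: "y \<in> el (A1 \<BB> i j)" and z: "z \<in> el (A1 \<BB> j k)" and zy: "sr \<BB> j k \<cdot> z = tg \<BB> i j \<cdot> y"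
    and s: "z = sa j k g \<cdot> sr \<BB> j k \<cdot> z"
  shows "mpair (cmp_cospan \<BB> i j k) z y = T i j k g \<cdot> y" "rst z = rst y"
proof -
  show r: "rst z = rst y"
    using rst_tot[OF sr_tot[OF ix(2,3)] z] rst_tot[OF tg_tot[OF ix(1,2)] y] by (simp add: zy)
  have "sa j k g \<cdot> tg \<BB> i j \<cdot> y = z" using s by (simp add: zy)
  then show "mpair (cmp_cospan \<BB> i j k) z y = T i j k g \<cdot> y" using y by (simp add: T_props(6)[OF g] r)
qed

text \<open>The tool for maps on a pullback of two glueings: the pieces in which \<open>y\<close>
  lies cover the domain, and each is covered by the pieces in which \<open>z\<close> lies. Equality
  may thus be tested where both coordinates lie on single sections.\<close>

lemma two_cover:
  assumes z: "z \<in> hom w (A1 \<BB> j k)" and y: "y \<in> hom w (A1 \<BB> i j)" and zy: "sr \<BB> j k \<cdot> z = tg \<BB> i j \<cdot> y"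
    and u: "u \<in> hom w t" "u \<cdot> rst y = u" and v: "v \<in> hom w t" "v \<cdot> rst y = v"
    and eq: "\<And>f g e. \<lbrakk>f \<in> Hom A i j; g \<in> Hom A j k; e \<in> idem w; y \<cdot> e = sa i j f \<cdot> sr \<BB> i j \<cdot> y \<cdot> e;
        z \<cdot> e = sa j k g \<cdot> sr \<BB> j k \<cdot> z \<cdot> e\<rbrakk> \<Longrightarrow> u \<cdot> e = v \<cdot> e"
  shows "u = v"
proof -
  have r: "rst z = rst y"
    using rst_tot[OF sr_tot[OF ix(2,3)] hom_el[OF z]] rst_tot[OF tg_tot[OF ix(1,2)] hom_el[OF y]] by (simp add: zy)
  show ?thesis
  proof (rule glue_eq[OF ijk(1,2) y u(1) v(1) u(2) v(2)])
    fix f assume f: "f \<in> Hom A i j"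
    let ?r = "rst (qa i j f \<cdot> y)"
    have ri: "?r \<in> idem w" by (rule rst_in_idem[OF cmp_hom[OF qa_hom[OF ijk(1,2) f] y]])
    have rr: "?r \<cdot> rst z = ?r" unfolding r by simp
    show "u \<cdot> ?r = v \<cdot> ?r"
    proof (rule glue_eq[OF ijk(2,3) z])
      show "u \<cdot> ?r \<in> hom w t" "v \<cdot> ?r \<in> hom w t" by (rule cmp_hom[OF u(1) idem_hom[OF ri]] cmp_hom[OF v(1) idem_hom[OF ri]])+
      show "(u \<cdot> ?r) \<cdot> rst z = u \<cdot> ?r" "(v \<cdot> ?r) \<cdot> rst z = v \<cdot> ?r" by (simp_all only: cmp_assoc rr)
      fix g assume g: "g \<in> Hom A j k"
      let ?s = "rst (qa j k g \<cdot> z)"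
      have si: "?s \<in> idem w" by (rule rst_in_idem[OF cmp_hom[OF qa_hom[OF ijk(2,3) g] z]])
      have "u \<cdot> ?r \<cdot> ?s = v \<cdot> ?r \<cdot> ?s"
      proof (rule eq[OF f g cmp_idem[OF ri si]])
        show "y \<cdot> ?r \<cdot> ?s = sa i j f \<cdot> sr \<BB> i j \<cdot> y \<cdot> ?r \<cdot> ?s"
          using cmp_reassoc[OF el_local[OF ijk(1,2) f, of y], of ?s] by (simp add: pa_sr cmp_assoc)
        show "z \<cdot> ?r \<cdot> ?s = sa j k g \<cdot> sr \<BB> j k \<cdot> z \<cdot> ?r \<cdot> ?s"
          unfolding rst_comm[of "qa i j f \<cdot> y"]
          using cmp_reassoc[OF el_local[OF ijk(2,3) g, of z], of ?r] by (simp add: pa_sr cmp_assoc)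
      qed
      then show "(u \<cdot> ?r) \<cdot> ?s = (v \<cdot> ?r) \<cdot> ?s" by (simp only: cmp_assoc)
    qed
  qed
qed

lemma pb_facts: "pb1 (cmp_cospan \<BB> i j k) \<in> hom (pb C (cmp_cospan \<BB> i j k)) (A1 \<BB> j k)"
  "pb2 (cmp_cospan \<BB> i j k) \<in> hom (pb C (cmp_cospan \<BB> i j k)) (A1 \<BB> i j)"
  "sr \<BB> j k \<cdot> pb1 (cmp_cospan \<BB> i j k) = tg \<BB> i j \<cdot> pb2 (cmp_cospan \<BB> i j k)"
  "rst (pb2 (cmp_cospan \<BB> i j k)) = ide (pb C (cmp_cospan \<BB> i j k))"
  "pb C (cmp_cospan \<BB> i j k) \<in> Ob C"
  using pb_cmp_hom[OF ix] tot_rst[OF pb_tot(2)[OF cmp_ok[OF ix]]] pb_ob[OF cmp_ok[OF ix]] by auto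

text \<open>Where both projections lie on sections, an element of the pullback factors through
  \<open>T i j k g \<cdot> sa i j f\<close>, on which the two maps agree.\<close>

lemma mul_unique:
  assumes m: "m \<in> hom (pb C (cmp_cospan \<BB> i j k)) t" "m' \<in> hom (pb C (cmp_cospan \<BB> i j k)) t"
    and eq: "\<And>f g. \<lbrakk>f \<in> Hom A i j; g \<in> Hom A j k\<rbrakk> \<Longrightarrow> m \<cdot> T i j k g \<cdot> sa i j f = m' \<cdot> T i j k g \<cdot> sa i j f"
  shows "m = m'"
proof (rule two_cover[OF pb_facts(1-3) m(1) _ m(2)])
  let ?K = "cmp_cospan \<BB> i j k"
  show "m \<cdot> rst (pb2 ?K) = m" "m' \<cdot> rst (pb2 ?K) = m'" using m by (simp_all add: pb_facts(4) cmp_ide)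
  fix f g e assume f: "f \<in> Hom A i j" and g: "g \<in> Hom A j k" and e: "e \<in> idem (pb C ?K)"
    and y: "pb2 ?K \<cdot> e = sa i j f \<cdot> sr \<BB> i j \<cdot> pb2 ?K \<cdot> e" and z: "pb1 ?K \<cdot> e = sa j k g \<cdot> sr \<BB> j k \<cdot> pb1 ?K \<cdot> e"
  have "e = mpair ?K (pb1 ?K \<cdot> e) (pb2 ?K \<cdot> e)" by (rule mpair_eta[OF cmp_ok[OF ix] hom_el[OF idem_hom[OF e]], symmetric])
  also have "\<dots> = T i j k g \<cdot> pb2 ?K \<cdot> e"
    using cmp_reassoc[OF pb_facts(3), of e]
    by (intro mpair_on_section[OF g _ _ _ z] hom_cmp_el[OF pb_facts(1)] hom_cmp_el[OF pb_facts(2)]) (simp add: cmp_assoc)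
  finally have e': "e = T i j k g \<cdot> sa i j f \<cdot> sr \<BB> i j \<cdot> pb2 ?K \<cdot> e" by (simp add: y[symmetric])
  have "(m \<cdot> T i j k g \<cdot> sa i j f) \<cdot> sr \<BB> i j \<cdot> pb2 ?K \<cdot> e = (m' \<cdot> T i j k g \<cdot> sa i j f) \<cdot> sr \<BB> i j \<cdot> pb2 ?K \<cdot> e"
    by (simp only: eq[OF f g])
  then show "m \<cdot> e = m' \<cdot> e" using e' by (simp add: cmp_assoc)
qed

text \<open>The second stage: over the first projection the pullback is covered by pieces indexed by
  g, and on the piece of g the value is the left multiplication by g at the second projection. For g
  and g' agreeing on an e, the comparison is refined by the sections f on which the second
  coordinate lies, where \<open>sa_comp_Eq\<close> decides it.\<close>

lemma mul_exists:
  "\<exists>m\<in>hom (pb C (cmp_cospan \<BB> i j k)) (A1 \<BB> i k). \<forall>f\<in>Hom A i j. \<forall>g\<in>Hom A j k.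
     m \<cdot> T i j k g \<cdot> sa i j f = sa i k (Cmp A i j k g f)"
proof -
  let ?K = "cmp_cospan \<BB> i j k" let ?w = "pb C ?K"
  have "\<exists>R. \<forall>g\<in>Hom A j k. R g \<in> hom (A1 \<BB> i j) (A1 \<BB> i k) \<and> (\<forall>f\<in>Hom A i j. R g \<cdot> sa i j f = sa i k (Cmp A i j k g f))"
    using ex_left_mul[OF ijk] by (intro bchoice) blast
  then obtain R where R: "\<And>g. g \<in> Hom A j k \<Longrightarrow> R g \<in> hom (A1 \<BB> i j) (A1 \<BB> i k)"
    "\<And>f g. \<lbrakk>f \<in> Hom A i j; g \<in> Hom A j k\<rbrakk> \<Longrightarrow> R g \<cdot> sa i j f = sa i k (Cmp A i j k g f)" by blast
  have "\<exists>v\<in>hom ?w (A1 \<BB> i k). v \<cdot> rst (pb1 ?K) = v \<and>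
      (\<forall>g\<in>Hom A j k. v \<cdot> rst (qa j k g \<cdot> pb1 ?K) = (R g \<cdot> pb2 ?K) \<cdot> rst (qa j k g \<cdot> pb1 ?K)) \<and>
      ((\<forall>g\<in>Hom A j k. rst (R g \<cdot> pb2 ?K) \<cdot> rst (qa j k g \<cdot> pb1 ?K) = rst (qa j k g \<cdot> pb1 ?K)) \<longrightarrow> rst v = rst (pb1 ?K))"
  proof (rule glue_ext[OF ijk(2,3) pb_facts(1)])
    show "A1 \<BB> i k \<in> Ob C" using ijk by simp
    show "R g \<cdot> pb2 ?K \<in> hom ?w (A1 \<BB> i k)" if "g \<in> Hom A j k" for g by (rule cmp_hom[OF R(1)[OF that] pb_facts(2)])
    fix g g' e r assume g: "g \<in> Hom A j k" "g' \<in> Hom A j k" and e: "e \<in> Eq j k g g'" and r: "r \<in> idem ?w"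
      and er: "Pa j j e \<cdot> pa j k \<cdot> pb1 ?K \<cdot> r = pa j k \<cdot> pb1 ?K \<cdot> r"
    let ?b = "pb2 ?K \<cdot> r"
    have b: "?b \<in> hom ?w (A1 \<BB> i j)" by (rule cmp_hom[OF pb_facts(2) idem_hom[OF r]])
    have pr: "pa j k \<cdot> pb1 ?K \<cdot> r = tg \<BB> i j \<cdot> ?b" using cmp_reassoc[OF pb_facts(3), of r] by (simp add: pa_sr cmp_assoc)
    show "(R g \<cdot> pb2 ?K) \<cdot> r = (R g' \<cdot> pb2 ?K) \<cdot> r"
      unfolding cmp_assoc
    proof (rule glue_eq[OF ijk(1,2) b])
      show "R g \<cdot> ?b \<in> hom ?w (A1 \<BB> i k)" "R g' \<cdot> ?b \<in> hom ?w (A1 \<BB> i k)"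
        by (rule cmp_hom[OF R(1)[OF g(1)] b] cmp_hom[OF R(1)[OF g(2)] b])+
      show "(R g \<cdot> ?b) \<cdot> rst ?b = R g \<cdot> ?b" "(R g' \<cdot> ?b) \<cdot> rst ?b = R g' \<cdot> ?b"
        using hom_rst[OF b] by (simp_all only: cmp_assoc[of "R g"] cmp_assoc[of "R g'"])
      fix f assume f: "f \<in> Hom A i j"
      let ?t = "rst (qa i j f \<cdot> ?b)" let ?y = "pa i j \<cdot> ?b \<cdot> ?t"
      have bt: "?b \<cdot> ?t = sa i j f \<cdot> ?y" by (rule el_local[OF ijk(1,2) f])
      have "tg \<BB> i j \<cdot> ?b \<cdot> ?t = Pa i j f \<cdot> ?y" using cmp_reassoc[OF tg_sa[OF ijk(1,2) f], of ?y] by (simp only: bt[symmetric])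
      moreover have "Pa j j e \<cdot> tg \<BB> i j \<cdot> ?b \<cdot> ?t = tg \<BB> i j \<cdot> ?b \<cdot> ?t"
        using cmp_reassoc[OF er[unfolded pr], of ?t] by (simp only: cmp_assoc)
      ultimately have "Pa j j e \<cdot> Pa i j f \<cdot> ?y = Pa i j f \<cdot> ?y" by simp
      then have "sa i k (Cmp A i j k g f) \<cdot> ?y = sa i k (Cmp A i j k g' f) \<cdot> ?y" by (rule sa_comp_Eq[OF ijk f g e])
      then have "R g \<cdot> sa i j f \<cdot> ?y = R g' \<cdot> sa i j f \<cdot> ?y"
        by (simp only: cmp_reassoc[OF R(2)[OF f g(1)]] cmp_reassoc[OF R(2)[OF f g(2)]])
      then show "(R g \<cdot> ?b) \<cdot> ?t = (R g' \<cdot> ?b) \<cdot> ?t" by (simp only: cmp_assoc[of "R g"] cmp_assoc[of "R g'"] bt[symmetric])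
    qed
  qed
  then obtain v where v: "v \<in> hom ?w (A1 \<BB> i k)"
    "\<And>g. g \<in> Hom A j k \<Longrightarrow> v \<cdot> rst (qa j k g \<cdot> pb1 ?K) = (R g \<cdot> pb2 ?K) \<cdot> rst (qa j k g \<cdot> pb1 ?K)" by blast
  have "v \<cdot> T i j k g \<cdot> sa i j f = sa i k (Cmp A i j k g f)" if f: "f \<in> Hom A i j" and g: "g \<in> Hom A j k" for f g
  proof -
    note T = T_props[OF g]
    \<comment> \<open>The image of \<open>T i j k g\<close> lies entirely in the piece of
      \<open>g\<close>, so there \<open>v\<close> is computed by \<open>R g\<close>.\<close>
    have "qa j k g \<cdot> pb1 ?K \<cdot> T i j k g = rst (sa j k g) \<cdot> tg \<BB> i j"
      using cmp_reassoc[OF qa_sa[OF ijk(2,3) g g], of "tg \<BB> i j"] by (simp add: T(3) loc_self[OF ijk(2,3) g] rst_sa[OF ijk(2,3) g])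
    then have "rst (qa j k g \<cdot> pb1 ?K \<cdot> T i j k g) = rst (T i j k g)" by (simp add: T(5))
    then have "rst (qa j k g \<cdot> pb1 ?K) \<cdot> T i j k g = T i j k g"
      using rst_swap[of "qa j k g \<cdot> pb1 ?K" "T i j k g"] hom_rst[OF T(2)] by (simp add: cmp_assoc)
    then have "v \<cdot> T i j k g = R g \<cdot> rst (sa j k g \<cdot> tg \<BB> i j)"
      using cmp_reassoc[OF v(2)[OF g], of "T i j k g"] by (simp add: cmp_assoc T(4))
    then have "(v \<cdot> T i j k g) \<cdot> sa i j f = R g \<cdot> rst (sa j k g \<cdot> tg \<BB> i j) \<cdot> sa i j f" by (simp add: cmp_assoc)
    also have "\<dots> = R g \<cdot> sa i j f \<cdot> rst (sa j k g \<cdot> Pa i j f)"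
      using rst_swap[of "sa j k g \<cdot> tg \<BB> i j" "sa i j f"] by (simp add: cmp_assoc tg_sa[OF ijk(1,2) f])
    also have "\<dots> = sa i k (Cmp A i j k g f) \<cdot> rst (Pa j k g \<cdot> Pa i j f)"
      using cmp_reassoc[OF R(2)[OF f g]] sa_dom(3)[OF ijk f g, of "ide (FOb P i)"] ijk Pa_hom[OF ijk(1,2) f]
      by (simp add: cmp_ide)
    finally show ?thesis using sa_dom(4)[OF ijk f g] by (simp add: cmp_assoc)
  qed
  then show ?thesis using v(1) by blast
qed

text \<open>\<open>?Q\<close> is the raw description of \<open>mul\<close>. Restated with
  \<open>T\<close> in \<open>Q\<close>, it is the condition for which \<open>mul_exists\<close> and
  \<open>mul_unique\<close> give existence and uniqueness, so the description is attained.\<close>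

lemma mul_props:
  "mul \<BB> i j k \<in> Hom C (pb C (cmp_cospan \<BB> i j k)) (A1 \<BB> i k)"
  "\<lbrakk>f \<in> Hom A i j; g \<in> Hom A j k\<rbrakk> \<Longrightarrow> mulA \<BB> i j k \<cdot> T i j k g \<cdot> sa i j f = sa i k (Cmp A i j k g f)"
proof -
  let ?K = "cmp_cospan \<BB> i j k" let ?w = "pb C ?K"
  let ?Q = "\<lambda>m. m \<in> Hom C ?w (A1 \<BB> i k) \<and> (\<forall>f\<in>Hom A i j. \<forall>g\<in>Hom A j k.
           Cmp C (FOb P i) ?w (A1 \<BB> i k) m
             (Cmp C (FOb P i) (A1 \<BB> i j) ?w (tgt_pull C \<BB> i j k (s j k g)) (s i j f))
           = s i k (Cmp A i j k g f))"
  have T: "tgt_pull C \<BB> i j k (s j k g) \<in> Hom C (A1 \<BB> i j) ?w" "arr (A1 \<BB> i j) ?w (tgt_pull C \<BB> i j k (s j k g)) = T i j k g"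
    if g: "g \<in> Hom A j k" for g
    using arr_tgt_pull[OF ix, of "s j k g"] raw_in(2)[OF ijk(2,3) g] pa_sa[OF ijk(2,3) g] rst_sa[OF ijk(2,3) g]
    by (simp_all add: A0_eq pa_sr T_def flip: sa_def)
  have Q: "?Q m \<longleftrightarrow> m \<in> Hom C ?w (A1 \<BB> i k) \<and> (\<forall>f\<in>Hom A i j. \<forall>g\<in>Hom A j k.
       arr ?w (A1 \<BB> i k) m \<cdot> T i j k g \<cdot> sa i j f = sa i k (Cmp A i j k g f))" for m
  proof (cases "m \<in> Hom C ?w (A1 \<BB> i k)")
    case m: True
    have "Cmp C (FOb P i) ?w (A1 \<BB> i k) m (Cmp C (FOb P i) (A1 \<BB> i j) ?w (tgt_pull C \<BB> i j k (s j k g)) (s i j f)) = s i k (Cmp A i j k g f)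
       \<longleftrightarrow> arr ?w (A1 \<BB> i k) m \<cdot> T i j k g \<cdot> sa i j f = sa i k (Cmp A i j k g f)"
      if f: "f \<in> Hom A i j" and g: "g \<in> Hom A j k" for f g
    proof -
      note r = raw_in(2)[OF ijk(1,2) f] raw_in(2)[OF ijk(1,3) sa_dom(1)[OF ijk f g]] T[OF g] pb_facts(5) m
      have c: "Cmp C (FOb P i) (A1 \<BB> i j) ?w (tgt_pull C \<BB> i j k (s j k g)) (s i j f) \<in> Hom C (FOb P i) ?w"
        using r ijk by (auto intro: Cmp_in)
      have c': "Cmp C (FOb P i) ?w (A1 \<BB> i k) m (Cmp C (FOb P i) (A1 \<BB> i j) ?w (tgt_pull C \<BB> i j k (s j k g)) (s i j f)) \<in> Hom C (FOb P i) (A1 \<BB> i k)"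
        using r c ijk by (auto intro: Cmp_in)
      show ?thesis
        unfolding arr_eq_iff[OF P_ob[OF ijk(1)] G_ob[OF ijk(1,3)] c' r(2)]
        using r c ijk by (simp add: arr_Cmp sa_def)
    qed
    then show ?thesis using m by simp
  qed simp
  from mul_exists obtain m where m: "m \<in> hom ?w (A1 \<BB> i k)"
    "\<And>f g. \<lbrakk>f \<in> Hom A i j; g \<in> Hom A j k\<rbrakk> \<Longrightarrow> m \<cdot> T i j k g \<cdot> sa i j f = sa i k (Cmp A i j k g f)" by blast
  have ex: "\<exists>!m. ?Q m"
  proof (rule ex1I[of _ "mor m"])
    show "?Q (mor m)" unfolding Q using m by (simp add: mor_in arr_mor)
    fix m' assume "?Q m'"
    then have m': "m' \<in> Hom C ?w (A1 \<BB> i k)"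
      "\<And>f g. \<lbrakk>f \<in> Hom A i j; g \<in> Hom A j k\<rbrakk> \<Longrightarrow> arr ?w (A1 \<BB> i k) m' \<cdot> T i j k g \<cdot> sa i j f = sa i k (Cmp A i j k g f)"
      unfolding Q by auto
    have "arr ?w (A1 \<BB> i k) m' = m"
      by (rule mul_unique[OF _ m(1)]) (use m m' pb_facts(5) ijk in \<open>auto intro: homI\<close>)
    then show "m' = mor m" using mor_arr[OF pb_facts(5) G_ob[OF ijk(1,3)] m'(1)] by simp
  qed
  have "?Q (mul \<BB> i j k)" unfolding mul_eq[OF ijk] by (rule theI'[OF ex])
  then show "mul \<BB> i j k \<in> Hom C ?w (A1 \<BB> i k)"
    "\<lbrakk>f \<in> Hom A i j; g \<in> Hom A j k\<rbrakk> \<Longrightarrow> mulA \<BB> i j k \<cdot> T i j k g \<cdot> sa i j f = sa i k (Cmp A i j k g f)"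
    unfolding Q by (auto simp: mulA_def)
qed

text \<open>By \<open>mpair_on_section\<close> the pair factors through \<open>T\<close>, where
  \<open>mul\<close> is specified. This is the working form of the multiplication: on sections it is
  composition in \<open>A\<close>, and the laws of \<Psi> are reduced to it.\<close>

lemma mu_on_section:
  assumes f: "f \<in> Hom A i j" and g: "g \<in> Hom A j k" and y: "y \<in> el (A1 \<BB> i j)" and z: "z \<in> el (A1 \<BB> j k)"
    and zy: "sr \<BB> j k \<cdot> z = tg \<BB> i j \<cdot> y" and sy: "y = sa i j f \<cdot> sr \<BB> i j \<cdot> y" and sz: "z = sa j k g \<cdot> sr \<BB> j k \<cdot> z"
  shows "mu \<BB> i j k z y = sa i k (Cmp A i j k g f) \<cdot> sr \<BB> i j \<cdot> y" "rst (sa i k (Cmp A i j k g f) \<cdot> sr \<BB> i j \<cdot> y) = rst y"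
proof -
  note m = mpair_on_section[OF g y z zy sz]
  have "mu \<BB> i j k z y = mulA \<BB> i j k \<cdot> T i j k g \<cdot> sa i j f \<cdot> sr \<BB> i j \<cdot> y"
    using sy by (simp add: mu_def m(1))
  then show "mu \<BB> i j k z y = sa i k (Cmp A i j k g f) \<cdot> sr \<BB> i j \<cdot> y"
    using cmp_reassoc[OF mul_props(2)[OF f g], of "sr \<BB> i j \<cdot> y"] by (simp add: cmp_assoc)
  have "tg \<BB> i j \<cdot> y = Pa i j f \<cdot> sr \<BB> i j \<cdot> y" using cmp_reassoc[OF tg_sa[OF ijk(1,2) f], of "sr \<BB> i j \<cdot> y"] sy by simp
  then have z: "z = sa j k g \<cdot> Pa i j f \<cdot> sr \<BB> i j \<cdot> y" using sz zy by simp
  have "rst (sa i k (Cmp A i j k g f) \<cdot> sr \<BB> i j \<cdot> y) = rst (rst (sa i k (Cmp A i j k g f)) \<cdot> sr \<BB> i j \<cdot> y)" by simp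
  also have "\<dots> = rst z" unfolding sa_dom(2)[OF ijk f g] z by (simp add: sa_dom(3)[OF ijk f g] cmp_assoc)
  finally show "rst (sa i k (Cmp A i j k g f) \<cdot> sr \<BB> i j \<cdot> y) = rst y" by (simp add: m(2))
qed

lemma sr_tg_on_section:
  assumes f: "f \<in> Hom A i j" and g: "g \<in> Hom A j k" and y: "y \<in> el (A1 \<BB> i j)" and z: "z \<in> el (A1 \<BB> j k)"
    and zy: "sr \<BB> j k \<cdot> z = tg \<BB> i j \<cdot> y" and sy: "y = sa i j f \<cdot> sr \<BB> i j \<cdot> y" and sz: "z = sa j k g \<cdot> sr \<BB> j k \<cdot> z"
  shows "sr \<BB> i k \<cdot> mu \<BB> i j k z y = sr \<BB> i j \<cdot> y" "tg \<BB> i k \<cdot> mu \<BB> i j k z y = tg \<BB> j k \<cdot> z"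
proof -
  note m = mu_on_section[OF assms] and c = sa_dom(1)[OF ijk f g]
  let ?x = "sr \<BB> i j \<cdot> y"
  have "sr \<BB> i k \<cdot> sa i k (Cmp A i j k g f) \<cdot> ?x = rst (sa i k (Cmp A i j k g f)) \<cdot> ?x"
    using cmp_reassoc[OF pa_sa[OF ijk(1,3) c], of ?x] rst_sa[OF ijk(1,3) c] by (simp add: pa_sr)
  also have "\<dots> = ?x \<cdot> rst (sa i k (Cmp A i j k g f) \<cdot> ?x)" by (rule rst_swap)
  also have "\<dots> = ?x" using y by (simp add: m(2) cmp_assoc)
  finally show "sr \<BB> i k \<cdot> mu \<BB> i j k z y = sr \<BB> i j \<cdot> y" by (simp add: m(1))
  have "tg \<BB> i j \<cdot> y = Pa i j f \<cdot> ?x" using cmp_reassoc[OF tg_sa[OF ijk(1,2) f], of ?x] sy by simp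
  moreover have "tg \<BB> j k \<cdot> z = Pa j k g \<cdot> tg \<BB> i j \<cdot> y"
    using cmp_reassoc[OF tg_sa[OF ijk(2,3) g], of "sr \<BB> j k \<cdot> z"] sz zy by simp
  moreover have "tg \<BB> i k \<cdot> mu \<BB> i j k z y = Pa j k g \<cdot> Pa i j f \<cdot> ?x"
    using cmp_reassoc[OF tg_sa[OF ijk(1,3) c], of ?x] by (simp add: m(1) Pa_Cmp[OF ijk f g] cmp_assoc)
  ultimately show "tg \<BB> i k \<cdot> mu \<BB> i j k z y = tg \<BB> j k \<cdot> z" by simp
qed

lemma sr_tg_mulA: "sr \<BB> i k \<cdot> mulA \<BB> i j k = sr \<BB> i j \<cdot> pb2 (cmp_cospan \<BB> i j k)"
  "tg \<BB> i k \<cdot> mulA \<BB> i j k = tg \<BB> j k \<cdot> pb1 (cmp_cospan \<BB> i j k)"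
proof -
  let ?K = "cmp_cospan \<BB> i j k" let ?w = "pb C ?K"
  have mh: "mulA \<BB> i j k \<in> hom ?w (A1 \<BB> i k)" using mul_props(1) pb_facts(5) ijk by (simp add: mulA_def homI)
  have eta: "mulA \<BB> i j k \<cdot> e = mu \<BB> i j k (pb1 ?K \<cdot> e) (pb2 ?K \<cdot> e)" if "e \<in> idem ?w" for e
    using mpair_eta[OF cmp_ok[OF ix] hom_el[OF idem_hom[OF that]]] by (simp add: mu_def)
  note e12 = hom_cmp_el[OF pb_facts(1)] hom_cmp_el[OF pb_facts(2)]
  have h: "sr \<BB> i k \<cdot> mulA \<BB> i j k \<in> hom ?w (FOb P i)" "sr \<BB> i j \<cdot> pb2 ?K \<in> hom ?w (FOb P i)"
    "tg \<BB> i k \<cdot> mulA \<BB> i j k \<in> hom ?w (FOb P k)" "tg \<BB> j k \<cdot> pb1 ?K \<in> hom ?w (FOb P k)"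
    using cmp_hom[OF sr_hom[OF ix(1,3)] mh] cmp_hom[OF sr_hom[OF ix(1,2)] pb_facts(2)]
      cmp_hom[OF tg_hom[OF ix(1,3)] mh] cmp_hom[OF tg_hom[OF ix(2,3)] pb_facts(1)] by (simp_all add: A0_eq)
  have zy: "sr \<BB> j k \<cdot> pb1 ?K \<cdot> e = tg \<BB> i j \<cdot> pb2 ?K \<cdot> e" for e
    using cmp_reassoc[OF pb_facts(3), of e] by (simp add: cmp_assoc)
  show "sr \<BB> i k \<cdot> mulA \<BB> i j k = sr \<BB> i j \<cdot> pb2 ?K"
  proof (rule two_cover[OF pb_facts(1-3) h(1) _ h(2)])
    show "(sr \<BB> i k \<cdot> mulA \<BB> i j k) \<cdot> rst (pb2 ?K) = sr \<BB> i k \<cdot> mulA \<BB> i j k" "(sr \<BB> i j \<cdot> pb2 ?K) \<cdot> rst (pb2 ?K) = sr \<BB> i j \<cdot> pb2 ?K"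
      unfolding pb_facts(4) by (rule cmp_ide[OF h(1)] cmp_ide[OF h(2)])+
    fix f g e assume "f \<in> Hom A i j" "g \<in> Hom A j k" "e \<in> idem ?w" "pb2 ?K \<cdot> e = sa i j f \<cdot> sr \<BB> i j \<cdot> pb2 ?K \<cdot> e"
        "pb1 ?K \<cdot> e = sa j k g \<cdot> sr \<BB> j k \<cdot> pb1 ?K \<cdot> e"
    from sr_tg_on_section(1)[OF this(1,2) e12(2,1) zy this(4,5)] eta[OF this(3)]
    show "(sr \<BB> i k \<cdot> mulA \<BB> i j k) \<cdot> e = (sr \<BB> i j \<cdot> pb2 ?K) \<cdot> e" by (simp add: cmp_assoc)
  qed
  show "tg \<BB> i k \<cdot> mulA \<BB> i j k = tg \<BB> j k \<cdot> pb1 ?K"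
  proof (rule two_cover[OF pb_facts(1-3) h(3) _ h(4)])
    show "(tg \<BB> i k \<cdot> mulA \<BB> i j k) \<cdot> rst (pb2 ?K) = tg \<BB> i k \<cdot> mulA \<BB> i j k" "(tg \<BB> j k \<cdot> pb1 ?K) \<cdot> rst (pb2 ?K) = tg \<BB> j k \<cdot> pb1 ?K"
      unfolding pb_facts(4) by (rule cmp_ide[OF h(3)] cmp_ide[OF h(4)])+
    fix f g e assume "f \<in> Hom A i j" "g \<in> Hom A j k" "e \<in> idem ?w" "pb2 ?K \<cdot> e = sa i j f \<cdot> sr \<BB> i j \<cdot> pb2 ?K \<cdot> e"
        "pb1 ?K \<cdot> e = sa j k g \<cdot> sr \<BB> j k \<cdot> pb1 ?K \<cdot> e"
    from sr_tg_on_section(2)[OF this(1,2) e12(2,1) zy this(4,5)] eta[OF this(3)]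
    show "(tg \<BB> i k \<cdot> mulA \<BB> i j k) \<cdot> e = (tg \<BB> j k \<cdot> pb1 ?K) \<cdot> e" by (simp add: cmp_assoc)
  qed
qed

end

lemma premul: "premul C \<BB>"
proof (unfold_locales, goal_cases)
  case (1 i j k)
  then show ?case using mul_props(1) by (simp add: Ix_eq)
next
  case (2 i j k K)
  then have i: "i \<in> Ob A" "j \<in> Ob A" "k \<in> Ob A" by (simp_all add: Ix_eq)
  show ?case
    using 2(1-3) mul_props(1)[OF i] pr_in[OF cmp_ok[OF 2(1-3)]] pb_ob[OF cmp_ok[OF 2(1-3)]] sr_tg_mulA(1)[OF i] unfolding 2(4)
    by (intro arr_inj[of "pb C (cmp_cospan \<BB> i j k)" "A0 \<BB> i"])
      (auto simp: arr_Cmp sr_def mulA_def pb2_def intro: Cmp_in)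
next
  case (3 i j k K)
  then have i: "i \<in> Ob A" "j \<in> Ob A" "k \<in> Ob A" by (simp_all add: Ix_eq)
  show ?case
    using 3(1-3) mul_props(1)[OF i] pr_in[OF cmp_ok[OF 3(1-3)]] pb_ob[OF cmp_ok[OF 3(1-3)]] sr_tg_mulA(2)[OF i] unfolding 3(4)
    by (intro arr_inj[of "pb C (cmp_cospan \<BB> i j k)" "A0 \<BB> k"])
      (auto simp: arr_Cmp tg_def mulA_def pb1_def intro: Cmp_in)
qed

end

sublocale psi_base \<subseteq> premul C \<BB>
  by (rule premul)

context psi_base
begin

no_notation A.cmp (infixr "\<cdot>" 70)

lemma un_section: "i \<in> Ob A \<Longrightarrow> x \<in> el (FOb P i) \<Longrightarrow> un \<BB> i \<cdot> x = sa i i (Idn A i) \<cdot> sr \<BB> i i \<cdot> un \<BB> i \<cdot> x"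
  using cmp_reassoc[OF sr_un, of i x] by (simp add: un_sa Ix_eq A0_eq)

lemma el_on_section: "\<lbrakk>i \<in> Ob A; j \<in> Ob A; f \<in> Hom A i j\<rbrakk> \<Longrightarrow>
   a \<cdot> rst (qa i j f \<cdot> a) = sa i j f \<cdot> sr \<BB> i j \<cdot> a \<cdot> rst (qa i j f \<cdot> a)"
  using el_local[of i j f a] by (simp add: pa_sr)

lemma internal: "internal C \<BB>"
proof (rule internalI)
  fix i j assume ix: "i \<in> Ix \<BB>" "j \<in> Ix \<BB>"
  then have i: "i \<in> Ob A" "j \<in> Ob A" by (simp_all add: Ix_eq)
  let ?w = "A1 \<BB> i j"
  have w: "ide ?w \<in> hom ?w ?w" using i by (simp add: ide_hom)
  have rw: "rst (ide ?w) = ide ?w" using i by simp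
  have sh: "sr \<BB> i j \<cdot> ide ?w = sr \<BB> i j" "tg \<BB> i j \<cdot> ide ?w = tg \<BB> i j"
    by (rule cmp_ide[OF sr_hom[OF ix]] cmp_ide[OF tg_hom[OF ix]])+
  have uh: "un \<BB> i \<cdot> sr \<BB> i j \<in> hom ?w (A1 \<BB> i i)" "un \<BB> j \<cdot> tg \<BB> i j \<in> hom ?w (A1 \<BB> j j)"
    by (rule cmp_hom[OF un_hom[OF ix(1)] sr_hom[OF ix]] cmp_hom[OF un_hom[OF ix(2)] tg_hom[OF ix]])+
  have m1: "sr \<BB> i j \<cdot> ide ?w = tg \<BB> i i \<cdot> un \<BB> i \<cdot> sr \<BB> i j"
    using cmp_reassoc[OF tg_un[OF ix(1)], of "sr \<BB> i j"] by (simp add: sh ide_cmp_hom[OF sr_hom[OF ix]])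
  have m2: "sr \<BB> j j \<cdot> un \<BB> j \<cdot> tg \<BB> i j = tg \<BB> i j \<cdot> ide ?w"
    using cmp_reassoc[OF sr_un[OF ix(2)], of "tg \<BB> i j"] by (simp add: sh ide_cmp_hom[OF tg_hom[OF ix]])
  let ?u = "mu \<BB> i i j (ide ?w) (un \<BB> i \<cdot> sr \<BB> i j)" and ?v = "mu \<BB> i j j (un \<BB> j \<cdot> tg \<BB> i j) (ide ?w)"
  have u: "?u \<in> hom ?w ?w" by (rule mu_hom[OF ix(1) ix w uh(1) m1])
  have v: "?v \<in> hom ?w ?w" by (rule mu_hom[OF ix ix(2) uh(2) w m2])
  have e: "f \<in> Hom A i j \<Longrightarrow> rst (qa i j f \<cdot> ide ?w) = rst (qa i j f)" "f \<in> Hom A i j \<Longrightarrow> rst (qa i j f) \<in> hom ?w ?w" for f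
    using cmp_ide[OF qa_hom[OF i]] rst_hom[OF qa_hom[OF i]] by simp_all
  have s: "rst (qa i j f) = sa i j f \<cdot> sr \<BB> i j \<cdot> rst (qa i j f)" if f: "f \<in> Hom A i j" for f
    using el_on_section[OF i f, of "ide ?w"] e[OF f] by (simp add: ide_cmp_hom)
  show "?u = ide ?w"
  proof (rule glue_eq[OF i w u w])
    show "?u \<cdot> rst (ide ?w) = ?u" "ide ?w \<cdot> rst (ide ?w) = ide ?w" unfolding rw by (rule cmp_ide[OF u] cmp_ide[OF w])+
    fix f assume f: "f \<in> Hom A i j"
    \<comment> \<open>On the piece of \<open>f\<close> the identity of \<open>?w\<close> is the
      section of \<open>f\<close> at its source, and the unit element is the section of the identity
      arrow, so the law becomes the unit law of \<open>A\<close>.\<close>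
    let ?e = "rst (qa i j f)"
    have x: "sr \<BB> i j \<cdot> ?e \<in> el (FOb P i)" using hom_cmp_el[OF sr_hom[OF ix], of ?e] by (simp add: A0_eq)
    have "?u \<cdot> ?e = mu \<BB> i i j (ide ?w \<cdot> ?e) ((un \<BB> i \<cdot> sr \<BB> i j) \<cdot> ?e)" by (rule mu_cmp[OF ix(1) ix hom_el[OF w] hom_el[OF uh(1)] m1])
    also have "\<dots> = mu \<BB> i i j ?e (un \<BB> i \<cdot> sr \<BB> i j \<cdot> ?e)" using e[OF f] by (simp add: ide_cmp_hom cmp_assoc)
    also have "\<dots> = sa i j (Cmp A i i j f (Idn A i)) \<cdot> sr \<BB> i i \<cdot> un \<BB> i \<cdot> sr \<BB> i j \<cdot> ?e"
      by (rule mu_on_section(1)[OF i(1) i A.Idn_in[OF i(1)] f _ _ _ un_section[OF i(1) x] s[OF f]])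
        (use e[OF f] cmp_reassoc[OF tg_un[OF ix(1)], of "sr \<BB> i j \<cdot> ?e"] x in \<open>auto simp: A0_eq intro: hom_el hom_cmp_el[OF un_hom[OF ix(1)]]\<close>)
    also have "\<dots> = ?e" using cmp_reassoc[OF sr_un[OF ix(1)], of "sr \<BB> i j \<cdot> ?e"] x i f s[OF f] by (simp add: A.Cmp_Idn A0_eq)
    finally show "?u \<cdot> rst (qa i j f \<cdot> ide ?w) = ide ?w \<cdot> rst (qa i j f \<cdot> ide ?w)"
      using e[OF f] by (simp add: ide_cmp_hom)
  qed
  show "?v = ide ?w"
  proof (rule glue_eq[OF i w v w])
    show "?v \<cdot> rst (ide ?w) = ?v" "ide ?w \<cdot> rst (ide ?w) = ide ?w" unfolding rw by (rule cmp_ide[OF v] cmp_ide[OF w])+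
    fix f assume f: "f \<in> Hom A i j"
    let ?e = "rst (qa i j f)"
    have x: "tg \<BB> i j \<cdot> ?e \<in> el (FOb P j)" using hom_cmp_el[OF tg_hom[OF ix], of ?e] by (simp add: A0_eq)
    have "?v \<cdot> ?e = mu \<BB> i j j ((un \<BB> j \<cdot> tg \<BB> i j) \<cdot> ?e) (ide ?w \<cdot> ?e)" by (rule mu_cmp[OF ix ix(2) hom_el[OF uh(2)] hom_el[OF w] m2])
    also have "\<dots> = mu \<BB> i j j (un \<BB> j \<cdot> tg \<BB> i j \<cdot> ?e) ?e" using e[OF f] by (simp add: ide_cmp_hom cmp_assoc)
    also have "\<dots> = sa i j (Cmp A i j j (Idn A j) f) \<cdot> sr \<BB> i j \<cdot> ?e"
      by (rule mu_on_section(1)[OF i i(2) f A.Idn_in[OF i(2)] _ _ _ s[OF f] un_section[OF i(2) x]])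
        (use e[OF f] cmp_reassoc[OF sr_un[OF ix(2)], of "tg \<BB> i j \<cdot> ?e"] x in \<open>auto simp: A0_eq intro: hom_el hom_cmp_el[OF un_hom[OF ix(2)]]\<close>)
    also have "\<dots> = ?e" using i f s[OF f] by (simp add: A.Idn_Cmp)
    finally show "?v \<cdot> rst (qa i j f \<cdot> ide ?w) = ide ?w \<cdot> rst (qa i j f \<cdot> ide ?w)"
      using e[OF f] by (simp add: ide_cmp_hom)
  qed
next
  fix i j k l w h g f
  assume ix: "i \<in> Ix \<BB>" "j \<in> Ix \<BB>" "k \<in> Ix \<BB>" "l \<in> Ix \<BB>" and h: "h \<in> hom w (A1 \<BB> k l)"
    and g: "g \<in> hom w (A1 \<BB> j k)" and f: "f \<in> hom w (A1 \<BB> i j)" and hg: "sr \<BB> k l \<cdot> h = tg \<BB> j k \<cdot> g" and gf: "sr \<BB> j k \<cdot> g = tg \<BB> i j \<cdot> f"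
  have i: "i \<in> Ob A" "j \<in> Ob A" "k \<in> Ob A" "l \<in> Ob A" using ix by (simp_all add: Ix_eq)
  note E = hom_el[OF h] hom_el[OF g] hom_el[OF f]
  note GF = mu_hom[OF ix(1-3) g f gf] and HG = mu_hom[OF ix(2-4) h g hg]
  have s1: "sr \<BB> k l \<cdot> h = tg \<BB> i k \<cdot> mu \<BB> i j k g f" using tg_mu[OF ix(1-3) E(2,3) gf] hg by simp
  have s2: "sr \<BB> j l \<cdot> mu \<BB> j k l h g = tg \<BB> i j \<cdot> f" using sr_mu[OF ix(2-4) E(1,2) hg] gf by simp
  let ?L = "mu \<BB> i k l h (mu \<BB> i j k g f)" and ?R = "mu \<BB> i j l (mu \<BB> j k l h g) f"
  have L: "?L \<in> hom w (A1 \<BB> i l)" by (rule mu_hom[OF ix(1,3,4) h GF s1])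
  have R: "?R \<in> hom w (A1 \<BB> i l)" by (rule mu_hom[OF ix(1,2,4) HG f s2])
  have Le: "?L \<cdot> e = mu \<BB> i k l (h \<cdot> e) (mu \<BB> i j k (g \<cdot> e) (f \<cdot> e))" for e
    using mu_cmp[OF ix(1,3,4) E(1) hom_el[OF GF] s1, of e] mu_cmp[OF ix(1-3) E(2,3) gf, of e] by simp
  have Re: "?R \<cdot> e = mu \<BB> i j l (mu \<BB> j k l (h \<cdot> e) (g \<cdot> e)) (f \<cdot> e)" for e
    using mu_cmp[OF ix(1,2,4) hom_el[OF HG] E(3) s2, of e] mu_cmp[OF ix(2-4) E(1,2) hg, of e] by simp
  have rh: "rst h = rst g" "rst g = rst f"
    using rst_tot[OF sr_tot[OF ix(3,4)] E(1)] rst_tot[OF tg_tot[OF ix(2,3)] E(2)] rst_tot[OF sr_tot[OF ix(2,3)] E(2)] rst_tot[OF tg_tot[OF ix(1,2)] E(3)]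
    by (simp_all add: hg gf)
  have self: "?L \<cdot> rst f = ?L" "?R \<cdot> rst f = ?R"
    unfolding Le Re using cmp_rst_self[OF E(1)] cmp_rst_self[OF E(2)] cmp_rst_self[OF E(3)] by (simp_all add: rh)
  \<comment> \<open>Three factors call for three nested covers: \<open>glue_eq\<close> for
    \<open>h\<close> and \<open>two_cover\<close> for \<open>g\<close> and \<open>f\<close>. On a
    common part each factor lies on one section and associativity is that of
    \<open>A\<close>.\<close>
  show "?L = ?R"
  proof (rule glue_eq[OF i(3,4) h L R])
    show "?L \<cdot> rst h = ?L" "?R \<cdot> rst h = ?R" using self by (simp_all only: rh)
    fix \<eta> assume \<eta>: "\<eta> \<in> Hom A k l"
    let ?r = "rst (qa k l \<eta> \<cdot> h)"
    have ri: "?r \<in> hom w w" by (rule rst_hom[OF cmp_hom[OF qa_hom[OF i(3,4) \<eta>] h]])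
    have rr: "?r \<cdot> rst f = ?r" by (simp only: rh[symmetric] rst_cmp_rst_right)
    show "?L \<cdot> ?r = ?R \<cdot> ?r"
    proof (rule two_cover[OF i(1-3) g f gf])
      show "?L \<cdot> ?r \<in> hom w (A1 \<BB> i l)" "?R \<cdot> ?r \<in> hom w (A1 \<BB> i l)" by (rule cmp_hom[OF L ri] cmp_hom[OF R ri])+
      show "(?L \<cdot> ?r) \<cdot> rst f = ?L \<cdot> ?r" "(?R \<cdot> ?r) \<cdot> rst f = ?R \<cdot> ?r" by (simp_all only: cmp_assoc rr)
      fix \<phi> \<gamma> d assume \<phi>: "\<phi> \<in> Hom A i j" and \<gamma>: "\<gamma> \<in> Hom A j k" and d: "d \<in> idem w"
        and fd: "f \<cdot> d = sa i j \<phi> \<cdot> sr \<BB> i j \<cdot> f \<cdot> d" and gd: "g \<cdot> d = sa j k \<gamma> \<cdot> sr \<BB> j k \<cdot> g \<cdot> d"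
      define e where "e = ?r \<cdot> d"
      have rd: "?r \<cdot> d = d \<cdot> ?r" using rst_comm[of "qa k l \<eta> \<cdot> h" d] idem_rst[OF d] by simp
      have fe: "f \<cdot> e = sa i j \<phi> \<cdot> sr \<BB> i j \<cdot> f \<cdot> e" unfolding e_def rd using cmp_reassoc[OF fd, of ?r] by (simp add: cmp_assoc)
      have ge: "g \<cdot> e = sa j k \<gamma> \<cdot> sr \<BB> j k \<cdot> g \<cdot> e" unfolding e_def rd using cmp_reassoc[OF gd, of ?r] by (simp add: cmp_assoc)
      have he: "h \<cdot> e = sa k l \<eta> \<cdot> sr \<BB> k l \<cdot> h \<cdot> e"
        unfolding e_def using cmp_reassoc[OF el_on_section[OF i(3,4) \<eta>, of h], of d] by (simp add: cmp_assoc)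
      note Ee = cmp_el[OF E(1), of e] cmp_el[OF E(2), of e] cmp_el[OF E(3), of e]
      have hge: "sr \<BB> k l \<cdot> h \<cdot> e = tg \<BB> j k \<cdot> g \<cdot> e" and gfe: "sr \<BB> j k \<cdot> g \<cdot> e = tg \<BB> i j \<cdot> f \<cdot> e"
        using cmp_reassoc[OF hg, of e] cmp_reassoc[OF gf, of e] by (simp_all add: cmp_assoc)
      let ?gf = "mu \<BB> i j k (g \<cdot> e) (f \<cdot> e)" and ?hg = "mu \<BB> j k l (h \<cdot> e) (g \<cdot> e)"
      note mgf = mu_on_section(1)[OF i(1-3) \<phi> \<gamma> Ee(3,2) gfe fe ge] and sgf = sr_mu[OF ix(1-3) Ee(2,3) gfe] tg_mu[OF ix(1-3) Ee(2,3) gfe]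
      note mhg = mu_on_section(1)[OF i(2-4) \<gamma> \<eta> Ee(2,1) hge ge he] and shg = sr_mu[OF ix(2-4) Ee(1,2) hge]
      have c: "Cmp A i j k \<gamma> \<phi> \<in> Hom A i k" "Cmp A j k l \<eta> \<gamma> \<in> Hom A j l" using i \<phi> \<gamma> \<eta> by (auto intro: A.Cmp_in)
      have "mu \<BB> i k l (h \<cdot> e) ?gf = sa i l (Cmp A i k l \<eta> (Cmp A i j k \<gamma> \<phi>)) \<cdot> sr \<BB> i k \<cdot> ?gf"
        by (rule mu_on_section(1)[OF i(1,3,4) c(1) \<eta> mu_el[OF ix(1-3)] Ee(1) _ _ he]) (simp_all add: sgf hge, simp add: mgf)
      moreover have "mu \<BB> i j l ?hg (f \<cdot> e) = sa i l (Cmp A i j l (Cmp A j k l \<eta> \<gamma>) \<phi>) \<cdot> sr \<BB> i j \<cdot> f \<cdot> e"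
        by (rule mu_on_section(1)[OF i(1,2,4) \<phi> c(2) Ee(3) mu_el[OF ix(2-4)] _ fe]) (simp_all add: shg gfe, simp add: mhg gfe)
      ultimately have "?L \<cdot> e = ?R \<cdot> e"
        unfolding Le Re using A.Cmp_assoc[OF i \<phi> \<gamma> \<eta>] by (simp add: sgf)
      then show "(?L \<cdot> ?r) \<cdot> d = (?R \<cdot> ?r) \<cdot> d" by (simp only: cmp_assoc e_def)
    qed
  qed
qed

lemma presentation: "presentation C A P \<BB> q s"
proof -
  interpret B: internal C \<BB> by (rule internal)
  show ?thesis
  proof (unfold_locales, goal_cases)
    case (5 i j k f g)
    then have i: "i \<in> Ob A" "j \<in> Ob A" "k \<in> Ob A" and f: "f \<in> Hom A i j" and g: "g \<in> Hom A j k" by auto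
    \<comment> \<open>\<open>?y\<close> is the section of \<open>f\<close> cut down to where the
      composite is defined. Both \<open>?y\<close> and \<open>?z\<close> lie on single sections, so
      \<open>mu_on_section\<close> evaluates the product that defines \<open>pcomp\<close>.\<close>
    let ?z = "sa j k g \<cdot> tg \<BB> i j \<cdot> sa i j f" let ?y = "sa i j f \<cdot> rst ?z"
    have z: "?z = sa j k g \<cdot> Pa i j f" by (simp add: tg_sa[OF i(1,2) f])
    have y: "?y \<in> el (A1 \<BB> i j)" and ze: "?z \<in> el (A1 \<BB> j k)"
      by (rule hom_cmp_el[OF sa_hom[OF i(1,2) f]] hom_cmp_el[OF sa_hom[OF i(2,3) g]])+
    have sy: "sr \<BB> i j \<cdot> ?y = rst (Pa i j f) \<cdot> rst ?z" using cmp_reassoc[OF pa_sa[OF i(1,2) f], of "rst ?z"] by (simp add: pa_sr)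
    have zy: "sr \<BB> j k \<cdot> ?z = tg \<BB> i j \<cdot> ?y" using sr_sa_cmp[OF i g, of "tg \<BB> i j \<cdot> sa i j f"] by (simp add: cmp_assoc)
    have y2: "?y = sa i j f \<cdot> sr \<BB> i j \<cdot> ?y"
      unfolding sy using cmp_reassoc[OF hom_rst[OF sa_hom[OF i(1,2) f]], of "rst ?z"] by (simp add: rst_sa[OF i(1,2) f])
    have z2: "?z = sa j k g \<cdot> sr \<BB> j k \<cdot> ?z"
      unfolding zy using cmp_rst_self[OF ze] by (simp add: cmp_assoc)
    have "B.pcomp i j k (sa j k g) (sa i j f) = sa i k (Cmp A i j k g f) \<cdot> rst (Pa i j f) \<cdot> rst ?z"
      unfolding B.pcomp_def using mu_on_section(1)[OF i f g y ze zy y2 z2] by (simp only: sy)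
    also have "rst ?z = rst (Pa j k g \<cdot> Pa i j f)"
      using sa_dom(3)[OF i f g, of "ide (FOb P i)"] Pa_hom[OF i(1,2) f] by (simp add: z cmp_ide)
    finally show ?case
      using sa_dom(4,5)[OF i f g] by (simp flip: cmp_assoc)
  qed (auto simp: Ix_eq A0_eq tg_sa un_sa)
qed

end

section \<open>Source-etale categories are presented by their partial sections\<close>

text \<open>
  If \<open>\<sigma>\<close> is a local homeomorphism then every partial section \<open>t\<close> of \<open>\<sigma>\<close> is a partial isomorphism, and the
  partial inverses of the partial sections join to \<open>\<sigma>\<close>.
\<close>

lemma (in restriction_category) partial_inverse_iff:
  assumes "x \<in> Ob C" "y \<in> Ob C"
  shows "partial_inverse C x y s t \<longleftrightarrow> s \<in> Hom C x y \<and> t \<in> Hom C y x \<and>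
    arr y x t \<cdot> arr x y s = rst (arr x y s) \<and> arr x y s \<cdot> arr y x t = rst (arr y x t)"
proof -
  have "Cmp C x y x t s = Rst C x y s \<longleftrightarrow> arr y x t \<cdot> arr x y s = rst (arr x y s)"
    if "s \<in> Hom C x y" "t \<in> Hom C y x" "x \<in> Ob C" "y \<in> Ob C" for x y s t
    using that by (simp add: arr_eq_iff[of x x] Cmp_in Rst_in arr_Cmp arr_Rst)
  then show ?thesis using assms by (auto simp: partial_inverse_def)
qed

context jinternal
begin

context
  fixes i j U
  assumes ij [simp]: "i \<in> Ix \<AA>" "j \<in> Ix \<AA>"
    and U: "lub (A1 \<AA> i j) (A0 \<AA> i) U (sr \<AA> i j)"
    and inv: "\<And>s. s \<in> U \<Longrightarrow> \<exists>s'\<in>hom (A0 \<AA> i) (A1 \<AA> i j). s' \<cdot> s = rst s \<and> s \<cdot> s' = rst s'"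
begin

lemma cover: "cov (A1 \<AA> i j) (ide (A1 \<AA> i j)) U rst"
  using cov_lub[of "A1 \<AA> i j" "A0 \<AA> i" "\<lambda>s. s" U "sr \<AA> i j"] U tot_rst[OF sr_tot[OF ij]] by simp

text \<open>The inverse is the source map restricted to the image of \<open>t\<close>, so the task
  is to find that image as an idempotent e of the object of arrows. It is the join of the parts
  \<open>?e s\<close>: the arrows in the domain of s which \<open>t \<cdot> ?p\<close> keeps in the
  domain of s.\<close>

lemma ex_inverse:
  assumes t: "t \<in> sec i j"
  shows "\<exists>q\<in>hom (A1 \<AA> i j) (A0 \<AA> i). q \<cdot> t = rst t \<and> t \<cdot> q = rst q \<and> sr \<AA> i j \<cdot> rst q = q"
proof -
  let ?a = "A1 \<AA> i j" and ?x = "A0 \<AA> i" and ?p = "sr \<AA> i j"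
  note th = sec_hom[OF t] and ph = sr_hom[OF ij] and pt = sr_sec[OF t]
  let ?e = "\<lambda>s. rst (s \<cdot> t \<cdot> ?p) \<cdot> rst s"
  have Uh: "s \<in> hom ?a ?x" if "s \<in> U" for s using U that by (auto simp: lub_def)
  have ei: "?e s \<in> idem ?a" if "s \<in> U" for s
    by (rule cmp_idem[OF rst_in_idem rst_in_idem]) (use Uh[OF that] th ph in \<open>auto intro: cmp_hom\<close>)
  obtain e where e: "cov ?a e U ?e" using cov_exists[of ?a U ?e] ei by auto
  note ehom = idem_hom[OF covD(1)[OF e]]
  \<comment> \<open>An arrow in \<open>?e s\<close> and its image under \<open>t \<cdot> ?p\<close>
    have the same source and both lie in the domain of \<open>s\<close>. There the source map agrees
    with \<open>s\<close>, which is injective, so the two coincide.\<close>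
  have tpe: "t \<cdot> ?p \<cdot> ?e s = ?e s" if s: "s \<in> U" for s
  proof -
    obtain s' where s': "s' \<cdot> s = rst s" using inv[OF s] by blast
    have ps: "?p \<cdot> rst s = s" by (rule lub_upper[OF U s])
    let ?z = "t \<cdot> ?p"
    have 1: "?z \<cdot> rst (s \<cdot> ?z) = rst s \<cdot> ?z" by (rule rst_swap[symmetric])
    have pz: "?p \<cdot> ?z = ?p \<cdot> rst ?z"
      using cmp_reassoc[OF pt, of ?p] rst_swap[of t ?p] by simp
    have zz: "rst ?z \<cdot> rst (s \<cdot> ?z) = rst (s \<cdot> ?z)" using rst_comm[of ?z "s \<cdot> ?z"] by simp
    have se: "rst s \<cdot> ?e s = ?e s" by (simp add: rst_left_comm[of s])
    have "?z \<cdot> ?e s = rst s \<cdot> ?z \<cdot> rst s" using cmp_reassoc[OF 1, of "rst s"] by (simp add: cmp_assoc)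
    also have "\<dots> = s' \<cdot> s \<cdot> ?z \<cdot> rst s" using cmp_reassoc[OF s'] by simp
    also have "s \<cdot> ?z \<cdot> rst s = ?p \<cdot> rst s \<cdot> ?z \<cdot> rst s" using cmp_reassoc[OF ps] by simp
    also have "\<dots> = ?p \<cdot> ?z \<cdot> ?e s" using cmp_reassoc[OF 1, of "rst s"] by (simp add: cmp_assoc)
    also have "\<dots> = ?p \<cdot> rst ?z \<cdot> ?e s" using cmp_reassoc[OF pz, of "?e s"] by (simp add: cmp_assoc)
    also have "\<dots> = ?p \<cdot> ?e s" by (simp only: cmp_reassoc[OF zz])
    also have "\<dots> = ?p \<cdot> rst s \<cdot> ?e s" by (simp only: se)
    also have "\<dots> = s \<cdot> ?e s" by (rule cmp_reassoc[OF ps])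
    also have "s' \<cdot> s \<cdot> ?e s = rst s \<cdot> ?e s" using cmp_reassoc[OF s'] by simp
    also have "\<dots> = ?e s" by (rule se)
    finally show ?thesis by (simp add: cmp_assoc)
  qed
  have te: "t \<cdot> ?p \<cdot> e = e"
  proof (rule cov_eq[OF e])
    show "t \<cdot> ?p \<cdot> e \<in> hom ?a ?a" "e \<in> hom ?a ?a" by (intro cmp_hom[OF th] cmp_hom[OF ph] ehom)+
    show "(t \<cdot> ?p \<cdot> e) \<cdot> e = t \<cdot> ?p \<cdot> e" "e \<cdot> e = e" using idem_idem[OF covD(1)[OF e]] by (simp_all add: cmp_assoc)
    fix s assume s: "s \<in> U"
    show "(t \<cdot> ?p \<cdot> e) \<cdot> ?e s = e \<cdot> ?e s" by (simp only: cmp_assoc covD(4)[OF e s] tpe[OF s])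
  qed
  have rpe: "rst (?p \<cdot> e) = e" using rst_tot[OF sr_tot[OF ij] hom_el[OF ehom]] idem_rst[OF covD(1)[OF e]] by simp
  \<comment> \<open>On the image of \<open>t\<close> the map \<open>t \<cdot> ?p\<close> is the
    identity, so the first factor of \<open>?e s\<close> imposes no further restriction there. Since
    \<open>U\<close> covers all arrows, the parts \<open>?e s\<close> then contain the whole image
    of \<open>t\<close>.\<close>
  have es: "rst (?e s \<cdot> t) = rst (rst s \<cdot> t)" if s: "s \<in> U" for s
  proof -
    have "(s \<cdot> t \<cdot> ?p) \<cdot> rst s \<cdot> t = s \<cdot> t \<cdot> ?p \<cdot> t \<cdot> rst (s \<cdot> t)" by (simp add: cmp_assoc rst_swap[of s t])
    also have "\<dots> = s \<cdot> t \<cdot> rst (s \<cdot> t)" using cmp_reassoc[OF pt, of "rst (s \<cdot> t)"] hom_rst[OF th]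
      by (simp add: cmp_reassoc)
    also have "\<dots> = s \<cdot> t" using hom_rst[OF cmp_hom[OF Uh[OF s] th]] by (simp add: cmp_assoc)
    finally have "rst (rst (s \<cdot> t \<cdot> ?p) \<cdot> rst s \<cdot> t) = rst (s \<cdot> t)" by (simp only: rst_rst_cmp)
    then show ?thesis by (simp add: cmp_assoc)
  qed
  have "lub ?x ?x ((\<lambda>s. rst (rst s \<cdot> t)) ` U) (rst t)"
    using covD(3)[OF cov_pull[OF cover th]] by (simp add: ide_cmp_hom[OF th])
  moreover have "lub ?x ?x ((\<lambda>s. rst (rst s \<cdot> t)) ` U) (rst (e \<cdot> t))"
    using covD(3)[OF cov_cong[OF cov_pull[OF e th] es]] by simp
  ultimately have ret: "rst (e \<cdot> t) = rst t" by (rule lub_unique[symmetric])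
  have "?p \<cdot> e \<cdot> t = ?p \<cdot> t \<cdot> rst (e \<cdot> t)" using rst_swap[of e t] by (simp add: idem_rst[OF covD(1)[OF e]])
  also have "\<dots> = rst t" using cmp_reassoc[OF pt, of "rst t"] by (simp add: ret)
  finally have "(?p \<cdot> e) \<cdot> t = rst t" by (simp add: cmp_assoc)
  then show ?thesis using te rpe cmp_hom[OF ph ehom] by (intro bexI[of _ "?p \<cdot> e"]) simp_all
qed

text \<open>The partial inverse s' of a member s of \<open>U\<close> is itself a partial section,
  and the domain of s lies in that of \<open>Q s'\<close>. So the domains of the \<open>Q t\<close>
  contain those of the cover \<open>U\<close>, and an upper bound of the \<open>Q t\<close> must be
  the source map.\<close>

lemma inverses_cover:
  assumes Q: "\<And>t. t \<in> sec i j \<Longrightarrow> Q t \<in> hom (A1 \<AA> i j) (A0 \<AA> i)" "\<And>t. t \<in> sec i j \<Longrightarrow> Q t \<cdot> t = rst t"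
    "\<And>t. t \<in> sec i j \<Longrightarrow> t \<cdot> Q t = rst (Q t)" "\<And>t. t \<in> sec i j \<Longrightarrow> sr \<AA> i j \<cdot> rst (Q t) = Q t"
  shows "lub (A1 \<AA> i j) (A0 \<AA> i) (Q ` sec i j) (sr \<AA> i j)"
  unfolding lub_def
proof (intro conjI ballI impI)
  let ?a = "A1 \<AA> i j" and ?x = "A0 \<AA> i" and ?p = "sr \<AA> i j"
  show "?p \<in> hom ?a ?x" by (rule sr_hom[OF ij])
  show "Q ` sec i j \<subseteq> hom ?a ?x" using Q(1) by auto
  show "?p \<cdot> rst s = s" if "s \<in> Q ` sec i j" for s using that Q(4) by auto
  fix h assume h: "h \<in> hom ?a ?x" and le: "\<forall>s\<in>Q ` sec i j. h \<cdot> rst s = s"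
  have "h = ?p"
  proof (rule cov_eq[OF cover h sr_hom[OF ij]])
    show "h \<cdot> ide ?a = h" "?p \<cdot> ide ?a = ?p" by (rule cmp_ide[OF h] cmp_ide[OF sr_hom[OF ij]])+
    fix s assume s: "s \<in> U"
    obtain s' where s': "s' \<in> hom ?x ?a" "s' \<cdot> s = rst s" "s \<cdot> s' = rst s'" using inv[OF s] by blast
    have ps: "?p \<cdot> rst s = s" by (rule lub_upper[OF U s])
    have "rst s \<cdot> s' = s'" using rst_swap[of s s'] hom_rst[OF s'(1)] by (simp add: s'(3))
    then have "?p \<cdot> s' = rst s'" using cmp_reassoc[OF ps, of s'] s'(3) by simp
    then have t: "s' \<in> sec i j" using s'(1) by (simp add: sec_def)
    have "rst (Q s') \<cdot> s' = s'"
      using cmp_reassoc[OF Q(3)[OF t], of s'] hom_rst[OF s'(1)] by (simp add: Q(2)[OF t])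
    then have r: "rst (Q s') \<cdot> rst s = rst s" using cmp_reassoc[of "rst (Q s')" s' s' s] by (simp add: s'(2))
    have "h \<cdot> rst (Q s') = Q s'" using le t by blast
    then have "h \<cdot> rst (Q s') = ?p \<cdot> rst (Q s')" using Q(4)[OF t] by simp
    then have "h \<cdot> rst (Q s') \<cdot> rst s = ?p \<cdot> rst (Q s') \<cdot> rst s" using cmp_reassoc[of h "rst (Q s')" _ "rst s"] by (simp add: cmp_assoc)
    then show "h \<cdot> rst s = ?p \<cdot> rst s" by (simp only: r)
  qed
  then show "h \<cdot> rst ?p = ?p" using hom_rst[OF sr_hom[OF ij]] by simp
qed

end

end

locale etale = jinternal C \<AA> for C :: "('o, 'm) rcat" and \<AA> :: "('i, 'o, 'm) pcat" +
  assumes etale: "source_etale C \<AA>"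
begin

definition sinv :: "'i \<Rightarrow> 'i \<Rightarrow> ('o, 'm) arrow \<Rightarrow> ('o, 'm) arrow" where
  "sinv i j t = (SOME q. q \<in> hom (A1 \<AA> i j) (A0 \<AA> i) \<and> q \<cdot> t = rst t \<and> t \<cdot> q = rst q \<and> sr \<AA> i j \<cdot> rst q = q)"

context
  fixes i j assumes ij [simp]: "i \<in> Ix \<AA>" "j \<in> Ix \<AA>"
begin

lemma src_covered: obtains U where "lub (A1 \<AA> i j) (A0 \<AA> i) U (sr \<AA> i j)"
  "\<And>s. s \<in> U \<Longrightarrow> \<exists>s'\<in>hom (A0 \<AA> i) (A1 \<AA> i j). s' \<cdot> s = rst s \<and> s \<cdot> s' = rst s'"
proof -
  let ?a = "A1 \<AA> i j" and ?x = "A0 \<AA> i"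
  have "local_homeo C ?a ?x (src \<AA> i j)" using etale ij unfolding source_etale_def by blast
  then obtain S where S: "\<forall>s\<in>S. partial_iso C ?a ?x s" "is_join C ?a ?x S (src \<AA> i j)"
    unfolding local_homeo_def by blast
  have p: "src \<AA> i j \<in> Hom C ?a ?x" using S(2) by (simp add: is_join_def)
  have sub: "S \<subseteq> Hom C ?a ?x" using S(1) by (auto simp: partial_iso_def partial_inverse_def)
  have 1: "lub ?a ?x (arr ?a ?x ` S) (sr \<AA> i j)" using S(2) p sub ij by (simp add: lub_iff sr_def)
  have "\<exists>s'\<in>hom ?x ?a. s' \<cdot> s = rst s \<and> s \<cdot> s' = rst s'" if s: "s \<in> arr ?a ?x ` S" for s
  proof -
    obtain r r' where r: "s = arr ?a ?x r" and inv: "partial_inverse C ?a ?x r r'"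
      using s S(1) by (auto simp: partial_iso_def)
    have "r' \<in> Hom C ?x ?a" "arr ?x ?a r' \<cdot> s = rst s" "s \<cdot> arr ?x ?a r' = rst (arr ?x ?a r')"
      using inv ij unfolding r by (simp_all add: partial_inverse_iff)
    then show ?thesis using ij by (intro bexI[of _ "arr ?x ?a r'"]) (simp_all add: homI)
  qed
  then show thesis using that 1 by blast
qed

lemma sinv:
  assumes t: "t \<in> sec i j"
  shows "sinv i j t \<in> hom (A1 \<AA> i j) (A0 \<AA> i)" "sinv i j t \<cdot> t = rst t" "t \<cdot> sinv i j t = rst (sinv i j t)"
    "sr \<AA> i j \<cdot> rst (sinv i j t) = sinv i j t"
proof -
  obtain U where "lub (A1 \<AA> i j) (A0 \<AA> i) U (sr \<AA> i j)"
    "\<And>s. s \<in> U \<Longrightarrow> \<exists>s'\<in>hom (A0 \<AA> i) (A1 \<AA> i j). s' \<cdot> s = rst s \<and> s \<cdot> s' = rst s'" using src_covered by blast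
  from ex_inverse[OF ij this t] have "\<exists>q. q \<in> hom (A1 \<AA> i j) (A0 \<AA> i) \<and> q \<cdot> t = rst t \<and> t \<cdot> q = rst q \<and> sr \<AA> i j \<cdot> rst q = q"
    by blast
  from someI_ex[OF this] show "sinv i j t \<in> hom (A1 \<AA> i j) (A0 \<AA> i)" "sinv i j t \<cdot> t = rst t"
    "t \<cdot> sinv i j t = rst (sinv i j t)" "sr \<AA> i j \<cdot> rst (sinv i j t) = sinv i j t" unfolding sinv_def by blast+
qed

lemma lub_sinv: "lub (A1 \<AA> i j) (A0 \<AA> i) (sinv i j ` sec i j) (sr \<AA> i j)"
proof -
  obtain U where "lub (A1 \<AA> i j) (A0 \<AA> i) U (sr \<AA> i j)"
    "\<And>s. s \<in> U \<Longrightarrow> \<exists>s'\<in>hom (A0 \<AA> i) (A1 \<AA> i j). s' \<cdot> s = rst s \<and> s \<cdot> s' = rst s'" using src_covered by blast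
  then show ?thesis by (rule inverses_cover[OF ij _ _ sinv])
qed

text \<open>\<open>sinv i j u \<cdot> t\<close> is the equality domain of the two sections: it is an
  idempotent, the sections agree on it, and it fixes every \<open>r\<close> on which they agree and
  \<open>u\<close> is defined.\<close>

lemma sinv_sec:
  assumes t: "t \<in> sec i j" and u: "u \<in> sec i j"
  shows "sinv i j u \<cdot> t \<in> idem (A0 \<AA> i)"
    and "t \<cdot> sinv i j u \<cdot> t = u \<cdot> sinv i j u \<cdot> t"
    and "u \<cdot> r = t \<cdot> r \<Longrightarrow> rst u \<cdot> r = r \<Longrightarrow> (sinv i j u \<cdot> t) \<cdot> r = r"
proof -
  let ?q = "sinv i j u"
  have "?q \<cdot> t = sr \<AA> i j \<cdot> rst ?q \<cdot> t" using cmp_reassoc[OF sinv(4)[OF u], of t] by simp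
  also have "\<dots> = rst t \<cdot> rst (?q \<cdot> t)" using cmp_reassoc[OF sr_sec[OF t]] by (simp add: rst_swap[of ?q t])
  also have "\<dots> = rst (?q \<cdot> t)" by (subst rst_comm) simp
  finally have q: "?q \<cdot> t = rst (?q \<cdot> t)" .
  then show "?q \<cdot> t \<in> idem (A0 \<AA> i)" using rst_in_idem[OF cmp_hom[OF sinv(1)[OF u] sec_hom[OF t]]] by simp
  have "t \<cdot> ?q \<cdot> t = t \<cdot> rst (?q \<cdot> t)" using q by simp
  also have "\<dots> = u \<cdot> ?q \<cdot> t" using rst_swap[of ?q t] cmp_reassoc[OF sinv(3)[OF u], of t] by simp
  finally show "t \<cdot> ?q \<cdot> t = u \<cdot> ?q \<cdot> t" .
  assume "u \<cdot> r = t \<cdot> r" "rst u \<cdot> r = r"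
  then show "(?q \<cdot> t) \<cdot> r = r" using cmp_reassoc[OF sinv(2)[OF u], of r] by (simp add: cmp_assoc)
qed

end

end

sublocale etale \<subseteq> over_loc C "Phi_cat C \<AA>" "Phi_proj C \<AA>"
  by (simp add: over_loc_def join_restriction_category_axioms restriction_category_Phi restriction_functor_Phi_proj)

context etale
begin

no_notation A.cmp (infixr "\<cdot>" 70)

text \<open>The point is that the category is its own glueing, i.e. that the equality locus of two
  partial sections t and u is the transition idempotent \<open>sinv u \<cdot> t\<close>. The
  presentation laws hold by the definition of \<open>Phi_cat\<close>, since every section is its own
  generator.\<close>

lemma presentation: "presentation C (Phi_cat C \<AA>) (Phi_proj C \<AA>) \<AA>
  (\<lambda>i j t. mor (sinv i j (arr (A0 \<AA> i) (A1 \<AA> i j) t))) (\<lambda>i j t. t)"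
proof -
  let ?A = "Phi_cat C \<AA>" let ?P = "Phi_proj C \<AA>" let ?q = "\<lambda>i j t. mor (sinv i j (arr (A0 \<AA> i) (A1 \<AA> i j) t))"
  note ps = Phi_proj_simps
  interpret glued C ?A ?P "A1 \<AA>" "src \<AA>" ?q "\<lambda>i j t. t"
  proof
    fix i j assume "i \<in> Ob ?A" "j \<in> Ob ?A"
    then have i [simp]: "i \<in> Ix \<AA>" "j \<in> Ix \<AA>" by simp_all
    let ?a = "A1 \<AA> i j" and ?x = "A0 \<AA> i" and ?H = "Hom ?A i j"
    have H: "t \<in> Hom C ?x ?a" "arr ?x ?a t \<in> sec i j" if "t \<in> ?H" for t using that by (simp_all add: Phi_Hom)
    have Q: "?q i j t \<in> Hom C ?a ?x" "arr ?a ?x (?q i j t) = sinv i j (arr ?x ?a t)" if "t \<in> ?H" for t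
      using sinv(1)[OF i H(2)[OF that]] by (simp_all add: mor_in arr_mor)
    have sub: "?q i j ` ?H \<subseteq> Hom C ?a ?x" using Q by auto
    have "arr ?x ?a ` ?H = sec i j"
      using H(2) sec_mor[OF i] arr_mor[OF sec_hom] by (auto simp: image_iff) metis
    then have "arr ?a ?x ` ?q i j ` ?H = sinv i j ` sec i j" using Q(2) by (force simp: image_iff)
    then have J: "is_join C ?a ?x (?q i j ` ?H) (src \<AA> i j)"
      using lub_sinv[OF i] src_total[OF i] sub by (simp add: lub_iff[symmetric] sr_def total_map_def)
    have inv: "partial_inverse C ?a ?x (?q i j t) t" if t: "t \<in> ?H" for t
      using H(1)[OF t] Q[OF t] sinv(2,3)[OF i H(2)[OF t]] by (simp add: partial_inverse_iff)
    have "eq_locus C (?A, ?P) i j t u = Cmp C ?x ?a ?x (?q i j u) t" if t: "t \<in> ?H" and u: "u \<in> ?H" for t u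
    proof (rule arr_inj[of ?x ?x])
      let ?t = "arr ?x ?a t" and ?u = "arr ?x ?a u" let ?c = "sinv i j ?u \<cdot> ?t"
      have oi: "i \<in> Ob ?A" "j \<in> Ob ?A" by simp_all
      note lp = loc_props[OF oi t u, unfolded ps(1)[OF i(1)]]
      note ts = H(2)[OF t] and us = H(2)[OF u]
      note cc = sinv_sec[OF i ts us]
      show "eq_locus C (?A, ?P) i j t u \<in> Hom C ?x ?x" by (rule lp(1))
      show "Cmp C ?x ?a ?x (?q i j u) t \<in> Hom C ?x ?x" using Q(1)[OF u] H(1)[OF t] by (auto intro: Cmp_in)
      \<comment> \<open>The hypothesis \<open>eu\<close> says that \<open>e\<close> is a restriction
        idempotent of \<open>Phi_cat\<close>; composing with it is restriction in
        \<open>C\<close>.\<close>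
      have pcm: "arr ?x (A1 \<AA> i k) (Cmp ?A i i k f e) = arr ?x (A1 \<AA> i k) f \<cdot> rst (arr ?x (A1 \<AA> i i) e)"
        if k: "k \<in> Ix \<AA>" and f: "f \<in> Hom ?A i k" and e: "e \<in> Hom ?A i i"
          and eu: "arr ?x (A1 \<AA> i i) e = un \<AA> i \<cdot> rst (arr ?x (A1 \<AA> i i) e)" for k f e
      proof -
        have s: "arr ?x (A1 \<AA> i i) e \<in> sec i i" "arr ?x (A1 \<AA> i k) f \<in> sec i k" using e f k by (simp_all add: Phi_Hom)
        have r: "rst (arr ?x (A1 \<AA> i i) e) \<in> idem ?x" by (rule rst_in_idem[OF sec_hom[OF s(1)]])
        show ?thesis using arr_Phi_Cmp(2)[OF i(1,1) k e f] pcomp_idem[OF i(1) k s(2) r] by (simp add: eu[symmetric])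
      qed
      \<comment> \<open>\<open>?c\<close> bounds the locus because the sections agree on every
        member of the cover. Conversely \<open>?c\<close> lifts to the idempotent
        \<open>un \<AA> i \<cdot> ?c\<close> of \<open>Phi_cat\<close>, which is itself a member of
        \<open>Eq i j t u\<close>, so the locus bounds \<open>?c\<close>.\<close>
      have "loc i j t u = ?c"
      proof (rule trans)
        have ci: "cov ?x (loc i j t u) (Eq i j t u) (Pa i i)" by (rule lp(2))
        have "?c \<cdot> loc i j t u = loc i j t u"
        proof (rule cov_least[OF ci cc(1)])
          fix e assume e: "e \<in> Eq i j t u"
          note d = EqD[OF oi t u e]
          let ?e = "arr ?x (A1 \<AA> i i) e"
          have eu: "?e = un \<AA> i \<cdot> rst ?e" using arr_Phi_Rst(2)[OF i(1) i(1) d(2)] d(3) by simp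
          have es: "?e \<in> sec i i" using d(2) by (simp add: Phi_Hom)
          have "Pa i i e = tg \<AA> i i \<cdot> ?e" using d(2) by (simp add: Pa_def ps)
          then have Pe: "Pa i i e = rst ?e"
            using cmp_reassoc[OF tg_un[OF i(1)], of "rst ?e"] eu rst_hom[OF sec_hom[OF es]] by (simp add: ide_cmp_hom)
          have tu: "?u \<cdot> rst ?e = ?t \<cdot> rst ?e" using pcm[OF i(2) t d(2) eu] pcm[OF i(2) u d(2) eu] d(4) by simp
          have "Pa i j u = tg \<AA> i j \<cdot> ?u" using u by (simp add: Pa_def ps)
          then have "rst (Pa i j u) = rst ?u" using rst_tot[OF tg_tot[OF i] hom_el[OF sec_hom[OF us]]] by simp
          then have "rst ?u \<cdot> rst ?e = rst ?e" using d(8) Pe by simp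
          then show "?c \<cdot> Pa i i e = Pa i i e" unfolding Pe by (rule cc(3)[OF tu])
        qed
        then show "loc i j t u = loc i j t u \<cdot> ?c" using idem_comm[OF cc(1) covD(1)[OF ci]] by simp
        let ?e = "mor (un \<AA> i \<cdot> ?c)"
        have es: "un \<AA> i \<cdot> ?c \<in> sec i i" by (rule sec_idem[OF un_sec[OF i(1)] cc(1)])
        have ee: "?e \<in> Hom ?A i i" "arr ?x (A1 \<AA> i i) ?e = un \<AA> i \<cdot> ?c" using sec_mor[OF i(1) i(1) es] arr_mor[OF sec_hom[OF es]] by simp_all
        have re: "rst (un \<AA> i \<cdot> ?c) = ?c"
          using rst_tot[OF un_tot[OF i(1)] hom_el[OF idem_hom[OF cc(1)]]] idem_rst[OF cc(1)] by simp
        have "Rst ?A i i ?e = ?e"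
          using arr_Phi_Rst[OF i(1) i(1) ee(1)] ee sec_hom[OF es] by (intro arr_inj[of ?x "A1 \<AA> i i"]) (auto simp: re Phi_Hom)
        then have ei: "?e \<in> rst_idems ?A i" using ee(1) by (simp add: rst_idems_def)
        have eu: "arr ?x (A1 \<AA> i i) ?e = un \<AA> i \<cdot> rst (arr ?x (A1 \<AA> i i) ?e)" by (simp add: ee(2) re)
        have "Cmp ?A i i j t ?e = Cmp ?A i i j u ?e"
          using pcm[OF i(2) t ee(1) eu] pcm[OF i(2) u ee(1) eu] arr_Phi_Cmp(1)[OF i(1) i ee(1)] t u cc(2)
          by (intro arr_inj[of ?x ?a]) (auto simp: ee(2) re)
        moreover have "Cmp ?A i i i (Rst ?A i j f) ?e = ?e" if f: "f \<in> ?H" and r: "rst (arr ?x ?a f) \<cdot> ?c = ?c" for f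
        proof -
          have R: "Rst ?A i j f \<in> Hom ?A i i" by (rule A.Rst_in[OF oi f])
          have "arr ?x (A1 \<AA> i i) (Cmp ?A i i i (Rst ?A i j f) ?e) = arr ?x (A1 \<AA> i i) ?e"
            using pcm[OF i(1) R ee(1) eu] arr_Phi_Rst(2)[OF i f] by (simp add: ee(2) re cmp_assoc r)
          then show ?thesis using arr_Phi_Cmp(1)[OF i(1,1,1) ee(1) R] ee(1) by (intro arr_inj[of ?x "A1 \<AA> i i"]) (auto simp: Phi_Hom)
        qed
        moreover have "rst ?t \<cdot> ?c = ?c" "rst ?u \<cdot> ?c = ?c"
        proof -
          have "rst ?t \<cdot> rst ?c = rst ?c" by (subst rst_comm) simp
          then show 1: "rst ?t \<cdot> ?c = ?c" by (simp only: idem_rst[OF cc(1)])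
          then have "rst (?t \<cdot> ?c) = ?c" using rst_cmp_idem[OF cc(1), of ?t] by simp
          then show "rst ?u \<cdot> ?c = ?c" using rst_cmp_idem[OF cc(1), of ?u] cc(2) by simp
        qed
        ultimately have "?e \<in> Eq i j t u" using t u by (intro EqI[OF oi t u ei]) auto
        then have "loc i j t u \<cdot> Pa i i ?e = Pa i i ?e" by (rule covD(4)[OF ci])
        moreover have "Pa i i ?e = ?c"
          using ee cmp_reassoc[OF tg_un[OF i(1)], of ?c] idem_hom[OF cc(1)] by (simp add: Pa_def ps ide_cmp_hom)
        ultimately show "loc i j t u \<cdot> ?c = ?c" by simp
      qed
      then show "arr ?x ?x (eq_locus C (?A, ?P) i j t u) = arr ?x ?x (Cmp C ?x ?a ?x (?q i j u) t)"
        using Q[OF u] H(1)[OF t] by (simp add: loc_def ps arr_Cmp)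
    qed simp_all
    then show "is_glueing C (FOb ?P i) ?H (eq_locus C (?A, ?P) i j) ?a (src \<AA> i j) (?q i j) (\<lambda>t. t)"
      using J inv etale by (simp add: is_glueing_def ps source_etale_def)
  qed
  have sa: "sa i j f = arr (A0 \<AA> i) (A1 \<AA> i j) f" if "i \<in> Ix \<AA>" for i j f using that by (simp add: sa_def ps)
  show ?thesis
  proof (unfold_locales, goal_cases)
    case (5 i j k f g)
    then show ?case by (simp add: sa arr_Phi_Cmp)
  qed (simp_all add: sa ps Pa_def un_def)
qed

text \<open>With the unit equal to an identity, the universal property of the presentation says that
  \<Phi> is bijective on the cofunctors out of this category.\<close>

lemma unit_map_etale: "presentation.unit_map C (Phi_cat C \<AA>) (Phi_proj C \<AA>) (\<lambda>i j t. t) = over_id C (Phi_cat C \<AA>, Phi_proj C \<AA>)"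
  using presentation.unit_map_def[OF presentation] by (simp add: over_id_def id_ftor_def)

end

section \<open>Join restriction categories hyperconnected over the base\<close>

locale jh_presentation = presentation C A P \<BB> q s + A: join_restriction_category A
  for C :: "('o, 'm) rcat" and A :: "('i, 'm) rcat" and P :: "('i, 'm, 'o, 'm) ftor"
    and \<BB> :: "('i, 'o, 'm) pcat" and q s +
  assumes hyper: "hyperconnected A C P"
begin

no_notation A.cmp (infixr "\<cdot>" 70)

lemma Pa_inj: "\<lbrakk>i \<in> Ob A; e \<in> rst_idems A i; e' \<in> rst_idems A i; Pa i i e = Pa i i e'\<rbrakk> \<Longrightarrow> e = e'"
proof -
  assume *: "i \<in> Ob A" "e \<in> rst_idems A i" "e' \<in> rst_idems A i" "Pa i i e = Pa i i e'"
  then have "e \<in> Hom A i i" "e' \<in> Hom A i i" by (auto simp: rst_idems_def)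
  then have "FHom P i i e = FHom P i i e'" using * by (intro arr_inj[of "FOb P i" "FOb P i"]) (auto simp: Pa_def P.FHom_in)
  then show "e = e'" using hyper * by (auto simp: hyperconnected_def bij_betw_def dest: inj_onD)
qed

lemma Pa_lift: "\<lbrakk>i \<in> Ob A; c \<in> idem (FOb P i)\<rbrakk> \<Longrightarrow> \<exists>e\<in>rst_idems A i. Pa i i e = c"
proof -
  assume i: "i \<in> Ob A" and c: "c \<in> idem (FOb P i)"
  then have "mor c \<in> rst_idems C (FOb P i)" by (simp add: rst_idems_iff mor_in arr_mor idem_hom)
  then obtain e where "e \<in> rst_idems A i" "FHom P i i e = mor c" using hyper i by (force simp: hyperconnected_def bij_betw_def)
  then show ?thesis using arr_mor[OF idem_hom[OF c]] by (intro bexI[of _ e]) (simp_all add: Pa_def)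
qed

context
  fixes i j assumes ij [simp]: "i \<in> Ob A" "j \<in> Ob A"
begin

text \<open>Here \<open>A\<close> has joins, so \<open>f\<close> and \<open>g\<close> agree on the
  join d of \<open>Eq i j f g\<close> formed in \<open>A\<close>. The image of d bounds the image of
  every member, hence the locus; preservation of the join by \<open>P\<close> does not
  enter.\<close>

lemma agree_on_locus:
  assumes f: "f \<in> Hom A i j" and g: "g \<in> Hom A i j"
  shows "\<exists>d\<in>rst_idems A i. Cmp A i i j f d = Cmp A i i j g d \<and> Pa i i d \<cdot> loc i j f g = loc i j f g"
proof -
  let ?a = "A.arr i i"
  note D = EqD[OF ij f g]
  have ei: "?a e \<in> A.idem i" if "e \<in> Eq i j f g" for e using D(1)[OF that] by (simp add: A.rst_idems_iff)
  have "\<exists>d. A.cov i d (Eq i j f g) ?a" by (rule A.cov_exists[OF ij(1) ei])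
  then obtain d where d: "A.cov i d (Eq i j f g) ?a" ..
  note dh = A.idem_hom[OF A.covD(1)[OF d]]
  let ?d = "mor d"
  have da: "?a ?d = d" by (rule A.arr_mor[OF dh])
  have d1: "?d \<in> Hom A i i" by (rule A.mor_in[OF dh])
  have di: "?d \<in> rst_idems A i" using A.covD(1)[OF d] d1 by (simp add: A.rst_idems_iff da)
  have "A.arr i j (Cmp A i i j f ?d) = A.arr i j (Cmp A i i j g ?d)"
  proof (rule A.cov_eq[OF d])
    show "A.arr i j (Cmp A i i j f ?d) \<in> A.hom i j" "A.arr i j (Cmp A i i j g ?d) \<in> A.hom i j"
      using f g d1 by (auto intro!: A.homI A.Cmp_in)
    show "A.cmp (A.arr i j (Cmp A i i j f ?d)) d = A.arr i j (Cmp A i i j f ?d)"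
      "A.cmp (A.arr i j (Cmp A i i j g ?d)) d = A.arr i j (Cmp A i i j g ?d)"
      using f g d1 by (simp_all add: A.arr_Cmp da A.cmp_assoc A.idem_idem[OF A.covD(1)[OF d]])
    fix e assume e: "e \<in> Eq i j f g"
    have "A.arr i j (Cmp A i i j f e) = A.arr i j (Cmp A i i j g e)" using D(4)[OF e] by simp
    then show "A.cmp (A.arr i j (Cmp A i i j f ?d)) (?a e) = A.cmp (A.arr i j (Cmp A i i j g ?d)) (?a e)"
      using f g d1 D(2)[OF e] by (simp add: A.arr_Cmp da A.cmp_assoc A.covD(4)[OF d e])
  qed
  then have "Cmp A i i j f ?d = Cmp A i i j g ?d" using f g d1 by (intro A.arr_inj[of i j]) (auto intro: A.Cmp_in)
  moreover have "Pa i i ?d \<cdot> loc i j f g = loc i j f g"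
  proof (rule cov_least[OF loc_props(2)[OF ij f g] Pa_idem[OF ij(1) di]])
    fix e assume e: "e \<in> Eq i j f g"
    have "?a (Cmp A i i i ?d e) = ?a e" using d1 D(2)[OF e] by (simp add: A.arr_Cmp da A.covD(4)[OF d e])
    then have "Cmp A i i i ?d e = e" using d1 D(2)[OF e] by (intro A.arr_inj[of i i]) (auto intro: A.Cmp_in)
    then show "Pa i i ?d \<cdot> Pa i i e = Pa i i e" using Pa_Cmp[of i i i e ?d] d1 D(2)[OF e] by simp
  qed
  ultimately show ?thesis using di by blast
qed

text \<open>Equality of the sections makes the locus the whole domain of \<open>f\<close> and of
  \<open>g\<close>. Injectivity of \<open>P\<close> on idempotents lifts this to \<open>A\<close>:
  the restrictions of \<open>f\<close> and \<open>g\<close> are equal and lie below the idempotent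
  of \<open>agree_on_locus\<close>, so the arrows agree on their whole domain.\<close>

lemma sa_inj:
  assumes f: "f \<in> Hom A i j" and g: "g \<in> Hom A i j" and eq: "sa i j f = sa i j g"
  shows "f = g"
proof -
  have l: "loc i j f g = rst (Pa i j f)" "loc i j f g = rst (Pa i j g)"
    using qa_sa[OF ij f g] qa_sa[OF ij g g] loc_self[OF ij g] rst_sa[OF ij f] rst_sa[OF ij g] by (simp_all add: eq)
  have R: "Rst A i j f \<in> rst_idems A i" "Rst A i j g \<in> rst_idems A i" "Rst A i j f \<in> Hom A i i"
    using f g by (auto intro: Rst_idem A.Rst_in)
  have fg: "Rst A i j f = Rst A i j g" by (rule Pa_inj[OF ij(1) R(1,2)]) (use f g l in \<open>simp add: Pa_Rst\<close>)
  obtain d where d: "d \<in> rst_idems A i" "Cmp A i i j f d = Cmp A i i j g d" "Pa i i d \<cdot> loc i j f g = loc i j f g"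
    using agree_on_locus[OF f g] by blast
  have dh: "d \<in> Hom A i i" using d(1) by (simp add: rst_idems_def)
  have dr: "Cmp A i i i d (Rst A i j f) = Rst A i j f"
  proof (rule Pa_inj[OF ij(1) _ R(1)])
    show "Cmp A i i i d (Rst A i j f) \<in> rst_idems A i" by (rule rst_idems_cmp(1)[OF ij d(1) R(1)])
    show "Pa i i (Cmp A i i i d (Rst A i j f)) = Pa i i (Rst A i j f)" using d(3) l f dh R by (simp add: Pa_Cmp Pa_Rst)
  qed
  have "f = Cmp A i i j f (Cmp A i i i d (Rst A i j f))" using f by (simp add: dr A.Cmp_Rst)
  also have "\<dots> = Cmp A i i j (Cmp A i i j g d) (Rst A i j f)" using f dh R by (simp add: A.Cmp_assoc d(2))
  also have "\<dots> = Cmp A i i j g (Cmp A i i i d (Rst A i j f))" using g dh R by (simp add: A.Cmp_assoc)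
  also have "\<dots> = g" unfolding dr using g fg by (simp add: A.Cmp_Rst)
  finally show ?thesis .
qed

text \<open>\<open>?c f\<close> is the part on which \<open>t\<close> agrees with the section of f.
  Hyperconnectedness lifts it to an idempotent of \<open>A\<close>; the restrictions
  \<open>h f\<close> of f to the lifted parts have sections \<open>t \<cdot> ?c f\<close>, and their
  join in \<open>A\<close> is the arrow sought.\<close>

lemma sa_surj:
  assumes t: "t \<in> sec i j"
  shows "\<exists>f\<in>Hom A i j. sa i j f = t"
proof -
  let ?c = "\<lambda>f. rst (qa i j f \<cdot> t)" let ?x = "FOb P i" let ?H = "Hom A i j"
  have th: "t \<in> hom ?x (A1 \<BB> i j)" using sec_hom[OF t] by (simp add: A0_eq)
  have ci: "?c f \<in> idem ?x" if "f \<in> ?H" for f by (rule rst_in_idem[OF cmp_hom[OF qa_hom[OF ij that] th]])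
  have sac: "sa i j f \<cdot> ?c f = t \<cdot> ?c f" if f: "f \<in> ?H" for f
    using el_local[OF ij f, of t] cmp_reassoc[OF sr_sec[OF t], of "?c f"] rst_comm[of t "qa i j f \<cdot> t"] by (simp add: pa_sr)
  have "\<forall>f\<in>?H. \<exists>e\<in>rst_idems A i. Pa i i e = ?c f" using Pa_lift[OF ij(1) ci] by blast
  then obtain e where e: "\<And>f. f \<in> ?H \<Longrightarrow> e f \<in> rst_idems A i" "\<And>f. f \<in> ?H \<Longrightarrow> Pa i i (e f) = ?c f" by metis
  define h where "h f = Cmp A i i j f (e f)" for f
  have eh: "e f \<in> Hom A i i" if "f \<in> ?H" for f using e(1)[OF that] by (simp add: rst_idems_def)
  have hH: "h f \<in> ?H" if "f \<in> ?H" for f unfolding h_def using that eh[OF that] by (auto intro: A.Cmp_in)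
  have sah: "sa i j (h f) = t \<cdot> ?c f" if f: "f \<in> ?H" for f
    using sa_cmp_idem[OF ij f e(1)[OF f]] by (simp add: h_def e(2)[OF f] sac[OF f])
  have Ph: "rst (Pa i j (h f)) = ?c f" if f: "f \<in> ?H" for f
    using rst_sa[OF ij hH[OF f]] rst_comm[of t "qa i j f \<cdot> t"] by (simp add: sah[OF f])
  have Rh: "Rst A i j f \<in> rst_idems A i" "Rst A i j f \<in> Hom A i i" if "f \<in> ?H" for f
    using that by (auto intro: Rst_idem A.Rst_in)
  have sar: "sa i j (Cmp A i i j f (Rst A i j g)) = sa i j f \<cdot> rst (Pa i j g)" if "f \<in> ?H" "g \<in> ?H" for f g
    using sa_cmp_idem[OF ij that(1) Rh(1)[OF that(2)]] that by (simp add: Pa_Rst)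
  \<comment> \<open>Compatibility is reflected by \<open>sa_inj\<close>, since the sections of both
    sides are restrictions of \<open>t\<close>.\<close>
  have comp: "compatible A i j u v" if uv: "u \<in> h ` ?H" "v \<in> h ` ?H" for u v
  proof -
    obtain f g where f: "f \<in> ?H" "u = h f" and g: "g \<in> ?H" "v = h g" using uv by blast
    show ?thesis unfolding compatible_def f(2) g(2)
    proof (rule sa_inj)
      show "Cmp A i i j (h f) (Rst A i j (h g)) \<in> ?H" "Cmp A i i j (h g) (Rst A i j (h f)) \<in> ?H"
        using hH[OF f(1)] hH[OF g(1)] Rh(2) by (auto intro: A.Cmp_in)
      show "sa i j (Cmp A i i j (h f) (Rst A i j (h g))) = sa i j (Cmp A i i j (h g) (Rst A i j (h f)))"
        unfolding sar[OF hH[OF f(1)] hH[OF g(1)]] sar[OF hH[OF g(1)] hH[OF f(1)]]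
        by (simp add: sah[OF f(1)] sah[OF g(1)] Ph[OF f(1)] Ph[OF g(1)] cmp_assoc rst_comm[of "qa i j f \<cdot> t"])
    qed
  qed
  obtain k where k: "is_join A i j (h ` ?H) k"
    using A.join_exists[OF ij _ comp] hH by blast
  have kH: "k \<in> ?H" using k by (simp add: is_join_def)
  have kc: "sa i j k \<cdot> ?c f = t \<cdot> ?c f" if f: "f \<in> ?H" for f
  proof -
    have "h f = Cmp A i i j k (Rst A i j (h f))" using k f by (auto simp: is_join_def map_le_def)
    then have "sa i j (h f) = sa i j (Cmp A i i j k (Rst A i j (h f)))" by simp
    then show ?thesis using sar[OF kH hH[OF f]] by (simp add: sah[OF f] Ph[OF f])
  qed
  \<comment> \<open>\<open>k\<close> agrees with \<open>t\<close> on every \<open>?c f\<close>; it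
    remains to see that its domain does not exceed that of \<open>t\<close>. Cutting
    \<open>k\<close> down to the lift \<open>d\<close> of \<open>rst t\<close> still gives an upper
    bound of the family, so minimality of \<open>k\<close> forces \<open>k\<close> to lie below
    it.\<close>
  obtain d where d: "d \<in> rst_idems A i" "Pa i i d = rst t" using Pa_lift[OF ij(1) rst_in_idem[OF th]] by blast
  have dh: "d \<in> Hom A i i" using d(1) by (simp add: rst_idems_def)
  let ?k = "Cmp A i i j k d"
  have kd: "?k \<in> ?H" using kH dh by (auto intro: A.Cmp_in)
  have sk: "sa i j ?k = sa i j k \<cdot> rst t" using sa_cmp_idem[OF ij kH d(1)] by (simp add: d(2))
  have "map_le A i j u ?k" if u: "u \<in> h ` ?H" for u
  proof -
    obtain f where f: "f \<in> ?H" "u = h f" using u by blast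
    show ?thesis unfolding map_le_def f(2)
    proof (rule sa_inj[OF hH[OF f(1)]])
      show "Cmp A i i j ?k (Rst A i j (h f)) \<in> ?H" using kd Rh(2)[OF hH[OF f(1)]] by (auto intro: A.Cmp_in)
      have "rst t \<cdot> ?c f = ?c f" by (subst rst_comm) simp
      then show "sa i j (h f) = sa i j (Cmp A i i j ?k (Rst A i j (h f)))"
        using sar[OF kd hH[OF f(1)]] kc[OF f(1)] by (simp add: sah[OF f(1)] Ph[OF f(1)] sk cmp_assoc)
    qed
  qed
  then have "map_le A i j k ?k" using k kd by (simp add: is_join_def)
  then have "sa i j k = sa i j (Cmp A i i j ?k (Rst A i j k))" by (simp add: map_le_def)
  then have s1: "sa i j k = sa i j k \<cdot> rst t \<cdot> rst (Pa i j k)" using sar[OF kd kH] by (simp add: sk cmp_assoc)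
  have "sa i j k \<cdot> rst t = sa i j k \<cdot> rst t \<cdot> rst (Pa i j k)"
    using hom_rst[OF sa_hom[OF ij kH]] rst_sa[OF ij kH] rst_comm[of t "Pa i j k"] cmp_reassoc[of "sa i j k" "rst (Pa i j k)" _ "rst t"]
    by simp
  then have s2: "sa i j k \<cdot> rst t = sa i j k" using s1 by simp
  have "sa i j k = t"
  proof (rule cov_eq[OF cov_el[OF ij th] sa_hom[OF ij kH] th s2])
    show "t \<cdot> rst t = t" by (rule hom_rst[OF th])
  qed (fact kc)
  then show ?thesis using kH by blast
qed

lemma s_bij: "bij_betw (s i j) (Hom A i j) (Hom (Phi_cat C \<BB>) i j)"
  unfolding bij_betw_def
proof
  note [simp] = Ix_eq
  have sin: "s i j f \<in> Hom (Phi_cat C \<BB>) i j" "arr (A0 \<BB> i) (A1 \<BB> i j) (s i j f) = sa i j f"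
    if "f \<in> Hom A i j" for f
    using sa_sec[OF ij that] raw_in(2)[OF ij that] by (auto simp: Phi_Hom sa_def A0_eq)
  show "inj_on (s i j) (Hom A i j)" using sa_inj by (auto intro!: inj_onI simp: sa_def)
  have "t \<in> s i j ` Hom A i j" if t: "t \<in> Hom (Phi_cat C \<BB>) i j" for t
  proof -
    have tt: "t \<in> Hom C (A0 \<BB> i) (A1 \<BB> i j)" "arr (A0 \<BB> i) (A1 \<BB> i j) t \<in> sec i j" using t by (simp_all add: Phi_Hom)
    obtain f where f: "f \<in> Hom A i j" "sa i j f = arr (A0 \<BB> i) (A1 \<BB> i j) t" using sa_surj[OF tt(2)] by blast
    then have "s i j f = t" using tt(1) sin(1)[OF f(1)] by (intro arr_inj[of "A0 \<BB> i" "A1 \<BB> i j"]) (auto simp: Phi_Hom sin(2))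
    then show ?thesis using f(1) by blast
  qed
  then show "s i j ` Hom A i j = Hom (Phi_cat C \<BB>) i j" using sin(1) by blast
qed

end

text \<open>The unit is the identity on objects and has identity components, so bijectivity on
  hom-sets provides an inverse. Its functor laws are inherited from those of \<open>?S\<close>
  through \<open>rs\<close> and \<open>sr\<close>.\<close>

lemma unit_map_iso:
  assumes "over_object \<kappa> C (A, P)" "over_object \<kappa> C (Phi_cat C \<BB>, Phi_proj C \<BB>)"
  shows "is_iso (rCat_over \<kappa> C) (A, P) (Phi_cat C \<BB>, Phi_proj C \<BB>) unit_map"
proof -
  let ?B = "Phi_cat C \<BB>" let ?Q = "Phi_proj C \<BB>"
  interpret B: restriction_category ?B by (rule restriction_category_Phi)
  note [simp] = Ix_eq
  define r where "r i j = inv_into (Hom A i j) (s i j)" for i j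
  let ?R = "mk_ftor ?B (\<lambda>i. i) r" let ?\<beta> = "\<lambda>i\<in>Ix \<BB>. Idn C (A0 \<BB> i)" let ?S = "mk_ftor A (\<lambda>i. i) s"
  have S: "restriction_functor A ?B ?S" using unit_over_map by (simp add: unit_map_def over_map_iff)
  interpret S: restriction_functor A ?B ?S by (rule S)
  have rs: "r i j (s i j f) = f" if "i \<in> Ob A" "j \<in> Ob A" "f \<in> Hom A i j" for i j f
    using bij_betw_imp_inj_on[OF s_bij[OF that(1,2)]] that(3) by (simp add: r_def)
  have sr: "s i j (r i j t) = t" "r i j t \<in> Hom A i j" if "i \<in> Ob A" "j \<in> Ob A" "t \<in> Hom ?B i j" for i j t
    using bij_betw_imp_surj_on[OF s_bij[OF that(1,2)]] that(3) by (auto simp: r_def f_inv_into_f inv_into_into)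
  have R: "restriction_functor ?B A ?R"
  proof (unfold_locales, goal_cases)
    case (3 x)
    then show ?case using S.FHom_Idn[of x] rs[of x x "Idn A x"] B.Idn_in[of x] by (simp add: A.Idn_in)
  next
    case (4 x y z f g)
    then show ?case using S.FHom_Cmp[of x y z "r x y f" "r y z g"] rs[of x z "Cmp A x y z (r y z g) (r x y f)"] B.Cmp_in[of x y z f g]
      by (simp add: A.Cmp_in sr)
  next
    case (5 x y f)
    then show ?case using S.FHom_Rst[of x y "r x y f"] rs[of x x "Rst A x y (r x y f)"] B.Rst_in[of x y f]
      by (simp add: A.Rst_in sr)
  qed (auto simp: sr)
  have inv: "over_map C (?B, ?Q) (A, P) (?R, ?\<beta>)"
  proof (rule over_mapI[OF R _ _ restriction_functor_Phi_proj P.restriction_functor_axioms])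
    fix x assume x: "x \<in> Ob ?B"
    then show "total_map C (FOb P (FOb ?R x)) (FOb ?Q x) (?\<beta> x)"
      using ide_tot[OF P_ob[of x]] by (simp add: Phi_proj_simps A0_eq total_map_iff Idn_in ide_def)
  next
    fix x y f assume f: "x \<in> Ob ?B" "y \<in> Ob ?B" "f \<in> Hom ?B x y"
    then have x: "x \<in> Ob A" "y \<in> Ob A" by simp_all
    note g = sr[OF x f(3)]
    have P: "Pa x y (r x y f) \<in> hom (FOb P x) (FOb P y)" by (rule Pa_hom[OF x g(2)])
    have "arr (FOb P x) (FOb P y) (FHom ?Q x y f) = Pa x y (r x y f)"
      using Phi_proj_simps(3)[of x y f] tg_sa[OF x g(2)] x f(3) by (simp add: sa_def g(1) A0_eq)
    then show "arr (FOb P (FOb ?R y)) (FOb ?Q y) (?\<beta> y) \<cdot>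
        arr (FOb P (FOb ?R x)) (FOb P (FOb ?R y)) (FHom P (FOb ?R x) (FOb ?R y) (FHom ?R x y f)) =
        arr (FOb ?Q x) (FOb ?Q y) (FHom ?Q x y f) \<cdot> arr (FOb P (FOb ?R x)) (FOb ?Q x) (?\<beta> x)"
      using f x cmp_ide[OF P] ide_cmp_hom[OF P] by (simp add: Phi_proj_simps(1) A0_eq flip: ide_def Pa_def)
  qed auto
  have "over_comp C (A, P) (?B, ?Q) (A, P) (?R, ?\<beta>) unit_map = over_id C (A, P)"
    unfolding unit_map_def over_comp_pair over_id_def split_conv
  proof (intro conjI prod_eqI; simp only: fst_conv snd_conv)
    show "comp_ftor A ?R ?S = id_ftor A" by (rule ext_ftor_eqI[of A]) (use S.FHom_in in \<open>auto simp: rs\<close>)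
  qed (auto intro!: restrict_ext simp: A0_eq Phi_proj_simps Cmp_Idn Idn_in)
  moreover have "over_comp C (?B, ?Q) (A, P) (?B, ?Q) unit_map (?R, ?\<beta>) = over_id C (?B, ?Q)"
    unfolding unit_map_def over_comp_pair over_id_def split_conv
  proof (intro conjI prod_eqI; simp only: fst_conv snd_conv)
    show "comp_ftor ?B ?S ?R = id_ftor ?B" by (rule ext_ftor_eqI[of ?B]) (auto simp: sr)
  qed (auto intro!: restrict_ext simp: A0_eq Phi_proj_simps Cmp_Idn Idn_in)
  ultimately show ?thesis
    unfolding is_iso_def using unit_over_map inv by (auto intro!: exI[of _ ?R] exI[of _ ?\<beta>])
qed

end

section \<open>The adjunction\<close>

locale glueable = join_restriction_category C for C :: "('o, 'm) rcat" +
  fixes \<kappa> :: "'k rel"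
  assumes ls: "locally_small \<kappa> C" and lg: "has_local_glueings \<kappa> C"
begin

abbreviation "rC \<equiv> rCat_over \<kappa> C"
abbreviation "pC \<equiv> pCat \<kappa> C"

text \<open>The third component of the chosen glueing, the partial isomorphisms inverse to the
  sections. The record built by \<open>Psi_ob\<close> does not keep it, but \<open>glued\<close> and
  \<open>presentation\<close> are stated with it.\<close>

definition Psi_q :: "('i, 'o, 'm) over \<Rightarrow> 'i \<Rightarrow> 'i \<Rightarrow> 'm \<Rightarrow> 'm" where
  "Psi_q X i j = fst (snd (snd (Psi_glueing C X i j)))"

lemma Psi_ob_simps: "Ix (Psi_ob C (A, P)) = Ob A" "A0 (Psi_ob C (A, P)) = FOb P" "A1 (Psi_ob C X) = Psi_A1 C X"
  "src (Psi_ob C X) = Psi_src C X" "tgt (Psi_ob C X) = Psi_tgt C X" "idm (Psi_ob C (A, P)) i = Psi_sec C (A, P) i i (Idn A i)"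
  "mul (Psi_ob C X) = Psi_mul C X"
  by (cases X; simp add: Psi_ob_def Psi_pre_def)+

lemma Psi_pre_ob: "cmp_cospan (Psi_pre C X) = cmp_cospan (Psi_ob C X)" "tgt_pull C (Psi_pre C X) = tgt_pull C (Psi_ob C X)"
  by (simp_all add: Psi_ob_def cmp_cospan_def tgt_pull_def fun_eq_iff)

context
  fixes A :: "('i, 'm) rcat" and P :: "('i, 'm, 'o, 'm) ftor"
  assumes X: "over_object \<kappa> C (A, P)"
begin

lemma over_loc: "over_loc C A P"
  using X by (simp add: over_loc_def over_object_def join_restriction_category_axioms)

lemma small_Hom: "\<lbrakk>i \<in> Ob A; j \<in> Ob A\<rbrakk> \<Longrightarrow> |Hom A i j| <o \<kappa>"
  using X by (simp add: over_object_def small_cat_def locally_small_def)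

lemma Psi_glued: "glued C A P (Psi_A1 C (A, P)) (Psi_src C (A, P)) (Psi_q (A, P)) (Psi_sec C (A, P))"
proof -
  interpret over_loc C A P by (rule over_loc)
  show ?thesis
  proof
    fix i j assume ij: "i \<in> Ob A" "j \<in> Ob A"
    let ?g = "\<lambda>(a, p, q, s). is_glueing C (FOb P i) (Hom A i j) (eq_locus C (A, P) i j) a p q s"
    have "\<exists>y. ?g y"
      using lg small_Hom[OF ij] local_atlas_eq_locus[OF ij] P_ob[OF ij(1)] unfolding has_local_glueings_def by auto
    then have "?g (Psi_glueing C (A, P) i j)" unfolding Psi_glueing_def prod.case by (rule someI_ex)
    then show "is_glueing C (FOb P i) (Hom A i j) (eq_locus C (A, P) i j) (Psi_A1 C (A, P) i j) (Psi_src C (A, P) i j)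
        (Psi_q (A, P) i j) (Psi_sec C (A, P) i j)"
      by (simp add: Psi_A1_def Psi_src_def Psi_q_def Psi_sec_def split_beta)
  qed
qed

lemma Psi_presentation: "presentation C A P (Psi_ob C (A, P)) (Psi_q (A, P)) (Psi_sec C (A, P))"
proof (rule psi_base.presentation)
  let ?a = "Psi_A1 C (A, P)" and ?s = "Psi_sec C (A, P)"
  interpret glued C A P ?a "Psi_src C (A, P)" "Psi_q (A, P)" ?s by (rule Psi_glued)
  show "psi_base C A P (Psi_ob C (A, P)) (Psi_q (A, P)) ?s"
    unfolding psi_base_def psi_base_axioms_def Psi_ob_simps
  proof (intro conjI allI impI refl glued_axioms)
    fix i j assume ij: "i \<in> Ob A" "j \<in> Ob A"
    have raw: "cmp t (sa i j f) = Pa i j f \<longleftrightarrow> Cmp C (FOb P i) (?a i j) (FOb P j) (mor t) (?s i j f) = FHom P i j f"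
      if t: "t \<in> hom (?a i j) (FOb P j)" and f: "f \<in> Hom A i j" for t f
    proof -
      have "cmp t (sa i j f) = arr (FOb P i) (FOb P j) (Cmp C (FOb P i) (?a i j) (FOb P j) (mor t) (?s i j f))"
        using raw_in(2)[OF ij f] ij mor_in[OF t] arr_mor[OF t] by (simp add: sa_def arr_Cmp)
      then show ?thesis
        using raw_in(2)[OF ij f] ij mor_in[OF t] P.FHom_in[OF ij f] G_ob[OF ij]
        by (simp add: Pa_def arr_eq_iff[of "FOb P i" "FOb P j"] Cmp_in)
    qed
    \<comment> \<open>\<open>Psi_tgt\<close> is a definite description. Existence is
      \<open>map_ext\<close>, because \<open>P\<close> carries the equation f e = g e to the base;
      uniqueness is \<open>map_eq\<close>.\<close>
    have "\<exists>t\<in>hom (?a i j) (FOb P j). \<forall>f\<in>Hom A i j. cmp t (sa i j f) = Pa i j f"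
    proof (rule map_ext[OF ij P_ob[OF ij(2)] Pa_hom[OF ij]])
      show "cmp (Pa i j f) (Pa i i e) = cmp (Pa i j g) (Pa i i e)"
        if "f \<in> Hom A i j" "g \<in> Hom A i j" "e \<in> Eq i j f g" for f g e
        using Pa_Cmp[of i i j e f] Pa_Cmp[of i i j e g] EqD(2,4)[OF ij that] that ij by simp
      show "cmp (Pa i j f) (rst (Pa i j f)) = Pa i j f" if "f \<in> Hom A i j" for f
        by (rule hom_rst[OF Pa_hom[OF ij that]])
    qed
    then obtain t where t: "t \<in> hom (?a i j) (FOb P j)" "\<forall>f\<in>Hom A i j. cmp t (sa i j f) = Pa i j f" by blast
    let ?spec = "\<lambda>t. t \<in> Hom C (?a i j) (FOb P j) \<and>
        (\<forall>f\<in>Hom A i j. Cmp C (FOb P i) (?a i j) (FOb P j) t (?s i j f) = FHom P i j f)"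
    have "?spec (THE t. ?spec t)"
    proof (rule theI[of ?spec "mor t"])
      show "?spec (mor t)" using t raw[OF t(1)] by (simp add: mor_in)
      fix u assume u: "?spec u"
      let ?u = "arr (?a i j) (FOb P j) u"
      have uh: "?u \<in> hom (?a i j) (FOb P j)" "mor ?u = u" using u ij G_ob[OF ij] by (simp_all add: homI mor_arr)
      have "?u = t"
        by (rule map_eq[OF ij uh(1) t(1)]) (use t(2) u raw[OF uh(1)] uh(2) in auto)
      then show "u = mor t" using uh(2) by simp
    qed
    then show "Psi_tgt C (A, P) i j \<in> Hom C (?a i j) (FOb P j)"
      "\<forall>f\<in>Hom A i j. Cmp C (FOb P i) (?a i j) (FOb P j) (Psi_tgt C (A, P) i j) (?s i j f) = FHom P i j f"
      unfolding Psi_tgt_def prod.case by blast+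
  next
    fix i j y g assume "i \<in> Ob A" "j \<in> Ob A" "y \<in> Ob C" "total_map C y (FOb P i) g"
    then show "\<exists>a p q. is_pullback C \<lparr>ob1 = ?a i j, ob2 = y, base = FOb P i, leg1 = Psi_src C (A, P) i j, leg2 = g\<rparr> a p q"
      by (intro glueing_pullback[OF _ _ glueing lg small_Hom]) simp_all
  next
    fix i j k assume "i \<in> Ob A" "j \<in> Ob A" "k \<in> Ob A"
    show "Psi_mul C (A, P) i j k =
      (THE m. m \<in> Hom C (pb C (cmp_cospan (Psi_ob C (A, P)) i j k)) (?a i k) \<and>
        (\<forall>f\<in>Hom A i j. \<forall>g\<in>Hom A j k.
           Cmp C (FOb P i) (pb C (cmp_cospan (Psi_ob C (A, P)) i j k)) (?a i k) m
             (Cmp C (FOb P i) (?a i j) (pb C (cmp_cospan (Psi_ob C (A, P)) i j k)) (tgt_pull C (Psi_ob C (A, P)) i j k (?s j k g)) (?s i j f))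
           = ?s i k (Cmp A i j k g f)))"
      by (simp add: Psi_mul_def Psi_pre_ob Let_def)
  qed
qed

lemma Psi_unit_eq: "Psi_unit C (A, P) = presentation.unit_map C A P (Psi_sec C (A, P))"
  by (simp add: presentation.unit_map_def[OF Psi_presentation] Psi_unit_def)

lemma Psi_etale: "source_etale C (Psi_ob C (A, P))"
  using glued.glueing[OF Psi_glued] by (simp add: source_etale_def Psi_ob_simps is_glueing_def)

end

lemma Psi_ob_in: "X \<in> Ob rC \<Longrightarrow> Psi_ob C X \<in> Ob pC"
  using Psi_presentation by (cases X) (auto simp: pCat_Ob Psi_ob_simps over_object_def small_cat_def presentation_def jinternal_def)

lemma unit_in: "X \<in> Ob rC \<Longrightarrow> over_map C X (FOb (Phi C) (Psi_ob C X)) (Psi_unit C X)"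
  using presentation.unit_over_map[OF Psi_presentation] by (cases X) (simp add: Psi_unit_eq)

lemma universal_arrow:
  assumes X: "X \<in> Ob rC" and D: "\<DD> \<in> Ob pC" and m: "m \<in> Hom rC X (FOb (Phi C) \<DD>)"
  shows "\<exists>!h. h \<in> Hom pC (Psi_ob C X) \<DD> \<and>
    Cmp rC X (FOb (Phi C) (Psi_ob C X)) (FOb (Phi C) \<DD>) (FHom (Phi C) (Psi_ob C X) \<DD> h) (Psi_unit C X) = m"
proof (cases X)
  case (Pair A P)
  then show ?thesis
    using presentation.unit_universal[OF Psi_presentation, of A P \<DD> m] X m D pCat_Hom[OF Psi_ob_in[OF X] D]
    by (simp add: Psi_unit_eq pCat_Ob)
qed

definition counit :: "('i, 'o, 'm) pcat \<Rightarrow> ('i, 'm) cofun" where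
  "counit \<BB> = (THE h. h \<in> Hom pC (FOb (Psi \<kappa> C) (FOb (Phi C) \<BB>)) \<BB> \<and>
     Cmp rC (FOb (Phi C) \<BB>) (FOb (Phi C) (FOb (Psi \<kappa> C) (FOb (Phi C) \<BB>))) (FOb (Phi C) \<BB>)
       (FHom (Phi C) (FOb (Psi \<kappa> C) (FOb (Phi C) \<BB>)) \<BB> h) (Psi_unit C (FOb (Phi C) \<BB>))
     = Idn rC (FOb (Phi C) \<BB>))"

lemma adjunction: "adjunction rC pC (Psi \<kappa> C) (Phi C) (Psi_unit C) counit"
proof (rule adjunction_from_universal[OF category_rCat_over category_pCat cat_functor_Phi[OF ls]])
  show "FOb (Psi \<kappa> C) X \<in> Ob pC" if "X \<in> Ob rC" for X
    using Psi_ob_in[OF that] by (simp add: Psi_def)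
  show "Psi_unit C X \<in> Hom rC X (FOb (Phi C) (FOb (Psi \<kappa> C) X))" if "X \<in> Ob rC" for X
    using unit_in[OF that] by (simp add: Psi_def)
qed (simp_all only: Psi_def Psi_map_def counit_def ftor.simps universal_arrow)

text \<open>An equation \<open>FHom (Phi C) \<BB> \<DD> h = m\<close> is the same as a factorisation
  of \<open>m\<close> through the identity of the image of \<BB>, which by
  \<open>unit_map_etale\<close> is the unit of the presentation of \<BB> by its own sections. The
  universal property then supplies the bijectivity that the general criterion requires.\<close>

lemma counit_iso:
  assumes B: "\<BB> \<in> Ob pC" and se: "source_etale C \<BB>"
  shows "is_iso pC (FOb (Psi \<kappa> C) (FOb (Phi C) \<BB>)) \<BB> (counit \<BB>)"
proof (rule adjunction.counit_iso[OF adjunction B])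
  interpret internal C \<BB> using B by (simp add: pCat_Ob)
  interpret etale C \<BB> by unfold_locales (rule se)
  interpret adj: adjunction rC pC "Psi \<kappa> C" "Phi C" "Psi_unit C" counit by (rule adjunction)
  fix \<DD> m assume D: "\<DD> \<in> Ob pC" and m: "m \<in> Hom rC (FOb (Phi C) \<BB>) (FOb (Phi C) \<DD>)"
  have "over_comp C (FOb (Phi C) \<BB>) (FOb (Phi C) \<BB>) (FOb (Phi C) \<DD>) (FHom (Phi C) \<BB> \<DD> h) (over_id C (FOb (Phi C) \<BB>))
      = FHom (Phi C) \<BB> \<DD> h" if "h \<in> Hom pC \<BB> \<DD>" for h
    using adj.A.Cmp_Idn[OF adj.G.FOb_in[OF B] adj.G.FOb_in[OF D] adj.G.FHom_in[OF B D that]] by simp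
  then have "(h \<in> Hom pC \<BB> \<DD> \<and> FHom (Phi C) \<BB> \<DD> h = m) \<longleftrightarrow> (cofunctor C \<BB> \<DD> h \<and> ext_cofun \<BB> h) \<and>
      over_comp C (Phi_cat C \<BB>, Phi_proj C \<BB>) (Phi_cat C \<BB>, Phi_proj C \<BB>) (Phi_cat C \<DD>, Phi_proj C \<DD>) (Phi_map C \<BB> \<DD> h)
        (over_id C (Phi_cat C \<BB>, Phi_proj C \<BB>)) = m" for h
    using pCat_Hom[OF B D] by auto
  then show "\<exists>!h. h \<in> Hom pC \<BB> \<DD> \<and> FHom (Phi C) \<BB> \<DD> h = m"
    using presentation.unit_universal[OF presentation, of \<DD> m] D m by (simp add: unit_map_etale pCat_Ob)
qed

lemma unit_iso:
  assumes X: "X \<in> Ob rC" and jh: "join_hyperconnected C X"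
  shows "is_iso rC X (FOb (Phi C) (FOb (Psi \<kappa> C) X)) (Psi_unit C X)"
proof (cases X)
  case (Pair A P)
  have o: "over_object \<kappa> C (A, P)" using X Pair by simp
  have "jh_presentation C A P (Psi_ob C (A, P)) (Psi_q (A, P)) (Psi_sec C (A, P))"
    unfolding jh_presentation_def jh_presentation_axioms_def
    using Psi_presentation[OF o] jh Pair by (simp add: join_hyperconnected_def)
  then show ?thesis
    using jh_presentation.unit_map_iso[of C A P _ _ _ \<kappa>] o cat_functor.FOb_in[OF cat_functor_Phi[OF ls] Psi_ob_in[OF X]] Pair
    by (simp add: Psi_unit_eq Psi_def)
qed

lemma join_hyperconnected_Phi: "\<BB> \<in> Ob pC \<Longrightarrow> join_hyperconnected C (FOb (Phi C) \<BB>)"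
  using jinternal.join_hyperconnected_Phi[of C \<BB>] by (simp add: pCat_Ob jinternal_def join_restriction_category_axioms)

lemma source_etale_Psi: "X \<in> Ob rC \<Longrightarrow> source_etale C (FOb (Psi \<kappa> C) X)"
  using Psi_etale by (cases X) (simp add: Psi_def)

end

theorem corollary5p18:
  fixes C :: "('o, 'm) rcat" and \<kappa> :: "'k rel"
  assumes "Card_order \<kappa>"
    and "join_restriction_category C"
    and "locally_small \<kappa> C"
    and "has_local_glueings \<kappa> C"
  shows "\<exists>counit :: ('i, 'o, 'm) pcat \<Rightarrow> ('i, 'm) cofun.
    galois_adjunction (rCat_over \<kappa> C) (pCat \<kappa> C) (Psi \<kappa> C) (Phi C) (Psi_unit C) counit \<and>
    reflective_via (rCat_over \<kappa> C) (join_hyperconnected C)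
      (comp_ftor (rCat_over \<kappa> C) (Phi C) (Psi \<kappa> C)) (Psi_unit C) \<and>
    coreflective_via (pCat \<kappa> C) (source_etale C)
      (comp_ftor (pCat \<kappa> C) (Psi \<kappa> C) (Phi C)) counit"
proof -
  interpret glueable C \<kappa> using assms by (simp add: glueable_def glueable_axioms_def)
  note adj = adjunction
  have ob: "FOb (Psi \<kappa> C) X \<in> Ob (pCat \<kappa> C)" if "X \<in> Ob (rCat_over \<kappa> C)" for X :: "('i, 'o, 'm) over"
    using Psi_ob_in[OF that] by (simp add: Psi_def)
  show ?thesis
  proof (intro exI[of _ counit] conjI)
    show "galois_adjunction (rCat_over \<kappa> C) (pCat \<kappa> C) (Psi \<kappa> C) (Phi C) (Psi_unit C)
        (counit :: ('i, 'o, 'm) pcat \<Rightarrow> ('i, 'm) cofun)"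
      unfolding galois_adjunction_def left_fixpoint_def
      using adj ob counit_iso[OF ob source_etale_Psi] by blast
  qed (rule adjunction.reflective[OF adj] adjunction.coreflective[OF adj];
      fact join_hyperconnected_Phi unit_iso source_etale_Psi counit_iso)+
qed

end
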